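(* Let $m,r\ge 1$, $1<p<6$ and $p\frac{m+1}{m}<6$. Let $(u_0,w_0,u_1,w_1)\in\mathcal H=H^1_{\Gamma_0}(\Omega)\times H^2_0(\Gamma)\times L^2(\Omega)\times L^2(\Gamma)$ with $u_0\in L^{p+1+\sigma}(\Omega)$ for some $\sigma>0$. If $p<\min\{m,r\}$, then the local weak solution $(u,w)$ of the structural acoustic system (S) described in the context (a weak solution on an interval $[0,T_0]$, satisfying the energy identity (EI)) is global in time, and $T_0$ can be taken arbitrarily large.
   Context: Setting. $\Omega\subset\mathbb R^3$ is a bounded, open, connected domain with smooth boundary $\partial\Omega=\overline{\Gamma_0\cup\Gamma}$, where $\Gamma_0,\Gamma$ are disjoint, open, connected subsets of $\partial\Omega$ of positive measure; $\Gamma$ is flat, and the curve $\partial\Gamma=\partial\Gamma_0$ is smooth. $\nu$ and $\nu_\Gamma$ are the outer normals to $\Gamma$ and $\partial\Gamma$. The function $s\mapsto|s|^{p-1}s\log|s|$ is set to be $0$ at $s=0$. System (S), for $u$ on $\Omega$ and $w$ on $\Gamma$, is $$\begin{cases}u_{tt}-\Delta u+|u_t|^{m-1}u_t=|u|^{p-1}u\log|u| & \text{in }\Omega\times(0,T),\\ w_{tt}+\Delta^2w+|w_t|^{r-1}w_t+u_t|_\Gamma=|w|^{p-1}w\log|w| & \text{in }\Gamma\times(0,T),\\ u=0 & \text{on }\Gamma_0\times(0,T),\\ \partial_\nu u=w_t & \text{on }\Gamma\times(0,T),\\ w=\partial_{\nu_\Gamma}w=0 & \text{on }\partial\Gamma\times(0,T),\\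 (u(0),u_t(0))=(u_0,u_1),\ (w(0),w_t(0))=(w_0,w_1).\end{cases}$$ Notation. $\|\cdot\|_q=\|\cdot\|_{L^q(\Omega)}$, $|\cdot|_q=\|\cdot\|_{L^q(\Gamma)}$, $(\cdot,\cdot)_\Omega$, $(\cdot,\cdot)_\Gamma$ are the $L^2$ inner products, $\gamma u=u|_\Gamma$ is the trace on $\Gamma$. $H^1_{\Gamma_0}(\Omega)=\{u\in H^1(\Omega):u|_{\Gamma_0}=0\}$ with norm $\|\nabla u\|_2$; $H^2_0(\Gamma)$ has norm $|\Delta w|_2$. Weak solution. $(u,w)$ is a weak solution of (S) on $[0,T]$ if: $u\in C([0,T];H^1_{\Gamma_0}(\Omega))$, $u_t\in C([0,T];L^2(\Omega))\cap L^{m+1}(\Omega\times(0,T))$; $w\in C([0,T];H^2_0(\Gamma))$, $w_t\in C([0,T];L^2(\Gamma))\cap L^{r+1}(\Gamma\times(0,T))$; $(u(0),u_t(0))=(u_0,u_1)\in H^1_{\Gamma_0}(\Omega)\times L^2(\Omega)$; $(w(0),w_t(0))=(w_0,w_1)\in H^2_0(\Gamma)\times L^2(\Gamma)$; and for all $t\in[0,T]$ $$(u_t(t),\phi(t))_\Omega-(u_1,\phi(0))_\Omega-\int_0^t(u_t,\phi_t)_\Omega ds+\int_0^t(\nabla u,\nabla\phi)_\Omega ds-\int_0^t(w_t,\gamma\phi)_\Gamma ds+\int_0^t\int_\Omega|u_t|^{m-1}u_t\phi\,dxds=\int_0^t\int_\Omega(|u|^{p-1}u\log|u|)\phi\,dxds,$$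 $$(w_t(t)+\gamma u(t),\psi(t))_\Gamma-(w_1+\gamma u_0,\psi(0))_\Gamma-\int_0^t(w_t,\psi_t)_\Gamma ds-\int_0^t(\gamma u,\psi_t)_\Gamma ds+\int_0^t(\Delta w,\Delta\psi)_\Gamma ds+\int_0^t\int_\Gamma|w_t|^{r-1}w_t\psi\,d\Gamma ds=\int_0^t\int_\Gamma(|w|^{p-1}w\log|w|)\psi\,d\Gamma ds,$$ for all test functions $\phi\in C([0,T];H^1_{\Gamma_0}(\Omega))\cap L^{m+1}(\Omega\times(0,T))$ with $\phi_t\in L^1(0,T;L^2(\Omega))$ and $\psi\in C([0,T];H^2_0(\Gamma))$ with $\psi_t\in L^1(0,T;L^2(\Gamma))$. Energy identity (EI), for all $t\in[0,T_0]$, with $E(t)=\frac12\left(\|u_t(t)\|_2^2+|w_t(t)|_2^2+\|\nabla u(t)\|_2^2+|\Delta w(t)|_2^2\right)$: $$E(t)+\int_0^t\int_\Omega|u_t|^{m+1}dxds+\int_0^t\int_\Gamma|w_t|^{r+1}d\Gamma ds=E(0)+\int_0^t\int_\Omega(|u|^{p-1}u\log|u|)u_t\,dxds+\int_0^t\int_\Gamma(|w|^{p-1}w\log|w|)w_t\,d\Gamma ds.$$ Under the stated conditions on $m,r,p$, for every data in $\mathcal H$ the local theory provides a weak solution on some $[0,T_0]$, with $T_0>0$ depending on $E(0)$, satisfying (EI). *)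

theory Defs
  imports "HOL-Analysis.Analysis"
begin

section \<open>Smooth maps and smooth sets\<close>

text \<open>\<open>Ck_on k f U\<close>: all iterated partial derivatives of \<open>f\<close> up to order \<open>k\<close> exist and are
  continuous; meant for open \<open>U\<close> only.\<close>

primrec Ck_on ::
  "nat \<Rightarrow> ('a::euclidean_space \<Rightarrow> 'b::real_normed_vector) \<Rightarrow> 'a set \<Rightarrow> bool" where
  "Ck_on 0 f U \<longleftrightarrow> continuous_on U f"
| "Ck_on (Suc k) f U \<longleftrightarrow> f differentiable_on U \<and>
     (\<forall>b\<in>Basis. Ck_on k (\<lambda>x. frechet_derivative f (at x) b) U)"

definition smooth_on ::
  "('a::euclidean_space \<Rightarrow> 'b::real_normed_vector) \<Rightarrow> 'a set \<Rightarrow> bool" where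
  "smooth_on f U \<longleftrightarrow> (\<forall>k. Ck_on k f U)"

definition smooth_diffeo ::
  "('a::euclidean_space \<Rightarrow> 'a) \<Rightarrow> ('a \<Rightarrow> 'a) \<Rightarrow> 'a set \<Rightarrow> 'a set \<Rightarrow> bool" where
  "smooth_diffeo f g U V \<longleftrightarrow>
     open U \<and> open V \<and> homeomorphism U V f g \<and> smooth_on f U \<and> smooth_on g V"

definition smooth_submanifold :: "nat \<Rightarrow> 'a::euclidean_space set \<Rightarrow> bool" where
  "smooth_submanifold k S \<longleftrightarrow> (\<forall>x\<in>S. \<exists>U V f g L.
     x \<in> U \<and> smooth_diffeo f g U V \<and> subspace L \<and> dim L = k \<and> f ` (S \<inter> U) = L \<inter> V)"

definition smooth_boundary :: "'a::euclidean_space set \<Rightarrow> bool" where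
  "smooth_boundary D \<longleftrightarrow> (\<forall>x\<in>frontier D. \<exists>U V f g a.
     x \<in> U \<and> smooth_diffeo f g U V \<and> a \<noteq> 0 \<and>
     f ` (D \<inter> U) = {y\<in>V. 0 < a \<bullet> y} \<and> f ` (frontier D \<inter> U) = {y\<in>V. a \<bullet> y = 0})"

text \<open>The surface measure of a surface in \<open>\<real>\<^sup>3\<close>, characterised by the area formula in all
  regular local parametrisations.\<close>

definition is_surface_measure :: "(real^3) set \<Rightarrow> (real^3) measure \<Rightarrow> bool" where
  "is_surface_measure S \<sigma> \<longleftrightarrow> sets \<sigma> = sets borel \<and> emeasure \<sigma> (- S) = 0 \<and>
     (\<forall>(V :: (real^2) set) h g B.
        open V \<and> smooth_on h V \<and> homeomorphism V (h ` V) h g \<and>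
        openin (top_of_set S) (h ` V) \<and>
        (\<forall>y\<in>V. cross3 (frechet_derivative h (at y) (axis 1 1))
                       (frechet_derivative h (at y) (axis 2 1)) \<noteq> 0) \<and>
        B \<in> sets borel \<and> B \<subseteq> V \<longrightarrow>
        emeasure \<sigma> (h ` B) =
          (\<integral>\<^sup>+y\<in>B. ennreal (norm (cross3 (frechet_derivative h (at y) (axis 1 1))
                                        (frechet_derivative h (at y) (axis 2 1)))) \<partial>lborel))"


section \<open>Lebesgue and Sobolev spaces\<close>

text \<open>All spaces consist of Borel measurable representatives, not of equivalence classes.\<close>

definition Lq_space :: "real \<Rightarrow> 'a measure \<Rightarrow> ('a \<Rightarrow> real) set" where
  "Lq_space q M = {f \<in> borel_measurable M. integrable M (\<lambda>x. \<bar>f x\<bar> powr q)}"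

definition L2_inner :: "'a measure \<Rightarrow> ('a \<Rightarrow> real) \<Rightarrow> ('a \<Rightarrow> real) \<Rightarrow> real" where
  "L2_inner M f g = (\<integral>x. f x * g x \<partial>M)"

definition L2_norm :: "'a measure \<Rightarrow> ('a \<Rightarrow> real) \<Rightarrow> real" where
  "L2_norm M f = sqrt (L2_inner M f f)"

definition leb :: "'a::euclidean_space set \<Rightarrow> 'a measure" where
  "leb U = restrict_space lborel U"

definition test_fun :: "'a::euclidean_space set \<Rightarrow> ('a \<Rightarrow> real) \<Rightarrow> bool" where
  "test_fun U \<zeta> \<longleftrightarrow> smooth_on \<zeta> UNIV \<and>
     compact (closure {x. \<zeta> x \<noteq> 0}) \<and> closure {x. \<zeta> x \<noteq> 0} \<subseteq> U"

definition has_weak_pd ::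
  "'a::euclidean_space set \<Rightarrow> 'a \<Rightarrow> ('a \<Rightarrow> real) \<Rightarrow> ('a \<Rightarrow> real) \<Rightarrow> bool" where
  "has_weak_pd U b u g \<longleftrightarrow> g \<in> Lq_space 2 (leb U) \<and>
     (\<forall>\<zeta>. test_fun U \<zeta> \<longrightarrow>
        (\<integral>x. u x * frechet_derivative \<zeta> (at x) b \<partial>leb U) = - (\<integral>x. g x * \<zeta> x \<partial>leb U))"

text \<open>\<open>weak_pd U b u\<close> is a representative of the weak partial derivative of \<open>u\<close> in the direction
  \<open>b\<close>, a class that is unique where it exists. It depends on \<open>u\<close> only through its class.\<close>

definition weak_pd ::
  "'a::euclidean_space set \<Rightarrow> 'a \<Rightarrow> ('a \<Rightarrow> real) \<Rightarrow> 'a \<Rightarrow> real" where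
  "weak_pd U b u = (SOME g. has_weak_pd U b u g)"

definition H1 :: "'a::euclidean_space set \<Rightarrow> ('a \<Rightarrow> real) set" where
  "H1 U = {u \<in> Lq_space 2 (leb U). \<forall>b\<in>Basis. \<exists>g. has_weak_pd U b u g}"

definition H2 :: "'a::euclidean_space set \<Rightarrow> ('a \<Rightarrow> real) set" where
  "H2 U = {u \<in> H1 U. \<forall>b\<in>Basis. weak_pd U b u \<in> H1 U}"

definition grad_inner ::
  "'a::euclidean_space set \<Rightarrow> ('a \<Rightarrow> real) \<Rightarrow> ('a \<Rightarrow> real) \<Rightarrow> real" where
  "grad_inner U u v = (\<Sum>b\<in>Basis. L2_inner (leb U) (weak_pd U b u) (weak_pd U b v))"

definition grad_norm :: "'a::euclidean_space set \<Rightarrow> ('a \<Rightarrow> real) \<Rightarrow> real" where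
  "grad_norm U u = sqrt (grad_inner U u u)"

definition H1_norm :: "'a::euclidean_space set \<Rightarrow> ('a \<Rightarrow> real) \<Rightarrow> real" where
  "H1_norm U u = sqrt ((L2_norm (leb U) u)\<^sup>2 + (grad_norm U u)\<^sup>2)"

definition H2_norm :: "'a::euclidean_space set \<Rightarrow> ('a \<Rightarrow> real) \<Rightarrow> real" where
  "H2_norm U u = sqrt ((L2_norm (leb U) u)\<^sup>2 + (\<Sum>b\<in>Basis. (H1_norm U (weak_pd U b u))\<^sup>2))"

definition weak_laplacian :: "'a::euclidean_space set \<Rightarrow> ('a \<Rightarrow> real) \<Rightarrow> 'a \<Rightarrow> real" where
  "weak_laplacian U u x = (\<Sum>b\<in>Basis. weak_pd U b (weak_pd U b u) x)"

text \<open>\<open>H\<^sup>2\<^sub>0\<close>: the closure of the test functions in \<open>H\<^sup>2\<close>.\<close>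

definition H20 :: "'a::euclidean_space set \<Rightarrow> ('a \<Rightarrow> real) set" where
  "H20 U = {u \<in> H2 U. \<exists>\<phi>. (\<forall>n::nat. test_fun U (\<phi> n)) \<and>
     (\<lambda>n. H2_norm U (\<lambda>x. u x - \<phi> n x)) \<longlonglongrightarrow> 0}"


section \<open>The structural acoustic geometry\<close>

text \<open>\<open>chart\<close> is an isometric parametrisation of the plane containing the flat part \<open>Gam\<close> of the
  boundary; differential operators on \<open>Gam\<close> are taken in these Cartesian coordinates. \<open>surf\<close> is the
  surface measure of the boundary of \<open>Om\<close>.\<close>

record acoustic_geometry =
  Om :: "(real^3) set"
  Gam0 :: "(real^3) set"
  Gam :: "(real^3) set"
  chart :: "real^2 \<Rightarrow> real^3"
  surf :: "(real^3) measure"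

definition plane_chart :: "(real^2 \<Rightarrow> real^3) \<Rightarrow> bool" where
  "plane_chart e \<longleftrightarrow> (\<exists>a b c. norm b = 1 \<and> norm c = 1 \<and> b \<bullet> c = 0 \<and>
     e = (\<lambda>y. a + (y $ 1) *\<^sub>R b + (y $ 2) *\<^sub>R c))"

definition structural_acoustic :: "acoustic_geometry \<Rightarrow> bool" where
  "structural_acoustic G \<longleftrightarrow>
     bounded (Om G) \<and> open (Om G) \<and> connected (Om G) \<and> Om G \<noteq> {} \<and> smooth_boundary (Om G) \<and>
     is_surface_measure (frontier (Om G)) (surf G) \<and>
     frontier (Om G) = closure (Gam0 G \<union> Gam G) \<and> Gam0 G \<inter> Gam G = {} \<and>
     openin (top_of_set (frontier (Om G))) (Gam0 G) \<and> connected (Gam0 G) \<and>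
     emeasure (surf G) (Gam0 G) > 0 \<and>
     openin (top_of_set (frontier (Om G))) (Gam G) \<and> connected (Gam G) \<and>
     emeasure (surf G) (Gam G) > 0 \<and>
     plane_chart (chart G) \<and> Gam G \<subseteq> range (chart G) \<and>
     closure (Gam G) - Gam G = closure (Gam0 G) - Gam0 G \<and>
     smooth_submanifold 1 (closure (Gam G) - Gam G)"

definition mOm :: "acoustic_geometry \<Rightarrow> (real^3) measure" where
  "mOm G = leb (Om G)"

definition mGam :: "acoustic_geometry \<Rightarrow> (real^3) measure" where
  "mGam G = restrict_space (surf G) (Gam G)"

text \<open>The trace on the boundary is the continuous extension to \<open>H\<^sup>1\<close> of the restriction of
  functions that are smooth up to the boundary.\<close>

definition has_trace :: "acoustic_geometry \<Rightarrow> (real^3 \<Rightarrow> real) \<Rightarrow> (real^3 \<Rightarrow> real) \<Rightarrow> bool" where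
  "has_trace G u g \<longleftrightarrow> g \<in> Lq_space 2 (restrict_space (surf G) (frontier (Om G))) \<and>
     (\<exists>\<phi>. (\<forall>n::nat. smooth_on (\<phi> n) UNIV) \<and>
        (\<lambda>n. H1_norm (Om G) (\<lambda>x. u x - \<phi> n x)) \<longlonglongrightarrow> 0 \<and>
        (\<lambda>n. L2_norm (restrict_space (surf G) (frontier (Om G))) (\<lambda>x. \<phi> n x - g x)) \<longlonglongrightarrow> 0)"

definition bdry_trace :: "acoustic_geometry \<Rightarrow> (real^3 \<Rightarrow> real) \<Rightarrow> real^3 \<Rightarrow> real" where
  "bdry_trace G u = (SOME g. has_trace G u g)"

definition H1_Gam0 :: "acoustic_geometry \<Rightarrow> (real^3 \<Rightarrow> real) set" where
  "H1_Gam0 G = {u \<in> H1 (Om G). AE x in restrict_space (surf G) (Gam0 G). bdry_trace G u x = 0}"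

definition H20_Gam :: "acoustic_geometry \<Rightarrow> (real^3 \<Rightarrow> real) set" where
  "H20_Gam G = {w. w \<circ> chart G \<in> H20 (chart G -` Gam G)}"

definition lap_Gam :: "acoustic_geometry \<Rightarrow> (real^3 \<Rightarrow> real) \<Rightarrow> real^3 \<Rightarrow> real" where
  "lap_Gam G w = weak_laplacian (chart G -` Gam G) (w \<circ> chart G) \<circ> inv (chart G)"


section \<open>Functions of time with values in function spaces\<close>

text \<open>\<open>C([0,T];X)\<close> where \<open>X\<close> carries the norm \<open>N\<close>.\<close>

definition C_time ::
  "real \<Rightarrow> ('a \<Rightarrow> real) set \<Rightarrow> (('a \<Rightarrow> real) \<Rightarrow> real) \<Rightarrow> (real \<Rightarrow> 'a \<Rightarrow> real) set" where
  "C_time T X N = {u. \<forall>t\<in>{0..T}. u t \<in> X \<and>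
     ((\<lambda>s. N (\<lambda>x. u s x - u t x)) \<longlongrightarrow> 0) (at t within {0..T})}"

text \<open>\<open>L\<^sup>q(M \<times> (0,T))\<close>\<close>

definition Lq_spacetime :: "real \<Rightarrow> 'a measure \<Rightarrow> real \<Rightarrow> (real \<Rightarrow> 'a \<Rightarrow> real) set" where
  "Lq_spacetime T M q = {v. case_prod v \<in> Lq_space q (leb {0<..<T} \<Otimes>\<^sub>M M)}"

text \<open>\<open>L\<^sup>1(0,T;L\<^sup>2(M))\<close>\<close>

definition L1_L2 :: "real \<Rightarrow> 'a measure \<Rightarrow> (real \<Rightarrow> 'a \<Rightarrow> real) set" where
  "L1_L2 T M = {v. case_prod v \<in> borel_measurable (leb {0<..<T} \<Otimes>\<^sub>M M) \<and>
     (AE s in leb {0<..<T}. v s \<in> Lq_space 2 M) \<and>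
     integrable (leb {0<..<T}) (\<lambda>s. L2_norm M (v s))}"

text \<open>\<open>v\<close> is the time derivative of the absolutely continuous \<open>L\<^sup>2(M)\<close>-valued function \<open>u\<close>:
  \<open>u(t) = u(0) + \<integral>\<^sub>0\<^sup>t v ds\<close> in \<open>L\<^sup>2(M)\<close>. The vector-valued integral is evaluated
  pointwise almost everywhere.\<close>

definition time_deriv ::
  "real \<Rightarrow> 'a measure \<Rightarrow> (real \<Rightarrow> 'a \<Rightarrow> real) \<Rightarrow> (real \<Rightarrow> 'a \<Rightarrow> real) \<Rightarrow> bool" where
  "time_deriv T M u v \<longleftrightarrow> v \<in> L1_L2 T M \<and>
     (\<forall>t\<in>{0..T}. AE x in M. integrable (leb {0..t}) (\<lambda>s. v s x) \<and>
        u t x = u 0 x + (\<integral>s. v s x \<partial>leb {0..t}))"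

abbreviation time_integral :: "real \<Rightarrow> (real \<Rightarrow> real) \<Rightarrow> real" where
  "time_integral t f \<equiv> (\<integral>s. f s \<partial>leb {0..t})"


section \<open>Weak solutions\<close>

definition damping :: "real \<Rightarrow> real \<Rightarrow> real" where
  "damping q s = \<bar>s\<bar> powr (q - 1) * s"

definition log_source :: "real \<Rightarrow> real \<Rightarrow> real" where
  "log_source p s = (if s = 0 then 0 else \<bar>s\<bar> powr (p - 1) * s * ln \<bar>s\<bar>)"

definition acoustic_test ::
  "acoustic_geometry \<Rightarrow> real \<Rightarrow> real \<Rightarrow> (real \<Rightarrow> real^3 \<Rightarrow> real) \<Rightarrow> (real \<Rightarrow> real^3 \<Rightarrow> real) \<Rightarrow> bool" where
  "acoustic_test G m T \<phi> \<phi>t \<longleftrightarrow>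
     \<phi> \<in> C_time T (H1_Gam0 G) (grad_norm (Om G)) \<and> \<phi> \<in> Lq_spacetime T (mOm G) (m + 1) \<and>
     time_deriv T (mOm G) \<phi> \<phi>t"

definition plate_test ::
  "acoustic_geometry \<Rightarrow> real \<Rightarrow> (real \<Rightarrow> real^3 \<Rightarrow> real) \<Rightarrow> (real \<Rightarrow> real^3 \<Rightarrow> real) \<Rightarrow> bool" where
  "plate_test G T \<psi> \<psi>t \<longleftrightarrow>
     \<psi> \<in> C_time T (H20_Gam G) (\<lambda>w. L2_norm (mGam G) (lap_Gam G w)) \<and>
     time_deriv T (mGam G) \<psi> \<psi>t"

definition phase_space ::
  "acoustic_geometry \<Rightarrow>
   ((real^3 \<Rightarrow> real) \<times> (real^3 \<Rightarrow> real) \<times> (real^3 \<Rightarrow> real) \<times> (real^3 \<Rightarrow> real)) set" where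
  "phase_space G =
     H1_Gam0 G \<times> H20_Gam G \<times> Lq_space 2 (mOm G) \<times> Lq_space 2 (mGam G)"

text \<open>The time derivatives \<open>ut\<close>, \<open>wt\<close> are carried along as explicit arguments.\<close>

definition weak_solution ::
  "acoustic_geometry \<Rightarrow> real \<Rightarrow> real \<Rightarrow> real \<Rightarrow>
   (real^3 \<Rightarrow> real) \<Rightarrow> (real^3 \<Rightarrow> real) \<Rightarrow> (real^3 \<Rightarrow> real) \<Rightarrow> (real^3 \<Rightarrow> real) \<Rightarrow> real \<Rightarrow>
   (real \<Rightarrow> real^3 \<Rightarrow> real) \<Rightarrow> (real \<Rightarrow> real^3 \<Rightarrow> real) \<Rightarrow>
   (real \<Rightarrow> real^3 \<Rightarrow> real) \<Rightarrow> (real \<Rightarrow> real^3 \<Rightarrow> real) \<Rightarrow> bool" where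
  "weak_solution G m r p u0 w0 u1 w1 T u w ut wt \<longleftrightarrow>
     u \<in> C_time T (H1_Gam0 G) (grad_norm (Om G)) \<and> time_deriv T (mOm G) u ut \<and>
     ut \<in> C_time T (Lq_space 2 (mOm G)) (L2_norm (mOm G)) \<and>
     ut \<in> Lq_spacetime T (mOm G) (m + 1) \<and>
     w \<in> C_time T (H20_Gam G) (\<lambda>w. L2_norm (mGam G) (lap_Gam G w)) \<and>
     time_deriv T (mGam G) w wt \<and>
     wt \<in> C_time T (Lq_space 2 (mGam G)) (L2_norm (mGam G)) \<and>
     wt \<in> Lq_spacetime T (mGam G) (r + 1) \<and>
     (u0, w0, u1, w1) \<in> phase_space G \<and>
     (AE x in mOm G. u 0 x = u0 x \<and> ut 0 x = u1 x) \<and>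
     (AE x in mGam G. w 0 x = w0 x \<and> wt 0 x = w1 x) \<and>
     (\<forall>t\<in>{0..T}. \<forall>\<phi> \<phi>t. acoustic_test G m T \<phi> \<phi>t \<longrightarrow>
        L2_inner (mOm G) (ut t) (\<phi> t) - L2_inner (mOm G) u1 (\<phi> 0)
        - time_integral t (\<lambda>s. L2_inner (mOm G) (ut s) (\<phi>t s))
        + time_integral t (\<lambda>s. grad_inner (Om G) (u s) (\<phi> s))
        - time_integral t (\<lambda>s. L2_inner (mGam G) (wt s) (bdry_trace G (\<phi> s)))
        + time_integral t (\<lambda>s. \<integral>x. damping m (ut s x) * \<phi> s x \<partial>mOm G)
        = time_integral t (\<lambda>s. \<integral>x. log_source p (u s x) * \<phi> s x \<partial>mOm G)) \<and>
     (\<forall>t\<in>{0..T}. \<forall>\<psi> \<psi>t. plate_test G T \<psi> \<psi>t \<longrightarrow>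
        L2_inner (mGam G) (\<lambda>x. wt t x + bdry_trace G (u t) x) (\<psi> t)
        - L2_inner (mGam G) (\<lambda>x. w1 x + bdry_trace G u0 x) (\<psi> 0)
        - time_integral t (\<lambda>s. L2_inner (mGam G) (wt s) (\<psi>t s))
        - time_integral t (\<lambda>s. L2_inner (mGam G) (bdry_trace G (u s)) (\<psi>t s))
        + time_integral t (\<lambda>s. L2_inner (mGam G) (lap_Gam G (w s)) (lap_Gam G (\<psi> s)))
        + time_integral t (\<lambda>s. \<integral>x. damping r (wt s x) * \<psi> s x \<partial>mGam G)
        = time_integral t (\<lambda>s. \<integral>x. log_source p (w s x) * \<psi> s x \<partial>mGam G))"

definition energy ::
  "acoustic_geometry \<Rightarrow> (real^3 \<Rightarrow> real) \<Rightarrow> (real^3 \<Rightarrow> real) \<Rightarrow>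
   (real^3 \<Rightarrow> real) \<Rightarrow> (real^3 \<Rightarrow> real) \<Rightarrow> real" where
  "energy G u w ut wt = ((L2_norm (mOm G) ut)\<^sup>2 + (L2_norm (mGam G) wt)\<^sup>2
     + (grad_norm (Om G) u)\<^sup>2 + (L2_norm (mGam G) (lap_Gam G w))\<^sup>2) / 2"

definition energy_identity ::
  "acoustic_geometry \<Rightarrow> real \<Rightarrow> real \<Rightarrow> real \<Rightarrow> real \<Rightarrow>
   (real \<Rightarrow> real^3 \<Rightarrow> real) \<Rightarrow> (real \<Rightarrow> real^3 \<Rightarrow> real) \<Rightarrow>
   (real \<Rightarrow> real^3 \<Rightarrow> real) \<Rightarrow> (real \<Rightarrow> real^3 \<Rightarrow> real) \<Rightarrow> bool" where
  "energy_identity G m r p T u w ut wt \<longleftrightarrow> (\<forall>t\<in>{0..T}.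
     energy G (u t) (w t) (ut t) (wt t)
     + time_integral t (\<lambda>s. \<integral>x. \<bar>ut s x\<bar> powr (m + 1) \<partial>mOm G)
     + time_integral t (\<lambda>s. \<integral>x. \<bar>wt s x\<bar> powr (r + 1) \<partial>mGam G)
     = energy G (u 0) (w 0) (ut 0) (wt 0)
     + time_integral t (\<lambda>s. \<integral>x. log_source p (u s x) * ut s x \<partial>mOm G)
     + time_integral t (\<lambda>s. \<integral>x. log_source p (w s x) * wt s x \<partial>mGam G))"

text \<open>The local existence theory for fixed geometry and exponents: the existence time depends on the
  data only through a bound \<open>K\<close> for the initial energy.\<close>

definition local_theory :: "acoustic_geometry \<Rightarrow> real \<Rightarrow> real \<Rightarrow> real \<Rightarrow> bool" where
  "local_theory G m r p \<longleftrightarrow> (\<forall>K. \<exists>T>0. \<forall>u0 w0 u1 w1.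
     (u0, w0, u1, w1) \<in> phase_space G \<and> energy G u0 w0 u1 w1 \<le> K \<longrightarrow>
     (\<exists>u w ut wt. weak_solution G m r p u0 w0 u1 w1 T u w ut wt \<and>
        energy_identity G m r p T u w ut wt))"

end

theory Submission
 imports Defs
begin

text \<open>The energy identity is closed by absorbing the sources into the damping: with
 \<open>p + 1 < q \<le> min m r + 1\<close>, Young's inequality bounds the work of the logarithmic source by half of
 the dissipation plus the \<open>L\<^sup>q\<close> norm of the displacement, and that norm is controlled by the
 initial displacement and the time integral of the dissipation. Gronwall's inequality then bounds
 the energy on every bounded time interval, so the existence time of the local theory does not
 shrink and finitely many local solutions reach any given time. Concatenation requires every term
 of the weak formulation to be integrable in time on each piece; for the coupling terms this rests
 on the continuity of the trace in \<open>H\<^sup>1\<close> and on the bound of \<open>H\<^sup>2\<^sub>0(\<Gamma>)\<close> functions by their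
 Laplacian. Test functions on a short interval extend to a longer one by reflection in time.\<close>

text \<open>The logarithm costs an arbitrarily small surplus of exponent, hence
  \<open>p + 1 < q\<close> and the extra integrability of the initial displacement. As
  \<open>p + 1\<close> may exceed 6, the energy alone need not control the \<open>L^q\<close> norm
  of \<open>u\<close>; that norm is recovered from \<open>u(t) = u(0) + \<integral> ut\<close>. The
  same formula shows that every restart begins with a displacement in \<open>L^q\<close>. On the
  plate the initial norm comes from a supremum bound. Two features of the setting shape the rest. A
  divergent Bochner integral has the value 0, so an identity between integrals says nothing about
  integrability, and additivity over adjacent time intervals has to be earned term by term. Moreover
  functions are representatives: a path continuous in time with values in a function space need not
  be jointly measurable, so it is replaced by a measurable version that agrees with it almost
  everywhere at each time; and a restarted solution meets the old one only almost everywhere at the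
  junction, so norms, weak derivatives and Laplacians have to be shown to ignore null sets.\<close>

abbreviation "Fd \<equiv> frechet_derivative"

section \<open>Square integrable functions\<close>

lemma Lq_space_2: "Lq_space 2 M = {f : borel_measurable M. integrable M (%x. (f x)\<^sup>2)}"
 by (auto simp: Lq_space_def)

lemma L2_measurable: "f : Lq_space 2 M ==> f : borel_measurable M"
 by (simp add: Lq_space_2)

lemma L2_integrable_square: "f : Lq_space 2 M ==> integrable M (%x. (f x)\<^sup>2)"
 by (simp add: Lq_space_2)

lemma L2_integrable_mult:
 assumes "f : Lq_space 2 M" "g : Lq_space 2 M"
 shows "integrable M (%x. f x * g x)"
proof (rule Bochner_Integration.integrable_bound)
 show "integrable M (%x. (f x)\<^sup>2 + (g x)\<^sup>2)"
  using assms by (auto simp: Lq_space_2)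
 show "AE x in M. norm (f x * g x) <= norm ((f x)\<^sup>2 + (g x)\<^sup>2)"
 proof (rule AE_I2)
  fix x
  have "2 * (\<bar>f x\<bar> * \<bar>g x\<bar>) <= \<bar>f x\<bar>\<^sup>2 + \<bar>g x\<bar>\<^sup>2"
   using sum_squares_bound[of "\<bar>f x\<bar>" "\<bar>g x\<bar>"] by (simp add: mult.assoc)
  moreover have "0 <= \<bar>f x\<bar> * \<bar>g x\<bar>" by simp
  ultimately have "\<bar>f x\<bar> * \<bar>g x\<bar> <= (f x)\<^sup>2 + (g x)\<^sup>2" unfolding power2_abs by linarith
  then show "norm (f x * g x) <= norm ((f x)\<^sup>2 + (g x)\<^sup>2)"
   by (simp add: abs_mult)
 qed
qed (use assms in \<open>auto simp: Lq_space_2\<close>)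

lemma L2_add: "f : Lq_space 2 M ==> g : Lq_space 2 M ==> (%x. f x + g x) : Lq_space 2 M"
 using L2_integrable_mult[of f M g]
 by (auto simp: Lq_space_2 power2_sum mult.assoc)

lemma L2_cmult: "f : Lq_space 2 M ==> (%x. c * f x) : Lq_space 2 M"
 by (auto simp: Lq_space_2 power_mult_distrib)

lemma L2_diff: "f : Lq_space 2 M ==> g : Lq_space 2 M ==> (%x. f x - g x) : Lq_space 2 M"
 using L2_add[of f M "%x. (-1) * g x"] L2_cmult[of g M "-1"] by simp

lemma L2_zero: "(%x. 0) : Lq_space 2 M"
 by (auto simp: Lq_space_2)

lemma L2_sum: "(!!i. i : I ==> f i : Lq_space 2 M) ==> (%x. \<Sum>i\<in>I. f i x) : Lq_space 2 M"
 by (induction I rule: infinite_finite_induct) (auto intro: L2_zero L2_add)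

lemma L2_abs: "f : Lq_space 2 M ==> (%x. \<bar>f x\<bar>) : Lq_space 2 M"
 by (auto simp: Lq_space_2)

lemma L2_bounded_mult:
 assumes "f : Lq_space 2 M" "g : borel_measurable M" "AE x in M. \<bar>g x\<bar> <= C"
 shows "(%x. g x * f x) : Lq_space 2 M"
proof -
 have "integrable M (%x. (g x * f x)\<^sup>2)"
 proof (rule Bochner_Integration.integrable_bound)
  show "integrable M (%x. C\<^sup>2 * (f x)\<^sup>2)" using assms by (auto simp: Lq_space_2)
  show "AE x in M. norm ((g x * f x)\<^sup>2) <= norm (C\<^sup>2 * (f x)\<^sup>2)"
   using assms(3)
  proof eventually_elim
   case (elim x)
   then have "\<bar>g x\<bar>\<^sup>2 <= C\<^sup>2" by (intro power_mono) auto
   then show ?case by (simp add: power_mult_distrib mult_right_mono)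
  qed
 qed (use assms in \<open>auto simp: Lq_space_2\<close>)
 then show ?thesis using assms by (auto simp: Lq_space_2)
qed

lemma (in finite_measure) L2_bounded:
 assumes "g : borel_measurable M" "AE x in M. \<bar>g x\<bar> <= (C::real)"
 shows "g : Lq_space 2 M"
 using L2_bounded_mult[of "%_. 1" M g C] assms by (auto simp: Lq_space_2)

lemma L2_inner_commute: "L2_inner M f g = L2_inner M g f"
 by (simp add: L2_inner_def mult.commute)

lemma L2_inner_self_nonneg: "0 <= L2_inner M f f"
 by (simp add: L2_inner_def)

lemma L2_norm_nonneg: "0 <= L2_norm M f"
 by (simp add: L2_norm_def L2_inner_self_nonneg)

lemma L2_norm_power2: "(L2_norm M f)\<^sup>2 = (\<integral>x. (f x)\<^sup>2 \<partial>M)"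
 by (simp add: L2_norm_def L2_inner_self_nonneg) (simp add: L2_inner_def power2_eq_square)

lemma L2_norm_minus_commute: "L2_norm M (%x. f x - g x) = L2_norm M (%x. g x - f x)"
 by (simp add: L2_norm_def L2_inner_def algebra_simps)

lemma L2_norm_abs: "L2_norm M (%x. \<bar>f x\<bar>) = L2_norm M f"
 by (simp add: L2_norm_def L2_inner_def)

lemma L2_norm_cmult: "L2_norm M (%x. c * f x) = \<bar>c\<bar> * L2_norm M f"
proof -
 have "L2_inner M (%x. c * f x) (%x. c * f x) = (\<integral>x. c\<^sup>2 * (f x * f x) \<partial>M)"
  by (simp add: L2_inner_def power2_eq_square mult_ac)
 also have "... = c\<^sup>2 * L2_inner M f f" by (simp add: L2_inner_def)
 finally show ?thesis by (simp add: L2_norm_def real_sqrt_mult)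
qed

lemma L2_inner_diff_left:
 assumes "f : Lq_space 2 M" "g : Lq_space 2 M" "h : Lq_space 2 M"
 shows "L2_inner M (%x. f x - g x) h = L2_inner M f h - L2_inner M g h"
 using assms by (simp add: L2_inner_def left_diff_distrib L2_integrable_mult)

lemma L2_inner_diff_right:
 assumes "f : Lq_space 2 M" "g : Lq_space 2 M" "h : Lq_space 2 M"
 shows "L2_inner M h (%x. f x - g x) = L2_inner M h f - L2_inner M h g"
 using L2_inner_diff_left[OF assms] by (simp add: L2_inner_commute)

lemma L2_inner_cong_AE:
 assumes "AE x in M. f x = f' x" "AE x in M. g x = g' x"
  "f : borel_measurable M" "f' : borel_measurable M" "g : borel_measurable M" "g' : borel_measurable M"
 shows "L2_inner M f g = L2_inner M f' g'"
 unfolding L2_inner_def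
proof (rule integral_cong_AE)
 show "AE x in M. f x * g x = f' x * g' x" using assms(1,2) by eventually_elim simp
qed (use assms in auto)

lemma L2_norm_cong_AE:
 assumes "AE x in M. f x = f' x" "f : borel_measurable M" "f' : borel_measurable M"
 shows "L2_norm M f = L2_norm M f'"
 unfolding L2_norm_def using L2_inner_cong_AE[OF assms(1,1,2,3,2,3)] by simp

lemma L2_norm_mono_AE:
 assumes "g : Lq_space 2 M" "f : borel_measurable M" "AE x in M. \<bar>f x\<bar> <= \<bar>g x\<bar>"
 shows "L2_norm M f <= L2_norm M g" "f : Lq_space 2 M"
proof -
 have sq: "AE x in M. (f x)\<^sup>2 <= (g x)\<^sup>2"
  using assms(3) by eventually_elim (simp add: abs_le_square_iff)
 have "integrable M (%x. (f x)\<^sup>2)"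
  by (rule Bochner_Integration.integrable_bound[OF L2_integrable_square[OF assms(1)]])
   (use assms sq in auto)
 then show f: "f : Lq_space 2 M" using assms by (simp add: Lq_space_2)
 have "(L2_norm M f)\<^sup>2 <= (L2_norm M g)\<^sup>2"
  unfolding L2_norm_power2 by (rule integral_mono_AE) (use assms f sq in \<open>auto simp: Lq_space_2\<close>)
 then show "L2_norm M f <= L2_norm M g" by (rule power2_le_imp_le) (rule L2_norm_nonneg)
qed

text \<open>The quadratic \<open>t \<mapsto> \<parallel>f - t g\<parallel>^2\<close> is nonnegative;
  its value at the minimiser \<open>?b / ?c\<close> gives the inequality.\<close>

lemma L2_cauchy_schwarz:
 assumes f: "f : Lq_space 2 M" and g: "g : Lq_space 2 M"
 shows "\<bar>L2_inner M f g\<bar> <= L2_norm M f * L2_norm M g"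
proof -
 let ?a = "L2_inner M f f" and ?b = "L2_inner M f g" and ?c = "L2_inner M g g"
 have quad: "0 <= ?a - 2 * t * ?b + t\<^sup>2 * ?c" for t
 proof -
  have "0 <= L2_inner M (%x. f x - t * g x) (%x. f x - t * g x)" by (rule L2_inner_self_nonneg)
  also have "... = (\<integral>x. f x * f x - 2 * t * (f x * g x) + t\<^sup>2 * (g x * g x) \<partial>M)"
   unfolding L2_inner_def by (simp add: algebra_simps power2_eq_square)
  also have "... = ?a - 2 * t * ?b + t\<^sup>2 * ?c"
   unfolding L2_inner_def using L2_integrable_mult[OF f f] L2_integrable_mult[OF f g] L2_integrable_mult[OF g g]
   by simp
  finally show ?thesis .
 qed
 have "?b\<^sup>2 <= ?a * ?c"
 proof (cases "?c = 0")
  case True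
  have "?b = 0"
  proof (rule ccontr)
   assume "?b ~= 0"
   \<comment> \<open>With \<open>?c = 0\<close> the expression is affine in \<open>t\<close>, and at
     this point it equals \<open>-1\<close>.\<close>
   then show False using quad[of "(?a + 1) / (2 * ?b)"] True by simp
  qed
  then show ?thesis using True by simp
 next
  case False
  then have c: "?c > 0" using L2_inner_self_nonneg[of M g] by simp
  have "0 <= ?a - 2 * (?b / ?c) * ?b + (?b / ?c)\<^sup>2 * ?c" by (rule quad)
  also have "... = ?a - ?b\<^sup>2 / ?c" using c by (simp add: field_simps power2_eq_square)
  finally show ?thesis using c by (simp add: field_simps)
 qed
 then have "sqrt (?b\<^sup>2) <= sqrt (?a * ?c)" by (rule real_sqrt_le_mono)
 then show ?thesis by (simp add: L2_norm_def real_sqrt_mult)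
qed

lemma L2_norm_triangle:
 assumes f: "f : Lq_space 2 M" and g: "g : Lq_space 2 M"
 shows "L2_norm M (%x. f x + g x) <= L2_norm M f + L2_norm M g"
proof -
 have "(L2_norm M (%x. f x + g x))\<^sup>2 = (\<integral>x. (f x)\<^sup>2 + (g x)\<^sup>2 + 2 * (f x * g x) \<partial>M)"
  by (simp add: L2_norm_power2 power2_sum mult.assoc)
 also have "... = (L2_norm M f)\<^sup>2 + (L2_norm M g)\<^sup>2 + 2 * L2_inner M f g"
  using f g L2_integrable_mult[OF f g] by (simp add: L2_norm_power2 L2_inner_def Lq_space_2)
 also have "... <= (L2_norm M f + L2_norm M g)\<^sup>2"
  using L2_cauchy_schwarz[OF f g] by (simp add: power2_sum)
 finally show ?thesis by (rule power2_le_imp_le) (simp add: L2_norm_nonneg)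
qed

lemma L2_norm_triangle_diff:
 assumes "f : Lq_space 2 M" "g : Lq_space 2 M" "h : Lq_space 2 M"
 shows "L2_norm M (%x. f x - h x) <= L2_norm M (%x. f x - g x) + L2_norm M (%x. g x - h x)"
 using L2_norm_triangle[OF L2_diff[OF assms(1,2)] L2_diff[OF assms(2,3)]] by simp

lemma L2_norm_triangle_sub:
 assumes "f : Lq_space 2 M" "g : Lq_space 2 M"
 shows "\<bar>L2_norm M f - L2_norm M g\<bar> <= L2_norm M (%x. f x - g x)"
 using L2_norm_triangle[OF L2_diff[OF assms] assms(2)] L2_norm_triangle[OF L2_diff[OF assms(2,1)] assms(1)]
  L2_norm_minus_commute[of M f g] by simp

lemma L2_norm_eq_0_iff:
 assumes "f : Lq_space 2 M"
 shows "L2_norm M f = 0 \<longleftrightarrow> (AE x in M. f x = 0)"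
proof -
 have "L2_norm M f = 0 \<longleftrightarrow> (L2_norm M f)\<^sup>2 = 0" by simp
 also have "... \<longleftrightarrow> (AE x in M. (f x)\<^sup>2 = 0)"
  unfolding L2_norm_power2 by (rule integral_nonneg_eq_0_iff_AE) (use assms in \<open>auto simp: Lq_space_2\<close>)
 finally show ?thesis by simp
qed

lemma nn_integral_square_L2:
 assumes "f : Lq_space 2 M"
 shows "(\<integral>\<^sup>+x. ennreal ((f x)\<^sup>2) \<partial>M) = ennreal ((L2_norm M f)\<^sup>2)"
 using assms by (subst nn_integral_eq_integral) (auto simp: Lq_space_2 L2_norm_power2)

text \<open>Fatou and Tonelli yield bounds for nonnegative integrals of squares; such a bound
  becomes square integrability and a norm estimate at once.\<close>

lemma L2_norm_le_nn_integral:
 assumes "f : borel_measurable M" "(\<integral>\<^sup>+x. ennreal ((f x)\<^sup>2) \<partial>M) <= ennreal (C\<^sup>2)" "0 <= C"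
 shows "L2_norm M f <= C" "f : Lq_space 2 M"
proof -
 have "integrable M (%x. (f x)\<^sup>2)"
  using assms(1,2) by (intro integrableI_bounded) (auto intro: order_le_less_trans)
 then show f: "f : Lq_space 2 M" using assms by (simp add: Lq_space_2)
 show "L2_norm M f <= C"
  using assms(2,3) unfolding nn_integral_square_L2[OF f] ennreal_le_iff[OF zero_le_power2]
  by (rule power2_le_imp_le)
qed

text \<open>Riesz--Fischer: a subsequence with \<open>\<parallel>f\<^sub>k\<^sub>+\<^sub>1 - f\<^sub>k\<parallel> \<le> 2\<^sup>-\<^sup>k\<close>
 converges almost everywhere, and Fatou's lemma upgrades this to convergence in the mean.\<close>

lemma L2_complete:
 assumes f: "!!n::nat. f n : Lq_space 2 M"
  and cauchy: "!!e. e > 0 ==> EX N. ALL m>=N. ALL n>=N. L2_norm M (%x. f m x - f n x) < e"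
 obtains g where "g : Lq_space 2 M" "(%n. L2_norm M (%x. f n x - g x)) \<longlonglongrightarrow> 0"
proof -
 have "ALL k. EX N. ALL m>=N. ALL n>=N. L2_norm M (%x. f m x - f n x) < (1/2)^k"
  using cauchy by simp
 then obtain N where N: "!!k m n. m >= N k ==> n >= N k ==> L2_norm M (%x. f m x - f n x) < (1/2)^k"
  by metis
 \<comment> \<open>\<open>s\<close> is increasing and dominates both \<open>k\<close> and
   \<open>N k\<close>, so it selects a rapidly convergent subsequence.\<close>
 define s where "s k = k + (\<Sum>i\<le>k. N i)" for k
 have sN: "N k <= s k" for k
  unfolding s_def using member_le_sum[of k "{..k}" N] by simp
 have ss: "s k <= s (Suc k)" for k by (simp add: s_def)
 have sk: "k <= s k" for k by (simp add: s_def)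
 define d where "d k x = f (s (Suc k)) x - f (s k) x" for k x
 have d: "d k : Lq_space 2 M" for k unfolding d_def by (intro L2_diff f)
 have dn: "L2_norm M (d k) <= (1/2)^k" for k
  unfolding d_def using N[of k "s (Suc k)" "s k"] sN[of k] ss[of k] by simp
 have meas[measurable]: "f n : borel_measurable M" "d n : borel_measurable M" for n
  using f d by (auto intro: L2_measurable)
 \<comment> \<open>The weight \<open>2^k\<close> still leaves the summable bound
   \<open>2^-k\<close>. Where the weighted sum is finite, with value \<open>C\<close>, it forces
   \<open>\<bar>d k x\<bar> \<le> sqrt C * 2^(-k/2)\<close>, which is summable in
   \<open>k\<close>.\<close>
 have "(\<integral>\<^sup>+x. (\<Sum>k. ennreal (2^k * (d k x)\<^sup>2)) \<partial>M) = (\<Sum>k. \<integral>\<^sup>+x. ennreal (2^k * (d k x)\<^sup>2) \<partial>M)"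
  by (rule nn_integral_suminf) simp
 also have "... <= (\<Sum>k. ennreal ((1/2)^k))"
 proof (intro suminf_le allI)
  fix k
  have "(\<integral>\<^sup>+x. ennreal (2^k * (d k x)\<^sup>2) \<partial>M) = ennreal (2^k) * ennreal ((L2_norm M (d k))\<^sup>2)"
   by (simp add: ennreal_mult nn_integral_cmult nn_integral_square_L2[OF d])
  also have "... = ennreal (2^k * (L2_norm M (d k))\<^sup>2)" by (simp add: ennreal_mult)
  also have "... <= ennreal (2^k * ((1/2)^k)\<^sup>2)"
   using dn[of k] L2_norm_nonneg[of M "d k"] by (intro ennreal_leI mult_left_mono power_mono) auto
  also have "2^k * ((1/2)^k)\<^sup>2 = ((1/2)^k :: real)"
   by (simp add: power2_eq_square power_divide)
  finally show "(\<integral>\<^sup>+x. ennreal (2^k * (d k x)\<^sup>2) \<partial>M) <= ennreal ((1/2)^k)" .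
 qed auto
 also have "... < \<infinity>"
  by (subst suminf_ennreal2) (auto intro!: summable_geometric)
 finally have "AE x in M. (\<Sum>k. ennreal (2^k * (d k x)\<^sup>2)) ~= \<infinity>"
  by (intro nn_integral_PInf_AE) auto
 then have conv: "AE x in M. convergent (%k. f (s k) x)"
 proof eventually_elim
  case (elim x)
  define S where "S = (\<Sum>k. ennreal (2^k * (d k x)\<^sup>2))"
  define C where "C = enn2real S"
  have C: "C >= 0" "S = ennreal C"
   using elim unfolding C_def S_def[symmetric] by (simp_all add: less_top)
  define \<theta> :: real where "\<theta> = sqrt (1/2)"
  have \<theta>: "0 <= \<theta>" "\<theta> < 1" unfolding \<theta>_def by (auto intro: real_sqrt_ge_zero simp: real_sqrt_lt_1_iff)
  have bnd: "\<bar>d k x\<bar> <= sqrt C * \<theta>^k" for k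
  proof -
   have "ennreal (2^k * (d k x)\<^sup>2) <= ennreal C"
    unfolding C(2)[symmetric] S_def
    by (rule order_trans[OF _ sum_le_suminf[OF summableI, of "{k}"]]) (simp_all only: sum.insert finite.intros empty_iff not_False_eq_True sum.empty add_0_right zero_le order_refl)
   then have "2^k * (d k x)\<^sup>2 <= C" using ennreal_le_iff[OF C(1)] by blast
   then have "(1/2)^k * (2^k * (d k x)\<^sup>2) <= (1/2)^k * C" by (intro mult_left_mono) auto
   moreover have "(1/2)^k * (2^k * (d k x)\<^sup>2) = (d k x)\<^sup>2"
    by (simp add: power_one_over)
   ultimately have "(d k x)\<^sup>2 <= C * (1/2)^k" by (simp only: mult.commute)
   then have "sqrt ((d k x)\<^sup>2) <= sqrt (C * (1/2)^k)" by (rule real_sqrt_le_mono)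
   then show ?thesis unfolding real_sqrt_mult \<theta>_def real_sqrt_power[symmetric] by (simp only: real_sqrt_abs)
  qed
  have "summable (%k. d k x)"
  proof (rule summable_comparison_test')
   show "summable (%k. sqrt C * \<theta>^k)"
    by (intro summable_mult summable_geometric) (use \<theta> in simp)
   show "norm (d k x) <= sqrt C * \<theta>^k" for k using bnd by simp
  qed
  then have "convergent (%n. \<Sum>k<n. d k x)" by (simp add: summable_iff_convergent)
  moreover have "(\<Sum>k<n. d k x) = f (s n) x - f (s 0) x" for n
   by (induction n) (auto simp: d_def)
  ultimately have "convergent (%n. f (s n) x - f (s 0) x)" by simp
  then have "convergent (%n. (f (s n) x - f (s 0) x) + f (s 0) x)"
   by (intro convergent_add convergent_const)
  then show ?case by simp
 qed
 define g where "g x = lim (%k. f (s k) x)" for x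
 have g[measurable]: "g : borel_measurable M" unfolding g_def[abs_def] by measurable
 have lim: "AE x in M. (%k. f (s k) x) \<longlonglongrightarrow> g x"
  using conv by eventually_elim (simp add: g_def convergent_LIMSEQ_iff)
 \<comment> \<open>Kept general in \<open>e\<close> because it is applied twice: with
   \<open>e = 1\<close> for membership of the limit, with small \<open>e\<close> for
   convergence.\<close>
 have key: "L2_norm M (%x. f n x - g x) <= e & (%x. f n x - g x) : Lq_space 2 M"
  if "e > 0" "ALL m>=N. ALL n>=N. L2_norm M (%x. f m x - f n x) < e" "n >= N" for e N n
 proof -
  have "(\<integral>\<^sup>+x. ennreal ((f n x - g x)\<^sup>2) \<partial>M) = (\<integral>\<^sup>+x. liminf (%k. ennreal ((f n x - f (s k) x)\<^sup>2)) \<partial>M)"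
  proof (rule nn_integral_cong_AE)
   show "AE x in M. ennreal ((f n x - g x)\<^sup>2) = liminf (%k. ennreal ((f n x - f (s k) x)\<^sup>2))"
    using lim
   proof eventually_elim
    case (elim x)
    then have "(%k. ennreal ((f n x - f (s k) x)\<^sup>2)) \<longlonglongrightarrow> ennreal ((f n x - g x)\<^sup>2)"
     by (intro tendsto_ennrealI tendsto_intros)
    then show ?case by (rule lim_imp_Liminf[OF trivial_limit_sequentially, symmetric])
   qed
  qed
  also have "... <= liminf (%k. \<integral>\<^sup>+x. ennreal ((f n x - f (s k) x)\<^sup>2) \<partial>M)"
   by (rule nn_integral_liminf) simp
  also have "... <= ennreal (e\<^sup>2)"
  proof (rule Liminf_le)
   have "\<forall>\<^sub>F k in sequentially. k >= N" by (rule eventually_ge_at_top)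
   then show "\<forall>\<^sub>F k in sequentially. (\<integral>\<^sup>+x. ennreal ((f n x - f (s k) x)\<^sup>2) \<partial>M) <= ennreal (e\<^sup>2)"
   proof eventually_elim
    case (elim k)
    then have "L2_norm M (%x. f n x - f (s k) x) <= e"
     using that sk[of k] by (meson less_imp_le order_trans)
    then show ?case
     unfolding nn_integral_square_L2[OF L2_diff[OF f f]]
     using L2_norm_nonneg[of M "%x. f n x - f (s k) x"] by (intro ennreal_leI power_mono) auto
   qed
  qed simp
  finally show ?thesis
   using L2_norm_le_nn_integral[of "%x. f n x - g x" M e] that by auto
 qed
 obtain N1 where "ALL m>=N1. ALL n>=N1. L2_norm M (%x. f m x - f n x) < 1" using cauchy[of 1] by auto
 from L2_diff[OF f[of N1] conjunct2[OF key[OF zero_less_one this order_refl]]]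
 have "g : Lq_space 2 M" by simp
 moreover have "(%n. L2_norm M (%x. f n x - g x)) \<longlonglongrightarrow> 0"
 proof (rule LIMSEQ_I)
  fix r :: real assume r: "r > 0"
  then obtain N2 where N2: "ALL m>=N2. ALL n>=N2. L2_norm M (%x. f m x - f n x) < r/2"
   using cauchy[of "r/2"] by auto
  have "norm (L2_norm M (%x. f n x - g x) - 0) < r" if "n >= N2" for n
   using key[OF _ N2 that] r L2_norm_nonneg[of M "%x. f n x - g x"] by simp
  then show "EX no. ALL n>=no. norm (L2_norm M (%x. f n x - g x) - 0) < r" by blast
 qed
 ultimately show ?thesis by (rule that)
qed

section \<open>Smooth functions\<close>

text \<open>Openness of \<open>U\<close> is essential: the derivative at a point sees the function
  on a neighbourhood.\<close>

lemma Ck_on_cong: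
 assumes "open U" "!!x. x : U ==> f x = g x"
 shows "Ck_on k f U \<longleftrightarrow> Ck_on k g U"
 using assms(2)
proof (induction k arbitrary: f g)
 case 0
 then show ?case using continuous_on_cong by fastforce
next
 case (Suc k)
 have hd: "(f has_derivative d) (at x) \<longleftrightarrow> (g has_derivative d) (at x)" if "x : U" for x d
  using has_derivative_transform_within_open[OF _ assms(1) that, of f d UNIV g]
   has_derivative_transform_within_open[OF _ assms(1) that, of g d UNIV f] Suc.prems by auto
 then have fd: "Fd f (at x) = Fd g (at x)" if "x : U" for x
  using that by (simp add: frechet_derivative_def)
 have "f differentiable_on U \<longleftrightarrow> g differentiable_on U"
  using hd assms(1) by (auto simp: differentiable_on_def differentiable_def at_within_open[OF _ assms(1)])
 moreover have "Ck_on k (%x. Fd f (at x) b) U \<longleftrightarrow> Ck_on k (%x. Fd g (at x) b) U" for b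
  by (rule Suc.IH) (simp add: fd)
 ultimately show ?case by simp
qed

lemma Ck_on_imp_continuous: "Ck_on k f U ==> continuous_on U f"
 by (cases k) (auto intro: differentiable_imp_continuous_on)

lemma Ck_on_SucD: "Ck_on (Suc k) f U ==> Ck_on k f U"
 by (induction k arbitrary: f) (auto intro: differentiable_imp_continuous_on)

lemma Ck_on_subset: "Ck_on k f U ==> V \<subseteq> U ==> Ck_on k f V"
proof (induction k arbitrary: f)
 case 0
 then show ?case using continuous_on_subset by simp
next
 case (Suc k)
 then show ?case using differentiable_on_subset by (metis Ck_on.simps(2))
qed

lemma Ck_on_has_derivative:
 assumes "Ck_on (Suc k) f U" "open U" "x : U"
 shows "(f has_derivative Fd f (at x)) (at x)"
proof -
 have "f differentiable (at x)"
  using assms by (auto simp: differentiable_on_def at_within_open[OF _ assms(2)])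
 then show ?thesis by (rule frechet_derivative_works[THEN iffD1])
qed

text \<open>\<open>Ck_on\<close> refers to the chosen \<open>frechet_derivative\<close>; on an open
  set an explicitly computed derivative may stand in for it.\<close>

lemma Ck_on_SucI:
 assumes U: "open U" and d: "!!x. x : U ==> (f has_derivative f' x) (at x)"
  and k: "!!b. b : Basis ==> Ck_on k (%x. f' x b) U"
 shows "Ck_on (Suc k) f U"
proof -
 have eq: "Fd f (at x) = f' x" if "x : U" for x
  using frechet_derivative_at[OF d[OF that]] by simp
 have "f differentiable_on U"
  using d U by (auto simp: differentiable_on_def differentiable_def at_within_open[OF _ U])
 moreover have "Ck_on k (%x. Fd f (at x) b) U" if "b : Basis" for b
  using Ck_on_cong[OF U, of "%x. Fd f (at x) b" "%x. f' x b" k] eq k[OF that] by simp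
 ultimately show ?thesis by simp
qed

lemma Ck_on_const: "open U ==> Ck_on k (%x. c) U"
proof (induction k arbitrary: c)
 case (Suc k)
 then show ?case by (intro Ck_on_SucI[where f' = "%x h. 0"]) auto
qed (auto intro: continuous_intros)

lemma Ck_on_linear:
 assumes "bounded_linear T" "open U" "Ck_on k f U"
 shows "Ck_on k (%x. T (f x)) U"
 using assms(3)
proof (induction k arbitrary: f)
 case 0
 then show ?case using bounded_linear.continuous_on[OF assms(1)] by auto
next
 case (Suc k)
 show ?case
  by (rule Ck_on_SucI[OF assms(2) bounded_linear.has_derivative[OF assms(1) Ck_on_has_derivative[OF Suc.prems assms(2)]]])
   (use Suc in auto)
qed

lemma Ck_on_add:
 assumes "open U" "Ck_on k f U" "Ck_on k g U"
 shows "Ck_on k (%x. f x + g x) U"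
 using assms(2,3)
proof (induction k arbitrary: f g)
 case 0
 then show ?case by (auto intro: continuous_intros)
next
 case (Suc k)
 show ?case
  by (rule Ck_on_SucI[OF assms(1) has_derivative_add[OF Ck_on_has_derivative[OF Suc.prems(1) assms(1)]
    Ck_on_has_derivative[OF Suc.prems(2) assms(1)]]])
   (use Suc in auto)
qed

lemma Ck_on_sum:
 assumes "open U" "!!i. i : I ==> Ck_on k (f i) U"
 shows "Ck_on k (%x. \<Sum>i\<in>I. f i x) U"
 using assms(2) by (induction I rule: infinite_finite_induct)
  (auto intro: Ck_on_const[OF assms(1)] Ck_on_add[OF assms(1)])

lemma Ck_on_scaleR:
 assumes "open U" "Ck_on k (f :: _ => real) U" "Ck_on k g U"
 shows "Ck_on k (%x. f x *\<^sub>R g x) U"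
 using assms(2,3)
proof (induction k arbitrary: f g)
 case 0
 then show ?case by (auto intro: continuous_intros)
next
 case (Suc k)
 show ?case
 proof (rule Ck_on_SucI[OF assms(1) has_derivative_scaleR[OF Ck_on_has_derivative[OF Suc.prems(1) assms(1)]
    Ck_on_has_derivative[OF Suc.prems(2) assms(1)]]])
  fix b :: 'a assume "b : Basis"
  then show "Ck_on k (%x. f x *\<^sub>R Fd g (at x) b + Fd f (at x) b *\<^sub>R g x) U"
   using Suc.prems by (intro Ck_on_add Suc.IH assms(1) Ck_on_SucD[OF Suc.prems(1)] Ck_on_SucD[OF Suc.prems(2)]) auto
 qed
qed

lemma Ck_on_mult:
 "open U ==> Ck_on k (f :: _ => real) U ==> Ck_on k g U ==> Ck_on k (%x. f x * g x) U"
 using Ck_on_scaleR[of U k f g] by simp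

text \<open>The chain rule produces the derivative of \<open>f\<close> along the moving vector
  \<open>Fd g (at x) b\<close>, to which the induction hypothesis does not apply. Expanding that
  vector in the basis leaves sums of products of derivatives in fixed directions.\<close>

lemma Ck_on_compose:
 fixes g :: "'a::euclidean_space => 'b::euclidean_space" and f :: "'b => 'c::real_normed_vector"
 assumes U: "open U" and V: "open V" and "Ck_on k f V" "Ck_on k g U" and gU: "g ` U \<subseteq> V"
 shows "Ck_on k (%x. f (g x)) U"
 using assms(3,4)
proof (induction k arbitrary: f)
 case 0
 then show ?case using continuous_on_compose2[OF _ _ gU, of f] by simp
next
 case (Suc k)
 let ?D = "%x h. Fd f (at (g x)) (Fd g (at x) h)"
 have d: "((%x. f (g x)) has_derivative ?D x) (at x)" if x: "x : U" for x
 proof -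
  have "g x : V" using x gU by auto
  from Ck_on_has_derivative[OF Suc.prems(1) V this] Ck_on_has_derivative[OF Suc.prems(2) U x]
  show ?thesis by (rule has_derivative_compose[rotated])
 qed
 have eq: "?D x b = (\<Sum>c\<in>Basis. (Fd g (at x) b \<bullet> c) *\<^sub>R Fd f (at (g x)) c)" if "x : U" for x b
 proof -
  have "g x : V" using that gU by auto
  then have lin: "linear (Fd f (at (g x)))"
   using Ck_on_has_derivative[OF Suc.prems(1) V] has_derivative_linear by blast
  let ?y = "Fd g (at x) b"
  have "Fd f (at (g x)) ?y = Fd f (at (g x)) (\<Sum>c\<in>Basis. (?y \<bullet> c) *\<^sub>R c)"
   by (simp add: euclidean_representation)
  then show ?thesis by (simp add: linear_sum[OF lin] linear_scale[OF lin])
 qed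
 show ?case
 proof (rule Ck_on_SucI[OF U d])
  fix b :: 'a assume b: "b : Basis"
  have "Ck_on k (%x. \<Sum>c\<in>Basis. (Fd g (at x) b \<bullet> c) *\<^sub>R Fd f (at (g x)) c) U"
  proof (intro Ck_on_sum[OF U] Ck_on_scaleR[OF U])
   fix c :: 'b assume c: "c : Basis"
   show "Ck_on k (%x. Fd g (at x) b \<bullet> c) U"
    by (rule Ck_on_linear[OF bounded_linear_inner_left U]) (use Suc.prems b in simp)
   show "Ck_on k (%x. Fd f (at (g x)) c) U"
    by (rule Suc.IH) (use Suc.prems c Ck_on_SucD[OF Suc.prems(2)] in simp_all)
  qed
  then show "Ck_on k (%x. ?D x b) U"
   using Ck_on_cong[OF U, of "%x. ?D x b"] eq by fastforce
 qed
qed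

lemma smooth_onI_deriv:
 assumes "open U" "!!x. x : U ==> (f has_derivative f' x) (at x)"
  "!!b. b : Basis ==> smooth_on (%x. f' x b) U"
 shows "smooth_on f U"
 unfolding smooth_on_def
proof
 fix k
 show "Ck_on k f U"
  by (rule Ck_on_SucD, rule Ck_on_SucI[OF assms(1,2)]) (use assms(3) in \<open>auto simp: smooth_on_def\<close>)
qed

lemma smooth_on_const: "open U ==> smooth_on (%x. c) U"
 by (simp add: smooth_on_def Ck_on_const)

lemma smooth_on_add: "open U ==> smooth_on f U ==> smooth_on g U ==> smooth_on (%x. f x + g x) U"
 by (simp add: smooth_on_def Ck_on_add)

lemma smooth_on_sum: "open U ==> (!!i. i : I ==> smooth_on (f i) U) ==> smooth_on (%x. \<Sum>i\<in>I. f i x) U"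
 by (simp add: smooth_on_def Ck_on_sum)

lemma smooth_on_mult: "open U ==> smooth_on (f :: _ => real) U ==> smooth_on g U ==> smooth_on (%x. f x * g x) U"
 by (simp add: smooth_on_def Ck_on_mult)

lemma smooth_on_cmult: "open U ==> smooth_on (f :: _ => real) U ==> smooth_on (%x. c * f x) U"
 by (intro smooth_on_mult smooth_on_const)

lemma smooth_on_diff: "open U ==> smooth_on (f :: _ => real) U ==> smooth_on g U ==> smooth_on (%x. f x - g x) U"
 using smooth_on_add[of U f "%x. (-1) * g x"] smooth_on_cmult[of U g "-1"] by simp

lemma smooth_on_linear: "bounded_linear T ==> open U ==> smooth_on T U"
 by (rule smooth_onI_deriv[where f' = "%_. T"])
  (auto intro: bounded_linear_imp_has_derivative smooth_on_const)

lemma smooth_on_compose: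
 fixes g :: "'a::euclidean_space => 'b::euclidean_space"
 assumes "open U" "open V" "smooth_on f V" "smooth_on g U" "g ` U \<subseteq> V"
 shows "smooth_on (%x. f (g x)) U"
 using assms by (auto simp: smooth_on_def intro: Ck_on_compose)

lemma smooth_on_subset: "smooth_on f U ==> V \<subseteq> U ==> smooth_on f V"
 by (auto simp: smooth_on_def intro: Ck_on_subset)

lemma smooth_on_continuous: "smooth_on f U ==> continuous_on U f"
 by (auto simp: smooth_on_def intro: Ck_on_imp_continuous)

lemma smooth_on_has_derivative:
 "smooth_on f U ==> open U ==> x : U ==> (f has_derivative Fd f (at x)) (at x)"
 using Ck_on_has_derivative unfolding smooth_on_def by blast

lemma smooth_on_frechet_basis:
 "smooth_on f U ==> b : Basis ==> smooth_on (%x. Fd f (at x) b) U"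
 unfolding smooth_on_def using Ck_on.simps(2) by blast

text \<open>Smoothness is defined through basis directions; linearity passes it on to every
  direction.\<close>

lemma frechet_derivative_basis_sum:
 fixes f :: "'a::euclidean_space => 'b::real_normed_vector"
 assumes "f differentiable (at x)"
 shows "Fd f (at x) v = (\<Sum>b\<in>Basis. (v \<bullet> b) *\<^sub>R Fd f (at x) b)"
proof -
 have lin: "linear (Fd f (at x))"
  using assms by (simp add: linear_frechet_derivative)
 have "Fd f (at x) v = Fd f (at x) (\<Sum>b\<in>Basis. (v \<bullet> b) *\<^sub>R b)"
  by (simp add: euclidean_representation)
 then show ?thesis by (simp add: linear_sum[OF lin] linear_scale[OF lin])
qed

lemma smooth_on_differentiable: "smooth_on f U ==> open U ==> x : U ==> f differentiable (at x)"
 using smooth_on_has_derivative differentiableI by blast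

lemma smooth_on_frechet:
 assumes "smooth_on (f :: 'a::euclidean_space => real) U" "open U"
 shows "smooth_on (%x. Fd f (at x) v) U"
proof -
 have "smooth_on (%x. \<Sum>b\<in>Basis. (v \<bullet> b) *\<^sub>R Fd f (at x) b) U"
  using assms by (auto intro!: smooth_on_sum smooth_on_cmult smooth_on_frechet_basis)
 then show ?thesis
  using Ck_on_cong[OF assms(2)] frechet_derivative_basis_sum[OF smooth_on_differentiable[OF assms]]
  unfolding smooth_on_def by (metis (no_types, lifting))
qed

subsection \<open>Bump functions\<close>

text \<open>Admitting all polynomials in \<open>1 / t\<close> makes the family closed under
  differentiation, so smoothness follows by a single induction.\<close>

definition exp_flat :: "real poly => real => real" where
 "exp_flat p t = (if t > 0 then poly p (1 / t) * exp (- (1 / t)) else 0)"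

lemma poly_exp_decay: "((%x. poly p x * exp (- x)) \<longlongrightarrow> 0) (at_top :: real filter)"
proof -
 have "((%x. \<Sum>i\<le>degree p. coeff p i * (x ^ i / exp x)) \<longlongrightarrow> (\<Sum>i\<le>degree p. coeff p i * 0)) (at_top :: real filter)"
  by (intro tendsto_intros tendsto_power_div_exp_0)
 then show ?thesis by (simp add: poly_altdef exp_minus divide_inverse[symmetric] sum_divide_distrib)
qed

text \<open>With \<open>x = 1 / t\<close>, differentiation acts as \<open>- x^2 d/dx\<close> and
  turns \<open>p\<close> into \<open>x^2 (p - p')\<close>. At \<open>0\<close> the decay of the
  exponential beats every polynomial in \<open>1 / h\<close>.\<close>

lemma exp_flat_has_derivative:
 "(exp_flat p has_real_derivative exp_flat ([:0, 0, 1:] * (p - pderiv p)) t) (at t)"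
proof -
 consider "t > 0" | "t < 0" | "t = 0" by linarith
 then show ?thesis
 proof cases
  case 1
  have "((%t. poly p (1 / t) * exp (- (1 / t))) has_real_derivative
    exp_flat ([:0, 0, 1:] * (p - pderiv p)) t) (at t)"
   using 1 by (auto intro!: derivative_eq_intros poly_DERIV[THEN DERIV_chain2]
     simp: exp_flat_def field_simps power2_eq_square)
  then show ?thesis
   by (rule has_field_derivative_transform_within_open[of _ _ _ "{0<..}"])
    (use 1 in \<open>auto simp: exp_flat_def\<close>)
 next
  case 2
  have "((%t::real. 0) has_real_derivative exp_flat ([:0, 0, 1:] * (p - pderiv p)) t) (at t)"
   using 2 by (auto simp: exp_flat_def)
  then show ?thesis
   by (rule has_field_derivative_transform_within_open[of _ _ _ "{..<0}"])
    (use 2 in \<open>auto simp: exp_flat_def\<close>)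
 next
  case 3
  have "((%h. exp_flat p h / h) \<longlongrightarrow> 0) (at 0)"
   unfolding filterlim_at_split
  proof
   show "((%h. exp_flat p h / h) \<longlongrightarrow> 0) (at_left 0)"
    by (rule tendsto_eventually) (auto simp: exp_flat_def eventually_at_filter)
   \<comment> \<open>Dividing by \<open>h\<close> multiplies the polynomial in \<open>1 / h\<close>
     by its variable, which is \<open>pCons 0 p\<close>.\<close>
   have "((%h. poly (pCons 0 p) (inverse h) * exp (- inverse h)) \<longlongrightarrow> 0) (at_right 0)"
    by (rule filterlim_compose[OF poly_exp_decay filterlim_inverse_at_top_right])
   then show "((%h. exp_flat p h / h) \<longlongrightarrow> 0) (at_right 0)"
    by (rule Lim_transform_eventually)
     (auto simp: exp_flat_def eventually_at_filter field_simps)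
  qed
  then show ?thesis using 3 by (simp add: DERIV_def exp_flat_def)
 qed
qed

lemma smooth_on_exp_flat: "smooth_on (exp_flat p) UNIV"
proof -
 have "Ck_on k (exp_flat p) UNIV" for k
 proof (induction k arbitrary: p)
  case 0
  show ?case
   using exp_flat_has_derivative DERIV_isCont continuous_at_imp_continuous_on by (metis Ck_on.simps(1))
 next
  case (Suc k)
  show ?case
   by (rule Ck_on_SucI[OF open_UNIV exp_flat_has_derivative[unfolded has_field_derivative_def]])
    (simp add: Suc mult_commute_abs)
 qed
 then show ?thesis by (simp add: smooth_on_def)
qed

text \<open>The squared distance keeps the profile smooth at the centre.\<close>

definition bump :: "'a::euclidean_space => real => 'a => real" where
 "bump x0 r x = exp_flat 1 (r\<^sup>2 - (x - x0) \<bullet> (x - x0))"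

lemma smooth_on_inner_self: "smooth_on (%x. (x - x0) \<bullet> (x - x0)) UNIV"
proof (rule smooth_onI_deriv[where f' = "%x h. 2 * ((x - x0) \<bullet> h)"])
 show "((%x. (x - x0) \<bullet> (x - x0)) has_derivative (%h. 2 * ((x - x0) \<bullet> h))) (at x)" for x
  by (auto intro!: derivative_eq_intros simp: inner_commute)
 show "smooth_on (%x. 2 * ((x - x0) \<bullet> b)) UNIV" for b :: 'a
 proof (rule smooth_onI_deriv[where f' = "%x h. 2 * (h \<bullet> b)"])
  show "((%x. 2 * ((x - x0) \<bullet> b)) has_derivative (%h. 2 * (h \<bullet> b))) (at x)" for x
   by (auto intro!: derivative_eq_intros)
 qed (auto intro: smooth_on_const)
qed auto

lemma smooth_on_bump: "smooth_on (bump x0 r) UNIV"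
proof -
 have "smooth_on (%x. exp_flat 1 (r\<^sup>2 - (x - x0) \<bullet> (x - x0))) UNIV"
  by (intro smooth_on_compose[OF open_UNIV open_UNIV smooth_on_exp_flat]
    smooth_on_diff smooth_on_const smooth_on_inner_self) auto
 then show ?thesis by (simp add: bump_def[abs_def])
qed

lemma bump_nonneg: "0 <= bump x0 r x"
 by (simp add: bump_def exp_flat_def)

lemma bump_pos_iff: "r > 0 ==> bump x0 r x > 0 \<longleftrightarrow> x : ball x0 r"
proof -
 assume r: "r > 0"
 have "x : ball x0 r \<longleftrightarrow> norm (x - x0) < r" by (simp add: dist_norm norm_minus_commute)
 also have "... \<longleftrightarrow> (norm (x - x0))\<^sup>2 < r\<^sup>2"
  using r by (smt (verit) norm_ge_zero power2_less_imp_less power_strict_mono zero_less_numeral)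
 finally show ?thesis by (simp add: bump_def exp_flat_def power2_norm_eq_inner)
qed

lemma bump_eq_0_iff: "r > 0 ==> bump x0 r x = 0 \<longleftrightarrow> x \<notin> ball x0 r"
 using bump_pos_iff[of r x0 x] bump_nonneg[of x0 r x] by linarith

text \<open>The step is \<open>e t / (e t + e (1 - t))\<close> with the flat exponential
  \<open>e\<close>; the denominator is positive because \<open>t\<close> and \<open>1 - t\<close>
  are never both nonpositive.\<close>

lemma smooth_step_exists:
 obtains s :: "real => real" where "smooth_on s UNIV" "!!t. t <= 0 ==> s t = 0" "!!t. t >= 1 ==> s t = 1"
proof -
 define e where "e t = exp_flat 1 t" for t
 have e0: "e t = 0" if "t <= 0" for t using that by (simp add: e_def exp_flat_def)
 have ep: "e t > 0" if "t > 0" for t using that by (simp add: e_def exp_flat_def)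
 have en: "e t >= 0" for t by (simp add: e_def exp_flat_def)
 have den: "e t + e (1 - t) > 0" for t
  using ep[of t] ep[of "1 - t"] en[of t] en[of "1 - t"] by (cases "t > 0") auto
 \<comment> \<open>All negative powers are treated together, since differentiation raises the
   exponent by one.\<close>
 have inv: "Ck_on k (%x::real. inverse x ^ Suc n) {0<..}" for k n
 proof (induction k arbitrary: n)
  case 0
  have "continuous_on {0<..} (%x::real. inverse x ^ Suc n)" by (intro continuous_intros) auto
  then show ?case by simp
 next
  case (Suc k)
  show ?case
  proof (rule Ck_on_SucI[where f' = "%x h. h * (- real (Suc n) * inverse x ^ Suc (Suc n))"])
   show "((%x. inverse x ^ Suc n) has_derivative (%h. h * (- real (Suc n) * inverse x ^ Suc (Suc n)))) (at x)"
    if "x : {0<..}" for x :: real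
   proof -
    have "x ~= 0" using that by simp
    from DERIV_power[OF DERIV_inverse[OF this], of "Suc n"]
    have "((%x. inverse x ^ Suc n) has_real_derivative (- real (Suc n) * inverse x ^ Suc (Suc n))) (at x)"
     by (simp add: mult_ac power2_eq_square) (simp add: algebra_simps)
    then show ?thesis unfolding has_field_derivative_def by (simp add: mult_commute_abs)
   qed
   show "Ck_on k (%x. b * (- real (Suc n) * inverse x ^ Suc (Suc n))) {0<..}" for b :: real
    by (intro Ck_on_mult Ck_on_const Suc.IH) auto
  qed auto
 qed
 have se: "smooth_on e UNIV" using smooth_on_exp_flat[of 1] by (simp add: e_def[abs_def])
 have se1: "smooth_on (%t. e (1 - t)) UNIV"
  by (rule smooth_on_compose[OF open_UNIV open_UNIV se smooth_on_diff[OF open_UNIV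
     smooth_on_const[OF open_UNIV] smooth_on_linear[OF bounded_linear_ident open_UNIV]]]) auto
 have "smooth_on (%t. inverse (e t + e (1 - t)) ^ Suc 0) UNIV"
  by (rule smooth_on_compose[OF open_UNIV _ _ smooth_on_add[OF open_UNIV se se1], of "{0<..}"])
   (use den inv[of _ 0] in \<open>auto simp: smooth_on_def\<close>)
 then have sm: "smooth_on (%t. e t * inverse (e t + e (1 - t))) UNIV"
  by (intro smooth_on_mult se) auto
 show ?thesis
 proof (rule that[OF sm])
  show "e t * inverse (e t + e (1 - t)) = 1" if "t >= 1" for t
   using e0[of "1 - t"] ep[of t] that by simp
 qed (simp add: e0)
qed

lemma smooth_cutoff_exists:
 fixes x0 :: "'a::euclidean_space"
 assumes "r > 0"
 obtains et :: "'a => real" where "smooth_on et UNIV" "!!x. x : ball x0 r ==> et x = 1"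
  "!!x. x \<notin> ball x0 (2 * r) ==> et x = 0"
proof -
 obtain s :: "real => real" where s: "smooth_on s UNIV" "!!t. t <= 0 ==> s t = 0" "!!t. t >= 1 ==> s t = 1"
  using smooth_step_exists by blast
 \<comment> \<open>Normalised so that \<open>q\<close> is \<open>1\<close> at distance
   \<open>r\<close> and \<open>0\<close> at distance \<open>2 * r\<close>.\<close>
 define q where "q x = (1 / (3 * r\<^sup>2)) * (4 * r\<^sup>2 - (x - x0) \<bullet> (x - x0))" for x
 show ?thesis
 proof (rule that[of "%x. s (q x)"])
  show "smooth_on (%x. s (q x)) UNIV"
   unfolding q_def by (intro smooth_on_compose[OF open_UNIV open_UNIV s(1)] smooth_on_cmult
    smooth_on_diff smooth_on_const smooth_on_inner_self) auto
  have d: "(x - x0) \<bullet> (x - x0) = (dist x0 x)\<^sup>2" for x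
   unfolding dist_commute[of x0 x] by (simp add: dist_norm power2_norm_eq_inner)
  show "s (q x) = 1" if "x : ball x0 r" for x
  proof (rule s(3))
   have "(dist x0 x)\<^sup>2 <= r\<^sup>2" using that by (intro power_mono) auto
   then show "q x >= 1" unfolding q_def d using assms by (simp add: field_simps)
  qed
  show "s (q x) = 0" if "x \<notin> ball x0 (2 * r)" for x
  proof (rule s(2))
   have "(2 * r)\<^sup>2 <= (dist x0 x)\<^sup>2" using that assms by (intro power_mono) auto
   then show "q x <= 0" unfolding q_def d using assms by (simp add: field_simps)
  qed
 qed
qed

section \<open>Test functions\<close>

lemma space_leb: "space (leb U) = U"
 by (simp add: leb_def space_restrict_space)

lemma sets_leb: "U : sets borel ==> A : sets (leb U) \<longleftrightarrow> A \<subseteq> U & A : sets borel"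
 by (auto simp: leb_def sets_restrict_space_iff)

lemma integrable_leb:
 fixes f :: "_ => real"
 shows "U : sets borel ==> integrable (leb U) f \<longleftrightarrow> integrable lborel (%x. indicator U x * f x)"
 unfolding leb_def by (subst integrable_restrict_space) auto

lemma integral_leb:
 fixes f :: "_ => real"
 shows "U : sets borel ==> (\<integral>x. f x \<partial>leb U) = (\<integral>x. indicator U x * f x \<partial>lborel)"
 unfolding leb_def by (subst integral_restrict_space) auto

lemma nn_integral_leb:
 "U : sets borel ==> (\<integral>\<^sup>+x. f x \<partial>leb U) = (\<integral>\<^sup>+x. f x * indicator U x \<partial>lborel)"
 unfolding leb_def by (subst nn_integral_restrict_space) auto

lemma borel_measurable_leb:
 fixes f :: "_ => real"
 shows "U : sets borel ==> f : borel_measurable (leb U) \<longleftrightarrow> (%x. indicator U x * f x) : borel_measurable borel"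
 unfolding leb_def by (subst borel_measurable_restrict_space_iff) auto

lemma AE_leb: "U : sets borel ==> (AE x in leb U. P x) \<longleftrightarrow> (AE x in lborel. x : U --> P x)"
 unfolding leb_def by (subst AE_restrict_space_iff) auto

lemma sigma_finite_leb: "U : sets borel ==> sigma_finite_measure (leb U)"
 unfolding leb_def by (intro sigma_finite_measure_restrict_space sigma_finite_lborel) auto

lemma finite_measure_leb:
 assumes "U : sets borel" "bounded U"
 shows "finite_measure (leb U)"
proof
 have "emeasure (leb U) U = emeasure lborel U"
  unfolding leb_def by (subst emeasure_restrict_space) (use assms in auto)
 then show "emeasure (leb U) (space (leb U)) ~= \<infinity>"
  using emeasure_bounded_finite[OF assms(2)] by (auto simp: space_leb)
qed

lemma indicator_mult_square: "(indicator U x * (u::real)) * (indicator U x * u) = indicator U x * (u * u)"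
 by (simp add: indicator_def)

lemma L2_leb:
 "U : sets borel ==> u : Lq_space 2 (leb U) \<longleftrightarrow> (%x. indicator U x * u x) : Lq_space 2 lborel"
 by (simp add: Lq_space_2 borel_measurable_leb integrable_leb power2_eq_square indicator_mult_square)

lemma L2_norm_leb:
 "U : sets borel ==> L2_norm (leb U) u = L2_norm lborel (%x. indicator U x * u x)"
 by (simp add: L2_norm_def L2_inner_def integral_leb indicator_mult_square)

lemma test_funI:
 assumes "smooth_on ze UNIV" "compact K" "K \<subseteq> U" "!!x. x \<notin> K ==> ze x = 0"
 shows "test_fun U ze"
proof -
 have "closure {x. ze x ~= 0} \<subseteq> K"
  using assms by (intro closure_minimal) (auto intro: compact_imp_closed)
 moreover from this have "compact (closure {x. ze x ~= 0})"
  using compact_Int_closed[OF assms(2) closed_closure] by (metis Int_absorb1)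
 ultimately show ?thesis using assms by (auto simp: test_fun_def)
qed

lemma test_funE:
 assumes "test_fun U ze"
 obtains K where "smooth_on ze UNIV" "compact K" "K \<subseteq> U" "!!x. x \<notin> K ==> ze x = 0"
proof (rule that[of "closure {x. ze x ~= 0}"])
 show "ze x = 0" if "x \<notin> closure {x. ze x ~= 0}" for x
  using that closure_subset[of "{x. ze x ~= 0}"] by auto
qed (use assms in \<open>auto simp: test_fun_def\<close>)

lemma test_fun_smooth: "test_fun U ze ==> smooth_on ze UNIV"
 by (simp add: test_fun_def)

lemma test_fun_UNIV: "test_fun U ze ==> test_fun UNIV ze"
 by (simp add: test_fun_def)

lemma test_fun_zero: "test_fun U ze ==> x \<notin> U ==> ze x = 0"
 by (auto elim: test_funE)

lemma test_fun_mult: "smooth_on f UNIV ==> test_fun U ze ==> test_fun U (%x. f x * ze x)"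
 by (erule test_funE, rule test_funI) (auto intro: smooth_on_mult)

lemma test_fun_cmult: "test_fun U ze ==> test_fun U (%x. c * ze x)"
 by (rule test_fun_mult) (auto intro: smooth_on_const)

lemma test_fun_frechet:
 assumes "test_fun U ze"
 shows "test_fun U (%x. Fd ze (at x) v)"
proof -
 obtain K where K: "smooth_on ze UNIV" "compact K" "K \<subseteq> U" "!!x. x \<notin> K ==> ze x = 0"
  using test_funE[OF assms] by blast
 have "Fd ze (at x) v = 0" if "x \<notin> K" for x
 proof -
  have "((%x. 0) has_derivative (%h. 0)) (at x)" by simp
  then have "(ze has_derivative (%h. 0)) (at x)"
   by (rule has_derivative_transform_within_open[of _ _ _ _ "- K"])
    (use K that in \<open>auto intro: compact_imp_closed\<close>)
  from frechet_derivative_at[OF this] show ?thesis by (metis)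
 qed
 then show ?thesis using K by (intro test_funI[of _ K]) (auto intro: smooth_on_frechet)
qed

lemma test_fun_reflect:
 assumes "test_fun UNIV ka"
 shows "test_fun UNIV (%y. ka (x - y))"
proof -
 obtain K where K: "smooth_on ka UNIV" "compact K" "K \<subseteq> UNIV" "!!x. x \<notin> K ==> ka x = 0"
  using test_funE[OF assms] by blast
 have "smooth_on (%y. x - y) UNIV"
 proof (rule smooth_onI_deriv[where f' = "%_ h. - h"])
  show "((%y. x - y) has_derivative (%h. - h)) (at y)" for y
   using has_derivative_diff[OF has_derivative_const[of x] has_derivative_ident] by simp
 qed (simp_all add: smooth_on_const)
 then show ?thesis
 proof (intro test_funI[of _ "(%z. x - z) ` K"] smooth_on_compose[OF open_UNIV open_UNIV K(1)])
  show "compact ((%z. x - z) ` K)"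
   by (intro compact_continuous_image K(2) continuous_intros)
  show "ka (x - y) = 0" if "y \<notin> (%z. x - z) ` K" for y
   by (rule K(4)) (use that in \<open>force intro: image_eqI[of _ _ "x - y"]\<close>)
 qed auto
qed

lemma frechet_derivative_reflect:
 assumes "smooth_on (ka :: 'a::euclidean_space => real) UNIV"
 shows "Fd (%y. ka (x - y)) (at y) v = - Fd ka (at (x - y)) v"
proof -
 let ?D = "Fd ka (at (x - y))"
 have D: "(ka has_derivative ?D) (at (x - y))"
  using smooth_on_has_derivative[OF assms open_UNIV] by simp
 have "((%y. ka (x - y)) has_derivative (%h. ?D (- h))) (at y)"
  by (rule has_derivative_compose[where g = ka and f = "%y. x - y", OF _ D]) (auto intro!: derivative_eq_intros)
 from frechet_derivative_at[OF this]
 have "Fd (%y. ka (x - y)) (at y) v = ?D (- v)" by metis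
 also have "... = - ?D v"
  using has_derivative_linear[OF D] by (rule linear_neg)
 finally show ?thesis .
qed

lemma test_fun_bounded:
 assumes "test_fun U ze"
 obtains C where "0 <= C" "!!x. \<bar>ze x\<bar> <= C"
proof -
 obtain K where K: "smooth_on ze UNIV" "compact K" "K \<subseteq> U" "!!x. x \<notin> K ==> ze x = 0"
  using test_funE[OF assms] by blast
 have "compact (ze ` K)"
  by (intro compact_continuous_image K continuous_on_subset[OF smooth_on_continuous[OF K(1)]]) auto
 then have "bounded (ze ` K)" by (rule compact_imp_bounded)
 then obtain C where C: "!!x. x : K ==> \<bar>ze x\<bar> <= C"
  unfolding bounded_iff by auto
 show ?thesis
  by (rule that[of "max 0 C"]) (use C K(4) in \<open>force simp: max_def\<close>)+
qed

lemma test_fun_measurable: "test_fun U ze ==> ze : borel_measurable borel"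
 using smooth_on_continuous[OF test_fun_smooth] by (auto intro: borel_measurable_continuous_onI)

lemma test_fun_integrable:
 assumes "test_fun U ze"
 shows "integrable lborel ze"
proof -
 obtain K where K: "smooth_on ze UNIV" "compact K" "K \<subseteq> U" "!!x. x \<notin> K ==> ze x = 0"
  using test_funE[OF assms] by blast
 have "integrable lborel (%x. indicator K x *\<^sub>R ze x)"
  by (intro borel_integrable_compact K continuous_on_subset[OF smooth_on_continuous[OF K(1)]]) auto
 moreover have "(%x. indicator K x *\<^sub>R ze x) = ze"
  using K(4) by (auto simp: indicator_def fun_eq_iff)
 ultimately show ?thesis by simp
qed

lemma test_fun_L2:
 assumes "test_fun U ze"
 shows "ze : Lq_space 2 lborel"
 using test_fun_integrable[OF test_fun_mult[OF test_fun_smooth[OF assms] assms]] test_fun_measurable[OF assms]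
 by (simp add: Lq_space_2 power2_eq_square)

lemma line_has_derivative:
 assumes "smooth_on (ze :: 'a::euclidean_space => real) UNIV"
 shows "((%t. ze (x + t *\<^sub>R v)) has_real_derivative Fd ze (at (x + t *\<^sub>R v)) v) (at t)"
proof -
 let ?D = "Fd ze (at (x + t *\<^sub>R v))"
 have D: "(ze has_derivative ?D) (at (x + t *\<^sub>R v))"
  using smooth_on_has_derivative[OF assms open_UNIV] by simp
 have "((%t. ze (x + t *\<^sub>R v)) has_derivative (%h. ?D (h *\<^sub>R v))) (at t)"
  by (rule has_derivative_compose[where g = ze and f = "%t. x + t *\<^sub>R v", OF _ D]) (auto intro!: derivative_eq_intros)
 moreover have "?D (h *\<^sub>R v) = ?D v * h" for h
  using linear_scale[OF has_derivative_linear[OF D]] by (simp add: mult.commute)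
 ultimately show ?thesis by (simp add: has_field_derivative_def)
qed

lemma line_mvt:
 assumes "smooth_on (ze :: 'a::euclidean_space => real) UNIV"
 obtains t where "0 < t" "t < 1" "ze (x + v) - ze x = Fd ze (at (x + t *\<^sub>R v)) v"
proof -
 have "EX t>0. t < 1 & ze (x + 1 *\<^sub>R v) - ze (x + 0 *\<^sub>R v)
   = (1 - 0) * Fd ze (at (x + t *\<^sub>R v)) v"
  by (rule MVT2[of 0 1 "%t. ze (x + t *\<^sub>R v)"]) (auto intro: line_has_derivative[OF assms])
 then show ?thesis using that by auto
qed

lemma test_fun_lipschitz:
 assumes "test_fun U (ze :: 'a::euclidean_space => real)"
 obtains L where "0 <= L" "!!x y. \<bar>ze x - ze y\<bar> <= L * norm (x - y)"
proof -
 have "ALL b. EX C. 0 <= C & (ALL x. \<bar>Fd ze (at x) b\<bar> <= C)"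
  using test_fun_bounded[OF test_fun_frechet[OF assms]] by metis
 then obtain C where C: "!!b. 0 <= C b" "!!b x. \<bar>Fd ze (at x) b\<bar> <= C b" by metis
 define L where "L = (\<Sum>b\<in>(Basis::'a set). C b)"
 have L: "0 <= L" unfolding L_def by (intro sum_nonneg C)
 have D: "\<bar>Fd ze (at x) v\<bar> <= L * norm v" for x v
 proof -
  have "\<bar>Fd ze (at x) v\<bar> = \<bar>\<Sum>b\<in>Basis. (v \<bullet> b) *\<^sub>R Fd ze (at x) b\<bar>"
   by (rule arg_cong[where f = abs], rule frechet_derivative_basis_sum)
    (rule smooth_on_differentiable[OF test_fun_smooth[OF assms] open_UNIV UNIV_I])
  also have "... <= (\<Sum>b\<in>Basis. norm v * C b)"
   by (rule order_trans[OF sum_abs])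
    (auto intro!: sum_mono mult_mono C Basis_le_norm simp: abs_mult)
  finally show ?thesis by (simp add: L_def sum_distrib_left sum_distrib_right mult.commute)
 qed
 show ?thesis
 proof (rule that[OF L])
  fix x y
  obtain t where "ze (y + (x - y)) - ze y = Fd ze (at (y + t *\<^sub>R (x - y))) (x - y)"
   using line_mvt[OF test_fun_smooth[OF assms]] by blast
  then show "\<bar>ze x - ze y\<bar> <= L * norm (x - y)" using D by simp
 qed
qed

section \<open>Invariance of Lebesgue measure and integration by parts\<close>

lemma nn_integral_translate:
 fixes f :: "'a::euclidean_space => ennreal"
 assumes "f : borel_measurable borel"
 shows "(\<integral>\<^sup>+x. f (c + x) \<partial>lborel) = (\<integral>\<^sup>+x. f x \<partial>lborel)"
proof -
 have "(\<integral>\<^sup>+x. f x \<partial>lborel) = (\<integral>\<^sup>+x. f x \<partial>distr lborel borel ((+) c))"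
  by (simp add: lborel_distr_plus)
 also have "... = (\<integral>\<^sup>+x. f (c + x) \<partial>lborel)" by (rule nn_integral_distr) (use assms in auto)
 finally show ?thesis by simp
qed

lemma integral_translate:
 fixes f :: "'a::euclidean_space => real"
 assumes "f : borel_measurable borel"
 shows "(\<integral>x. f (c + x) \<partial>lborel) = (\<integral>x. f x \<partial>lborel)"
proof -
 have "(\<integral>x. f x \<partial>lborel) = (\<integral>x. f x \<partial>distr lborel borel ((+) c))"
  by (simp add: lborel_distr_plus)
 also have "... = (\<integral>x. f (c + x) \<partial>lborel)" by (rule integral_distr) (use assms in auto)
 finally show ?thesis by simp
qed

lemma lborel_distr_reflect: "distr lborel borel (%y. (x::'a::euclidean_space) - y) = lborel"
proof -
 have "(lborel :: 'a measure) = density (distr lborel borel (%y. x + (-1) *\<^sub>R y)) (%_. \<bar>-1 :: real\<bar> ^ DIM('a))"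
  by (rule lborel_affine) simp
 then show ?thesis by (simp add: density_1)
qed

lemma nn_integral_reflect:
 assumes "f : borel_measurable borel"
 shows "(\<integral>\<^sup>+y. f ((x::'a::euclidean_space) - y) \<partial>lborel) = (\<integral>\<^sup>+y. f y \<partial>lborel)"
 using nn_integral_distr[of "%y. x - y" lborel borel f] assms by (simp add: lborel_distr_reflect)

lemma integral_reflect:
 fixes f :: "'a::euclidean_space => real"
 assumes "f : borel_measurable borel"
 shows "(\<integral>y. f (x - y) \<partial>lborel) = (\<integral>y. f y \<partial>lborel)"
 using integral_distr[of "%y. x - y" lborel borel f] assms by (simp add: lborel_distr_reflect)

lemma integrable_reflect:
 fixes f :: "'a::euclidean_space => real"
 assumes "integrable lborel f"
 shows "integrable lborel (%y. f (x - y))"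
 using integrable_distr_eq[of "%y. x - y" lborel borel f] assms by (simp add: lborel_distr_reflect)

text \<open>Translation invariance makes the integral of every difference quotient vanish.\<close>

lemma integral_frechet_test_fun:
 assumes "test_fun U (ze :: 'a::euclidean_space => real)"
 shows "(\<integral>x. Fd ze (at x) v \<partial>lborel) = 0"
proof -
 obtain K where K: "smooth_on ze UNIV" "compact K" "K \<subseteq> U" "!!x. x \<notin> K ==> ze x = 0"
  using test_funE[OF assms] by blast
 obtain L where L: "0 <= L" "!!x y. \<bar>ze x - ze y\<bar> <= L * norm (x - y)"
  using test_fun_lipschitz[OF assms] by blast
 obtain R where R: "!!x. x : K ==> norm x <= R"
  using compact_imp_bounded[OF K(2)] unfolding bounded_iff by blast
 \<comment> \<open>Since \<open>h n \<le> 1\<close>, all difference quotients vanish outside this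
   ball; inside it the Lipschitz constant dominates them.\<close>
 define B where "B = cball (0::'a) (R + norm v)"
 define h where "h n = inverse (real (Suc n))" for n
 have h: "0 < h n" "h n <= 1" for n by (auto simp: h_def field_simps)
 have h0: "h \<longlonglongrightarrow> 0" unfolding h_def by (rule LIMSEQ_inverse_real_of_nat)
 have meas[measurable]: "ze : borel_measurable borel" by (rule test_fun_measurable[OF assms])
 define q where "q n x = (ze (h n *\<^sub>R v + x) - ze x) / h n" for n x
 have int: "integrable lborel ze" by (rule test_fun_integrable[OF assms])
 have int2: "integrable lborel (%x. ze (c + x))" for c
  using integrable_distr_eq[of "(+) c" lborel borel ze] int by (simp add: lborel_distr_plus)
 have q0: "(\<integral>x. q n x \<partial>lborel) = 0" for n
  unfolding q_def using int int2[of "h n *\<^sub>R v"] by (simp add: integral_translate)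
 have "(%n. \<integral>x. q n x \<partial>lborel) \<longlonglongrightarrow> (\<integral>x. Fd ze (at x) v \<partial>lborel)"
 proof (rule integral_dominated_convergence[where w = "%x. indicator B x * (L * norm v)"])
  show "(%x. Fd ze (at x) v) : borel_measurable lborel"
   using test_fun_measurable[OF test_fun_frechet[OF assms]] by simp
  show "q n : borel_measurable lborel" for n unfolding q_def by measurable
  show "integrable lborel (%x. indicator B x * (L * norm v))"
   unfolding B_def by (intro integrable_mult_left integrable_real_indicator) (auto simp: emeasure_lborel_cball_finite[unfolded infinity_ennreal_def])
  show "AE x in lborel. (%n. q n x) \<longlonglongrightarrow> Fd ze (at x) v"
  proof (rule AE_I2)
   fix x
   have "((%t. (ze (x + t *\<^sub>R v) - ze x) / t) \<longlongrightarrow> Fd ze (at x) v) (at 0)"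
    using line_has_derivative[OF K(1), of x v 0] by (simp add: DERIV_def)
   then have "(%n. (ze (x + h n *\<^sub>R v) - ze x) / h n) \<longlonglongrightarrow> Fd ze (at x) v"
    by (rule filterlim_compose) (use h h0 in \<open>auto simp: filterlim_at intro!: always_eventually less_imp_neq[symmetric]\<close>)
   then show "(%n. q n x) \<longlonglongrightarrow> Fd ze (at x) v"
    by (simp add: q_def add.commute)
  qed
  show "AE x in lborel. norm (q n x) <= indicator B x * (L * norm v)" for n
  proof (rule AE_I2)
   fix x
   show "norm (q n x) <= indicator B x * (L * norm v)"
   proof (cases "x : B")
    case True
    have "\<bar>ze (h n *\<^sub>R v + x) - ze x\<bar> <= L * (h n * norm v)"
     using L(2)[of "h n *\<^sub>R v + x" x] h[of n] by simp
    then show ?thesis using True h[of n] by (simp add: q_def field_simps)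
   next
    case False
    then have "norm x > R + norm v" by (simp add: B_def)
    moreover have "norm (h n *\<^sub>R v) <= norm v" using h[of n] mult_right_mono[of "h n" 1 "norm v"] by simp
    moreover have "norm x - norm (h n *\<^sub>R v) <= norm (h n *\<^sub>R v + x)"
     using norm_triangle_ineq4[of "h n *\<^sub>R v + x" "h n *\<^sub>R v"] by simp
    moreover have "norm v >= 0" by simp
    ultimately have "\<not> norm x <= R" "\<not> norm (h n *\<^sub>R v + x) <= R" by linarith+
    then have "ze (h n *\<^sub>R v + x) = 0" "ze x = 0" using R K(4) by blast+
    then show ?thesis using False by (simp add: q_def)
   qed
  qed
 qed
 then show ?thesis using q0 by (simp add: LIMSEQ_const_iff)
qed

lemma frechet_derivative_mult_smooth:
 fixes f g :: "'a::euclidean_space => real"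
 assumes "smooth_on f UNIV" "smooth_on g UNIV"
 shows "Fd (%x. f x * g x) (at x) v
  = f x * Fd g (at x) v + Fd f (at x) v * g x"
 using frechet_derivative_at[OF has_derivative_mult[OF
   smooth_on_has_derivative[OF assms(1) open_UNIV UNIV_I] smooth_on_has_derivative[OF assms(2) open_UNIV UNIV_I]], of x]
 by metis

lemma frechet_derivative_diff_smooth:
 fixes f g :: "'a::euclidean_space => real"
 assumes "smooth_on f UNIV" "smooth_on g UNIV"
 shows "Fd (%x. f x - g x) (at x) v
  = Fd f (at x) v - Fd g (at x) v"
 using frechet_derivative_at[OF has_derivative_diff[OF
   smooth_on_has_derivative[OF assms(1) open_UNIV UNIV_I] smooth_on_has_derivative[OF assms(2) open_UNIV UNIV_I]], of x]
 by metis

text \<open>The product \<open>f * ze\<close> is a test function even though \<open>f\<close> is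
  merely smooth, and the integral of its derivative vanishes.\<close>

lemma integral_by_parts_test_fun:
 assumes "smooth_on f UNIV" "test_fun U (ze :: 'a::euclidean_space => real)"
 shows "(\<integral>x. f x * Fd ze (at x) v \<partial>lborel) = - (\<integral>x. Fd f (at x) v * ze x \<partial>lborel)"
proof -
 have "(\<integral>x. f x * Fd ze (at x) v + Fd f (at x) v * ze x \<partial>lborel) = 0"
  using integral_frechet_test_fun[OF test_fun_mult[OF assms], of v]
  by (simp add: frechet_derivative_mult_smooth[OF assms(1) test_fun_smooth[OF assms(2)]])
 moreover have "integrable lborel (%x. f x * Fd ze (at x) v)"
  by (rule test_fun_integrable[OF test_fun_mult[OF assms(1) test_fun_frechet[OF assms(2)]]])
 moreover have "integrable lborel (%x. Fd f (at x) v * ze x)"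
  by (rule test_fun_integrable[OF test_fun_mult[OF smooth_on_frechet[OF assms(1) open_UNIV] assms(2)]])
 ultimately show ?thesis by simp
qed

section \<open>Mollification\<close>

definition conv :: "('a::euclidean_space => real) => ('a => real) => 'a => real" where
 "conv v ka x = (\<integral>y. v y * ka (x - y) \<partial>lborel)"

lemma conv_integrable:
 assumes "v : Lq_space 2 lborel" "test_fun UNIV ka"
 shows "integrable lborel (%y. v y * ka (x - y))"
 by (rule L2_integrable_mult[OF assms(1) test_fun_L2[OF test_fun_reflect[OF assms(2)]]])

text \<open>The derivative of the kernel is Lipschitz, so its first-order Taylor remainder is at
  most \<open>C * (norm h)^2\<close> uniformly. That remainder is supported in a fixed ball, on
  which \<open>\<bar>v\<bar>\<close> is integrable.\<close>

lemma conv_has_derivative: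
 assumes v: "v : Lq_space 2 lborel" and ka: "test_fun UNIV (ka :: 'a::euclidean_space => real)"
 shows "(conv v ka has_derivative (%h. conv v (%z. Fd ka (at z) h) x)) (at x)"
proof -
 obtain K where K: "smooth_on ka UNIV" "compact K" "K \<subseteq> UNIV" "!!x. x \<notin> K ==> ka x = 0"
  using test_funE[OF ka] by blast
 let ?D = "%z h. Fd ka (at z) h"
 have D: "test_fun UNIV (%z. ?D z h)" for h by (rule test_fun_frechet[OF ka])
 have Dz: "(ka has_derivative ?D z) (at z)" for z
  using smooth_on_has_derivative[OF K(1) open_UNIV] by simp
 have lin: "linear (?D z)" for z by (rule has_derivative_linear[OF Dz])
 have "ALL b. EX L. 0 <= L & (ALL x y. \<bar>?D x b - ?D y b\<bar> <= L * norm (x - y))"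
  using test_fun_lipschitz[OF D] by metis
 then obtain L where L: "!!b. 0 <= L b" "!!b x y. \<bar>?D x b - ?D y b\<bar> <= L b * norm (x - y)" by metis
 define C where "C = (\<Sum>b\<in>(Basis::'a set). L b)"
 have C0: "0 <= C" unfolding C_def by (intro sum_nonneg L)
 have Dlip: "\<bar>?D z h - ?D w h\<bar> <= C * norm (z - w) * norm h" for z w h
 proof -
  note e = frechet_derivative_basis_sum[OF smooth_on_differentiable[OF K(1) open_UNIV UNIV_I]]
  have "?D z h - ?D w h = (\<Sum>b\<in>Basis. (h \<bullet> b) *\<^sub>R ?D z b) - (\<Sum>b\<in>Basis. (h \<bullet> b) *\<^sub>R ?D w b)"
   by (rule arg_cong2[where f = "(-)", OF e e])
  also have "... = (\<Sum>b\<in>Basis. (h \<bullet> b) * (?D z b - ?D w b))"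
   by (simp add: sum_subtractf right_diff_distrib)
  finally have "\<bar>?D z h - ?D w h\<bar> = \<bar>\<Sum>b\<in>Basis. (h \<bullet> b) * (?D z b - ?D w b)\<bar>" by simp
  also have "... <= (\<Sum>b\<in>Basis. norm h * (L b * norm (z - w)))"
   by (rule order_trans[OF sum_abs]) (auto intro!: sum_mono mult_mono L Basis_le_norm simp: abs_mult)
  finally show ?thesis by (simp add: C_def sum_distrib_left sum_distrib_right mult_ac)
 qed
 have rem: "\<bar>ka (z + h) - ka z - ?D z h\<bar> <= C * (norm h)\<^sup>2" for z h
 proof -
  obtain t where t: "0 < t" "t < 1" "ka (z + h) - ka z = ?D (z + t *\<^sub>R h) h"
   using line_mvt[OF K(1)] by blast
  then have "\<bar>ka (z + h) - ka z - ?D z h\<bar> = \<bar>?D (z + t *\<^sub>R h) h - ?D z h\<bar>" by simp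
  also have "... <= C * norm (t *\<^sub>R h) * norm h" using Dlip[of "z + t *\<^sub>R h" h z] by simp
  also have "... <= C * norm h * norm h"
   using t mult_right_mono[of t 1 "norm h"] by (intro mult_right_mono mult_left_mono C0) auto
  finally show ?thesis by (simp add: power2_eq_square mult.assoc)
 qed
 obtain R where R: "!!x. x : K ==> norm x <= R"
  using compact_imp_bounded[OF K(2)] unfolding bounded_iff by blast
 \<comment> \<open>For \<open>norm h \<le> 1\<close> the kernel, its shift by \<open>h\<close> and
   its derivative all vanish at \<open>x - w\<close> when \<open>w\<close> lies outside
   \<open>B\<close>.\<close>
 define B where "B = cball x (R + 1)"
 have Dzero: "?D z h = 0" if "norm z > R" for z h
 proof -
  have "open {z. norm z > R}" by (intro open_Collect_less continuous_intros)
  moreover have "ka z = 0" if "z : {z. norm z > R}" for z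
   using R[of z] K(4)[of z] that by force
  ultimately have "(ka has_derivative (%h. 0)) (at z)"
   using has_derivative_transform_within_open[of "%x. 0" "%h. 0" z UNIV "{z. norm z > R}" ka] that by auto
  then show ?thesis by (metis frechet_derivative_at)
 qed
 have iB: "(%y. indicator B y) : Lq_space 2 lborel"
  by (auto simp: Lq_space_2 B_def indicator_def of_bool_def power2_eq_square
    intro!: integrable_cong_AE_imp[OF integrable_real_indicator[of B lborel]])
   (auto simp: B_def emeasure_lborel_cball_finite[unfolded infinity_ennreal_def])
 define V where "V = (\<integral>y. \<bar>v y\<bar> * indicator B y \<partial>lborel)"
 have Vi: "integrable lborel (%y. \<bar>v y\<bar> * indicator B y)"
  by (rule L2_integrable_mult[OF L2_abs[OF v] iB])
 have V0: "0 <= V" unfolding V_def by (intro integral_nonneg_AE) (auto simp: indicator_def)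
 have lin': "linear (%h. conv v (%z. ?D z h) x)"
 proof (rule linearI)
  show "conv v (%z. ?D z (a + b)) x = conv v (%z. ?D z a) x + conv v (%z. ?D z b) x" for a b
   unfolding conv_def using conv_integrable[OF v D] by (simp add: linear_add[OF lin] distrib_left)
  show "conv v (%z. ?D z (c *\<^sub>R a)) x = c *\<^sub>R conv v (%z. ?D z a) x" for c a
   unfolding conv_def by (simp add: linear_scale[OF lin] mult.left_commute)
 qed
 show ?thesis
 proof (rule has_derivativeI_sandwich[of 1])
  show "bounded_linear (%h. conv v (%z. ?D z h) x)"
   using lin' by (simp add: linear_conv_bounded_linear)
  fix y assume y: "y ~= x" "dist y x < 1"
  define h where "h = y - x"
  have h: "norm h <= 1" "h ~= 0" using y by (auto simp: h_def dist_norm)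
  have eq: "conv v ka (x + h) - conv v ka x - conv v (%z. ?D z h) x
    = (\<integral>w. v w * (ka (x - w + h) - ka (x - w) - ?D (x - w) h) \<partial>lborel)"
   unfolding conv_def using conv_integrable[OF v ka, of "x + h"] conv_integrable[OF v ka, of x] conv_integrable[OF v D, of x h]
   by (simp add: right_diff_distrib algebra_simps)
  have "\<bar>\<integral>w. v w * (ka (x - w + h) - ka (x - w) - ?D (x - w) h) \<partial>lborel\<bar>
    <= (\<integral>w. (C * (norm h)\<^sup>2) * (\<bar>v w\<bar> * indicator B w) \<partial>lborel)"
  proof (rule integral_abs_bound[THEN order_trans], rule integral_mono_AE')
   show "AE w in lborel. \<bar>v w * (ka (x - w + h) - ka (x - w) - ?D (x - w) h)\<bar> <= C * (norm h)\<^sup>2 * (\<bar>v w\<bar> * indicator B w)"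
   proof (rule AE_I2)
    fix w
    show "\<bar>v w * (ka (x - w + h) - ka (x - w) - ?D (x - w) h)\<bar> <= C * (norm h)\<^sup>2 * (\<bar>v w\<bar> * indicator B w)"
    proof (cases "w : B")
     case True
     then show ?thesis
      using mult_left_mono[OF rem[of "x - w" h], of "\<bar>v w\<bar>"] by (simp add: abs_mult mult_ac)
    next
     case False
     then have *: "norm (x - w) > R + 1" by (simp add: B_def dist_norm)
     moreover have "norm (x - w) - norm h <= norm (x - w + h)"
      using norm_triangle_ineq4[of "x - w + h" h] by simp
     ultimately have "\<not> norm (x - w + h) <= R" "\<not> norm (x - w) <= R" using h by linarith+
     then have "ka (x - w + h) = 0" "ka (x - w) = 0" using R K(4) by blast+
     moreover have "?D (x - w) h = 0" using * by (intro Dzero) simp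
     ultimately show ?thesis using C0 by simp
    qed
   qed
  qed (use C0 Vi in \<open>auto simp: indicator_def\<close>)
  also have "... = C * (norm h)\<^sup>2 * V" by (simp add: V_def)
  finally have "\<bar>conv v ka (x + h) - conv v ka x - conv v (%z. ?D z h) x\<bar> <= C * V * (norm h * norm h)"
   unfolding eq by (simp add: power2_eq_square mult_ac)
  then show "norm ((conv v ka y - conv v ka x) - conv v (%z. ?D z (y - x)) x) / norm (y - x) <= C * V * norm (y - x)"
   using h by (simp add: h_def field_simps)
 next
  have "((%y. C * V * norm (y - x)) \<longlongrightarrow> C * V * norm (x - x)) (at x)"
   by (intro tendsto_intros)
  then show "((%y. C * V * norm (y - x)) \<longlongrightarrow> 0) (at x)" by simp
 qed auto
qed

lemma conv_frechet_derivative: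
 assumes "v : Lq_space 2 lborel" "test_fun UNIV ka"
 shows "Fd (conv v ka) (at x) h = conv v (%z. Fd ka (at z) h) x"
 using frechet_derivative_at[OF conv_has_derivative[OF assms]] by metis

text \<open>Differentiation falls on the kernel, whose derivatives are again test functions; hence
  the induction is over all kernels.\<close>

lemma conv_smooth:
 assumes "v : Lq_space 2 lborel" "test_fun UNIV ka"
 shows "smooth_on (conv v ka) UNIV"
proof -
 have "Ck_on k (conv v ka) UNIV" for k using assms(2)
 proof (induction k arbitrary: ka)
  case 0
  then show ?case
   using conv_has_derivative[OF assms(1)] has_derivative_continuous
   by (metis Ck_on.simps(1) continuous_at_imp_continuous_on)
 next
  case (Suc k)
  show ?case
   by (rule Ck_on_SucI[OF open_UNIV conv_has_derivative[OF assms(1) Suc.prems]])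
    (rule Suc.IH[OF test_fun_frechet[OF Suc.prems]])
 qed
 then show ?thesis by (simp add: smooth_on_def)
qed

text \<open>Outer regularity is applied to \<open>A\<close> and to its complement. The complement of
  the second open set is closed and inside \<open>A\<close>; intersecting it with growing balls
  makes it compact, at a loss that tends to zero because \<open>A\<close> has finite
  measure.\<close>

lemma lborel_regular_pair:
 fixes A :: "'a::euclidean_space set"
 assumes A: "A : sets borel" "emeasure lborel A < \<infinity>" and e: "e > 0"
 obtains K W where "compact K" "open W" "K \<subseteq> A" "A \<subseteq> W" "emeasure lborel (W - K) < ennreal e"
proof -
 obtain W where W: "open W" "A \<subseteq> W" "emeasure lborel (W - A) < ennreal (e / 3)"
  using outer_regular_lborel[OF A(1), of "e/3"] e by auto
 have "- A : sets borel" using A by auto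
 then obtain V where V: "open V" "- A \<subseteq> V" "emeasure lborel (V - - A) < ennreal (e / 3)"
  using outer_regular_lborel[of "- A" "e/3"] e by auto
 define K where "K n = - V \<inter> cball 0 (real n)" for n
 have KL: "K n : sets lborel" for n
  using V by (auto simp: K_def intro!: sets.Int borel_closed)
 have "(%n. emeasure lborel (A - K n)) \<longlonglongrightarrow> emeasure lborel (\<Inter>n. A - K n)"
 proof (rule Lim_emeasure_decseq)
  show "range (%n. A - K n) \<subseteq> sets lborel" using A KL by auto
  show "decseq (%n. A - K n)"
   by (auto simp: decseq_def K_def)
  have "emeasure lborel (A - K n) <= emeasure lborel A" for n
   by (rule emeasure_mono) (use A in auto)
  then show "emeasure lborel (A - K n) ~= \<infinity>" for n
   using A(2) by (metis leD top.not_eq_extremum infinity_ennreal_def)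
 qed
 moreover have "(\<Inter>n. A - K n) = V - - A"
 proof -
  have "EX n. norm x <= real n" for x :: 'a by (rule real_arch_simple)
  then show ?thesis using V(2) by (auto simp: K_def)
 qed
 ultimately have "(%n. emeasure lborel (A - K n)) \<longlonglongrightarrow> emeasure lborel (V - - A)" by simp
 then have "\<forall>\<^sub>F n in sequentially. emeasure lborel (A - K n) < ennreal (e / 3)"
  using V(3) by (rule order_tendstoD(2))
 then obtain n where n: "emeasure lborel (A - K n) < ennreal (e / 3)"
  using eventually_happens' sequentially_bot by blast
 have KA: "K n \<subseteq> A" using V(2) by (auto simp: K_def)
 have "emeasure lborel (W - K n) <= emeasure lborel ((W - A) \<union> (A - K n))"
  using A KL[of n] W by (intro emeasure_mono) auto
 also have "... <= emeasure lborel (W - A) + emeasure lborel (A - K n)"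
  using A KL[of n] W by (intro emeasure_subadditive) auto
 also have "... <= ennreal (e / 3) + ennreal (e / 3)"
  using W(3) n by (intro add_mono) auto
 also have "... = ennreal (e / 3 + e / 3)" using e by (intro ennreal_plus[symmetric]) auto
 also have "... < ennreal e" using e by (intro ennreal_lessI) auto
 finally have less: "emeasure lborel (W - K n) < ennreal e" .
 have "compact (K n)" unfolding K_def using V by (intro closed_Int_compact) auto
 then show ?thesis using W less KA by (intro that[of "K n" W]) auto
qed

section \<open>Continuity of translations in the mean\<close>

lemma L2_translate:
 assumes "v : Lq_space 2 (lborel :: 'a::euclidean_space measure)"
 shows "(%x. v (x - h)) : Lq_space 2 lborel" "L2_norm lborel (%x. v (x - h)) = L2_norm lborel v"
proof -
 have v[measurable]: "v : borel_measurable borel" using assms by (simp add: Lq_space_2)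
 have i: "integrable lborel (%x. (v x)\<^sup>2)" by (rule L2_integrable_square[OF assms])
 have "integrable lborel (%x. (v (- h + x))\<^sup>2)"
  using integrable_distr_eq[of "(+) (- h)" lborel borel "%x. (v x)\<^sup>2"] i by (simp add: lborel_distr_plus)
 then show "(%x. v (x - h)) : Lq_space 2 lborel" by (simp add: Lq_space_2)
 have "(L2_norm lborel (%x. v (x - h)))\<^sup>2 = (L2_norm lborel v)\<^sup>2"
  unfolding L2_norm_power2 using integral_translate[of "%x. (v x)\<^sup>2" "- h"] by simp
 then show "L2_norm lborel (%x. v (x - h)) = L2_norm lborel v"
  by (simp add: L2_norm_nonneg)
qed

definition transl_cont :: "('a::euclidean_space => real) => bool" where
 "transl_cont v \<longleftrightarrow> (ALL e>0. EX d>0. ALL h. norm h < d --> L2_norm lborel (%x. v (x - h) - v x) < e)"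

text \<open>Translation is an isometry, so replacing \<open>v\<close> by \<open>w\<close> costs the
  same error before and after the shift.\<close>

lemma transl_cont_approx:
 assumes v: "v : Lq_space 2 lborel"
  and w: "!!e. e > 0 ==> EX w. w : Lq_space 2 lborel & transl_cont w & L2_norm lborel (%x. v x - w x) < e"
 shows "transl_cont v"
 unfolding transl_cont_def
proof (intro allI impI)
 fix e :: real assume "e > 0"
 then obtain w where w: "w : Lq_space 2 lborel" "transl_cont w" "L2_norm lborel (%x. v x - w x) < e / 3"
  using w[of "e/3"] by auto
 from w(2) obtain d where d: "d > 0" "!!h. norm h < d ==> L2_norm lborel (%x. w (x - h) - w x) < e / 3"
  unfolding transl_cont_def using \<open>e > 0\<close> by (metis zero_less_divide_iff zero_less_numeral)
 have "L2_norm lborel (%x. v (x - h) - v x) < e" if h: "norm h < d" for h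
 proof -
  note t = L2_translate[OF v, of h] L2_translate[OF w(1), of h]
  have "L2_norm lborel (%x. v (x - h) - v x) <= L2_norm lborel (%x. v (x - h) - w (x - h)) + L2_norm lborel (%x. w (x - h) - v x)"
   by (rule L2_norm_triangle_diff[OF t(1) t(3) v])
  also have "L2_norm lborel (%x. w (x - h) - v x) <= L2_norm lborel (%x. w (x - h) - w x) + L2_norm lborel (%x. w x - v x)"
   by (rule L2_norm_triangle_diff[OF t(3) w(1) v])
  also have "L2_norm lborel (%x. v (x - h) - w (x - h)) = L2_norm lborel (%x. v x - w x)"
   by (rule L2_translate[OF L2_diff[OF v w(1)]])
  finally show ?thesis using w(3) d(2)[OF h] L2_norm_minus_commute[of lborel w v] by simp
 qed
 then show "EX d>0. ALL h. norm h < d --> L2_norm lborel (%x. v (x - h) - v x) < e" using d(1) by blast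
qed

lemma transl_cont_add:
 assumes "v : Lq_space 2 lborel" "w : Lq_space 2 lborel" "transl_cont v" "transl_cont w"
 shows "transl_cont (%x. v x + w x)"
 unfolding transl_cont_def
proof (intro allI impI)
 fix e :: real assume "e > 0"
 then have e: "e / 2 > 0" by simp
 obtain d1 where d1: "d1 > 0" "!!h. norm h < d1 ==> L2_norm lborel (%x. v (x - h) - v x) < e / 2"
  using assms(3) e unfolding transl_cont_def by blast
 obtain d2 where d2: "d2 > 0" "!!h. norm h < d2 ==> L2_norm lborel (%x. w (x - h) - w x) < e / 2"
  using assms(4) e unfolding transl_cont_def by blast
 have "L2_norm lborel (%x. v (x - h) + w (x - h) - (v x + w x)) < e" if "norm h < min d1 d2" for h
 proof -
  have "L2_norm lborel (%x. (v (x - h) - v x) + (w (x - h) - w x))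
    <= L2_norm lborel (%x. v (x - h) - v x) + L2_norm lborel (%x. w (x - h) - w x)"
   by (intro L2_norm_triangle L2_diff L2_translate assms)
  moreover have "L2_norm lborel (%x. v (x - h) - v x) < e / 2" "L2_norm lborel (%x. w (x - h) - w x) < e / 2"
   using d1(2) d2(2) that by auto
  ultimately show ?thesis by (simp add: algebra_simps)
 qed
 then show "EX d>0. ALL h. norm h < d --> L2_norm lborel (%x. v (x - h) + w (x - h) - (v x + w x)) < e"
  using d1(1) d2(1) by (intro exI[of _ "min d1 d2"]) auto
qed

lemma transl_cont_cmult:
 assumes "transl_cont v"
 shows "transl_cont (%x. c * v x)"
 unfolding transl_cont_def
proof (intro allI impI)
 fix e :: real assume e: "e > 0"
 have "e / (\<bar>c\<bar> + 1) > 0" using e by (intro divide_pos_pos) auto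
 then obtain d where d: "d > 0" "!!h. norm h < d ==> L2_norm lborel (%x. v (x - h) - v x) < e / (\<bar>c\<bar> + 1)"
  using assms unfolding transl_cont_def by blast
 have "L2_norm lborel (%x. c * v (x - h) - c * v x) < e" if "norm h < d" for h
 proof -
  have "L2_norm lborel (%x. c * v (x - h) - c * v x) = \<bar>c\<bar> * L2_norm lborel (%x. v (x - h) - v x)"
   by (subst L2_norm_cmult[symmetric]) (simp add: right_diff_distrib)
  also have "... <= \<bar>c\<bar> * (e / (\<bar>c\<bar> + 1))" using d(2)[OF that] by (intro mult_left_mono) auto
  also have "... < e" using e by (simp add: field_simps)
  finally show ?thesis .
 qed
 then show "EX d>0. ALL h. norm h < d --> L2_norm lborel (%x. c * v (x - h) - c * v x) < e" using d(1) by blast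
qed

lemma L2_indicator:
 assumes "A : sets M" "emeasure M A < \<infinity>"
 shows "(indicator A :: _ => real) : Lq_space 2 M"
proof -
 have "(%x. (indicator A x :: real)\<^sup>2) = indicator A" by (auto simp: indicator_def fun_eq_iff)
 then show ?thesis using assms by (simp add: Lq_space_2 integrable_real_indicator)
qed

text \<open>A short translation keeps \<open>K\<close> inside \<open>W\<close>. Points where the
  indicator and its translate differ therefore lie in \<open>W - K\<close> or in a translate of it,
  and two sets of measure \<open>e^2 / 4\<close> keep the squared norm below
  \<open>e^2\<close>.\<close>

lemma transl_cont_indicator:
 fixes A :: "'a::euclidean_space set"
 assumes A: "A : sets borel" "emeasure lborel A < \<infinity>"
 shows "transl_cont (indicator A :: 'a => real)"
 unfolding transl_cont_def
proof (intro allI impI)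
 fix e :: real assume e: "e > 0"
 obtain K W where KW: "compact K" "open W" "K \<subseteq> A" "A \<subseteq> W" "emeasure lborel (W - K) < ennreal (e\<^sup>2 / 4)"
  using lborel_regular_pair[OF A, of "e\<^sup>2 / 4"] e by auto
 obtain d where d: "d > 0" "(\<Union>x\<in>K. ball x d) \<subseteq> W"
  using compact_subset_open_imp_ball_epsilon_subset[OF KW(1,2)] KW(3,4) by blast
 have S[measurable]: "W - K : sets borel" by (intro sets.Diff borel_open borel_closed compact_imp_closed KW)
 have [measurable]: "A : sets borel" by fact
 have "L2_norm lborel (%x. indicator A (x - h) - indicator A x :: real) < e" if h: "norm h < d" for h
 proof -
  have W: "x : K ==> x + h : W & x - h : W" for x
   using d(2) h by (fastforce simp: dist_norm)
  have "(\<integral>\<^sup>+x. ennreal ((indicator A (x - h) - indicator A x :: real)\<^sup>2) \<partial>lborel)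
    <= (\<integral>\<^sup>+x. indicator (W - K) (- h + x) + indicator (W - K) x \<partial>lborel)"
  proof (rule nn_integral_mono)
   fix x :: 'a
   have "x - h : A ==> x \<notin> A ==> x - h : W - K \<or> x : W - K"
    using W[of "x - h"] KW(3,4) by auto
   moreover have "x - h \<notin> A ==> x : A ==> x - h : W - K \<or> x : W - K"
    using W[of x] KW(3,4) by auto
   ultimately show "ennreal ((indicator A (x - h) - indicator A x :: real)\<^sup>2)
     <= indicator (W - K) (- h + x) + indicator (W - K) x"
    by (cases "x : A"; cases "x - h : A") (auto simp: indicator_def)
  qed
  also have "... = emeasure lborel (W - K) + emeasure lborel (W - K)"
   using nn_integral_translate[of "indicator (W - K)" "- h"] by (subst nn_integral_add) auto
  also have "... <= ennreal (e\<^sup>2 / 4) + ennreal (e\<^sup>2 / 4)" using KW(5) by (intro add_mono) auto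
  also have "... = ennreal (e\<^sup>2 / 4 + e\<^sup>2 / 4)" by (rule ennreal_plus[symmetric]) auto
  finally have le: "(\<integral>\<^sup>+x. ennreal ((indicator A (x - h) - indicator A x :: real)\<^sup>2) \<partial>lborel) <= ennreal (e\<^sup>2 / 4 + e\<^sup>2 / 4)" .
  have "e\<^sup>2 / 4 + e\<^sup>2 / 4 = (sqrt (e\<^sup>2 / 2))\<^sup>2" by simp
  with le have "L2_norm lborel (%x. indicator A (x - h) - indicator A x :: real) <= sqrt (e\<^sup>2 / 2)"
   by (intro L2_norm_le_nn_integral) auto
  also have "... < sqrt (e\<^sup>2)" using e by (intro real_sqrt_less_mono) auto
  finally show ?thesis using e by simp
 qed
 then show "EX d>0. ALL h. norm h < d --> L2_norm lborel (%x. indicator A (x - h) - indicator A x :: real) < e"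
  using d(1) by blast
qed

text \<open>Simple functions dominated by \<open>2 * \<bar>v\<bar>\<close> approximate
  \<open>v\<close> in the mean by dominated convergence, and they are finite combinations of
  indicators.\<close>

lemma transl_cont_L2:
 fixes v :: "'a::euclidean_space => real"
 assumes v: "v : Lq_space 2 lborel"
 shows "transl_cont v"
proof (rule transl_cont_approx[OF v])
 fix e :: real assume e: "e > 0"
 have vm[measurable]: "v : borel_measurable lborel" using v by (rule L2_measurable)
 obtain F where F: "!!i. simple_function lborel (F i)" "!!x. (%i. F i x) \<longlonglongrightarrow> v x"
   "!!i x. dist (F i x) 0 <= 2 * dist (v x) 0"
  using borel_measurable_implies_sequence_metric[where z = 0, OF vm] by auto
 have Fm[measurable]: "F i : borel_measurable lborel" for i using F(1) by (rule borel_measurable_simple_function)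
 have FL: "F i : Lq_space 2 lborel" for i
  by (rule L2_norm_mono_AE(2)[OF L2_cmult[where c = 2, OF v]]) (use F(3) Fm in \<open>auto simp: abs_mult\<close>)
 have "(%i. \<integral>x. (v x - F i x)\<^sup>2 \<partial>lborel) \<longlonglongrightarrow> (\<integral>x. 0 \<partial>(lborel :: 'a measure))"
 proof (rule integral_dominated_convergence[where w = "%x. 9 * (v x)\<^sup>2"])
  show "integrable lborel (%x. 9 * (v x)\<^sup>2)" using v by (simp add: Lq_space_2)
  show "AE x in lborel. (%i. (v x - F i x)\<^sup>2) \<longlonglongrightarrow> 0"
  proof (rule AE_I2)
   fix x
   have "(%i. (v x - F i x)\<^sup>2) \<longlonglongrightarrow> (v x - v x)\<^sup>2" by (intro tendsto_intros F(2))
   then show "(%i. (v x - F i x)\<^sup>2) \<longlonglongrightarrow> 0" by (simp only: diff_self power_zero_numeral)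
  qed
  show "AE x in lborel. norm ((v x - F i x)\<^sup>2) <= 9 * (v x)\<^sup>2" for i
  proof (rule AE_I2)
   fix x
   have "\<bar>v x - F i x\<bar> <= 3 * \<bar>v x\<bar>" using F(3)[of i x] by simp
   then have "\<bar>v x - F i x\<bar>\<^sup>2 <= (3 * \<bar>v x\<bar>)\<^sup>2" by (intro power_mono) auto
   then show "norm ((v x - F i x)\<^sup>2) <= 9 * (v x)\<^sup>2" by (simp add: power_mult_distrib)
  qed
 qed auto
 then have "(%i. (L2_norm lborel (%x. v x - F i x))\<^sup>2) \<longlonglongrightarrow> 0" unfolding L2_norm_power2 by simp
 then have "\<forall>\<^sub>F i in sequentially. (L2_norm lborel (%x. v x - F i x))\<^sup>2 < e\<^sup>2"
  by (rule order_tendstoD(2)) (use e in simp)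
 then obtain i where "(L2_norm lborel (%x. v x - F i x))\<^sup>2 < e\<^sup>2"
  using eventually_happens' sequentially_bot by blast
 then have less: "L2_norm lborel (%x. v x - F i x) < e" using e by (intro power2_less_imp_less[of _ e]) auto
 \<comment> \<open>Chebyshev's inequality: the value \<open>0\<close> may be taken on a set of
   infinite measure, every other value only on a set of finite measure.\<close>
 have fin: "emeasure lborel (F i -` {y}) < \<infinity>" if "y ~= 0" for y
 proof -
  have S: "F i -` {y} : sets lborel" using measurable_sets[OF Fm, of "{y}" i] by simp
  have "ennreal (y\<^sup>2) * emeasure lborel (F i -` {y}) = (\<integral>\<^sup>+x. ennreal (y\<^sup>2) * indicator (F i -` {y}) x \<partial>lborel)"
   by (rule nn_integral_cmult_indicator[OF S, symmetric])
  also have "... <= (\<integral>\<^sup>+x. ennreal ((F i x)\<^sup>2) \<partial>lborel)"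
   by (intro nn_integral_mono) (auto simp: indicator_def)
  also have "... < \<infinity>" by (simp add: nn_integral_square_L2[OF FL])
  finally show ?thesis using that by (auto simp: ennreal_mult_less_top)
 qed
 have fin_img: "finite (range (F i))" using simple_functionD(1)[OF F(1), of i] by simp
 have term_L2: "(%x. y * indicator (F i -` {y}) x) : Lq_space 2 lborel & transl_cont (%x. y * indicator (F i -` {y}) x)" for y
 proof (cases "y = 0")
  case True
  then show ?thesis by (auto simp: L2_zero transl_cont_def L2_norm_def L2_inner_def intro: exI[of _ 1])
 next
  case False
  have S: "F i -` {y} : sets lborel" using measurable_sets[OF Fm, of "{y}" i] by simp
  then have "F i -` {y} : sets borel" by simp
  then show ?thesis
   by (intro conjI L2_cmult L2_indicator[OF S fin[OF False]] transl_cont_cmult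
     transl_cont_indicator[OF _ fin[OF False]])
 qed
 have "(%x. \<Sum>y\<in>S. y * indicator (F i -` {y}) x) : Lq_space 2 lborel & transl_cont (%x. \<Sum>y\<in>S. y * indicator (F i -` {y}) x)"
  if "finite S" for S using that
 proof (induction S)
  case empty
  then show ?case by (auto simp: L2_zero transl_cont_def L2_norm_def L2_inner_def intro: exI[of _ 1])
 next
  case (insert y S)
  show ?case unfolding sum.insert[OF insert.hyps]
   using conjI[OF L2_add[OF conjunct1[OF term_L2[of y]] conjunct1[OF insert.IH]]
     transl_cont_add[OF conjunct1[OF term_L2[of y]] conjunct1[OF insert.IH]
      conjunct2[OF term_L2[of y]] conjunct2[OF insert.IH]]] .
 qed
 from this[OF fin_img] have "transl_cont (%x. \<Sum>y\<in>range (F i). y * indicator (F i -` {y}) x)" by blast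
 moreover have "(%x. \<Sum>y\<in>range (F i). y * indicator (F i -` {y}) x) = F i"
 proof
  fix x
  have "(\<Sum>y\<in>range (F i). y * indicator (F i -` {y}) x) = (\<Sum>y\<in>{F i x}. y * indicator (F i -` {y}) x)"
   by (rule sum.mono_neutral_right) (use fin_img in auto)
  then show "(\<Sum>y\<in>range (F i). y * indicator (F i -` {y}) x) = F i x" by simp
 qed
 ultimately show "EX w. w : Lq_space 2 lborel & transl_cont w & L2_norm lborel (%x. v x - w x) < e"
  using FL less by auto
qed

section \<open>Mollifiers and convergence of mollified functions\<close>

definition mollifier :: "('a::euclidean_space => real) => bool" where
 "mollifier ka \<longleftrightarrow> test_fun UNIV ka & (ALL z. 0 <= ka z) & (\<integral>z. ka z \<partial>lborel) = 1"

lemma mollifier_exists: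
 fixes c :: "'a::euclidean_space"
 assumes "r > 0"
 obtains ka where "mollifier ka" "!!z. z \<notin> ball c r ==> ka z = 0"
proof -
 have t: "test_fun UNIV (bump c r)"
 proof (rule test_funI[of _ "cball c r"])
  show "bump c r x = 0" if "x \<notin> cball c r" for x
   using that bump_eq_0_iff[OF assms, of c x] by (auto simp: subset_iff)
 qed (auto intro: smooth_on_bump)
 define I where "I = (\<integral>z. bump c r z \<partial>lborel)"
 have "I ~= 0"
 proof
  assume "I = 0"
  then have "AE z in lborel. bump c r z = 0"
   using integral_nonneg_eq_0_iff_AE[OF test_fun_integrable[OF t]] by (simp add: I_def bump_nonneg)
  then have "AE z in lborel. z \<notin> ball c r" by (simp add: bump_eq_0_iff[OF assms])
  then have "ball c r : null_sets lborel" using AE_iff_null_sets[of "ball c r" lborel] by auto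
  then show False using content_ball_pos[OF assms, of c] by (simp add: null_sets_def measure_def)
 qed
 moreover have "I >= 0" unfolding I_def by (simp add: bump_nonneg)
 ultimately have I: "I > 0" by simp
 show ?thesis
 proof (rule that[of "%z. (1 / I) * bump c r z"])
  have "(\<integral>z. (1 / I) * bump c r z \<partial>lborel) = (1 / I) * I" unfolding I_def by (rule integral_mult_right_zero)
  then show "mollifier (%z. (1 / I) * bump c r z)"
   unfolding mollifier_def using test_fun_cmult[OF t, of "1 / I"] I by (simp add: bump_nonneg)
  show "(1 / I) * bump c r z = 0" if "z \<notin> ball c r" for z
   using bump_eq_0_iff[OF assms, of c z] that by simp
 qed
qed

lemma conv_commute:
 assumes v: "v : Lq_space 2 lborel" and ka: "test_fun UNIV ka"
 shows "conv v ka x = (\<integral>z. v (x - z) * ka z \<partial>lborel)" "integrable lborel (%z. v (x - z) * ka z)"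
proof -
 have [measurable]: "v : borel_measurable borel" "ka : borel_measurable borel"
  using v test_fun_measurable[OF ka] by (auto simp: Lq_space_2)
 show "conv v ka x = (\<integral>z. v (x - z) * ka z \<partial>lborel)"
  unfolding conv_def using integral_reflect[of "%y. v y * ka (x - y)" x] by simp
 show "integrable lborel (%z. v (x - z) * ka z)"
  using integrable_reflect[OF conv_integrable[OF v ka, of x], of x] by simp
qed

text \<open>Jensen's inequality for the probability density \<open>ka\<close>, obtained from
  Cauchy-Schwarz by splitting \<open>ka\<close> into two factors \<open>sqrt ka\<close>.\<close>

lemma conv_jensen:
 assumes v: "v : Lq_space 2 lborel" and ka: "mollifier ka"
 shows "ennreal ((conv v ka x - v x)\<^sup>2) <= (\<integral>\<^sup>+z. ennreal ((v (x - z) - v x)\<^sup>2 * ka z) \<partial>lborel)"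
proof -
 have k: "test_fun UNIV ka" "!!z. 0 <= ka z" "(\<integral>z. ka z \<partial>lborel) = 1" using ka by (auto simp: mollifier_def)
 have [measurable]: "v : borel_measurable borel" "ka : borel_measurable borel"
  using v test_fun_measurable[OF k(1)] by (auto simp: Lq_space_2)
 let ?F = "%z. (v (x - z) - v x) * sqrt (ka z)"
 have sq: "(%z. sqrt (ka z)) : Lq_space 2 lborel"
  using test_fun_integrable[OF k(1)] k(2) by (simp add: Lq_space_2)
 have n1: "L2_norm lborel (%z. sqrt (ka z)) = 1"
 proof -
  have "(L2_norm lborel (%z. sqrt (ka z)))\<^sup>2 = 1" unfolding L2_norm_power2 using k by simp
  then show ?thesis using L2_norm_nonneg[of lborel "%z. sqrt (ka z)"] by (simp add: power2_eq_1_iff)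
 qed
 have F2: "(?F z)\<^sup>2 = (v (x - z) - v x)\<^sup>2 * ka z" for z using k(2) by (simp add: power_mult_distrib)
 show ?thesis
 proof (cases "?F : Lq_space 2 lborel")
  case True
  have "conv v ka x - v x = (\<integral>z. v (x - z) * ka z \<partial>lborel) - v x * (\<integral>z. ka z \<partial>lborel)"
   using conv_commute(1)[OF v k(1)] k(3) by simp
  also have "... = (\<integral>z. v (x - z) * ka z - v x * ka z \<partial>lborel)"
   using conv_commute(2)[OF v k(1), of x] test_fun_integrable[OF k(1)] by simp
  also have "... = L2_inner lborel ?F (%z. sqrt (ka z))"
   unfolding L2_inner_def mult.assoc real_sqrt_mult_self using k(2) by (simp add: left_diff_distrib)
  finally have "\<bar>conv v ka x - v x\<bar> <= L2_norm lborel ?F"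
   using L2_cauchy_schwarz[OF True sq] n1 by simp
  then have "\<bar>conv v ka x - v x\<bar>\<^sup>2 <= (L2_norm lborel ?F)\<^sup>2" by (intro power_mono) auto
  then show ?thesis using nn_integral_square_L2[OF True] unfolding F2 by (simp add: ennreal_leI)
 next
  case False
  \<comment> \<open>The right-hand side is infinite in this case.\<close>
  then have "\<not> integrable lborel (%z. (?F z)\<^sup>2)" by (simp add: Lq_space_2)
  then have "\<not> (\<integral>\<^sup>+z. ennreal (norm ((?F z)\<^sup>2)) \<partial>lborel) < \<infinity>"
   unfolding integrable_iff_bounded by simp
  then show ?thesis unfolding F2 using k(2) by (simp add: less_top[symmetric])
 qed
qed

text \<open>By Jensen and Tonelli the squared error is an average of
  \<open>\<parallel>v(. - z) - v\<parallel>^2\<close> over the support of the kernel. The radius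
  \<open>d\<close> is fixed before the kernel, so one kernel can serve several functions.\<close>

lemma conv_L2_approx:
 fixes v :: "'a::euclidean_space => real"
 assumes v: "v : Lq_space 2 lborel" and e: "e > 0"
 obtains d where "d > 0" "!!ka. mollifier ka ==> (!!z. ka z ~= 0 ==> norm z < d) ==>
  conv v ka : Lq_space 2 lborel & L2_norm lborel (%x. v x - conv v ka x) <= e"
proof -
 obtain d where d: "d > 0" "!!h. norm h < d ==> L2_norm lborel (%x. v (x - h) - v x) < e"
  using transl_cont_L2[OF v] e unfolding transl_cont_def by blast
 show ?thesis
 proof (rule that[OF d(1)])
  fix ka :: "'a => real" assume ka: "mollifier ka" and supp: "!!z. ka z ~= 0 ==> norm z < d"
  have k: "test_fun UNIV ka" "!!z. 0 <= ka z" "(\<integral>z. ka z \<partial>lborel) = 1" using ka by (auto simp: mollifier_def)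
  have [measurable]: "v : borel_measurable borel" "ka : borel_measurable borel"
   using v test_fun_measurable[OF k(1)] by (auto simp: Lq_space_2)
  have [measurable]: "conv v ka : borel_measurable borel"
   using smooth_on_continuous[OF conv_smooth[OF v k(1)]] by (rule borel_measurable_continuous_onI)
  have "(\<integral>\<^sup>+x. ennreal ((conv v ka x - v x)\<^sup>2) \<partial>lborel)
    <= (\<integral>\<^sup>+x. \<integral>\<^sup>+z. ennreal ((v (x - z) - v x)\<^sup>2 * ka z) \<partial>lborel \<partial>lborel)"
   by (intro nn_integral_mono conv_jensen v ka)
  also have "... = (\<integral>\<^sup>+z. \<integral>\<^sup>+x. ennreal ((v (x - z) - v x)\<^sup>2 * ka z) \<partial>lborel \<partial>lborel)"
   by (rule lborel_pair.Fubini') measurable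
  also have "... <= (\<integral>\<^sup>+z. ennreal (e\<^sup>2) * ennreal (ka z) \<partial>lborel)"
  proof (rule nn_integral_mono)
   fix z
   show "(\<integral>\<^sup>+x. ennreal ((v (x - z) - v x)\<^sup>2 * ka z) \<partial>lborel) <= ennreal (e\<^sup>2) * ennreal (ka z)"
   proof (cases "ka z = 0")
    case False
    have "(\<integral>\<^sup>+x. ennreal ((v (x - z) - v x)\<^sup>2 * ka z) \<partial>lborel)
      = (\<integral>\<^sup>+x. ennreal ((v (x - z) - v x)\<^sup>2) * ennreal (ka z) \<partial>lborel)"
     using k(2) by (simp add: ennreal_mult)
    also have "... = ennreal ((L2_norm lborel (%x. v (x - z) - v x))\<^sup>2) * ennreal (ka z)"
     by (simp add: nn_integral_multc nn_integral_square_L2[OF L2_diff[OF L2_translate(1)[OF v] v]])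
    also have "... <= ennreal (e\<^sup>2) * ennreal (ka z)"
     using d(2)[OF supp[OF False]] L2_norm_nonneg[of lborel "%x. v (x - z) - v x"]
     by (intro mult_right_mono ennreal_leI power_mono) auto
    finally show ?thesis .
   qed simp
  qed
  also have "... = ennreal (e\<^sup>2) * (\<integral>\<^sup>+z. ennreal (ka z) \<partial>lborel)"
   by (rule nn_integral_cmult) simp
  also have "(\<integral>\<^sup>+z. ennreal (ka z) \<partial>lborel) = 1"
   using nn_integral_eq_integral[OF test_fun_integrable[OF k(1)]] k by simp
  finally have "(\<integral>\<^sup>+x. ennreal ((conv v ka x - v x)\<^sup>2) \<partial>lborel) <= ennreal (e\<^sup>2)" by simp
  from L2_norm_le_nn_integral[OF _ this] e
  have r: "L2_norm lborel (%x. conv v ka x - v x) <= e" "(%x. conv v ka x - v x) : Lq_space 2 lborel" by auto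
  from L2_add[OF r(2) v] have "conv v ka : Lq_space 2 lborel" by simp
  then show "conv v ka : Lq_space 2 lborel & L2_norm lborel (%x. v x - conv v ka x) <= e"
   using r(1) L2_norm_minus_commute[of lborel v "conv v ka"] by simp
 qed
qed

section \<open>Weak derivatives\<close>

lemma test_fun_L2_leb:
 assumes "U : sets borel" "test_fun V ze"
 shows "ze : Lq_space 2 (leb U)"
 unfolding L2_leb[OF assms(1)]
 by (rule L2_bounded_mult[OF test_fun_L2[OF assms(2)], of _ 1]) (use assms(1) in \<open>auto simp: indicator_def\<close>)

lemma integral_leb_test_fun:
 assumes "U : sets borel" "test_fun U ze"
 shows "(\<integral>x. f x * ze x \<partial>leb U) = (\<integral>x. f x * ze x \<partial>lborel)"
proof -
 have "indicator U x * (f x * ze x) = f x * ze x" for x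
  using test_fun_zero[OF assms(2), of x] by (cases "x : U") auto
 then show ?thesis by (simp only: integral_leb[OF assms(1)])
qed

text \<open>Cut \<open>d\<close> off inside a ball in \<open>U\<close>. Every mollification of the
  result vanishes, because a reflected kernel times the cutoff is a test function in
  \<open>U\<close>; yet the mollifications approximate the cut-off function in the mean.\<close>

theorem fundamental_lemma:
 fixes d :: "'a::euclidean_space => real"
 assumes U: "open U" and d: "d : Lq_space 2 (leb U)"
  and zero: "!!ze. test_fun U ze ==> (\<integral>x. d x * ze x \<partial>leb U) = 0"
 shows "AE x in leb U. d x = 0"
proof -
 have Ub: "U : sets borel" using U by auto
 have dU: "(%x. indicator U x * d x) : Lq_space 2 lborel" using d L2_leb[OF Ub] by blast
 have local: "EX r>0. AE x in lborel. x : ball x0 r --> d x = 0" if x0: "x0 : U" for x0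
 proof -
  obtain R where R: "R > 0" "cball x0 R \<subseteq> U" using U x0 open_contains_cball by blast
  define r where "r = R / 2"
  have r: "r > 0" "cball x0 (2 * r) \<subseteq> U" using R by (auto simp: r_def)
  obtain et :: "'a => real" where et: "smooth_on et UNIV" "!!x. x : ball x0 r ==> et x = 1"
    "!!x. x \<notin> ball x0 (2 * r) ==> et x = 0"
   using smooth_cutoff_exists[OF r(1), of x0] by blast
  have t: "test_fun U et"
   by (rule test_funI[OF et(1) compact_cball r(2)]) (use et(3) in \<open>auto simp: not_le not_less\<close>)
  obtain C where C: "!!x. \<bar>et x\<bar> <= C" using test_fun_bounded[OF t] by blast
  define v where "v x = et x * (indicator U x * d x)" for x
  have v: "v : Lq_space 2 lborel"
   unfolding v_def by (rule L2_bounded_mult[OF dU, of _ C]) (use C test_fun_measurable[OF t] in auto)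
  have cz: "conv v ka x = 0" if "test_fun UNIV ka" for ka x
  proof -
   have t2: "test_fun U (%y. ka (x - y) * et y)"
    by (rule test_fun_mult[OF test_fun_smooth[OF test_fun_reflect[OF that]] t])
   have "conv v ka x = (\<integral>y. indicator U y * (d y * (ka (x - y) * et y)) \<partial>lborel)"
    unfolding conv_def v_def by (simp add: mult_ac)
   also have "... = (\<integral>y. d y * (ka (x - y) * et y) \<partial>leb U)" by (simp add: integral_leb[OF Ub])
   also have "... = 0" by (rule zero[OF t2])
   finally show ?thesis .
  qed
  have "L2_norm lborel v <= e" if e: "e > 0" for e
  proof -
   obtain de where de: "de > 0" "!!ka. mollifier ka ==> (!!z. ka z ~= 0 ==> norm z < de) ==>
     conv v ka : Lq_space 2 lborel & L2_norm lborel (%x. v x - conv v ka x) <= e"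
    using conv_L2_approx[OF v e] by blast
   obtain ka :: "'a => real" where ka: "mollifier ka" "!!z. z \<notin> ball 0 de ==> ka z = 0"
    using mollifier_exists[OF de(1), of 0] by blast
   have "norm z < de" if "ka z ~= 0" for z using ka(2)[of z] that by (cases "norm z < de") auto
   from de(2)[OF ka(1) this] have "L2_norm lborel (%x. v x - conv v ka x) <= e" by blast
   moreover have "test_fun UNIV ka" using ka(1) by (simp add: mollifier_def)
   ultimately show ?thesis using cz by simp
  qed
  then have "L2_norm lborel v <= 0" by (rule field_le_epsilon) simp
  then have "L2_norm lborel v = 0" using L2_norm_nonneg[of lborel v] by simp
  then have "AE x in lborel. v x = 0" using L2_norm_eq_0_iff[OF v] by simp
  then have "AE x in lborel. x : ball x0 r --> d x = 0"
  proof eventually_elim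
   case (elim x)
   have "ball x0 r \<subseteq> U" using r by (auto simp: subset_iff)
   then show ?case using elim et(2)[of x] by (auto simp: v_def indicator_def split: if_splits)
  qed
  then show ?thesis using r(1) by blast
 qed
 then obtain r where r: "!!x0. x0 : U ==> r x0 > 0 & (AE x in lborel. x : ball x0 (r x0) --> d x = 0)" by metis
 \<comment> \<open>Lindelof leaves countably many balls, so the exceptional null sets can be
   united.\<close>
 obtain F where F: "F \<subseteq> (%x0. ball x0 (r x0)) ` U" "countable F" "\<Union>F = (\<Union>x0\<in>U. ball x0 (r x0))"
  using Lindelof[of "(%x0. ball x0 (r x0)) ` U"] by auto
 have "AE x in lborel. ALL B:F. x : B --> d x = 0"
  unfolding AE_ball_countable[OF F(2)] using F(1) r by blast
 moreover have "U \<subseteq> \<Union>F" unfolding F(3) using r by force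
 ultimately have "AE x in lborel. x : U --> d x = 0" by (auto elim!: eventually_mono)
 then show ?thesis using AE_leb[OF Ub] by blast
qed

lemma has_weak_pd_L2: "has_weak_pd U b u g ==> g : Lq_space 2 (leb U)"
 by (simp add: has_weak_pd_def)

lemma has_weak_pd_eq:
 "has_weak_pd U b u g ==> test_fun U ze ==>
  (\<integral>x. u x * Fd ze (at x) b \<partial>leb U) = - (\<integral>x. g x * ze x \<partial>leb U)"
 by (simp add: has_weak_pd_def)

lemma has_weak_pd_unique:
 assumes U: "open U" and g: "has_weak_pd U b u g" and h: "has_weak_pd U b u h"
 shows "AE x in leb U. g x = h x"
proof -
 have Ub: "U : sets borel" using U by auto
 have "(\<integral>x. (g x - h x) * ze x \<partial>leb U) = 0" if t: "test_fun U ze" for ze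
 proof -
  have "(\<integral>x. (g x - h x) * ze x \<partial>leb U) = (\<integral>x. g x * ze x \<partial>leb U) - (\<integral>x. h x * ze x \<partial>leb U)"
   using L2_inner_diff_left[OF has_weak_pd_L2[OF g] has_weak_pd_L2[OF h] test_fun_L2_leb[OF Ub t]]
   by (simp add: L2_inner_def)
  then show ?thesis using has_weak_pd_eq[OF g t] has_weak_pd_eq[OF h t] by simp
 qed
 from fundamental_lemma[OF U L2_diff[OF has_weak_pd_L2[OF g] has_weak_pd_L2[OF h]] this]
 show ?thesis by simp
qed

lemma has_weak_pd_weak_pd: "has_weak_pd U b u g ==> has_weak_pd U b u (weak_pd U b u)"
 unfolding weak_pd_def by (rule someI[of "has_weak_pd U b u"])

lemma weak_pd_AE: "open U ==> has_weak_pd U b u g ==> AE x in leb U. weak_pd U b u x = g x"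
 by (rule has_weak_pd_unique[OF _ has_weak_pd_weak_pd])

lemma L2_norm_weak_pd:
 assumes "open U" "has_weak_pd U b u g"
 shows "L2_norm (leb U) (weak_pd U b u) = L2_norm (leb U) g"
 by (rule L2_norm_cong_AE[OF weak_pd_AE[OF assms]])
  (use has_weak_pd_L2[OF assms(2)] has_weak_pd_L2[OF has_weak_pd_weak_pd[OF assms(2)]] in \<open>auto simp: Lq_space_2\<close>)

lemma has_weak_pd_diff:
 assumes U: "U : sets borel" and u: "u : Lq_space 2 (leb U)" "v : Lq_space 2 (leb U)"
  and g: "has_weak_pd U b u g" and h: "has_weak_pd U b v h"
 shows "has_weak_pd U b (%x. u x - v x) (%x. g x - h x)"
 unfolding has_weak_pd_def
proof (intro conjI allI impI)
 show "(%x. g x - h x) : Lq_space 2 (leb U)" by (intro L2_diff has_weak_pd_L2[OF g] has_weak_pd_L2[OF h])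
 fix ze :: "'a => real" assume t: "test_fun U ze"
 note L = L2_inner_diff_left[unfolded L2_inner_def]
 show "(\<integral>x. (u x - v x) * Fd ze (at x) b \<partial>leb U) = - (\<integral>x. (g x - h x) * ze x \<partial>leb U)"
  unfolding L[OF u test_fun_L2_leb[OF U test_fun_frechet[OF t]]]
   L[OF has_weak_pd_L2[OF g] has_weak_pd_L2[OF h] test_fun_L2_leb[OF U t]]
  using has_weak_pd_eq[OF g t] has_weak_pd_eq[OF h t] by simp
qed

lemma has_weak_pd_zero: "has_weak_pd U b (%x. 0) (%x. 0)"
 by (auto simp: has_weak_pd_def L2_zero)

lemma has_weak_pd_cong_AE:
 assumes U: "U : sets borel" and u: "AE x in leb U. u x = v x"
  "u : borel_measurable (leb U)" "v : borel_measurable (leb U)"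
 shows "has_weak_pd U b u = has_weak_pd U b v"
proof -
 have "(\<integral>x. u x * Fd ze (at x) b \<partial>leb U) = (\<integral>x. v x * Fd ze (at x) b \<partial>leb U)"
  if "test_fun U ze" for ze
 proof (rule integral_cong_AE)
  have "(%x. Fd ze (at x) b) : borel_measurable (leb U)"
   by (rule L2_measurable[OF test_fun_L2_leb[OF U test_fun_frechet[OF that]]])
  then show "(%x. u x * Fd ze (at x) b) : borel_measurable (leb U)"
   "(%x. v x * Fd ze (at x) b) : borel_measurable (leb U)" using u by auto
  show "AE x in leb U. u x * Fd ze (at x) b = v x * Fd ze (at x) b"
   using u(1) by eventually_elim simp
 qed
 then show ?thesis by (auto simp: has_weak_pd_def fun_eq_iff)
qed

text \<open>Equality of functions, not merely almost everywhere: both sides are the same choice from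
  one and the same predicate.\<close>

lemma weak_pd_cong_AE:
 assumes "U : sets borel" "AE x in leb U. u x = v x"
  "u : borel_measurable (leb U)" "v : borel_measurable (leb U)"
 shows "weak_pd U b u = weak_pd U b v"
 unfolding weak_pd_def has_weak_pd_cong_AE[OF assms] ..

lemma has_weak_pd_smooth:
 assumes U: "U : sets borel" and f: "smooth_on f UNIV"
  and L2: "(%x. Fd f (at x) b) : Lq_space 2 (leb U)"
 shows "has_weak_pd U b f (%x. Fd f (at x) b)"
 unfolding has_weak_pd_def
proof (intro conjI allI impI L2)
 fix ze :: "'a => real" assume t: "test_fun U ze"
 show "(\<integral>x. f x * Fd ze (at x) b \<partial>leb U) = - (\<integral>x. Fd f (at x) b * ze x \<partial>leb U)"
  unfolding integral_leb_test_fun[OF U t] integral_leb_test_fun[OF U test_fun_frechet[OF t]]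
  by (rule integral_by_parts_test_fun[OF f t])
qed

lemma smooth_bounded_on:
 assumes "smooth_on (f :: 'a::euclidean_space => real) UNIV" "bounded U"
 obtains C where "0 <= C" "!!x. x : U ==> \<bar>f x\<bar> <= C"
proof -
 have "compact (f ` closure U)"
  by (intro compact_continuous_image continuous_on_subset[OF smooth_on_continuous[OF assms(1)]])
   (use assms(2) in auto)
 then have "bounded (f ` closure U)" by (rule compact_imp_bounded)
 then obtain C where C: "!!x. x : closure U ==> \<bar>f x\<bar> <= C" unfolding bounded_iff by auto
 show ?thesis
  by (rule that[of "max 0 C"]) (use C closure_subset[of U] in \<open>auto simp: subset_iff le_max_iff_disj\<close>)
qed

lemma smooth_measurable: "smooth_on (f :: 'a::euclidean_space => real) UNIV ==> f : borel_measurable borel"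
 by (rule borel_measurable_continuous_onI) (rule smooth_on_continuous)

lemma smooth_measurable_leb:
 "smooth_on (f :: 'a::euclidean_space => real) UNIV ==> f : borel_measurable (leb U)"
 unfolding leb_def by (intro measurable_restrict_space1) (simp add: smooth_measurable)

lemma smooth_L2_leb:
 assumes "smooth_on (f :: 'a::euclidean_space => real) UNIV" "bounded U" "U : sets borel"
 shows "f : Lq_space 2 (leb U)"
proof -
 obtain C where "!!x. x : U ==> \<bar>f x\<bar> <= C" using smooth_bounded_on[OF assms(1,2)] by blast
 then show ?thesis
  by (intro finite_measure.L2_bounded[OF finite_measure_leb[OF assms(3,2)], of _ C] smooth_measurable_leb assms)
   (auto simp: space_leb)
qed

lemma has_weak_pd_smooth_bounded:
 assumes "smooth_on f UNIV" "bounded U" "U : sets borel"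
 shows "has_weak_pd U b f (%x. Fd f (at x) b)"
 by (intro has_weak_pd_smooth smooth_L2_leb assms smooth_on_frechet) auto

text \<open>Test \<open>u\<close> with \<open>et * ze\<close> and move the term that contains the
  derivative of \<open>et\<close> to the other side.\<close>

lemma has_weak_pd_mult:
 assumes U: "U : sets borel" "bounded U" and u: "u : Lq_space 2 (leb U)" and g: "has_weak_pd U b u g"
  and et: "smooth_on et UNIV"
 shows "has_weak_pd U b (%x. et x * u x) (%x. et x * g x + Fd et (at x) b * u x)"
  "(%x. et x * u x) : Lq_space 2 (leb U)"
proof -
 have mult: "(%x. f x * v x) : Lq_space 2 (leb U)" if f: "smooth_on f UNIV" and v: "v : Lq_space 2 (leb U)" for f v
 proof -
  obtain C where "!!x. x : U ==> \<bar>f x\<bar> <= C" using smooth_bounded_on[OF f U(2)] by blast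
  then show ?thesis by (intro L2_bounded_mult[OF v smooth_measurable_leb[OF f], of C]) (auto simp: space_leb)
 qed
 have et': "smooth_on (%x. Fd et (at x) b) UNIV" by (rule smooth_on_frechet[OF et open_UNIV])
 show "(%x. et x * u x) : Lq_space 2 (leb U)" by (rule mult[OF et u])
 note gL = has_weak_pd_L2[OF g]
 show "has_weak_pd U b (%x. et x * u x) (%x. et x * g x + Fd et (at x) b * u x)"
  unfolding has_weak_pd_def
 proof (intro conjI allI impI)
  show "(%x. et x * g x + Fd et (at x) b * u x) : Lq_space 2 (leb U)"
   by (rule L2_add[OF mult[OF et gL] mult[OF et' u]])
  fix ze :: "'a => real" assume t: "test_fun U ze"
  let ?D = "Fd ze" and ?E = "Fd et"
  have t2: "test_fun U (%x. et x * ze x)" by (rule test_fun_mult[OF et t])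
  have Dt2: "Fd (%x. et x * ze x) (at x) b = et x * ?D (at x) b + ?E (at x) b * ze x" for x
   by (rule frechet_derivative_mult_smooth[OF et test_fun_smooth[OF t]])
  have i1: "integrable (leb U) (%x. u x * (et x * ?D (at x) b))"
   by (rule L2_integrable_mult[OF u mult[OF et test_fun_L2_leb[OF U(1) test_fun_frechet[OF t]]]])
  have i2: "integrable (leb U) (%x. u x * (?E (at x) b * ze x))"
   by (rule L2_integrable_mult[OF u mult[OF et' test_fun_L2_leb[OF U(1) t]]])
  have i3: "integrable (leb U) (%x. g x * (et x * ze x))"
   by (rule L2_integrable_mult[OF gL mult[OF et test_fun_L2_leb[OF U(1) t]]])
  have "(\<integral>x. u x * (et x * ?D (at x) b) + u x * (?E (at x) b * ze x) \<partial>leb U) = - (\<integral>x. g x * (et x * ze x) \<partial>leb U)"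
   using has_weak_pd_eq[OF g t2] unfolding Dt2 by (simp only: distrib_left)
  then have "(\<integral>x. u x * (et x * ?D (at x) b) \<partial>leb U)
    = - ((\<integral>x. g x * (et x * ze x) \<partial>leb U) + (\<integral>x. u x * (?E (at x) b * ze x) \<partial>leb U))"
   using i1 i2 by simp
  also have "(\<integral>x. g x * (et x * ze x) \<partial>leb U) + (\<integral>x. u x * (?E (at x) b * ze x) \<partial>leb U)
    = (\<integral>x. (et x * g x + ?E (at x) b * u x) * ze x \<partial>leb U)"
   using i2 i3 by (subst Bochner_Integration.integral_add[symmetric]) (auto simp: algebra_simps)
  finally show "(\<integral>x. et x * u x * ?D (at x) b \<partial>leb U) = - (\<integral>x. (et x * g x + ?E (at x) b * u x) * ze x \<partial>leb U)"
   by (simp add: mult_ac)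
 qed
qed

section \<open>The space \<open>H1\<close> and its norms\<close>

lemma H1_L2: "u : H1 U ==> u : Lq_space 2 (leb U)"
 by (simp add: H1_def)

lemma H1_has_weak_pd: "u : H1 U ==> b : Basis ==> has_weak_pd U b u (weak_pd U b u)"
 unfolding H1_def using has_weak_pd_weak_pd by blast

lemma H1_weak_pd_L2: "u : H1 U ==> b : Basis ==> weak_pd U b u : Lq_space 2 (leb U)"
 using has_weak_pd_L2[OF H1_has_weak_pd] .

lemma H1_diff:
 assumes "U : sets borel" "u : H1 U" "v : H1 U"
 shows "(%x. u x - v x) : H1 U"
proof -
 have "EX g. has_weak_pd U b (%x. u x - v x) g" if "b : Basis" for b
  using has_weak_pd_diff[OF assms(1) H1_L2[OF assms(2)] H1_L2[OF assms(3)]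
    H1_has_weak_pd[OF assms(2) that] H1_has_weak_pd[OF assms(3) that]] by blast
 then show ?thesis using L2_diff[OF H1_L2[OF assms(2)] H1_L2[OF assms(3)]] by (simp add: H1_def)
qed

lemma weak_pd_diff_AE:
 assumes "open U" "u : H1 U" "v : H1 U" "b : Basis"
 shows "AE x in leb U. weak_pd U b (%x. u x - v x) x = weak_pd U b u x - weak_pd U b v x"
proof -
 have "U : sets borel" using assms(1) by auto
 then show ?thesis
  by (intro weak_pd_AE[OF assms(1)] has_weak_pd_diff H1_L2 H1_has_weak_pd assms)
qed

lemma H1_mult_smooth:
 assumes "U : sets borel" "bounded U" "u : H1 U" "smooth_on et UNIV"
 shows "(%x. et x * u x) : H1 U"
proof -
 have "EX g. has_weak_pd U b (%x. et x * u x) g" if "b : Basis" for b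
  using has_weak_pd_mult(1)[OF assms(1,2) H1_L2[OF assms(3)] H1_has_weak_pd[OF assms(3) that] assms(4)] by blast
 moreover have "(%x. et x * u x) : Lq_space 2 (leb U)"
  by (rule has_weak_pd_mult(2)[OF assms(1,2) H1_L2[OF assms(3)] H1_has_weak_pd[OF assms(3) SOME_Basis] assms(4)])
 ultimately show ?thesis by (auto simp: H1_def)
qed

lemma smooth_H1:
 assumes "smooth_on f UNIV" "bounded U" "U : sets borel"
 shows "f : H1 U"
 unfolding H1_def using smooth_L2_leb[OF assms] has_weak_pd_smooth_bounded[OF assms] by blast

lemma grad_norm_power2: "(grad_norm U u)\<^sup>2 = (\<Sum>b\<in>Basis. (L2_norm (leb U) (weak_pd U b u))\<^sup>2)"
 unfolding grad_norm_def grad_inner_def L2_norm_def by (simp add: sum_nonneg L2_inner_self_nonneg)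

lemma grad_norm_nonneg: "0 <= grad_norm U u"
 unfolding grad_norm_def grad_inner_def by (simp add: sum_nonneg L2_inner_self_nonneg)

lemma H1_norm_power2: "(H1_norm U u)\<^sup>2 = (L2_norm (leb U) u)\<^sup>2 + (\<Sum>b\<in>Basis. (L2_norm (leb U) (weak_pd U b u))\<^sup>2)"
 by (simp add: H1_norm_def grad_norm_power2 sum_nonneg)

lemma H1_norm_nonneg: "0 <= H1_norm U u"
 by (simp add: H1_norm_def)

lemma L2_le_H1_norm: "L2_norm (leb U) u <= H1_norm U u"
 by (rule power2_le_imp_le) (auto simp: H1_norm_power2 H1_norm_nonneg intro!: sum_nonneg)

lemma grad_le_H1_norm: "grad_norm U u <= H1_norm U u"
 by (rule power2_le_imp_le) (auto simp: H1_norm_power2 grad_norm_power2 H1_norm_nonneg)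

lemma weak_pd_le_grad_norm:
 assumes "b : Basis"
 shows "L2_norm (leb U) (weak_pd U b u) <= grad_norm U u"
proof (rule power2_le_imp_le)
 show "(L2_norm (leb U) (weak_pd U b u))\<^sup>2 <= (grad_norm U u)\<^sup>2"
  unfolding grad_norm_power2 using assms by (intro member_le_sum) auto
qed (rule grad_norm_nonneg)

lemma H1_norm_le_sum: "H1_norm U u <= L2_norm (leb U) u + (\<Sum>b\<in>Basis. L2_norm (leb U) (weak_pd U b u))"
proof (rule power2_le_imp_le)
 let ?s = "\<Sum>b\<in>Basis. L2_norm (leb U) (weak_pd U b u)"
 have s: "(\<Sum>b\<in>Basis. (L2_norm (leb U) (weak_pd U b u))\<^sup>2) <= ?s\<^sup>2"
 proof -
  have "(\<Sum>b\<in>Basis. (L2_norm (leb U) (weak_pd U b u))\<^sup>2) <= (\<Sum>b\<in>Basis. L2_norm (leb U) (weak_pd U b u) * ?s)"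
   unfolding power2_eq_square by (intro sum_mono mult_left_mono member_le_sum) (auto simp: L2_norm_nonneg)
  then show ?thesis by (simp add: sum_distrib_right[symmetric] power2_eq_square)
 qed
 have "?s >= 0" by (intro sum_nonneg L2_norm_nonneg)
 then have "0 <= L2_norm (leb U) u * ?s" by (intro mult_nonneg_nonneg L2_norm_nonneg)
 then show "(H1_norm U u)\<^sup>2 <= (L2_norm (leb U) u + ?s)\<^sup>2"
  using s by (simp add: H1_norm_power2 power2_sum)
qed (intro add_nonneg_nonneg sum_nonneg L2_norm_nonneg)

lemma H1_norm_le_grad: "H1_norm U u <= L2_norm (leb U) u + grad_norm U u"
 by (rule power2_le_imp_le)
  (auto simp: H1_norm_def power2_sum L2_norm_nonneg grad_norm_nonneg)

lemma H1_norm_cong_AE: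
 assumes "U : sets borel" "AE x in leb U. u x = v x"
  "u : borel_measurable (leb U)" "v : borel_measurable (leb U)"
 shows "H1_norm U u = H1_norm U v" "grad_norm U u = grad_norm U v"
 using weak_pd_cong_AE[OF assms] L2_norm_cong_AE[OF assms(2-4)]
 by (simp_all add: H1_norm_def grad_norm_def grad_inner_def)

lemma L2_norm_weak_pd_triangle:
 assumes "open U" "u : H1 U" "v : H1 U" "b : Basis"
 shows "L2_norm (leb U) (weak_pd U b (%x. u x - v x)) = L2_norm (leb U) (%x. weak_pd U b u x - weak_pd U b v x)"
 by (rule L2_norm_cong_AE[OF weak_pd_diff_AE[OF assms]])
  (use assms H1_weak_pd_L2[OF H1_diff[of U u v]] H1_weak_pd_L2[of u U] H1_weak_pd_L2[of v U] in
   \<open>auto intro!: L2_measurable L2_diff\<close>)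

text \<open>The weak derivative of a sum is only a chosen representative, so the estimate goes
  through each derivative separately. The factor comes from bounding the norm by a sum of
  \<open>1 + DIM('a)\<close> terms and is harmless in limits.\<close>

lemma H1_norm_triangle:
 assumes "open (U :: 'a::euclidean_space set)" "u : H1 U" "v : H1 U" "w : H1 U"
 shows "H1_norm U (%x. u x - w x) <= (1 + DIM('a)) * (H1_norm U (%x. u x - v x) + H1_norm U (%x. v x - w x))"
proof -
 let ?N = "H1_norm U (%x. u x - v x) + H1_norm U (%x. v x - w x)"
 have 1: "L2_norm (leb U) (%x. u x - w x) <= ?N"
  using L2_norm_triangle_diff[OF H1_L2[OF assms(2)] H1_L2[OF assms(3)] H1_L2[OF assms(4)]]
   L2_le_H1_norm[of U "%x. u x - v x"] L2_le_H1_norm[of U "%x. v x - w x"] by linarith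
 have 2: "L2_norm (leb U) (weak_pd U b (%x. u x - w x)) <= ?N" if b: "b : Basis" for b
 proof -
  have "L2_norm (leb U) (weak_pd U b (%x. u x - w x))
    <= L2_norm (leb U) (weak_pd U b (%x. u x - v x)) + L2_norm (leb U) (weak_pd U b (%x. v x - w x))"
   using L2_norm_triangle_diff[OF H1_weak_pd_L2[OF assms(2) b] H1_weak_pd_L2[OF assms(3) b] H1_weak_pd_L2[OF assms(4) b]]
    L2_norm_weak_pd_triangle[OF assms(1,2,3) b] L2_norm_weak_pd_triangle[OF assms(1,3,4) b]
    L2_norm_weak_pd_triangle[OF assms(1,2,4) b] by simp
  then show ?thesis
   using order_trans[OF weak_pd_le_grad_norm[OF b] grad_le_H1_norm, of U "%x. u x - v x"]
    order_trans[OF weak_pd_le_grad_norm[OF b] grad_le_H1_norm, of U "%x. v x - w x"] by linarith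
 qed
 have "H1_norm U (%x. u x - w x) <= ?N + (\<Sum>b\<in>(Basis :: 'a set). ?N)"
  by (rule order_trans[OF H1_norm_le_sum]) (intro add_mono 1 sum_mono 2)
 then show ?thesis by (simp add: algebra_simps)
qed

section \<open>Density of smooth functions\<close>

text \<open>The kernel is centred off the origin so that mollification at a point of \<open>U\<close> near the
 boundary only uses values of \<open>u\<close> inside \<open>U\<close>.\<close>

lemma local_smooth_approx:
 fixes U :: "'a::euclidean_space set"
 assumes U: "open U" "bounded U" and u: "u : H1 U" and r: "r > 0" and et: "test_fun (ball x0 (3 * r)) et"
  and shift: "!!de. de > 0 ==> EX c rh. rh > 0 & norm c + rh < de & (ALL x : U \<inter> ball x0 (4 * r). ALL z : cball c rh. x - z : U)"
  and e: "e > 0"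
 obtains ph where "smooth_on ph UNIV" "H1_norm U (%x. et x * u x - ph x) <= e"
proof -
 have Ub: "U : sets borel" using U by auto
 have ets: "smooth_on et UNIV" by (rule test_fun_smooth[OF et])
 \<comment> \<open>The zero extension is square integrable on the whole space but in general has no
   weak derivative across the boundary of \<open>U\<close>; derivatives of its mollification are
   therefore computed only at points of \<open>U\<close>.\<close>
 define v where "v x = indicator U x * (et x * u x)" for x
 define g where "g b x = et x * weak_pd U b u x + Fd et (at x) b * u x" for b x
 define G where "G b x = indicator U x * g b x" for b x
 have wp: "has_weak_pd U b (%x. et x * u x) (g b)" if "b : Basis" for b
  using has_weak_pd_mult(1)[OF Ub U(2) H1_L2[OF u] H1_has_weak_pd[OF u that] ets] unfolding g_def .
 have etu: "(%x. et x * u x) : H1 U" by (rule H1_mult_smooth[OF Ub U(2) u ets])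
 have v: "v : Lq_space 2 lborel" unfolding v_def by (rule L2_leb[OF Ub, THEN iffD1, OF H1_L2[OF etu]])
 have G: "G b : Lq_space 2 lborel" if "b : Basis" for b
  unfolding G_def by (rule L2_leb[OF Ub, THEN iffD1, OF has_weak_pd_L2[OF wp[OF that]]])
 have v0: "v y = 0" and G0: "G b y = 0" if "y \<notin> ball x0 (3 * r)" for y b
  using test_fun_zero[OF et that] test_fun_zero[OF test_fun_frechet[OF et] that] by (simp_all add: v_def G_def g_def)
 \<comment> \<open>One error for the function and one for each partial derivative.\<close>
 define e' where "e' = e / (1 + DIM('a))"
 have e': "e' > 0" using e by (simp add: e'_def)
 obtain dv where dv: "dv > 0" "!!ka. mollifier ka ==> (!!z. ka z ~= 0 ==> norm z < dv) ==>
   conv v ka : Lq_space 2 lborel & L2_norm lborel (%x. v x - conv v ka x) <= e'"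
  using conv_L2_approx[OF v e'] by blast
 have "ALL b:Basis. EX d>0. ALL ka. mollifier ka --> (ALL z. ka z ~= 0 --> norm z < d) -->
   conv (G b) ka : Lq_space 2 lborel & L2_norm lborel (%x. G b x - conv (G b) ka x) <= e'"
 proof
  fix b :: 'a assume "b : Basis"
  then show "EX d>0. ALL ka. mollifier ka --> (ALL z. ka z ~= 0 --> norm z < d) -->
    conv (G b) ka : Lq_space 2 lborel & L2_norm lborel (%x. G b x - conv (G b) ka x) <= e'"
   using conv_L2_approx[OF G e'] by metis
 qed
 then obtain dG where dG: "!!b. b : Basis ==> dG b > 0" "!!b ka. b : Basis ==> mollifier ka ==>
   (!!z. ka z ~= 0 ==> norm z < dG b) ==> conv (G b) ka : Lq_space 2 lborel & L2_norm lborel (%x. G b x - conv (G b) ka x) <= e'"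
  by metis
 \<comment> \<open>A single kernel has to approximate \<open>v\<close> and all the
   \<open>G b\<close>, so the smallest admissible radius is taken.\<close>
 define de where "de = Min (insert r (insert dv (dG ` Basis)))"
 have de: "de > 0" "de <= r" "de <= dv" "!!b. b : Basis ==> de <= dG b"
 proof -
  have fin: "finite (insert r (insert dv (dG ` Basis)))" by simp
  show "de > 0" unfolding de_def by (subst Min_gr_iff[OF fin]) (use r dv(1) dG(1) in auto)
  show "de <= r" "de <= dv" unfolding de_def by (rule Min_le[OF fin], simp)+
  show "de <= dG b" if "b : Basis" for b unfolding de_def by (rule Min_le[OF fin]) (use that in simp)
 qed
 obtain c rh where c: "rh > 0" "norm c + rh < de" "!!x z. x : U \<inter> ball x0 (4 * r) ==> z : cball c rh ==> x - z : U"
  using shift[OF de(1)] by blast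
 obtain ka where ka: "mollifier ka" "!!z. z \<notin> ball c rh ==> ka z = 0"
  using mollifier_exists[OF c(1), of c] by blast
 have kat: "test_fun UNIV ka" using ka(1) by (simp add: mollifier_def)
 have cb: "norm z < de" if "z : cball c rh" for z
  using that c(2) norm_triangle_sub[of z c] by (auto simp: dist_norm norm_minus_commute)
 have kade: "test_fun (ball 0 de) ka"
  by (rule test_funI[of _ "cball c rh"]) (use cb ka(2) test_fun_smooth[OF kat] in \<open>auto simp: subset_iff\<close>)
 have kan: "norm z < de" if "ka z ~= 0" for z
  using test_fun_zero[OF kade, of z] that by (cases "norm z < de") auto
 define ph where "ph = conv v ka"
 have ph: "smooth_on ph UNIV" unfolding ph_def by (rule conv_smooth[OF v kat])
 \<comment> \<open>Within \<open>4 * r\<close> of \<open>x0\<close> the reflected kernel is a test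
   function of \<open>U\<close>, and the derivative moves onto \<open>et * u\<close>. Farther away
   both sides vanish, as the kernel has radius at most \<open>r\<close> and \<open>v\<close> lives
   within \<open>3 * r\<close>.\<close>
 have Dph: "Fd ph (at x) b = conv (G b) ka x" if x: "x : U" and b: "b : Basis" for x b
 proof -
  have "Fd ph (at x) b = (\<integral>y. v y * Fd ka (at (x - y)) b \<partial>lborel)"
   unfolding ph_def conv_frechet_derivative[OF v kat] by (simp add: conv_def)
  also have "... = (\<integral>y. G b y * ka (x - y) \<partial>lborel)"
  proof (cases "x : ball x0 (4 * r)")
   case True
   have t: "test_fun U (%y. ka (x - y))"
   proof (rule test_funI[of _ "(%z. x - z) ` cball c rh"])
    show "smooth_on (%y. ka (x - y)) UNIV" by (rule test_fun_smooth[OF test_fun_reflect[OF kat]])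
    show "compact ((%z. x - z) ` cball c rh)" by (intro compact_continuous_image continuous_intros compact_cball)
    show "(%z. x - z) ` cball c rh \<subseteq> U" using c(3) x True by blast
    show "ka (x - y) = 0" if "y \<notin> (%z. x - z) ` cball c rh" for y
    proof (rule ka(2))
     have "x - y \<notin> cball c rh" using that by (force intro: image_eqI[of _ _ "x - y"])
     then show "x - y \<notin> ball c rh" by auto
    qed
   qed
   have "(\<integral>y. v y * Fd ka (at (x - y)) b \<partial>lborel)
     = - (\<integral>y. et y * u y * Fd (%y. ka (x - y)) (at y) b \<partial>leb U)"
    unfolding frechet_derivative_reflect[OF test_fun_smooth[OF kat]] integral_leb[OF Ub] v_def
    by (simp add: mult.assoc)
   also have "... = (\<integral>y. g b y * ka (x - y) \<partial>leb U)" using has_weak_pd_eq[OF wp[OF b] t] by simp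
   also have "... = (\<integral>y. G b y * ka (x - y) \<partial>lborel)"
    unfolding integral_leb[OF Ub] G_def by (simp add: mult.assoc)
   finally show ?thesis .
  next
   case False
   have z: "ka (x - y) = 0 & Fd ka (at (x - y)) b = 0" if "y : ball x0 (3 * r)" for y
   proof -
    have "dist x0 x >= 4 * r" "dist x0 y < 3 * r" using False that by auto
    then have "dist x y >= r" using dist_triangle[of x0 x y] by (simp add: dist_commute)
    then have "x - y \<notin> ball 0 de" using de(2) by (simp add: dist_norm norm_minus_commute)
    then show ?thesis using test_fun_zero[OF kade] test_fun_zero[OF test_fun_frechet[OF kade]] by blast
   qed
   have "v y * Fd ka (at (x - y)) b = G b y * ka (x - y)" for y
    using z[of y] v0[of y] G0[of y b] by (cases "y : ball x0 (3 * r)") auto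
   then show ?thesis by simp
  qed
  finally show ?thesis by (simp add: conv_def)
 qed
 have ind: "\<bar>indicator U x * w\<bar> <= \<bar>w\<bar>" for x :: 'a and w :: real by (simp add: indicator_def)
 have L2: "L2_norm (leb U) (%x. et x * u x - ph x) <= e'"
 proof -
  have vc: "conv v ka : Lq_space 2 lborel" "L2_norm lborel (%x. v x - conv v ka x) <= e'"
   using dv(2)[OF ka(1)] kan de(3) by (meson less_le_trans)+
  have "L2_norm (leb U) (%x. et x * u x - ph x) = L2_norm lborel (%x. indicator U x * (v x - conv v ka x))"
   unfolding L2_norm_leb[OF Ub] v_def ph_def by (rule arg_cong[where f = "L2_norm lborel"]) (auto simp: indicator_def)
  also have "... <= L2_norm lborel (%x. v x - conv v ka x)"
   by (rule L2_norm_mono_AE[OF L2_diff[OF v vc(1)]])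
    (use v vc(1) Ub ind in \<open>auto simp: Lq_space_2\<close>)
  finally show ?thesis using vc(2) by simp
 qed
 have L2D: "L2_norm (leb U) (weak_pd U b (%x. et x * u x - ph x)) <= e'" if b: "b : Basis" for b
 proof -
  have gc: "conv (G b) ka : Lq_space 2 lborel" "L2_norm lborel (%x. G b x - conv (G b) ka x) <= e'"
   using dG(2)[OF b ka(1)] kan de(4)[OF b] by (meson less_le_trans)+
  have "has_weak_pd U b (%x. et x * u x - ph x) (%x. g b x - Fd ph (at x) b)"
   by (intro has_weak_pd_diff[OF Ub] wp b H1_L2[OF etu] smooth_L2_leb has_weak_pd_smooth_bounded ph U Ub)
  then have "L2_norm (leb U) (weak_pd U b (%x. et x * u x - ph x))
    = L2_norm (leb U) (%x. g b x - Fd ph (at x) b)"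
   by (rule L2_norm_weak_pd[OF U(1)])
  also have "... = L2_norm lborel (%x. indicator U x * (G b x - conv (G b) ka x))"
   unfolding L2_norm_leb[OF Ub] by (rule arg_cong[where f = "L2_norm lborel"])
    (use Dph b in \<open>auto simp: indicator_def G_def\<close>)
  also have "... <= L2_norm lborel (%x. G b x - conv (G b) ka x)"
   by (rule L2_norm_mono_AE[OF L2_diff[OF G[OF b] gc(1)]])
    (use G[OF b] gc(1) Ub ind in \<open>auto simp: Lq_space_2\<close>)
  finally show ?thesis using gc(2) by simp
 qed
 have "H1_norm U (%x. et x * u x - ph x) <= e' + (\<Sum>b\<in>(Basis :: 'a set). e')"
  by (rule order_trans[OF H1_norm_le_sum]) (intro add_mono sum_mono L2 L2D)
 also have "... = (1 + DIM('a)) * e'" by (simp add: algebra_simps)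
 also have "... = e"
 proof -
  have "1 + real DIM('a) ~= 0" by (simp add: add_nonneg_eq_0_iff)
  then show ?thesis unfolding e'_def by simp
 qed
 finally show ?thesis using ph that by blast
qed

text \<open>A translation form of the cone condition: for arbitrarily small \<open>c\<close>, points
  of \<open>U\<close> near \<open>x0\<close> stay in \<open>U\<close> when moved by
  \<open>- z\<close> with \<open>z\<close> in a full ball around \<open>c\<close>. Those are the
  points at which a kernel supported in that ball samples a convolution.\<close>

definition interior_shift :: "'a::euclidean_space set => 'a => real => bool" where
 "interior_shift U x0 r \<longleftrightarrow> r > 0 & (ALL de>0. EX c rh. rh > 0 & norm c + rh < de &
   (ALL x : U \<inter> ball x0 (4 * r). ALL z : cball c rh. x - z : U))"

text \<open>A partition of unity by peeling: for one ball of a finite cover, \<open>et * u\<close>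
  is approximated locally, and \<open>(1 - et) * u\<close> vanishes on that ball.\<close>

lemma smooth_dense_H1:
 fixes U :: "'a::euclidean_space set"
 assumes U: "open U" "bounded U" and shift: "!!x0. x0 : closure U ==> EX r. interior_shift U x0 r"
  and u: "u : H1 U" and e: "e > 0"
 obtains ph where "smooth_on ph UNIV" "H1_norm U (%x. u x - ph x) < e"
proof -
 have Ub: "U : sets borel" using U by auto
 obtain r where r: "!!x0. x0 : closure U ==> interior_shift U x0 (r x0)" using shift by metis
 have rpos: "r x0 > 0" if "x0 : closure U" for x0 using r[OF that] by (simp add: interior_shift_def)
 have "compact (closure U)" using U by simp
 moreover have "closure U \<subseteq> (\<Union>x0\<in>closure U. ball x0 (r x0))" using rpos by force
 ultimately obtain I where I: "I \<subseteq> closure U" "finite I" "closure U \<subseteq> (\<Union>x0\<in>I. ball x0 (r x0))"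
  using compactE_image[of "closure U" "closure U" "%x0. ball x0 (r x0)"] by blast
 \<comment> \<open>Quantifying over all functions that vanish in \<open>U\<close> off the balls of
   \<open>J\<close> makes the induction hypothesis applicable to the remainder.\<close>
 have main: "ALL u:H1 U. (ALL x:U. x \<notin> (\<Union>x0\<in>J. ball x0 (r x0)) --> u x = 0) -->
   (ALL e>0. EX ph. smooth_on ph UNIV & H1_norm U (%x. u x - ph x) < e)" if "finite J" "J \<subseteq> closure U" for J
  using that
 proof (induction J)
  case empty
  show ?case
  proof (intro ballI allI impI exI conjI)
   fix u and e :: real assume u: "u : H1 U" and z: "ALL x:U. x \<notin> (\<Union>x0\<in>{}. ball x0 (r x0)) --> u x = 0" and e: "e > 0"
   have H0: "H1_norm U (%x. 0) = 0"
    using L2_norm_weak_pd[OF U(1) has_weak_pd_zero]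
    by (simp add: H1_norm_def grad_norm_power2) (simp add: L2_norm_def L2_inner_def)
   have "H1_norm U (%x. u x - 0) = H1_norm U (%x. 0)"
    by (rule H1_norm_cong_AE[OF Ub]) (use z L2_measurable[OF H1_L2[OF u]] in \<open>auto simp: space_leb\<close>)
   then show "H1_norm U (%x. u x - 0) < e" using H0 e by simp
  qed (auto intro: smooth_on_const)
 next
  case (insert x0 J)
  show ?case
  proof (intro ballI allI impI)
   fix u and e :: real assume u: "u : H1 U" and z: "ALL x:U. x \<notin> (\<Union>x0\<in>insert x0 J. ball x0 (r x0)) --> u x = 0" and e: "e > 0"
   have x0: "x0 : closure U" using insert.prems by auto
   obtain et :: "'a => real" where et: "smooth_on et UNIV" "!!x. x : ball x0 (r x0) ==> et x = 1"
     "!!x. x \<notin> ball x0 (2 * r x0) ==> et x = 0"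
    using smooth_cutoff_exists[OF rpos[OF x0], of x0] by blast
   have t: "test_fun (ball x0 (3 * r x0)) et"
    by (rule test_funI[OF et(1) compact_cball[of x0 "2 * r x0"]]) (use et(3) rpos[OF x0] in auto)
   define N where "N = real (1 + DIM('a))"
   have N: "N > 0" by (simp add: N_def)
   define e' where "e' = e / (2 * N)"
   have e': "e' > 0" using e N by (simp add: e'_def)
   have e'2: "real (1 + DIM('a)) * (2 * e') = e"
    unfolding N_def[symmetric] e'_def using N by simp
   obtain ph where ph: "smooth_on ph UNIV" "H1_norm U (%x. et x * u x - ph x) <= e'"
    using local_smooth_approx[OF U u rpos[OF x0] t
      r[OF x0, unfolded interior_shift_def, THEN conjunct2, rule_format] e'] by blast
   have s1: "smooth_on (%x. 1 - et x) UNIV" by (intro smooth_on_diff smooth_on_const et(1)) auto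
   have u1: "(%x. (1 - et x) * u x) : H1 U" by (rule H1_mult_smooth[OF Ub U(2) u s1])
   have "ALL x:U. x \<notin> (\<Union>x0\<in>J. ball x0 (r x0)) --> (1 - et x) * u x = 0"
    using z et(2) by auto
   moreover have "J \<subseteq> closure U" using insert.prems by simp
   ultimately have "EX ps. smooth_on ps UNIV & H1_norm U (%x. (1 - et x) * u x - ps x) < e'"
    using insert.IH[THEN bspec, OF _ u1] e' by metis
   then
   obtain ps where ps: "smooth_on ps UNIV" "H1_norm U (%x. (1 - et x) * u x - ps x) < e'"
    by auto
   let ?v = "%x. ph x + (1 - et x) * u x" and ?w = "%x. ph x + ps x"
   have sw: "smooth_on ?w UNIV" by (intro smooth_on_add ph ps) auto
   have "?v = (%x. (1 - et x) * u x - (-1) * ph x)" by (simp add: fun_eq_iff)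
   then have vH: "?v : H1 U"
    using H1_diff[OF Ub u1 smooth_H1[OF smooth_on_cmult[OF open_UNIV ph(1), of "-1"] U(2) Ub]] by simp
   have "H1_norm U (%x. u x - ?w x) <= (1 + DIM('a)) * (H1_norm U (%x. u x - ?v x) + H1_norm U (%x. ?v x - ?w x))"
    by (rule H1_norm_triangle[OF U(1) u vH smooth_H1[OF sw U(2) Ub]])
   also have "(%x. u x - ?v x) = (%x. et x * u x - ph x)" by (auto simp: algebra_simps)
   also have "(%x. ?v x - ?w x) = (%x. (1 - et x) * u x - ps x)" by auto
   also have "(1 + DIM('a)) * (H1_norm U (%x. et x * u x - ph x) + H1_norm U (%x. (1 - et x) * u x - ps x))
     < real (1 + DIM('a)) * (2 * e')"
    using ph(2) ps(2) by (intro mult_strict_left_mono) auto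
   finally show "EX ph. smooth_on ph UNIV & H1_norm U (%x. u x - ph x) < e"
    using sw unfolding e'2 by blast
  qed
 qed
 have "ALL x:U. x \<notin> (\<Union>x0\<in>I. ball x0 (r x0)) --> u x = 0"
  using I(3) closure_subset[of U] by blast
 then show ?thesis using main[OF I(2,1)] u e that by blast
qed

lemma interior_shift_inner:
 assumes "open (U :: 'a::euclidean_space set)" "x0 : U"
 shows "EX r. interior_shift U x0 r"
proof -
 obtain R where R: "R > 0" "ball x0 R \<subseteq> U" using assms open_contains_ball by blast
 have "EX c rh. rh > 0 & norm c + rh < de & (ALL x : U \<inter> ball x0 (4 * (R / 8)). ALL z : cball c rh. x - z : U)"
  if d: "de > 0" for de
 proof (intro exI conjI ballI)
  show "0 < min (de / 2) (R / 4)" "norm (0::'a) + min (de / 2) (R / 4) < de" using d R by auto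
  fix x z assume x: "x : U \<inter> ball x0 (4 * (R / 8))" and z: "z : cball (0::'a) (min (de / 2) (R / 4))"
  have "dist x0 (x - z) <= dist x0 x + norm z"
   using dist_triangle[of x0 "x - z" x] by (simp add: dist_norm)
  also have "... < R" using x z R(1) by auto
  finally show "x - z : U" using R(2) by auto
 qed
 then show ?thesis using R(1) by (intro exI[of _ "R / 8"]) (simp add: interior_shift_def)
qed

lemma smooth_diffeo_derivatives:
 assumes d: "smooth_diffeo f g U V" and x: "x : U"
 shows "Fd f (at x) (Fd g (at (f x)) h) = h"
  "Fd g (at (f x)) (Fd f (at x) h) = h"
proof -
 have o: "open U" "open V" and hom: "homeomorphism U V f g" and s: "smooth_on f U" "smooth_on g V"
  using d by (auto simp: smooth_diffeo_def)
 have fx: "f x : V" using hom x by (auto simp: homeomorphism_def)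
 have gf: "g (f x) = x" using hom x by (auto simp: homeomorphism_def)
 note Df = smooth_on_has_derivative[OF s(1) o(1) x]
 note Dg = smooth_on_has_derivative[OF s(2) o(2) fx]
 have "((%x. g (f x)) has_derivative (%h. Fd g (at (f x)) (Fd f (at x) h))) (at x)"
  using has_derivative_compose[OF Df, of g] Dg by simp
 moreover have "((%x. g (f x)) has_derivative (%h. h)) (at x)"
  by (rule has_derivative_transform_within_open[OF has_derivative_ident o(1) x])
   (use hom in \<open>auto simp: homeomorphism_def\<close>)
 ultimately show "Fd g (at (f x)) (Fd f (at x) h) = h"
  using has_derivative_unique by metis
 have "((%y. f (g y)) has_derivative (%h. Fd f (at x) (Fd g (at (f x)) h))) (at (f x))"
  using has_derivative_compose[OF Dg, of f] Df gf by simp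
 moreover have "((%y. f (g y)) has_derivative (%h. h)) (at (f x))"
  by (rule has_derivative_transform_within_open[OF has_derivative_ident o(2) fx])
   (use hom in \<open>auto simp: homeomorphism_def\<close>)
 ultimately show "Fd f (at x) (Fd g (at (f x)) h) = h"
  using has_derivative_unique by metis
qed

text \<open>Near a boundary point the defining function \<open>a \<bullet> f\<close> increases along all directions close to
 the image of \<open>a\<close> under the derivative of the inverse chart.\<close>

lemma interior_shift_boundary:
 assumes sb: "smooth_boundary D" and x0: "x0 : frontier D"
 shows "EX r. interior_shift D x0 r"
proof -
 obtain U V f g a where U: "x0 : U" "smooth_diffeo f g U V" "a ~= 0"
   and im: "f ` (D \<inter> U) = {y:V. 0 < a \<bullet> y}"
  using sb x0 unfolding smooth_boundary_def by metis
 have o: "open U" and hom: "homeomorphism U V f g" and s: "smooth_on f U"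
  using U(2) by (auto simp: smooth_diffeo_def)
 have inD: "x : D" if "x : U" "0 < a \<bullet> f x" for x
 proof -
  have "f x : f ` (D \<inter> U)" unfolding im using that hom by (auto simp: homeomorphism_def)
  then obtain x' where "x' : D \<inter> U" "f x' = f x" by auto
  then show ?thesis using that(1) hom by (metis IntE homeomorphism_def)
 qed
 define v where "v = Fd g (at (f x0)) a"
 \<comment> \<open>The derivative of \<open>a \<bullet> f\<close> at \<open>fst p\<close> in the
   direction \<open>snd p\<close>; written through the basis it is visibly continuous in both
   variables.\<close>
 define q where "q p = (\<Sum>b\<in>Basis. (snd p \<bullet> b) * (a \<bullet> Fd f (at (fst p)) b))" for p
 have q: "q (x, w) = a \<bullet> Fd f (at x) w" if "x : U" for x w
  unfolding frechet_derivative_basis_sum[OF smooth_on_differentiable[OF s o that], of w] q_def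
  by (simp add: inner_sum_right)
 have "continuous_on (U \<times> UNIV) q"
  unfolding q_def
 proof (intro continuous_on_sum continuous_on_mult continuous_on_inner continuous_on_const continuous_on_snd continuous_on_id)
  fix b :: 'a assume "b : Basis"
  have "continuous_on U (%x. Fd f (at x) b)"
   by (rule smooth_on_continuous[OF smooth_on_frechet_basis[OF s \<open>b : Basis\<close>]])
  then show "continuous_on (U \<times> UNIV) (%p. Fd f (at (fst p)) b)"
   by (rule continuous_on_compose2[OF _ continuous_on_fst[OF continuous_on_id]]) auto
 qed
 then have "open ((U \<times> UNIV) \<inter> q -` {0<..})"
  using o by (intro continuous_open_preimage open_Times) auto
 moreover have "q (x0, v) > 0"
  unfolding q[OF U(1)] v_def smooth_diffeo_derivatives[OF U(2,1)] using U(3) by simp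
 then have "(x0, v) : (U \<times> UNIV) \<inter> q -` {0<..}" using U(1) by simp
 ultimately obtain A B where AB: "open A" "open B" "x0 : A" "v : B" "A \<times> B \<subseteq> (U \<times> UNIV) \<inter> q -` {0<..}"
  by (auto elim!: open_prod_elim)
 obtain R where R: "R > 0" "ball x0 R \<subseteq> A" using AB open_contains_ball by blast
 obtain eps where eps: "eps > 0" "cball v eps \<subseteq> B" using AB open_contains_cball by blast
 have RU: "x : U" if "x : ball x0 R" for x using that R(2) AB(4,5) by blast
 have "EX c rh. rh > 0 & norm c + rh < de & (ALL x : D \<inter> ball x0 (4 * (R / 8)). ALL z : cball c rh. x - z : D)"
  if d: "de > 0" for de
 proof -
  \<comment> \<open>So short that a move by \<open>t *\<^sub>R w\<close> with
    \<open>norm (w - v) \<le> eps\<close> stays below both \<open>de\<close> and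
    \<open>R / 4\<close>.\<close>
  define t where "t = min (de / 2) (R / 4) / (norm v + eps + 1)"
  have den: "norm v + eps + 1 > 0" using eps(1) by (intro add_nonneg_pos add_nonneg_nonneg) auto
  have t: "t > 0" unfolding t_def using d R den by (intro divide_pos_pos) auto
  have t2: "t * (norm v + eps + 1) = min (de / 2) (R / 4)" unfolding t_def using den by simp
  have t3: "t * (norm v + eps) < de" "t * (norm v + eps) <= R / 4"
  proof -
   have "t * (norm v + eps) <= t * (norm v + eps + 1)" using t by (intro mult_left_mono) auto
   then show "t * (norm v + eps) < de" "t * (norm v + eps) <= R / 4" using t2 d by auto
  qed
  show ?thesis
  proof (intro exI[of _ "- (t *\<^sub>R v)"] exI[of _ "t * eps"] conjI ballI)
   show "t * eps > 0" using t eps by simp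
   show "norm (- (t *\<^sub>R v)) + t * eps < de" using t3(1) t by (simp add: algebra_simps)
   fix x z assume x: "x : D \<inter> ball x0 (4 * (R / 8))" and z: "z : cball (- (t *\<^sub>R v)) (t * eps)"
   \<comment> \<open>A point \<open>z\<close> of the ball around \<open>- (t *\<^sub>R v)\<close>
     corresponds to a direction \<open>w\<close> within \<open>eps\<close> of \<open>v\<close>,
     along which \<open>a \<bullet> f\<close> still increases.\<close>
   define w where "w = - (1 / t) *\<^sub>R z"
   have zw: "z = - (t *\<^sub>R w)" using t by (simp add: w_def)
   have "t * norm (w - v) = norm (- (t *\<^sub>R v) - z)"
    unfolding zw using t by (simp add: scaleR_diff_right[symmetric])
   then have "t * norm (w - v) <= t * eps" using z by (simp add: dist_norm)
   then have wv: "norm (w - v) <= eps" using t by simp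
   then have wB: "w : B" using eps(2) by (auto simp: dist_norm norm_minus_commute)
   have nw: "norm w <= norm v + eps" using wv norm_triangle_sub[of w v] by simp
   have seg: "x + s *\<^sub>R w : ball x0 R" if "0 <= s" "s <= t" for s
   proof -
    have "norm (s *\<^sub>R w) <= t * (norm v + eps)" using that nw by (auto intro!: mult_mono)
    then have "norm (s *\<^sub>R w) <= R / 4" using t3(2) by simp
    moreover have "dist x0 (x + s *\<^sub>R w) <= dist x0 x + norm (s *\<^sub>R w)"
     using dist_triangle[of x0 "x + s *\<^sub>R w" x] by (simp add: dist_norm)
    ultimately show ?thesis using x R(1) by auto
   qed
   have der: "((%s. a \<bullet> f (x + s *\<^sub>R w)) has_real_derivative q (x + s *\<^sub>R w, w)) (at s)" if "0 <= s" "s <= t" for s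
   proof -
    let ?y = "x + s *\<^sub>R w"
    have y: "?y : U" using seg[OF that] RU by blast
    note Df = smooth_on_has_derivative[OF s o y]
    have "((%s. f (x + s *\<^sub>R w)) has_derivative (%h. Fd f (at ?y) (h *\<^sub>R w))) (at s)"
     by (rule has_derivative_compose[where g = f and f = "%s. x + s *\<^sub>R w", OF _ Df]) (auto intro!: derivative_eq_intros)
    then have "((%s. a \<bullet> f (x + s *\<^sub>R w)) has_derivative (%h. a \<bullet> Fd f (at ?y) (h *\<^sub>R w))) (at s)"
     by (rule has_derivative_inner_right)
    moreover have "a \<bullet> Fd f (at ?y) (h *\<^sub>R w) = q (?y, w) * h" for h
     unfolding q[OF y] using linear_scale[OF has_derivative_linear[OF Df]] by simp
    ultimately show ?thesis by (simp add: has_field_derivative_def)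
   qed
   have qpos: "q (x + s *\<^sub>R w, w) > 0" if "0 <= s" "s <= t" for s
   proof -
    have "(x + s *\<^sub>R w, w) : A \<times> B" using seg[OF that] R(2) wB by auto
    then show ?thesis using AB(5) by auto
   qed
   obtain s where "a \<bullet> f (x + t *\<^sub>R w) - a \<bullet> f (x + 0 *\<^sub>R w) = (t - 0) * q (x + s *\<^sub>R w, w)" "0 < s" "s < t"
    using MVT2[OF t der] by blast
   then have "a \<bullet> f (x + t *\<^sub>R w) > a \<bullet> f x" using qpos[of s] t by (smt (verit) mult_pos_pos scale_zero_left add.right_neutral)
   moreover have "0 < a \<bullet> f x"
   proof -
    have "x : ball x0 R" using seg[of 0] t by simp
    then have "f x : f ` (D \<inter> U)" using x RU by blast
    then show ?thesis unfolding im by simp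
   qed
   ultimately have "0 < a \<bullet> f (x + t *\<^sub>R w)" by linarith
   moreover have "x + t *\<^sub>R w : U" using seg[of t] RU t by simp
   ultimately have "x + t *\<^sub>R w : D" by (intro inD)
   then show "x - z : D" by (simp add: zw)
  qed
 qed
 then show ?thesis using R(1) by (intro exI[of _ "R / 8"]) (simp add: interior_shift_def)
qed

theorem smooth_dense_H1_smooth_boundary:
 assumes "open U" "bounded U" "smooth_boundary U" "u : H1 U" "e > 0"
 obtains ph where "smooth_on ph UNIV" "H1_norm U (%x. u x - ph x) < e"
proof -
 have "EX r. interior_shift U x0 r" if "x0 : closure U" for x0
  using that interior_shift_inner[OF assms(1)] interior_shift_boundary[OF assms(3)]
  by (auto simp: closure_Un_frontier)
 then show ?thesis using smooth_dense_H1[OF assms(1,2) _ assms(4,5)] that by blast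
qed

section \<open>The trace inequality\<close>

definition lift3 :: "real^2 => real => real^3" where
 "lift3 y s = vector [y $ 1, y $ 2, s]"

definition proj2 :: "real^3 => real^2" where
 "proj2 z = vector [z $ 1, z $ 2]"

lemma lift3_nth [simp]: "lift3 y s $ 1 = y $ 1" "lift3 y s $ 2 = y $ 2" "lift3 y s $ 3 = s"
 by (simp_all add: lift3_def)

lemma proj2_nth [simp]: "proj2 z $ 1 = z $ 1" "proj2 z $ 2 = z $ 2"
 by (simp_all add: proj2_def)

lemma proj2_lift3 [simp]: "proj2 (lift3 y s) = y"
 by (simp add: vec_eq_iff forall_2)

lemma lift3_proj2 [simp]: "lift3 (proj2 z) (z $ 3) = z"
 by (simp add: vec_eq_iff forall_3)

lemma lift3_eq: "lift3 y s = (y $ 1) *\<^sub>R axis 1 1 + (y $ 2) *\<^sub>R axis 2 1 + s *\<^sub>R axis 3 1"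
 by (simp add: vec_eq_iff forall_3 axis_def)

lemma bounded_linear_lift3: "bounded_linear (%y. lift3 y 0)"
proof -
 have "linear (%y. lift3 y 0)"
  by (rule linearI) (simp_all add: vec_eq_iff forall_3)
 then show ?thesis by (simp add: linear_conv_bounded_linear)
qed

lemma bounded_linear_proj2: "bounded_linear proj2"
proof -
 have "linear proj2"
  by (rule linearI) (simp_all add: vec_eq_iff forall_2)
 then show ?thesis by (simp add: linear_conv_bounded_linear)
qed

lemma continuous_on_lift3: "continuous_on S (%p. lift3 (fst p) (snd p))"
 unfolding lift3_eq by (intro continuous_intros)

lemma dist_lift3: "dist (lift3 y s) (lift3 y' s') <= dist y y' + \<bar>s - s'\<bar>"
proof -
 have "lift3 y s - lift3 y' s' = lift3 (y - y') 0 + (s - s') *\<^sub>R axis 3 1"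
  by (simp add: vec_eq_iff forall_3 axis_def)
 then have "dist (lift3 y s) (lift3 y' s') <= norm (lift3 (y - y') 0) + \<bar>s - s'\<bar>"
  using norm_triangle_ineq[of "lift3 (y - y') 0" "(s - s') *\<^sub>R axis 3 1"] by (simp add: dist_norm)
 also have "norm (lift3 (y - y') 0) = norm (y - y')"
  by (simp add: norm_eq_sqrt_inner inner_vec_def sum_3 sum_2)
 finally show ?thesis by (simp add: dist_norm)
qed

lemma Basis_real3: "(Basis :: (real^3) set) = {axis 1 1, axis 2 1, axis 3 1}"
 by (auto simp: Basis_vec_def UNIV_3)

lemma Basis_real2: "(Basis :: (real^2) set) = {axis 1 1, axis 2 1}"
 by (auto simp: Basis_vec_def UNIV_2)

lemma axis_neq: "i ~= j ==> axis i (1::real) ~= axis j 1"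
 by (simp add: axis_eq_axis)

text \<open>Fubini with the third coordinate split off; boxes determine Lebesgue measure, and their
  preimages are products of boxes.\<close>

lemma lborel_lift3: "(lborel :: (real^3) measure) = distr ((lborel :: (real^2) measure) \<Otimes>\<^sub>M lborel) borel (%p. lift3 (fst p) (snd p))"
proof (rule lborel_eqI)
 fix l u :: "real^3" assume le: "!!b. b : Basis ==> l \<bullet> b <= u \<bullet> b"
 have le': "l $ i <= u $ i" for i using le[of "axis i 1"] by (simp add: inner_axis)
 have m: "(%p. lift3 (fst p) (snd p)) : borel_measurable (lborel \<Otimes>\<^sub>M lborel)"
  using borel_measurable_continuous_onI[OF continuous_on_lift3[of UNIV]]
  by (simp add: lborel_prod)
 have pre: "(%p. lift3 (fst p) (snd p)) -` box l u \<inter> space (lborel \<Otimes>\<^sub>M lborel)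
   = box (proj2 l) (proj2 u) \<times> box (l $ 3) (u $ 3)"
  by (auto simp: mem_box_cart forall_3 forall_2 space_pair_measure)
 have "emeasure (distr (lborel \<Otimes>\<^sub>M lborel) borel (%p. lift3 (fst p) (snd p))) (box l u)
   = emeasure (lborel \<Otimes>\<^sub>M lborel) (box (proj2 l) (proj2 u) \<times> box (l $ 3) (u $ 3))"
  by (subst emeasure_distr[OF m]) (simp_all only: pre borel_open open_box)
 also have "... = emeasure lborel (box (proj2 l) (proj2 u)) * emeasure lborel (box (l $ 3) (u $ 3))"
  by (rule lborel.emeasure_pair_measure_Times) auto
 also have "emeasure lborel (box (proj2 l) (proj2 u)) = ennreal ((u $ 1 - l $ 1) * (u $ 2 - l $ 2))"
  using le' by (subst emeasure_lborel_box) (auto simp: Basis_real2 inner_axis axis_neq)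
 also have "emeasure lborel (box (l $ 3) (u $ 3)) = ennreal (u $ 3 - l $ 3)"
  using le'[of 3] by (simp add: box_real)
 also have "ennreal ((u $ 1 - l $ 1) * (u $ 2 - l $ 2)) * ennreal (u $ 3 - l $ 3)
   = ennreal (\<Prod>b\<in>Basis. (u - l) \<bullet> b)"
  using le' by (simp add: Basis_real3 inner_axis axis_neq ennreal_mult[symmetric])
 finally show "emeasure (distr (lborel \<Otimes>\<^sub>M lborel) borel (%p. lift3 (fst p) (snd p))) (box l u)
   = ennreal (\<Prod>b\<in>Basis. (u - l) \<bullet> b)" .
qed simp

lemma nn_integral_lift3:
 assumes K: "K : borel_measurable borel"
 shows "(\<integral>\<^sup>+y. \<integral>\<^sup>+s. K (lift3 y s) \<partial>lborel \<partial>lborel) = (\<integral>\<^sup>+z. K z \<partial>lborel)"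
proof -
 have m: "(%p. lift3 (fst p) (snd p)) : (lborel \<Otimes>\<^sub>M lborel) \<rightarrow>\<^sub>M borel"
  using borel_measurable_continuous_onI[OF continuous_on_lift3[of UNIV]]
  by (simp add: lborel_prod)
 have "(\<integral>\<^sup>+z. K z \<partial>lborel) = (\<integral>\<^sup>+z. K z \<partial>distr (lborel \<Otimes>\<^sub>M lborel) borel (%p. lift3 (fst p) (snd p)))"
  using lborel_lift3 by simp
 also have "... = (\<integral>\<^sup>+p. K (lift3 (fst p) (snd p)) \<partial>(lborel \<Otimes>\<^sub>M lborel))"
  by (rule nn_integral_distr[OF m]) (use K in simp)
 also have "... = (\<integral>\<^sup>+y. \<integral>\<^sup>+s. K (lift3 y s) \<partial>lborel \<partial>lborel)"
  by (subst lborel.nn_integral_fst[symmetric]) (use measurable_compose[OF m K] in simp_all)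
 finally show ?thesis ..
qed

lemma continuous_on_measurable_leb:
 fixes h :: "'a::euclidean_space => 'b::topological_space"
 assumes "continuous_on S h"
 shows "h : leb S \<rightarrow>\<^sub>M borel"
proof -
 have "sets (leb S) = sets (restrict_space borel S)" by (simp add: leb_def sets_restrict_space)
 then show ?thesis
  using borel_measurable_continuous_on_restrict[OF assms] measurable_cong_sets[of "leb S" "restrict_space borel S" borel borel]
  by simp
qed

text \<open>A boundary chart turned so that \<open>D\<close> is the side of positive third
  coordinate. The radius \<open>2 * de\<close> leaves room for the cylinder of height
  \<open>de\<close> over a disc of radius \<open>de\<close>.\<close>

locale flat_chart =
 fixes D U V :: "(real^3) set" and f g :: "real^3 => real^3" and z0 :: "real^3" and de :: real
 assumes diffeo: "smooth_diffeo f g U V"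
  and image_D: "f ` (D \<inter> U) = {z:V. 0 < z $ 3}"
  and image_frontier: "f ` (frontier D \<inter> U) = {z:V. z $ 3 = 0}"
  and de: "de > 0" and z0: "z0 $ 3 = 0" and V: "cball z0 (2 * de) \<subseteq> V"
begin

lemma open_U: "open U" and open_V: "open V" and hom: "homeomorphism U V f g"
 and smooth_f: "smooth_on f U" and smooth_g: "smooth_on g V"
 using diffeo by (auto simp: smooth_diffeo_def)

lemma fg: "z : V ==> f (g z) = z" "z : V ==> g z : U" "x : U ==> g (f x) = x" "x : U ==> f x : V"
 using hom by (auto simp: homeomorphism_def)

lemma g_in_D: assumes "z : V" "0 < z $ 3" shows "g z : D"
proof -
 have "z : f ` (D \<inter> U)" using assms image_D by simp
 then show ?thesis using fg(3) by auto
qed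

lemma g_in_frontier: assumes "z : V" "z $ 3 = 0" shows "g z : frontier D"
proof -
 have "z : f ` (frontier D \<inter> U)" using assms image_frontier by simp
 then show ?thesis using fg(3) by auto
qed

lemma f_frontier: "x : frontier D ==> x : U ==> f x $ 3 = 0"
 using image_frontier by blast

definition V2 :: "(real^2) set" where "V2 = ball (proj2 z0) de"

definition h :: "real^2 => real^3" where "h y = g (lift3 y 0)"

definition k :: "real^3 => real^2" where "k x = proj2 (f x)"

lemma lift3_in: assumes "y : V2" "0 <= s" "s <= de" shows "lift3 y s : cball z0 (2 * de)"
proof -
 have "dist z0 (lift3 y s) <= dist (proj2 z0) y + \<bar>z0 $ 3 - s\<bar>"
  using dist_lift3[of "proj2 z0" "z0 $ 3" y s] by simp
 then show ?thesis using assms z0 by (simp add: V2_def)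
qed

lemma lift3_in_V: "y : V2 ==> 0 <= s ==> s <= de ==> lift3 y s : V"
 using lift3_in V by blast

lemma kh: "y : V2 ==> k (h y) = y"
 using lift3_in_V[of y 0] de by (simp add: k_def h_def fg)

lemma hk: assumes "x : frontier D" "x : U" shows "h (k x) = x"
proof -
 have "lift3 (proj2 (f x)) (f x $ 3) = f x" by (rule lift3_proj2)
 then show ?thesis using f_frontier[OF assms] fg(3)[OF assms(2)] by (simp add: h_def k_def)
qed

lemma h_image: "h ` V2 = frontier D \<inter> (U \<inter> k -` V2)"
proof (intro set_eqI iffI)
 fix x assume "x : h ` V2"
 then obtain y where y: "y : V2" "x = h y" by auto
 have "lift3 y 0 : V" using lift3_in_V[OF y(1)] de by simp
 then have "h y : frontier D" "h y : U" using g_in_frontier fg(2) by (simp_all add: h_def)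
 then show "x : frontier D \<inter> (U \<inter> k -` V2)" using kh[OF y(1)] y by simp
next
 fix x assume "x : frontier D \<inter> (U \<inter> k -` V2)"
 then have "h (k x) = x" "k x : V2" using hk by auto
 then show "x : h ` V2" by (metis imageI)
qed

lemma open_V2: "open V2" by (simp add: V2_def)

lemma cont_k: "continuous_on U k"
 unfolding k_def
 by (rule bounded_linear.continuous_on[OF bounded_linear_proj2 smooth_on_continuous[OF smooth_f]])

lemma openin_h: "openin (top_of_set (frontier D)) (h ` V2)"
 unfolding h_image by (intro openin_open_Int continuous_open_preimage cont_k open_U open_V2)

lemma h_image_borel: "h ` V2 : sets borel"
 unfolding h_image
 by (intro sets.Int borel_closed borel_open continuous_open_preimage cont_k open_U open_V2) auto

lemma smooth_h: "smooth_on h V2"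
proof -
 have "smooth_on (%y. g (lift3 y 0)) V2"
  by (rule smooth_on_compose[OF open_V2 open_V smooth_g smooth_on_linear[OF bounded_linear_lift3 open_V2]])
   (use lift3_in_V de in auto)
 then show ?thesis by (simp add: h_def[abs_def])
qed

lemma hom_h: "homeomorphism V2 (h ` V2) h k"
 by (intro homeomorphismI smooth_on_continuous[OF smooth_h] continuous_on_subset[OF cont_k])
  (use h_image in \<open>auto simp: kh hk\<close>)

lemma frechet_h: assumes y: "y : V2" shows "Fd h (at y) v = Fd g (at (lift3 y 0)) (lift3 v 0)"
proof -
 have z: "lift3 y 0 : V" using lift3_in_V[OF y] de by simp
 have "((%y. g (lift3 y 0)) has_derivative (%v. Fd g (at (lift3 y 0)) (lift3 v 0))) (at y)"
  by (rule has_derivative_compose[where f = "%y. lift3 y 0",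
     OF bounded_linear_imp_has_derivative[OF bounded_linear_lift3] smooth_on_has_derivative[OF smooth_g open_V z]])
 then have "(h has_derivative (%v. Fd g (at (lift3 y 0)) (lift3 v 0))) (at y)"
  by (simp add: h_def[abs_def])
 from frechet_derivative_at[OF this] show ?thesis by metis
qed

lemma lift3_axis: "lift3 (axis 1 1) 0 = axis 1 1" "lift3 (axis 2 1) 0 = axis 2 1"
 by (simp_all add: vec_eq_iff forall_3 axis_def)

text \<open>The derivative of \<open>g\<close> has a left inverse, hence is injective, and keeps the
  first two axes linearly independent.\<close>

lemma cross_nonzero:
 assumes y: "y : V2"
 shows "cross3 (Fd h (at y) (axis 1 1)) (Fd h (at y) (axis 2 1)) ~= 0"
proof
 let ?z = "lift3 y 0"
 let ?Dg = "Fd g (at ?z)"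
 have z: "?z : V" using lift3_in_V[OF y] de by simp
 have lin: "linear ?Dg" by (rule has_derivative_linear[OF smooth_on_has_derivative[OF smooth_g open_V z]])
 have inv: "Fd f (at (g ?z)) (?Dg v) = v" for v
  using smooth_diffeo_derivatives(1)[OF diffeo fg(2)[OF z]] fg(1)[OF z] by simp
 then have inj: "inj ?Dg" by (metis injI)
 assume "cross3 (Fd h (at y) (axis 1 1)) (Fd h (at y) (axis 2 1)) = 0"
 then have "cross3 (?Dg (axis 1 1)) (?Dg (axis 2 1)) = 0" by (simp add: frechet_h[OF y] lift3_axis)
 then have "collinear {0, ?Dg (axis 1 1), ?Dg (axis 2 1)}" by (simp add: cross_eq_0)
 then have "?Dg (axis 1 1) = 0 \<or> ?Dg (axis 2 1) = 0 \<or> (EX c. ?Dg (axis 2 1) = c *\<^sub>R ?Dg (axis 1 1))"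
  by (simp add: collinear_lemma)
 then consider "?Dg (axis 1 1) = ?Dg 0" | "?Dg (axis 2 1) = ?Dg 0" | c where "?Dg (axis 2 1) = ?Dg (c *\<^sub>R axis 1 1)"
  using linear_0[OF lin] linear_scale[OF lin] by metis
 then show False
 proof cases
  case 1 then show ?thesis using injD[OF inj 1] by (simp add: axis_eq_0_iff)
 next
  case 2 then show ?thesis using injD[OF inj 2] by (simp add: axis_eq_0_iff)
 next
  case 3
  then have "axis 2 1 = c *\<^sub>R (axis 1 1 :: real^3)" using injD[OF inj 3] by simp
  then have "(axis 2 1 :: real^3) $ 2 = (c *\<^sub>R (axis 1 1 :: real^3)) $ 2" by simp
  then show ?thesis by (simp add: axis_def)
 qed
qed

lemma bounded_frechet_g:
 assumes b: "b : Basis"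
 obtains C where "0 <= C" "!!z. z : cball z0 (2 * de) ==> norm (Fd g (at z) b) <= C"
proof -
 have "compact ((%z. Fd g (at z) b) ` cball z0 (2 * de))"
  by (intro compact_continuous_image compact_cball
    continuous_on_subset[OF smooth_on_continuous[OF smooth_on_frechet_basis[OF smooth_g b]] V])
 then have "bounded ((%z. Fd g (at z) b) ` cball z0 (2 * de))" by (rule compact_imp_bounded)
 then obtain C where C: "ALL z:cball z0 (2 * de). norm (Fd g (at z) b) <= C"
  unfolding bounded_iff ball_simps by blast
 moreover have "z0 : cball z0 (2 * de)" using de by simp
 then have "0 <= C" using C norm_ge_zero order_trans by blast
 ultimately show ?thesis by (intro that[of C]) auto
qed

text \<open>The area formula expresses the surface measure of a parametrised set through the cross
  product, which is bounded because the derivatives of \<open>g\<close> are bounded on the compact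
  ball.\<close>

lemma surface_integral_le:
 assumes si: "is_surface_measure (frontier D) si"
 obtains C where "0 <= C" "!!ph. ph : borel_measurable borel ==>
  (\<integral>\<^sup>+x. ph x * indicator (h ` V2) x \<partial>si) <= ennreal C * (\<integral>\<^sup>+y. ph (h y) \<partial>leb V2)"
proof -
 have sets[measurable_cong]: "sets si = sets borel" using si by (simp add: is_surface_measure_def)
 obtain C1 where C1: "0 <= C1" "!!z. z : cball z0 (2 * de) ==> norm (Fd g (at z) (axis 1 1)) <= C1"
  using bounded_frechet_g[of "axis 1 1"] unfolding Basis_real3 by blast
 obtain C2 where C2: "0 <= C2" "!!z. z : cball z0 (2 * de) ==> norm (Fd g (at z) (axis 2 1)) <= C2"
  using bounded_frechet_g[of "axis 2 1"] unfolding Basis_real3 by blast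
 let ?J = "%y. norm (cross3 (Fd h (at y) (axis 1 1)) (Fd h (at y) (axis 2 1)))"
 have J: "?J y <= C1 * C2" if y: "y : V2" for y
 proof -
  have cr: "norm (cross3 a b) <= norm a * norm b" for a b :: "real^3"
  proof (rule power2_le_imp_le)
   show "(norm (cross3 a b))\<^sup>2 <= (norm a * norm b)\<^sup>2"
    using norm_cross[of a b] by (simp add: power_mult_distrib)
  qed simp
  have "?J y <= norm (Fd h (at y) (axis 1 1)) * norm (Fd h (at y) (axis 2 1))" by (rule cr)
  also have "... <= C1 * C2"
   using C1 C2 lift3_in[OF y, of 0] de by (intro mult_mono) (auto simp: frechet_h[OF y] lift3_axis)
  finally show ?thesis .
 qed
 have hm: "h : leb V2 \<rightarrow>\<^sub>M borel"
  by (rule continuous_on_measurable_leb[OF smooth_on_continuous[OF smooth_h]])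
 have V2b: "V2 : sets borel" using open_V2 by auto
 have le: "emeasure si (A \<inter> h ` V2) <= ennreal (C1 * C2) * emeasure lborel (V2 \<inter> h -` A)" if A: "A : sets borel" for A
 proof -
  define B where "B = V2 \<inter> h -` A"
  have B: "B : sets borel" "B \<subseteq> V2"
   using measurable_sets[OF hm A] sets_leb[OF V2b] by (auto simp: B_def space_leb Int_commute)
  have "A \<inter> h ` V2 = h ` B" by (auto simp: B_def)
  then have "emeasure si (A \<inter> h ` V2) = (\<integral>\<^sup>+y\<in>B. ennreal (?J y) \<partial>lborel)"
   using si[unfolded is_surface_measure_def, THEN conjunct2, THEN conjunct2, THEN spec[of _ V2],
     THEN spec[of _ h], THEN spec[of _ k], THEN spec[of _ B]]
    open_V2 smooth_h hom_h openin_h cross_nonzero B by simp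
  also have "... <= (\<integral>\<^sup>+y. ennreal (C1 * C2) * indicator B y \<partial>lborel)"
   using B J by (intro nn_integral_mono) (auto simp: indicator_def intro!: ennreal_leI)
  also have "... = ennreal (C1 * C2) * emeasure lborel B" using B by (simp add: nn_integral_cmult_indicator)
  finally show ?thesis by (simp add: B_def)
 qed
 show ?thesis
 proof (rule that[of "C1 * C2"])
  show "0 <= C1 * C2" using C1 C2 by simp
  fix ph :: "real^3 => ennreal" assume ph[measurable]: "ph : borel_measurable borel"
  \<comment> \<open>Both sides become integrals of \<open>ph\<close> against two measures, so a
    comparison on Borel sets settles all nonnegative \<open>ph\<close>.\<close>
  let ?M = "density si (indicator (h ` V2))"
  let ?N = "density (distr (leb V2) borel h) (%_. ennreal (C1 * C2))"
  have hb: "h ` V2 : sets si" using h_image_borel sets by simp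
  have "(\<integral>\<^sup>+x. ph x * indicator (h ` V2) x \<partial>si) = (\<integral>\<^sup>+x. ph x \<partial>?M)"
   using hb by (subst nn_integral_density) (auto simp: mult.commute)
  also have "... <= (\<integral>\<^sup>+x. ph x \<partial>?N)"
  proof (rule nn_integral_mono_measure)
   show s: "sets ?M = sets ?N" using sets by simp
   show "?M <= ?N"
    unfolding le_measure[OF s]
   proof
    fix A assume "A : sets ?M"
    then have True: "A : sets borel" using s by simp
    show "emeasure ?M A <= emeasure ?N A"
    proof -
     have "emeasure ?M A = emeasure si (A \<inter> h ` V2)"
      using True hb sets by (subst emeasure_density) (auto simp: indicator_inter_arith[symmetric] mult.commute Int_commute)
     moreover have "emeasure ?N A = ennreal (C1 * C2) * emeasure lborel (V2 \<inter> h -` A)"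
     proof -
      have "emeasure ?N A = ennreal (C1 * C2) * emeasure (distr (leb V2) borel h) A"
       using True by (subst emeasure_density) (auto simp: nn_integral_cmult_indicator)
      also have "emeasure (distr (leb V2) borel h) A = emeasure (leb V2) (h -` A \<inter> V2)"
       using True by (subst emeasure_distr[OF hm]) (auto simp: space_leb)
      also have "... = emeasure lborel (V2 \<inter> h -` A)"
       unfolding leb_def by (subst emeasure_restrict_space) (use V2b in \<open>auto simp: Int_commute\<close>)
      finally show ?thesis .
     qed
     ultimately show ?thesis using le[OF True] by simp
    qed
   qed
  qed
  also have "... = ennreal (C1 * C2) * (\<integral>\<^sup>+x. ph x \<partial>distr (leb V2) borel h)"
   by (subst nn_integral_density) (auto simp: nn_integral_cmult)
  also have "(\<integral>\<^sup>+x. ph x \<partial>distr (leb V2) borel h) = (\<integral>\<^sup>+y. ph (h y) \<partial>leb V2)"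
   by (rule nn_integral_distr[OF hm]) simp
  finally show "(\<integral>\<^sup>+x. ph x * indicator (h ` V2) x \<partial>si) <= ennreal (C1 * C2) * (\<integral>\<^sup>+y. ph (h y) \<partial>leb V2)" .
 qed
qed

definition W :: "(real^3) set" where "W = {z. proj2 z : V2 & 0 < z $ 3 & z $ 3 <= de}"

lemma W_sub: "W \<subseteq> cball z0 (2 * de)" "W \<subseteq> V"
proof -
 have "z : cball z0 (2 * de)" if "z : W" for z
  using lift3_in[of "proj2 z" "z $ 3"] that by (simp add: W_def)
 then show "W \<subseteq> cball z0 (2 * de)" "W \<subseteq> V" using V by auto
qed

lemma W_borel: "W : sets borel"
proof -
 have "W = {z. proj2 z : V2} \<inter> {z. 0 < z $ 3} \<inter> {z. z $ 3 <= de}" by (auto simp: W_def)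
 moreover have "open (proj2 -` V2)"
  by (intro open_vimage open_V2 bounded_linear.continuous_on[OF bounded_linear_proj2] continuous_on_id)
 then have "{z. proj2 z : V2} : sets borel" by (simp add: vimage_def)
 moreover have "{z :: real^3. 0 < z $ 3} : sets borel" "{z :: real^3. z $ 3 <= de} : sets borel"
  by (auto intro!: borel_open borel_closed open_Collect_less closed_Collect_le continuous_intros)
 ultimately show ?thesis by auto
qed

text \<open>Change of variables is applied to \<open>f\<close>, which maps the image
  \<open>S\<close> of a set \<open>T\<close> under \<open>g\<close> back onto \<open>T\<close>: the
  measure of \<open>T\<close> is at most the integral of \<open>\<bar>det Df\<bar>\<close> over
  \<open>S\<close>, and this determinant is bounded on the compact image of the ball.\<close>

lemma flatten_integral_le:
 assumes D: "D : sets borel"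
 obtains C where "0 <= C" "!!K. K : borel_measurable borel ==>
  (\<integral>\<^sup>+z. K (g z) \<partial>leb W) <= ennreal C * (\<integral>\<^sup>+x. K x * indicator D x \<partial>lborel)"
proof -
 let ?d = "%x. \<bar>det (matrix (Fd f (at x)))\<bar>"
 have cd: "continuous_on U ?d"
 proof -
  have c: "continuous_on U (%x. Fd f (at x) (axis j 1) $ i)" for i j
   by (intro continuous_intros smooth_on_continuous[OF smooth_on_frechet_basis[OF smooth_f]]) (simp add: axis_in_Basis_iff)
  show ?thesis unfolding det_3 matrix_def vec_lambda_beta
   by (intro continuous_on_rabs continuous_on_add continuous_on_diff continuous_on_mult c)
 qed
 have cg: "continuous_on V g" by (rule smooth_on_continuous[OF smooth_g])
 have cgb: "compact (g ` cball z0 (2 * de))"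
  by (rule compact_continuous_image[OF continuous_on_subset[OF cg V] compact_cball])
 have "g ` cball z0 (2 * de) \<subseteq> U" using V fg(2) by blast
 then have "compact (?d ` g ` cball z0 (2 * de))"
  by (rule compact_continuous_image[OF continuous_on_subset[OF cd] cgb])
 then have "bounded (?d ` g ` cball z0 (2 * de))" by (rule compact_imp_bounded)
 then obtain C where "ALL z:cball z0 (2 * de). norm (?d (g z)) <= C"
  unfolding bounded_iff ball_simps by blast
 then have C: "?d (g z) <= C" if "z : cball z0 (2 * de)" for z using that by simp
 have "z0 : cball z0 (2 * de)" using de by simp
 from order_trans[OF abs_ge_zero C[OF this]] have C0: "0 <= C" .
 have gm: "g : leb W \<rightarrow>\<^sub>M borel"
  by (rule continuous_on_measurable_leb[OF continuous_on_subset[OF cg W_sub(2)]])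
 have le: "emeasure lborel (W \<inter> g -` A) <= ennreal C * emeasure lborel (A \<inter> D)" if A: "A : sets borel" for A
 proof -
  define T where "T = W \<inter> g -` A"
  have T: "T : sets borel" using measurable_sets[OF gm A] sets_leb[OF W_borel] by (auto simp: T_def space_leb Int_commute)
  define S where "S = g ` T"
  have TV: "z : V" if "z : T" for z using W_sub(2) that by (auto simp: T_def)
  have TS: "T = f ` S" "S \<subseteq> U"
  proof -
   have "f ` S = (%z. f (g z)) ` T" by (simp add: S_def image_image)
   also have "... = (%z. z) ` T" by (rule image_cong) (simp_all add: TV fg)
   finally show "T = f ` S" by simp
   show "S \<subseteq> U" using TV fg(2) by (auto simp: S_def)
  qed
  have SA: "S \<subseteq> A \<inter> D" using W_sub(2) g_in_D by (auto simp: S_def T_def W_def)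
  have Seq: "S = U \<inter> f -` T"
  proof (intro set_eqI iffI)
   fix x assume "x : S"
   then obtain z where z: "z : T" "x = g z" by (auto simp: S_def)
   then have "z : V" using W_sub(2) by (auto simp: T_def)
   then show "x : U \<inter> f -` T" using z fg(1,2) by simp
  next
   fix x assume x: "x : U \<inter> f -` T"
   then have "g (f x) = x" "f x : T" using fg(3) by auto
   then show "x : S" unfolding S_def by (metis imageI)
  qed
  have fm: "f : restrict_space borel U \<rightarrow>\<^sub>M borel"
   by (rule borel_measurable_continuous_on_restrict[OF smooth_on_continuous[OF smooth_f]])
  have Sb: "S : sets borel"
  proof -
   have "f -` T \<inter> space (restrict_space borel U) : sets (restrict_space borel U)" by (rule measurable_sets[OF fm T])
   then have "f -` T \<inter> U : sets borel"
    using open_U by (subst (asm) sets_restrict_space_iff) (auto simp: space_restrict_space)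
   then show ?thesis unfolding Seq by (simp add: Int_commute)
  qed
  have Sbd: "bounded S"
  proof -
   have "S \<subseteq> g ` cball z0 (2 * de)" using W_sub(1) by (auto simp: S_def T_def)
   then show ?thesis by (rule bounded_subset[OF compact_imp_bounded[OF cgb]])
  qed
  have Sfin: "emeasure lborel S < \<infinity>" by (rule emeasure_bounded_finite[OF Sbd])
  have dle: "?d x <= C" if "x : S" for x using that C W_sub(1) by (auto simp: S_def T_def)
  have int: "set_integrable lborel S ?d"
   unfolding set_integrable_def
  proof (rule Bochner_Integration.integrable_bound)
   show "integrable lborel (%x. indicator S x * C)" using Sb Sfin by (intro integrable_mult_left integrable_real_indicator) auto
   show "(%x. indicator S x *\<^sub>R ?d x) : borel_measurable lborel"
    using borel_measurable_continuous_on_indicator[OF Sb continuous_on_subset[OF cd TS(2)]] by simp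
   show "AE x in lborel. norm (indicator S x *\<^sub>R ?d x) <= norm (indicator S x * C)"
    using dle C0 by (intro AE_I2) (auto simp: indicator_def)
  qed
  have der: "(f has_derivative Fd f (at x)) (at x within S)" if "x : S" for x
   using smooth_on_has_derivative[OF smooth_f open_U] TS(2) that has_derivative_at_withinI by blast
  have SL: "S : sets lebesgue" using Sb by auto
  note mdi = measurable_differentiable_image[OF SL der set_borel_integral_eq_integral(1)[OF int]]
   measure_differentiable_image[OF SL der set_borel_integral_eq_integral(1)[OF int]]
  have "measure lebesgue T <= integral S ?d" using mdi(2) TS(1) by simp
  also have "... = (LINT x:S|lborel. ?d x)" using set_borel_integral_eq_integral(2)[OF int] by simp
  also have "... <= (LINT x:S|lborel. C)"
   by (rule set_integral_mono[OF int]) (use dle Sb Sfin in \<open>auto simp: set_integrable_def intro!: integrable_mult_left integrable_real_indicator\<close>)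
  also have "... = C * measure lborel S" using Sb by (simp add: set_lebesgue_integral_def)
  finally have mT: "measure lborel T <= C * measure lborel S" using T by simp
  have Tfin: "emeasure lborel T < \<infinity>"
   by (rule emeasure_bounded_finite, rule bounded_subset[OF bounded_cball]) (use W_sub(1) in \<open>auto simp: T_def\<close>)
  have "emeasure lborel T = ennreal (measure lborel T)" using Tfin by (intro emeasure_eq_ennreal_measure) auto
  also have "... <= ennreal (C * measure lborel S)" by (rule ennreal_leI[OF mT])
  also have "... = ennreal C * emeasure lborel S"
   using Sfin C0 by (subst emeasure_eq_ennreal_measure) (auto simp: ennreal_mult)
  also have "... <= ennreal C * emeasure lborel (A \<inter> D)"
   using SA A D by (intro mult_left_mono emeasure_mono) auto
  finally show ?thesis by (simp add: T_def)
 qed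
 show ?thesis
 proof (rule that[OF C0])
  fix K :: "real^3 => ennreal" assume K[measurable]: "K : borel_measurable borel"
  let ?M = "distr (leb W) borel g" and ?N = "density lborel (%x. ennreal C * indicator D x)"
  have "(\<integral>\<^sup>+z. K (g z) \<partial>leb W) = (\<integral>\<^sup>+x. K x \<partial>?M)" by (rule nn_integral_distr[OF gm, symmetric]) simp
  also have "... <= (\<integral>\<^sup>+x. K x \<partial>?N)"
  proof (rule nn_integral_mono_measure)
   show s: "sets ?M = sets ?N" by simp
   show "?M <= ?N" unfolding le_measure[OF s]
   proof
    fix A assume "A : sets ?M"
    then have True: "A : sets borel" using s by simp
    show "emeasure ?M A <= emeasure ?N A"
    proof -
     have "emeasure ?M A = emeasure lborel (W \<inter> g -` A)"
      using True W_borel by (subst emeasure_distr[OF gm])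
       (auto simp: space_leb leb_def emeasure_restrict_space Int_commute)
     moreover have "emeasure ?N A = (\<integral>\<^sup>+x. ennreal C * indicator (A \<inter> D) x \<partial>lborel)"
      using True D by (subst emeasure_density) (auto simp: indicator_inter_arith mult_ac intro!: nn_integral_cong)
     then have "emeasure ?N A = ennreal C * emeasure lborel (A \<inter> D)"
      using True D by (simp add: nn_integral_cmult_indicator)
     ultimately show ?thesis using le[OF True] by simp
    qed
   qed
  qed
  also have "... = (\<integral>\<^sup>+x. ennreal C * (K x * indicator D x) \<partial>lborel)"
   using D by (subst nn_integral_density) (auto simp: mult_ac)
  also have "... = ennreal C * (\<integral>\<^sup>+x. K x * indicator D x \<partial>lborel)"
   using D by (intro nn_integral_cmult) auto
  finally show "(\<integral>\<^sup>+z. K (g z) \<partial>leb W) <= ennreal C * (\<integral>\<^sup>+x. K x * indicator D x \<partial>lborel)" .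
 qed
qed

end

section \<open>Integration along segments transversal to the boundary\<close>

definition H1_density :: "('a::euclidean_space => real) => 'a => real" where
 "H1_density ph x = (ph x)\<^sup>2 + (\<Sum>b\<in>Basis. (Fd ph (at x) b)\<^sup>2)"

lemma H1_density_nonneg: "0 <= H1_density ph x"
 by (simp add: H1_density_def sum_nonneg)

lemma smooth_on_power2: "smooth_on (f :: 'a::euclidean_space => real) UNIV ==> smooth_on (%x. (f x)\<^sup>2) UNIV"
 unfolding power2_eq_square by (intro smooth_on_mult) auto

lemma smooth_H1_density: "smooth_on ph UNIV ==> smooth_on (H1_density ph) UNIV"
 unfolding H1_density_def[abs_def]
 by (intro smooth_on_add smooth_on_sum smooth_on_power2 smooth_on_frechet open_UNIV)

lemma frechet_derivative_square_le:
 assumes "smooth_on ph UNIV"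
 shows "(Fd ph (at x) w)\<^sup>2 <= (norm w)\<^sup>2 * (\<Sum>b\<in>Basis. (Fd ph (at x) b)\<^sup>2)"
proof -
 define G where "G = (\<Sum>b\<in>Basis. Fd ph (at x) b *\<^sub>R b)"
 have "Fd ph (at x) w = (\<Sum>b\<in>Basis. (w \<bullet> b) *\<^sub>R Fd ph (at x) b)"
  by (rule frechet_derivative_basis_sum[OF smooth_on_differentiable[OF assms open_UNIV UNIV_I]])
 also have "... = w \<bullet> G" by (simp add: G_def inner_sum_right mult.commute)
 finally have "\<bar>Fd ph (at x) w\<bar> <= norm w * norm G" by (simp add: Cauchy_Schwarz_ineq2)
 then have "\<bar>Fd ph (at x) w\<bar>\<^sup>2 <= (norm w * norm G)\<^sup>2" by (intro power_mono) auto
 moreover have "(norm G)\<^sup>2 = (\<Sum>b\<in>Basis. (Fd ph (at x) b)\<^sup>2)"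
 proof -
  have "G \<bullet> b = Fd ph (at x) b" if "b : Basis" for b
   using that by (simp add: G_def inner_sum_left_Basis)
  moreover have "(norm G)\<^sup>2 = (\<Sum>b\<in>Basis. (G \<bullet> b)\<^sup>2)"
   unfolding power2_norm_eq_inner by (subst euclidean_inner) (simp add: power2_eq_square)
  ultimately show ?thesis by simp
 qed
 ultimately show ?thesis by (simp add: power_mult_distrib)
qed

context flat_chart
begin

text \<open>Integrate the derivative of \<open>- (1 - s/de) Ph\<^sup>2\<close> along the line \<open>s \<mapsto> lift3 y s\<close>.\<close>

lemma line_estimate:
 assumes M: "!!z. z : cball z0 (2 * de) ==> norm (Fd g (at z) (axis 3 1)) <= M"
  and ph: "smooth_on ph UNIV" and y: "y : V2"
 shows "ennreal ((ph (h y))\<^sup>2) <= ennreal (1 / de + 1 + M\<^sup>2) *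
  (\<integral>\<^sup>+s. ennreal (H1_density ph (g (lift3 y s))) * indicator {0<..de} s \<partial>lborel)"
proof -
 let ?l = "%s. lift3 y s"
 define Ph where "Ph s = ph (g (?l s))" for s
 define Ph' where "Ph' s = Fd ph (at (g (?l s))) (Fd g (at (?l s)) (axis 3 1))" for s
 \<comment> \<open>\<open>1 / de\<close> stems from differentiating the weight; \<open>1\<close> and
   \<open>M^2\<close> stem from splitting \<open>2 * Ph * Ph'\<close> and bounding the speed of the
   segment under \<open>g\<close>.\<close>
 define C where "C = 1 / de + 1 + M\<^sup>2"
 have C0: "C >= 0" using de by (simp add: C_def)
 have lV: "?l s : V" "?l s : cball z0 (2 * de)" if "s : {0..de}" for s
  using lift3_in_V[OF y, of s] lift3_in[OF y, of s] that by auto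
 have DPh: "(Ph has_real_derivative Ph' s) (at s)" if s: "s : {0..de}" for s
 proof -
  let ?Dg = "Fd g (at (?l s))" and ?Df = "Fd ph (at (g (?l s)))"
  have l: "(?l has_derivative (%t. t *\<^sub>R axis 3 1)) (at s)"
   unfolding lift3_eq by (auto intro!: derivative_eq_intros)
  note dg = smooth_on_has_derivative[OF smooth_g open_V lV(1)[OF s]]
  note dph = smooth_on_has_derivative[OF ph open_UNIV UNIV_I, of "g (?l s)"]
  have "((%s. g (?l s)) has_derivative (%t. ?Dg (t *\<^sub>R axis 3 1))) (at s)"
   by (rule has_derivative_compose[where g = g, OF l dg])
  from has_derivative_compose[where g = ph, OF this dph]
  have "(Ph has_derivative (%t. ?Df (?Dg (t *\<^sub>R axis 3 1)))) (at s)" by (simp add: Ph_def[abs_def])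
  moreover have "?Df (?Dg (t *\<^sub>R axis 3 1)) = Ph' s * t" for t
   using linear_scale[OF has_derivative_linear[OF dg]] linear_scale[OF has_derivative_linear[OF dph]]
   by (simp add: Ph'_def)
  ultimately show ?thesis by (simp add: has_field_derivative_def)
 qed
 have cl: "continuous_on {0..de} ?l" unfolding lift3_eq by (intro continuous_intros)
 have cgl: "continuous_on {0..de} (%s. g (?l s))"
  by (rule continuous_on_compose2[OF smooth_on_continuous[OF smooth_g] cl]) (use lV in auto)
 have cPh: "continuous_on {0..de} Ph"
  unfolding Ph_def by (rule continuous_on_compose2[OF smooth_on_continuous[OF ph] cgl]) auto
 have cPh': "continuous_on {0..de} Ph'"
 proof -
  have eq: "Ph' = (%s. \<Sum>b\<in>Basis. (Fd g (at (?l s)) (axis 3 1) \<bullet> b) *\<^sub>R Fd ph (at (g (?l s))) b)"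
   unfolding Ph'_def by (rule ext, rule frechet_derivative_basis_sum) (rule smooth_on_differentiable[OF ph open_UNIV UNIV_I])
  have c1: "continuous_on {0..de} (%s. Fd g (at (?l s)) (axis 3 1))"
   by (rule continuous_on_compose2[OF smooth_on_continuous[OF smooth_on_frechet_basis[OF smooth_g]] cl]) (use lV in auto)
  have c2: "continuous_on {0..de} (%s. Fd ph (at (g (?l s))) b)" for b
   by (rule continuous_on_compose2[OF smooth_on_continuous[OF smooth_on_frechet[OF ph open_UNIV]] cgl]) auto
  show ?thesis unfolding eq
   by (intro continuous_on_sum continuous_on_scaleR continuous_on_inner c1 c2 continuous_on_const)
 qed
 \<comment> \<open>The weight vanishes at \<open>s = de\<close>, so only the boundary value at
   \<open>s = 0\<close> survives.\<close>
 define F where "F s = - (1 - s / de) * (Ph s)\<^sup>2" for s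
 define q where "q s = (1 / de) * (Ph s)\<^sup>2 - (1 - s / de) * (2 * Ph s * Ph' s)" for s
 have vd: "(F has_vector_derivative q s) (at s within {0..de})" if "0 <= s" "s <= de" for s
 proof -
  have "(F has_real_derivative q s) (at s)"
   unfolding F_def[abs_def] q_def using de that
   by (auto intro!: derivative_eq_intros DPh simp: field_simps)
  then show ?thesis
   by (auto simp: has_real_derivative_iff_has_vector_derivative intro: has_vector_derivative_at_within)
 qed
 have cq: "continuous_on {0..de} q" unfolding q_def by (intro continuous_intros cPh cPh') (use de in auto)
 have "has_bochner_integral lborel (%s. indicator {0..de} s *\<^sub>R q s) (F de - F 0)"
  by (rule has_bochner_integral_FTC_Icc[OF less_imp_le[OF de] vd cq])
 then have int: "integrable lborel (%s. indicator {0..de} s *\<^sub>R q s)"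
  and val: "(\<integral>s. indicator {0..de} s *\<^sub>R q s \<partial>lborel) = (Ph 0)\<^sup>2"
  using de by (auto simp: has_bochner_integral_iff F_def)
 have bound: "\<bar>q s\<bar> <= C * H1_density ph (g (?l s))" if s: "s : {0..de}" for s
 proof -
  let ?S = "\<Sum>b\<in>Basis. (Fd ph (at (g (?l s))) b)\<^sup>2"
  have S0: "?S >= 0" by (intro sum_nonneg) auto
  have r: "0 <= 1 - s / de" "1 - s / de <= 1" using s de by (auto simp: field_simps)
  have "\<bar>(1 - s / de) * (2 * Ph s * Ph' s)\<bar> <= 1 * \<bar>2 * Ph s * Ph' s\<bar>"
   unfolding abs_mult[of "1 - s / de"] using r by (intro mult_right_mono) auto
  also have "... <= (Ph s)\<^sup>2 + (Ph' s)\<^sup>2"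
   using sum_squares_bound[of "\<bar>Ph s\<bar>" "\<bar>Ph' s\<bar>"] by (simp add: abs_mult)
  also have "(Ph' s)\<^sup>2 <= M\<^sup>2 * ?S"
   unfolding Ph'_def
   by (rule order_trans[OF frechet_derivative_square_le[OF ph]])
    (use M[OF lV(2)[OF s]] S0 in \<open>auto intro!: mult_right_mono power_mono\<close>)
  finally have *: "\<bar>(1 - s / de) * (2 * Ph s * Ph' s)\<bar> <= (Ph s)\<^sup>2 + M\<^sup>2 * ?S" by simp
  have "\<bar>q s\<bar> <= (1 / de) * (Ph s)\<^sup>2 + ((Ph s)\<^sup>2 + M\<^sup>2 * ?S)"
   unfolding q_def using * de abs_triangle_ineq4[of "(1 / de) * (Ph s)\<^sup>2" "(1 - s / de) * (2 * Ph s * Ph' s)"]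
   by (simp add: abs_mult)
  also have "... = (1 / de + 1) * (Ph s)\<^sup>2 + M\<^sup>2 * ?S" by (simp add: algebra_simps)
  also have "... <= C * (Ph s)\<^sup>2 + C * ?S"
   using S0 de by (intro add_mono mult_right_mono) (auto simp: C_def)
  finally show ?thesis by (simp add: H1_density_def Ph_def distrib_left)
 qed
 have "ennreal ((ph (h y))\<^sup>2) = ennreal (norm (\<integral>s. indicator {0..de} s *\<^sub>R q s \<partial>lborel))"
  unfolding val by (simp add: Ph_def h_def)
 also have "... <= (\<integral>\<^sup>+s. ennreal (norm (indicator {0..de} s *\<^sub>R q s)) \<partial>lborel)"
  by (rule integral_norm_bound_ennreal[OF int])
 also have "... <= (\<integral>\<^sup>+s. ennreal C * (ennreal (H1_density ph (g (?l s))) * indicator {0<..de} s) \<partial>lborel)"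
 proof (rule nn_integral_mono_AE)
  \<comment> \<open>Removing the endpoint \<open>0\<close>, a null set, keeps the segment inside the
    open side \<open>0 < z $ 3\<close>.\<close>
  have "AE s in lborel. s ~= (0::real)" by (rule AE_lborel_singleton)
  then show "AE s in lborel. ennreal (norm (indicator {0..de} s *\<^sub>R q s))
    <= ennreal C * (ennreal (H1_density ph (g (?l s))) * indicator {0<..de} s)"
  proof eventually_elim
   case (elim s)
   show ?case
   proof (cases "s : {0..de}")
    case True
    then have i: "indicator {0<..de} s = (1 :: ennreal)" using elim by (auto simp: indicator_def)
    have "ennreal \<bar>q s\<bar> <= ennreal C * ennreal (H1_density ph (g (?l s)))"
     unfolding ennreal_mult[OF C0 H1_density_nonneg, symmetric] by (rule ennreal_leI[OF bound[OF True]])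
    then show ?thesis using True by (simp add: i)
   qed simp
  qed
 qed
 also have "... = ennreal C * (\<integral>\<^sup>+s. ennreal (H1_density ph (g (?l s))) * indicator {0<..de} s \<partial>lborel)"
 proof (rule nn_integral_cmult)
  have "continuous_on {0<..de} (%s. H1_density ph (g (?l s)))"
   by (rule continuous_on_compose2[OF smooth_on_continuous[OF smooth_H1_density[OF ph]] continuous_on_subset[OF cgl]]) auto
  then have "(%s. indicator {0<..de} s *\<^sub>R H1_density ph (g (?l s))) : borel_measurable borel"
   by (intro borel_measurable_continuous_on_indicator) auto
  then have "(%s. ennreal (indicator {0<..de} s *\<^sub>R H1_density ph (g (?l s)))) : borel_measurable borel" by measurable
  moreover have "(%s. ennreal (indicator {0<..de} s *\<^sub>R H1_density ph (g (?l s))))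
    = (%s. ennreal (H1_density ph (g (?l s))) * indicator {0<..de} s)" by (auto simp: indicator_def)
  ultimately show "(%s. ennreal (H1_density ph (g (?l s))) * indicator {0<..de} s) : borel_measurable lborel" by simp
 qed
 finally show ?thesis by (simp add: C_def)
qed

text \<open>Three estimates in a row: from the surface patch to its parameter disc
  (\<open>C1\<close>), from the disc to the cylinder \<open>W\<close> by integrating the segment
  estimate (\<open>C3\<close>), and from \<open>W\<close> back into \<open>D\<close>
  (\<open>C2\<close>).\<close>

lemma local_trace_inequality:
 assumes si: "is_surface_measure (frontier D) si" and D: "D : sets borel"
 obtains C where "0 <= C" "!!ph. smooth_on ph UNIV ==>
  (\<integral>\<^sup>+x. ennreal ((ph x)\<^sup>2) * indicator (h ` V2) x \<partial>si) <= ennreal C * (\<integral>\<^sup>+x. ennreal (H1_density ph x) * indicator D x \<partial>lborel)"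
proof -
 obtain M where M: "0 <= M" "!!z. z : cball z0 (2 * de) ==> norm (Fd g (at z) (axis 3 1)) <= M"
  using bounded_frechet_g[of "axis 3 1"] unfolding Basis_real3 by blast
 obtain C1 where C1: "0 <= C1" "!!ph. ph : borel_measurable borel ==>
  (\<integral>\<^sup>+x. ph x * indicator (h ` V2) x \<partial>si) <= ennreal C1 * (\<integral>\<^sup>+y. ph (h y) \<partial>leb V2)"
  using surface_integral_le[OF si] by blast
 obtain C2 where C2: "0 <= C2" "!!K. K : borel_measurable borel ==>
  (\<integral>\<^sup>+z. K (g z) \<partial>leb W) <= ennreal C2 * (\<integral>\<^sup>+x. K x * indicator D x \<partial>lborel)"
  using flatten_integral_le[OF D] by blast
 define C3 where "C3 = 1 / de + 1 + M\<^sup>2"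
 have C3: "0 <= C3" using de by (simp add: C3_def)
 have V2b: "V2 : sets borel" using open_V2 by auto
 show ?thesis
 proof (rule that[of "C1 * (C3 * C2)"])
  show "0 <= C1 * (C3 * C2)" using C1 C2 C3 by simp
  fix ph :: "real^3 => real" assume ph: "smooth_on ph UNIV"
  have [measurable]: "ph : borel_measurable borel" "H1_density ph : borel_measurable borel"
   by (auto intro: smooth_measurable ph smooth_H1_density)
  define K where "K z = ennreal (indicator W z *\<^sub>R H1_density ph (g z))" for z
  have "continuous_on W (%z. H1_density ph (g z))"
   by (rule continuous_on_compose2[OF smooth_on_continuous[OF smooth_H1_density[OF ph]]
      continuous_on_subset[OF smooth_on_continuous[OF smooth_g] W_sub(2)]]) auto
  then have "(%z. indicator W z *\<^sub>R H1_density ph (g z)) : borel_measurable borel"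
   by (intro borel_measurable_continuous_on_indicator W_borel)
  then have K[measurable]: "K : borel_measurable borel" unfolding K_def[abs_def] by measurable
  have mi: "(%y. \<integral>\<^sup>+s. K (lift3 y s) \<partial>lborel) : borel_measurable lborel"
  proof (rule lborel.borel_measurable_nn_integral)
   have m: "(%p. lift3 (fst p) (snd p)) : (lborel \<Otimes>\<^sub>M lborel) \<rightarrow>\<^sub>M borel"
    using borel_measurable_continuous_onI[OF continuous_on_lift3[of UNIV]] by (simp add: lborel_prod)
   from measurable_compose[OF m K] show "(%(x, y). K (lift3 x y)) : borel_measurable (lborel \<Otimes>\<^sub>M lborel)"
    by (simp add: case_prod_beta)
  qed
  have "(\<integral>\<^sup>+y. ennreal ((ph (h y))\<^sup>2) \<partial>leb V2) = (\<integral>\<^sup>+y. ennreal ((ph (h y))\<^sup>2) * indicator V2 y \<partial>lborel)"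
   by (rule nn_integral_leb[OF V2b])
  also have "... <= (\<integral>\<^sup>+y. ennreal C3 * (\<integral>\<^sup>+s. K (lift3 y s) \<partial>lborel) \<partial>lborel)"
  proof (rule nn_integral_mono)
   fix y :: "real^2"
   show "ennreal ((ph (h y))\<^sup>2) * indicator V2 y <= ennreal C3 * (\<integral>\<^sup>+s. K (lift3 y s) \<partial>lborel)"
   proof (cases "y : V2")
    case True
    have "ennreal (H1_density ph (g (lift3 y s))) * indicator {0<..de} s = K (lift3 y s)" for s
     using True by (auto simp: K_def indicator_def W_def)
    then show ?thesis using line_estimate[OF M(2) ph True] True by (simp add: C3_def)
   qed simp
  qed
  also have "... = ennreal C3 * (\<integral>\<^sup>+y. \<integral>\<^sup>+s. K (lift3 y s) \<partial>lborel \<partial>lborel)"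
   by (rule nn_integral_cmult[OF mi])
  also have "(\<integral>\<^sup>+y. \<integral>\<^sup>+s. K (lift3 y s) \<partial>lborel \<partial>lborel) = (\<integral>\<^sup>+z. K z \<partial>lborel)" by (rule nn_integral_lift3[OF K])
  also have "... = (\<integral>\<^sup>+z. ennreal (H1_density ph (g z)) \<partial>leb W)"
   unfolding nn_integral_leb[OF W_borel] by (rule nn_integral_cong) (auto simp: K_def indicator_def)
  also have "... <= ennreal C2 * (\<integral>\<^sup>+x. ennreal (H1_density ph x) * indicator D x \<partial>lborel)"
   by (rule C2(2)) measurable
  finally have *: "(\<integral>\<^sup>+y. ennreal ((ph (h y))\<^sup>2) \<partial>leb V2)
    <= ennreal C3 * (ennreal C2 * (\<integral>\<^sup>+x. ennreal (H1_density ph x) * indicator D x \<partial>lborel))"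
   by (simp add: mult_left_mono)
  have "(\<integral>\<^sup>+x. ennreal ((ph x)\<^sup>2) * indicator (h ` V2) x \<partial>si) <= ennreal C1 * (\<integral>\<^sup>+y. ennreal ((ph (h y))\<^sup>2) \<partial>leb V2)"
   by (rule C1(2)) measurable
  also have "... <= ennreal C1 * (ennreal C3 * (ennreal C2 * (\<integral>\<^sup>+x. ennreal (H1_density ph x) * indicator D x \<partial>lborel)))"
   by (intro mult_left_mono *) auto
  finally show "(\<integral>\<^sup>+x. ennreal ((ph x)\<^sup>2) * indicator (h ` V2) x \<partial>si)
    <= ennreal (C1 * (C3 * C2)) * (\<integral>\<^sup>+x. ennreal (H1_density ph x) * indicator D x \<partial>lborel)"
   using C1(1) C2(1) C3 by (simp add: ennreal_mult mult_ac)
 qed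
qed

end

section \<open>From local charts to the global trace inequality\<close>

lemma flat_chart_exists:
 fixes D :: "(real^3) set"
 assumes sb: "smooth_boundary D" and x0: "x0 : frontier D"
 obtains U V f g z0 de where "flat_chart D U V f g z0 de" "x0 : flat_chart.h g ` flat_chart.V2 z0 de"
proof -
 obtain U V f g a where U: "x0 : U" "smooth_diffeo f g U V" "a ~= 0"
   and im: "f ` (D \<inter> U) = {y:V. 0 < a \<bullet> y}" and imf: "f ` (frontier D \<inter> U) = {y:V. a \<bullet> y = 0}"
  using sb[unfolded smooth_boundary_def, THEN bspec, OF x0] by blast
 have o: "open U" "open V" and hom: "homeomorphism U V f g" and s: "smooth_on f U" "smooth_on g V"
  using U(2) by (auto simp: smooth_diffeo_def)
 have "norm (axis 3 1 :: real^3) = norm (a /\<^sub>R norm a)" using U(3) by simp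
 \<comment> \<open>Boundary charts flatten onto an arbitrary plane through the origin; a rotation
   carrying the third axis to the normal direction \<open>a\<close> reduces this to
   \<open>z $ 3 = 0\<close>.\<close>
 then obtain Q :: "real^3 => real^3" where Q: "orthogonal_transformation Q" "Q (axis 3 1) = a /\<^sub>R norm a"
  by (rule orthogonal_transformation_exists)
 have Qb: "bij Q" and Ql: "linear Q" using Q(1) by (simp_all add: orthogonal_transformation_bij orthogonal_transformation_linear)
 have Rl: "linear (inv Q)" using orthogonal_transformation_inv[OF Q(1)] by (rule orthogonal_transformation_linear)
 have QR: "Q (inv Q y) = y" "inv Q (Q y) = y" for y
  using Qb by (simp_all add: bij_is_surj surj_f_inv_f bij_is_inj inv_f_f)
 have bl: "bounded_linear Q" "bounded_linear (inv Q)" using Ql Rl by (simp_all add: linear_conv_bounded_linear)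
 have aQ: "a \<bullet> Q z = norm a * z $ 3" for z
 proof -
  have "a = norm a *\<^sub>R Q (axis 3 1)" using Q(2) U(3) by simp
  then have "a \<bullet> Q z = norm a * (Q (axis 3 1) \<bullet> Q z)" by (metis inner_scaleR_left)
  also have "Q (axis 3 1) \<bullet> Q z = axis 3 1 \<bullet> z" using Q(1) by (simp add: orthogonal_transformation_def)
  finally show ?thesis by (simp add: inner_axis')
 qed
 define V' where "V' = Q -` V"
 define f' where "f' x = inv Q (f x)" for x
 define g' where "g' z = g (Q z)" for z
 have oV': "open V'" unfolding V'_def
  by (intro open_vimage o bounded_linear.continuous_on[OF bl(1)] continuous_on_id)
 have sf: "smooth_on f' U" unfolding f'_def[abs_def]
  by (rule smooth_on_compose[OF o(1) open_UNIV smooth_on_linear[OF bl(2) open_UNIV] s(1)]) auto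
 have sg: "smooth_on g' V'" unfolding g'_def[abs_def]
  by (rule smooth_on_compose[OF oV' o(2) s(2) smooth_on_linear[OF bl(1) oV']]) (auto simp: V'_def)
 have hm: "homeomorphism U V' f' g'"
  by (intro homeomorphismI smooth_on_continuous sf sg)
   (use hom in \<open>auto simp: homeomorphism_def f'_def g'_def V'_def QR\<close>)
 have d: "smooth_diffeo f' g' U V'" using o oV' hm sf sg by (simp add: smooth_diffeo_def)
 have na: "norm a > 0" using U(3) by simp
 have img: "f' ` S = {z : V'. P (z $ 3)}" if "f ` S = {y : V. P' (a \<bullet> y)}" "!!t. P' (norm a * t) = P t" for S P P'
 proof -
  have "f' ` S = inv Q ` {y : V. P' (a \<bullet> y)}" unfolding f'_def that(1)[symmetric] by (simp add: image_image)
  also have "... = {z : V'. P (z $ 3)}"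
  proof (intro set_eqI iffI)
   fix z assume "z : inv Q ` {y : V. P' (a \<bullet> y)}"
   then obtain y where y: "y : V" "P' (a \<bullet> y)" "z = inv Q y" by auto
   then have "Q z = y" using QR by simp
   then show "z : {z : V'. P (z $ 3)}" using y(1,2) aQ[of z] that(2) by (auto simp: V'_def)
  next
   fix z assume z: "z : {z : V'. P (z $ 3)}"
   then have "Q z : {y : V. P' (a \<bullet> y)}" using aQ[of z] that(2) by (auto simp: V'_def)
   then show "z : inv Q ` {y : V. P' (a \<bullet> y)}" by (rule rev_image_eqI) (simp add: QR)
  qed
  finally show ?thesis .
 qed
 have i1: "f' ` (D \<inter> U) = {z : V'. 0 < z $ 3}"
 proof (rule img[where P' = "%t. 0 < t", OF im])
  show "(0 < norm a * t) = (0 < t)" for t using na by (simp add: zero_less_mult_iff)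
 qed
 have i2: "f' ` (frontier D \<inter> U) = {z : V'. z $ 3 = 0}"
 proof (rule img[where P' = "%t. t = 0", OF imf])
  show "(norm a * t = 0) = (t = 0)" for t using na by simp
 qed
 have z0: "f' x0 : V'" "f' x0 $ 3 = 0"
  using i2 x0 U(1) by auto
 obtain e where e: "e > 0" "cball (f' x0) e \<subseteq> V'" using oV' z0(1) open_contains_cball by blast
 \<comment> \<open>Half the radius, because the locale asks for a ball of radius
   \<open>2 * de\<close> inside the chart.\<close>
 have fc: "flat_chart D U V' f' g' (f' x0) (e / 2)"
  by unfold_locales (use d i1 i2 e z0 in auto)
 interpret flat_chart D U V' f' g' "f' x0" "e / 2" by (rule fc)
 have "k x0 : V2" using e(1) by (simp add: k_def V2_def)
 then have "x0 : h ` V2" unfolding h_image using x0 U(1) by simp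
 then show ?thesis using fc that by blast
qed

text \<open>The frontier is compact, so finitely many patches cover it, and their constants are
  added.\<close>

lemma trace_inequality_nn:
 fixes D :: "(real^3) set"
 assumes sb: "smooth_boundary D" and D: "D : sets borel" "bounded D" and si: "is_surface_measure (frontier D) si"
 obtains C where "0 <= C" "!!ph. smooth_on ph UNIV ==>
  (\<integral>\<^sup>+x. ennreal ((ph x)\<^sup>2) * indicator (frontier D) x \<partial>si) <= ennreal C * (\<integral>\<^sup>+x. ennreal (H1_density ph x) * indicator D x \<partial>lborel)"
proof -
 have sets[measurable_cong]: "sets si = sets borel" using si by (simp add: is_surface_measure_def)
 let ?I = "%ph. \<integral>\<^sup>+x. ennreal (H1_density ph x) * indicator D x \<partial>lborel"
 define Q where "Q x0 O' C \<longleftrightarrow> open O' & x0 : O' & 0 <= C & (ALL ph. smooth_on ph UNIV -->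
   (\<integral>\<^sup>+x. ennreal ((ph x)\<^sup>2) * indicator (frontier D \<inter> O') x \<partial>si) <= ennreal C * ?I ph)" for x0 O' C
 have Q: "EX O' C. Q x0 O' C" if x0: "x0 : frontier D" for x0
 proof -
  obtain U V f g z0 de where fc: "flat_chart D U V f g z0 de" "x0 : flat_chart.h g ` flat_chart.V2 z0 de"
   using flat_chart_exists[OF sb x0] by blast
  interpret flat_chart D U V f g z0 de by (rule fc)
  obtain C where C: "0 <= C" "!!ph. smooth_on ph UNIV ==>
    (\<integral>\<^sup>+x. ennreal ((ph x)\<^sup>2) * indicator (h ` V2) x \<partial>si) <= ennreal C * ?I ph"
   using local_trace_inequality[OF si D(1)] by blast
  obtain O' where O': "open O'" "h ` V2 = frontier D \<inter> O'" using openin_h by (auto simp: openin_open)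
  show ?thesis using C O' fc(2) by (intro exI[of _ O'] exI[of _ C]) (auto simp: Q_def)
 qed
 from Q have "ALL x0:frontier D. EX O' C. Q x0 O' C" by blast
 from bchoice[OF this] obtain O' where "ALL x0:frontier D. EX C. Q x0 (O' x0) C" by blast
 from bchoice[OF this] obtain C where OCQ: "ALL x0:frontier D. Q x0 (O' x0) (C x0)" by blast
 then have OC: "!!x0. x0 : frontier D ==> open (O' x0)" "!!x0. x0 : frontier D ==> x0 : O' x0"
   "!!x0. x0 : frontier D ==> 0 <= C x0" "!!x0 ph. x0 : frontier D ==> smooth_on ph UNIV ==>
   (\<integral>\<^sup>+x. ennreal ((ph x)\<^sup>2) * indicator (frontier D \<inter> O' x0) x \<partial>si) <= ennreal (C x0) * ?I ph"
  unfolding Q_def by blast+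
 have "compact (frontier D)" using D(2) by (simp add: compact_frontier_bounded)
 moreover have "frontier D \<subseteq> (\<Union>x0\<in>frontier D. O' x0)" using OC(2) by blast
 ultimately obtain J where J: "J \<subseteq> frontier D" "finite J" "frontier D \<subseteq> (\<Union>x0\<in>J. O' x0)"
  using compactE_image[of "frontier D" "frontier D" O'] OC(1) by blast
 show ?thesis
 proof (rule that[of "\<Sum>x0\<in>J. C x0"])
  show "0 <= (\<Sum>x0\<in>J. C x0)" using OC(3) J(1) by (intro sum_nonneg) auto
  fix ph :: "real^3 => real" assume ph: "smooth_on ph UNIV"
  have [measurable]: "ph : borel_measurable borel" by (rule smooth_measurable[OF ph])
  have mO: "frontier D \<inter> O' x0 : sets borel" if "x0 : J" for x0
   using OC(1) J(1) that by (intro sets.Int borel_closed borel_open) auto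
  have "(\<integral>\<^sup>+x. ennreal ((ph x)\<^sup>2) * indicator (frontier D) x \<partial>si)
    <= (\<integral>\<^sup>+x. (\<Sum>x0\<in>J. ennreal ((ph x)\<^sup>2) * indicator (frontier D \<inter> O' x0) x) \<partial>si)"
  proof (rule nn_integral_mono)
   fix x
   show "ennreal ((ph x)\<^sup>2) * indicator (frontier D) x <= (\<Sum>x0\<in>J. ennreal ((ph x)\<^sup>2) * indicator (frontier D \<inter> O' x0) x)"
   proof (cases "x : frontier D")
    case True
    then obtain x0 where x0: "x0 : J" "x : O' x0" using J(3) by blast
    have "ennreal ((ph x)\<^sup>2) * indicator (frontier D \<inter> O' x0) x <= (\<Sum>x0\<in>J. ennreal ((ph x)\<^sup>2) * indicator (frontier D \<inter> O' x0) x)"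
     by (rule member_le_sum[OF x0(1)]) (use J(2) in auto)
    then show ?thesis using True x0(2) by simp
   qed simp
  qed
  also have "... = (\<Sum>x0\<in>J. \<integral>\<^sup>+x. ennreal ((ph x)\<^sup>2) * indicator (frontier D \<inter> O' x0) x \<partial>si)"
   using mO by (intro nn_integral_sum) (auto intro!: borel_measurable_times_ennreal borel_measurable_indicator simp: sets)
  also have "... <= (\<Sum>x0\<in>J. ennreal (C x0) * ?I ph)"
   using OC(4) J(1) ph by (intro sum_mono) auto
  also have "... = (\<Sum>x0\<in>J. ennreal (C x0)) * ?I ph" by (simp add: sum_distrib_right)
  also have "(\<Sum>x0\<in>J. ennreal (C x0)) = ennreal (\<Sum>x0\<in>J. C x0)" using OC(3) J(1) by (intro sum_ennreal) auto
  finally show "(\<integral>\<^sup>+x. ennreal ((ph x)\<^sup>2) * indicator (frontier D) x \<partial>si) <= ennreal (\<Sum>x0\<in>J. C x0) * ?I ph" .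
 qed
qed

text \<open>On smooth functions weak derivatives are classical ones, so the volume side of the trace
  inequality is the squared \<open>H1_norm\<close>.\<close>

lemma nn_integral_H1_density:
 assumes ph: "smooth_on ph UNIV" and U: "open U" "bounded U"
 shows "(\<integral>\<^sup>+x. ennreal (H1_density ph x) * indicator U x \<partial>lborel) = ennreal ((H1_norm U ph)\<^sup>2)"
proof -
 have Ub: "U : sets borel" using U by auto
 have L: "ph : Lq_space 2 (leb U)" by (rule smooth_L2_leb[OF ph U(2) Ub])
 have LD: "(%x. Fd ph (at x) b) : Lq_space 2 (leb U)" for b
  by (rule smooth_L2_leb[OF smooth_on_frechet[OF ph open_UNIV] U(2) Ub])
 have "(\<integral>\<^sup>+x. ennreal (H1_density ph x) * indicator U x \<partial>lborel) = (\<integral>\<^sup>+x. ennreal (H1_density ph x) \<partial>leb U)"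
  by (rule nn_integral_leb[OF Ub, symmetric])
 also have "... = ennreal (\<integral>x. H1_density ph x \<partial>leb U)"
  by (rule nn_integral_eq_integral)
   (use L LD in \<open>auto simp: H1_density_def Lq_space_2 sum_nonneg intro!: Bochner_Integration.integrable_add Bochner_Integration.integrable_sum\<close>)
 also have "(\<integral>x. H1_density ph x \<partial>leb U) = (L2_norm (leb U) ph)\<^sup>2 + (\<Sum>b\<in>Basis. (L2_norm (leb U) (%x. Fd ph (at x) b))\<^sup>2)"
  unfolding H1_density_def L2_norm_power2
  using L2_integrable_square[OF L] L2_integrable_square[OF LD] by simp
 also have "... = (H1_norm U ph)\<^sup>2"
  unfolding H1_norm_power2 using L2_norm_weak_pd[OF U(1) has_weak_pd_smooth_bounded[OF ph U(2) Ub]] by simp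
 finally show ?thesis .
qed

section \<open>Traces\<close>

lemma structural_acousticD:
 assumes "structural_acoustic G"
 shows "open (Om G)" "bounded (Om G)" "smooth_boundary (Om G)" "is_surface_measure (frontier (Om G)) (surf G)"
  "Om G : sets borel" "openin (top_of_set (frontier (Om G))) (Gam G)" "plane_chart (chart G)" "Gam G \<subseteq> range (chart G)"
 using assms unfolding structural_acoustic_def by auto

lemma H1_norm_minus_commute:
 assumes "open U" "u : H1 U" "v : H1 U"
 shows "H1_norm U (%x. u x - v x) = H1_norm U (%x. v x - u x)"
proof -
 have "L2_norm (leb U) (weak_pd U b (%x. u x - v x)) = L2_norm (leb U) (weak_pd U b (%x. v x - u x))" if "b : Basis" for b
  unfolding L2_norm_weak_pd_triangle[OF assms that] L2_norm_weak_pd_triangle[OF assms(1,3,2) that]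
  by (rule L2_norm_minus_commute)
 then have "(H1_norm U (%x. u x - v x))\<^sup>2 = (H1_norm U (%x. v x - u x))\<^sup>2"
  unfolding H1_norm_power2 by (simp add: L2_norm_minus_commute[of "leb U" u v])
 then show ?thesis by (simp add: H1_norm_nonneg)
qed

abbreviation bdry_measure :: "acoustic_geometry => (real^3) measure" where
 "bdry_measure G \<equiv> restrict_space (surf G) (frontier (Om G))"

lemma sets_surf: "structural_acoustic G ==> sets (surf G) = sets borel"
 using structural_acousticD(4) by (simp add: is_surface_measure_def)

lemma smooth_measurable_bdry:
 "structural_acoustic G ==> smooth_on (f :: real^3 => real) UNIV ==> f : borel_measurable (bdry_measure G)"
 using smooth_measurable[of f] sets_surf[of G]
 by (intro measurable_restrict_space1) (simp add: measurable_cong_sets[of "surf G" borel])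

lemma trace_inequality:
 assumes G: "structural_acoustic G"
 obtains C where "0 <= C" "!!ph. smooth_on ph UNIV ==> ph : Lq_space 2 (bdry_measure G) &
  L2_norm (bdry_measure G) ph <= C * H1_norm (Om G) ph"
proof -
 note g = structural_acousticD[OF G]
 obtain C where C: "0 <= C" "!!ph. smooth_on ph UNIV ==>
   (\<integral>\<^sup>+x. ennreal ((ph x)\<^sup>2) * indicator (frontier (Om G)) x \<partial>surf G)
   <= ennreal C * (\<integral>\<^sup>+x. ennreal (H1_density ph x) * indicator (Om G) x \<partial>lborel)"
  using trace_inequality_nn[OF g(3,5,2,4)] by blast
 have fr: "frontier (Om G) : sets (surf G)" using sets_surf[OF G] by simp
 show ?thesis
 proof (rule that[of "sqrt C"])
  show "0 <= sqrt C" using C(1) by simp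
  fix ph :: "real^3 => real" assume ph: "smooth_on ph UNIV"
  have "(\<integral>\<^sup>+x. ennreal ((ph x)\<^sup>2) \<partial>bdry_measure G) = (\<integral>\<^sup>+x. ennreal ((ph x)\<^sup>2) * indicator (frontier (Om G)) x \<partial>surf G)"
   using fr by (intro nn_integral_restrict_space) (simp add: sets.Int)
  also have "... <= ennreal C * ennreal ((H1_norm (Om G) ph)\<^sup>2)"
   using C(2)[OF ph] unfolding nn_integral_H1_density[OF ph g(1,2)] .
  also have "... = ennreal ((sqrt C * H1_norm (Om G) ph)\<^sup>2)"
   using C(1) by (simp add: ennreal_mult[symmetric] power_mult_distrib)
  finally have "(\<integral>\<^sup>+x. ennreal ((ph x)\<^sup>2) \<partial>bdry_measure G) <= ennreal ((sqrt C * H1_norm (Om G) ph)\<^sup>2)" .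
  from L2_norm_le_nn_integral[OF smooth_measurable_bdry[OF G ph] this]
  show "ph : Lq_space 2 (bdry_measure G) & L2_norm (bdry_measure G) ph <= sqrt C * H1_norm (Om G) ph"
   using C(1) by (simp add: H1_norm_nonneg)
 qed
qed

text \<open>By the trace inequality, smooth approximations that converge in \<open>H1\<close> have
  Cauchy restrictions to the boundary; completeness supplies the limit.\<close>

lemma has_trace_exists:
 assumes G: "structural_acoustic G" and u: "u : H1 (Om G)"
 shows "EX g. has_trace G u g"
proof -
 note g = structural_acousticD[OF G]
 have "ALL n. EX ph. smooth_on ph UNIV & H1_norm (Om G) (%x. u x - ph x) < inverse (real (Suc n))"
 proof
  fix n
  have "inverse (real (Suc n)) > 0" by simp
  from smooth_dense_H1_smooth_boundary[OF g(1,2,3) u this]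
  show "EX ph. smooth_on ph UNIV & H1_norm (Om G) (%x. u x - ph x) < inverse (real (Suc n))" by blast
 qed
 then obtain ph where ph: "!!n. smooth_on (ph n) UNIV" "!!n. H1_norm (Om G) (%x. u x - ph n x) < inverse (real (Suc n))"
  by metis
 have phH: "ph n : H1 (Om G)" for n by (rule smooth_H1[OF ph(1) g(2,5)])
 have lim: "(%n. H1_norm (Om G) (%x. u x - ph n x)) \<longlonglongrightarrow> 0"
  by (rule Lim_null_comparison[OF always_eventually LIMSEQ_inverse_real_of_nat])
   (use ph(2) in \<open>auto simp: H1_norm_nonneg intro: less_imp_le\<close>)
 obtain C where C: "0 <= C" "!!ph. smooth_on ph UNIV ==> ph : Lq_space 2 (bdry_measure G) &
   L2_norm (bdry_measure G) ph <= C * H1_norm (Om G) ph"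
  using trace_inequality[OF G] by blast
 \<comment> \<open>The summand \<open>1\<close> makes \<open>K\<close> positive and the final
   estimate strict.\<close>
 define K where "K = C * real (1 + DIM(real^3)) * 2 + 1"
 have K: "K > 0" unfolding K_def using C(1) by (intro add_nonneg_pos mult_nonneg_nonneg) auto
 have est: "L2_norm (bdry_measure G) (%x. ph m x - ph n x) < e"
  if e: "e > 0" and N: "!!n. n >= N ==> H1_norm (Om G) (%x. u x - ph n x) < e / K" and mn: "m >= N" "n >= N" for e N m n
 proof -
  have "L2_norm (bdry_measure G) (%x. ph m x - ph n x) <= C * H1_norm (Om G) (%x. ph m x - ph n x)"
   using C(2)[OF smooth_on_diff[OF open_UNIV ph(1) ph(1)]] by blast
  also have "... <= C * (real (1 + DIM(real^3)) * (H1_norm (Om G) (%x. ph m x - u x) + H1_norm (Om G) (%x. u x - ph n x)))"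
   by (intro mult_left_mono H1_norm_triangle g phH u C)
  also have "... <= C * (real (1 + DIM(real^3)) * (e / K + e / K))"
   using N[OF mn(1)] N[OF mn(2)] C(1) unfolding H1_norm_minus_commute[OF g(1) phH u]
   by (intro mult_left_mono add_mono) auto
  also have "... = (K - 1) * (e / K)" by (simp add: K_def)
  also have "... < K * (e / K)" using e K by (intro mult_strict_right_mono) auto
  finally show ?thesis using K by simp
 qed
 have cauchy: "EX N. ALL m>=N. ALL n>=N. L2_norm (bdry_measure G) (%x. ph m x - ph n x) < e" if e: "e > 0" for e
 proof -
  have "e / K > 0" using e K by simp
  then have "\<forall>\<^sub>F n in sequentially. H1_norm (Om G) (%x. u x - ph n x) < e / K" by (rule order_tendstoD(2)[OF lim])
  then obtain N where "!!n. n >= N ==> H1_norm (Om G) (%x. u x - ph n x) < e / K" unfolding eventually_sequentially by blast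
  from est[OF e this] show ?thesis by blast
 qed
 have phL: "ph n : Lq_space 2 (bdry_measure G)" for n using C(2)[OF ph(1)] by blast
 obtain h where "h : Lq_space 2 (bdry_measure G)" "(%n. L2_norm (bdry_measure G) (%x. ph n x - h x)) \<longlonglongrightarrow> 0"
  using L2_complete[OF phL cauchy] by blast
 then show ?thesis unfolding has_trace_def using ph(1) lim by blast
qed

text \<open>The trace inequality for differences of approximating smooth functions, passed to the
  limit. The dimension factor \<open>d\<close> enters twice because the triangle inequality is
  applied twice. Admitting arbitrary \<open>g\<close> and \<open>h\<close> makes the result
  independent of the representative chosen by \<open>bdry_trace\<close>.\<close>

lemma has_trace_lipschitz:
 assumes G: "structural_acoustic G"
 obtains K where "0 <= K" "!!u v g h. u : H1 (Om G) ==> v : H1 (Om G) ==> has_trace G u g ==> has_trace G v h ==>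
  L2_norm (bdry_measure G) (%x. g x - h x) <= K * H1_norm (Om G) (%x. u x - v x)"
proof -
 note ga = structural_acousticD[OF G]
 obtain C where C: "0 <= C" "!!ph. smooth_on ph UNIV ==> ph : Lq_space 2 (bdry_measure G) &
   L2_norm (bdry_measure G) ph <= C * H1_norm (Om G) ph"
  using trace_inequality[OF G] by blast
 define d where "d = real (1 + DIM(real^3))"
 have d0: "0 <= d" by (simp add: d_def)
 show ?thesis
 proof (rule that[of "C * d * d"])
  show "0 <= C * d * d" using C(1) d0 by simp
  fix u v g h assume u: "u : H1 (Om G)" and v: "v : H1 (Om G)" and tg: "has_trace G u g" and th: "has_trace G v h"
  let ?B = "bdry_measure G" and ?N = "H1_norm (Om G)"
  obtain ph where ph: "!!n::nat. smooth_on (ph n) UNIV" "(%n. ?N (%x. u x - ph n x)) \<longlonglongrightarrow> 0"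
    "(%n. L2_norm ?B (%x. ph n x - g x)) \<longlonglongrightarrow> 0" using tg unfolding has_trace_def by blast
  obtain ps where ps: "!!n::nat. smooth_on (ps n) UNIV" "(%n. ?N (%x. v x - ps n x)) \<longlonglongrightarrow> 0"
    "(%n. L2_norm ?B (%x. ps n x - h x)) \<longlonglongrightarrow> 0" using th unfolding has_trace_def by blast
  have gL: "g : Lq_space 2 ?B" "h : Lq_space 2 ?B" using tg th by (auto simp: has_trace_def)
  have L: "ph n : Lq_space 2 ?B" "ps n : Lq_space 2 ?B" for n using C(2) ph(1) ps(1) by blast+
  have H: "ph n : H1 (Om G)" "ps n : H1 (Om G)" for n using smooth_H1 ga(2,5) ph(1) ps(1) by blast+
  have le: "L2_norm ?B (%x. g x - h x) <= L2_norm ?B (%x. ph n x - g x)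
    + C * (d * (?N (%x. u x - ph n x) + d * (?N (%x. u x - v x) + ?N (%x. v x - ps n x)))) + L2_norm ?B (%x. ps n x - h x)" for n
  proof -
   have "L2_norm ?B (%x. g x - h x) <= L2_norm ?B (%x. g x - ph n x) + (L2_norm ?B (%x. ph n x - ps n x) + L2_norm ?B (%x. ps n x - h x))"
    using L2_norm_triangle_diff[OF gL(1) L(1)[of n] gL(2)] L2_norm_triangle_diff[OF L(1)[of n] L(2)[of n] gL(2)] by linarith
   moreover have "L2_norm ?B (%x. ph n x - ps n x) <= C * ?N (%x. ph n x - ps n x)"
    using C(2)[OF smooth_on_diff[OF open_UNIV ph(1) ps(1)]] by blast
   moreover have "C * ?N (%x. ph n x - ps n x) <= C * (d * (?N (%x. u x - ph n x) + d * (?N (%x. u x - v x) + ?N (%x. v x - ps n x))))"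
   proof (intro mult_left_mono C(1))
    have "?N (%x. ph n x - ps n x) <= d * (?N (%x. ph n x - u x) + ?N (%x. u x - ps n x))"
     unfolding d_def by (intro H1_norm_triangle ga H u)
    also have "... <= d * (?N (%x. u x - ph n x) + d * (?N (%x. u x - v x) + ?N (%x. v x - ps n x)))"
     unfolding H1_norm_minus_commute[OF ga(1) H(1) u]
     by (intro mult_left_mono add_left_mono d0) (unfold d_def, intro H1_norm_triangle ga H u v)
    finally show "?N (%x. ph n x - ps n x) <= d * (?N (%x. u x - ph n x) + d * (?N (%x. u x - v x) + ?N (%x. v x - ps n x)))" .
   qed
   ultimately show ?thesis using L2_norm_minus_commute[of ?B g "ph n"] by linarith
  qed
  have "(%n. L2_norm ?B (%x. ph n x - g x)
    + C * (d * (?N (%x. u x - ph n x) + d * (?N (%x. u x - v x) + ?N (%x. v x - ps n x)))) + L2_norm ?B (%x. ps n x - h x))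
    \<longlonglongrightarrow> 0 + C * (d * (0 + d * (?N (%x. u x - v x) + 0))) + 0"
   by (intro tendsto_intros ph ps)
  from tendsto_lowerbound[OF this always_eventually] le
  have "L2_norm ?B (%x. g x - h x) <= 0 + C * (d * (0 + d * (?N (%x. u x - v x) + 0))) + 0" by auto
  then show "L2_norm ?B (%x. g x - h x) <= C * d * d * ?N (%x. u x - v x)" by (simp add: mult.assoc)
 qed
qed

lemma bdry_trace_lipschitz:
 assumes G: "structural_acoustic G"
 obtains K where "0 <= K" "!!u v. u : H1 (Om G) ==> v : H1 (Om G) ==>
  L2_norm (bdry_measure G) (%x. bdry_trace G u x - bdry_trace G v x) <= K * H1_norm (Om G) (%x. u x - v x)"
  "!!u. u : H1 (Om G) ==> bdry_trace G u : Lq_space 2 (bdry_measure G)"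
proof -
 have ht: "has_trace G u (bdry_trace G u)" if "u : H1 (Om G)" for u
  unfolding bdry_trace_def by (rule someI_ex[OF has_trace_exists[OF G that]])
 obtain K where K: "0 <= K" "!!u v g h. u : H1 (Om G) ==> v : H1 (Om G) ==> has_trace G u g ==> has_trace G v h ==>
   L2_norm (bdry_measure G) (%x. g x - h x) <= K * H1_norm (Om G) (%x. u x - v x)"
  using has_trace_lipschitz[OF G] by blast
 show ?thesis
 proof (rule that[OF K(1)])
  show "L2_norm (bdry_measure G) (%x. bdry_trace G u x - bdry_trace G v x) <= K * H1_norm (Om G) (%x. u x - v x)"
   if "u : H1 (Om G)" "v : H1 (Om G)" for u v by (rule K(2)[OF that ht[OF that(1)] ht[OF that(2)]])
  show "bdry_trace G u : Lq_space 2 (bdry_measure G)" if "u : H1 (Om G)" for u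
   using ht[OF that] by (simp add: has_trace_def)
 qed
qed

lemma Gam_borel: "structural_acoustic G ==> Gam G : sets borel"
 using structural_acousticD(6)[of G] by (auto simp: openin_open)

lemma L2_mGam:
 assumes G: "structural_acoustic G" and f: "f : Lq_space 2 (bdry_measure G)"
 shows "f : Lq_space 2 (mGam G)" "L2_norm (mGam G) f <= L2_norm (bdry_measure G) f"
proof -
 have sub: "Gam G \<subseteq> frontier (Om G)" using structural_acousticD(6)[OF G] by (auto simp: openin_open)
 have Gb: "Gam G : sets (surf G)" and Fb: "frontier (Om G) : sets (surf G)" using Gam_borel[OF G] sets_surf[OF G] by auto
 have fm: "(%x. f x * indicator (frontier (Om G)) x) : borel_measurable (surf G)"
  using L2_measurable[OF f] Fb by (subst (asm) borel_measurable_restrict_space_iff) (auto simp: mult.commute sets.Int)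
 have "(%x. indicator (Gam G) x *\<^sub>R f x) = (%x. indicator (Gam G) x * (f x * indicator (frontier (Om G)) x))"
  using sub by (auto simp: indicator_def fun_eq_iff)
 then have fG: "f : borel_measurable (mGam G)"
  unfolding mGam_def using fm Gb by (subst borel_measurable_restrict_space_iff) (auto simp: sets.Int)
 have "(\<integral>\<^sup>+x. ennreal ((f x)\<^sup>2) \<partial>mGam G) = (\<integral>\<^sup>+x. ennreal ((f x)\<^sup>2) * indicator (Gam G) x \<partial>surf G)"
  unfolding mGam_def using Gb by (intro nn_integral_restrict_space) (auto simp: sets.Int)
 also have "... <= (\<integral>\<^sup>+x. ennreal ((f x)\<^sup>2) * indicator (frontier (Om G)) x \<partial>surf G)"
  using sub by (intro nn_integral_mono) (auto simp: indicator_def)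
 also have "... = (\<integral>\<^sup>+x. ennreal ((f x)\<^sup>2) \<partial>bdry_measure G)"
  using Fb by (intro nn_integral_restrict_space[symmetric]) (auto simp: sets.Int)
 also have "... = ennreal ((L2_norm (bdry_measure G) f)\<^sup>2)" by (rule nn_integral_square_L2[OF f])
 finally have le: "(\<integral>\<^sup>+x. ennreal ((f x)\<^sup>2) \<partial>mGam G) <= ennreal ((L2_norm (bdry_measure G) f)\<^sup>2)" .
 show "f : Lq_space 2 (mGam G)" "L2_norm (mGam G) f <= L2_norm (bdry_measure G) f"
  by (rule L2_norm_le_nn_integral[OF fG le L2_norm_nonneg])+
qed

section \<open>The flat part of the boundary\<close>

definition chart_dom :: "acoustic_geometry => (real^2) set" where
 "chart_dom G = chart G -` Gam G"

text \<open>Planar coordinates of the orthogonal projection give a continuous left inverse on all of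
  space, and orthonormality gives area factor one.\<close>

lemma plane_chart_props:
 assumes "plane_chart e"
 obtains p where "!!y. p (e y) = y" "continuous_on UNIV p" "smooth_on e UNIV"
  "!!y. norm (cross3 (Fd e (at y) (axis 1 1)) (Fd e (at y) (axis 2 1))) = 1"
proof -
 obtain a b c where abc: "norm b = 1" "norm c = 1" "b \<bullet> c = 0" and e: "e = (%y. a + (y $ 1) *\<^sub>R b + (y $ 2) *\<^sub>R c)"
  using assms unfolding plane_chart_def by blast
 define p :: "real^3 => real^2" where "p x = vector [(x - a) \<bullet> b, (x - a) \<bullet> c]" for x
 have bb: "b \<bullet> b = 1" "c \<bullet> c = 1" using abc by (simp_all add: norm_eq_sqrt_inner)
 have pe: "p (e y) = y" for y
  using bb abc(3) by (simp add: p_def e vec_eq_iff forall_2 inner_add_left inner_commute[of c b])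
 have cp: "continuous_on UNIV p"
 proof -
  have "p = (%x. ((x - a) \<bullet> b) *\<^sub>R axis 1 1 + ((x - a) \<bullet> c) *\<^sub>R axis 2 1)"
   by (auto simp: p_def vec_eq_iff forall_2 axis_def)
  then show ?thesis by (simp only:) (intro continuous_intros)
 qed
 have d: "(e has_derivative (%v. (v $ 1) *\<^sub>R b + (v $ 2) *\<^sub>R c)) (at y)" for y
 proof -
  have l: "linear (%v :: real^2. (v $ 1) *\<^sub>R b + (v $ 2) *\<^sub>R c)"
   by (rule linearI) (simp_all add: algebra_simps)
  then have "bounded_linear (%v :: real^2. (v $ 1) *\<^sub>R b + (v $ 2) *\<^sub>R c)" by (simp add: linear_conv_bounded_linear)
  from has_derivative_add[OF has_derivative_const[of a] bounded_linear_imp_has_derivative[OF this]]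
  show ?thesis by (simp add: e add.assoc)
 qed
 have s: "smooth_on e UNIV"
  by (rule smooth_onI_deriv[OF open_UNIV d]) (rule smooth_on_const[OF open_UNIV])
 have fd: "Fd e (at y) v = (v $ 1) *\<^sub>R b + (v $ 2) *\<^sub>R c" for y v
  by (simp add: frechet_derivative_at[OF d[of y], symmetric])
 have "(norm (cross3 b c))\<^sup>2 = 1" using norm_cross[of b c] abc by simp
 then have n: "norm (cross3 b c) = 1" using norm_ge_zero[of "cross3 b c"] by (auto simp: power2_eq_1_iff)
 show ?thesis
 proof (rule that[OF pe cp s])
  show "norm (cross3 (Fd e (at y) (axis 1 1)) (Fd e (at y) (axis 2 1))) = 1" for y
   unfolding fd by (simp add: axis_def n)
 qed
qed

text \<open>\<open>Gam G\<close> is open only relative to the curved frontier. A local boundary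
  parametrisation followed by planar coordinates is continuous and injective between open plane
  sets, so invariance of domain turns relative openness into openness in the plane.\<close>

lemma open_chart_dom:
 assumes G: "structural_acoustic G"
 shows "open (chart_dom G)"
proof (subst open_subopen, intro ballI)
 note ga = structural_acousticD[OF G]
 obtain p where p: "!!y. p (chart G y) = y" "continuous_on UNIV p" using plane_chart_props[OF ga(7)] by metis
 obtain N where N: "open N" "Gam G = frontier (Om G) \<inter> N" using ga(6) by (auto simp: openin_open)
 fix y assume "y : chart_dom G"
 then have x: "chart G y : Gam G" by (simp add: chart_dom_def)
 then have xf: "chart G y : frontier (Om G)" using N by auto
 obtain U V f g z0 de where fc: "flat_chart (Om G) U V f g z0 de" "chart G y : flat_chart.h g ` flat_chart.V2 z0 de"
  using flat_chart_exists[OF ga(3) xf] by blast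
 interpret flat_chart "Om G" U V f g z0 de by (rule fc)
 define S where "S = V2 \<inter> h -` N"
 have ch: "continuous_on V2 h" by (rule smooth_on_continuous[OF smooth_h])
 have S: "open S" unfolding S_def by (rule continuous_open_preimage[OF ch open_V2 N(1)])
 have hG: "h s : Gam G" if "s : S" for s
  using that h_image N(2) by (auto simp: S_def)
 have rg: "chart G (p (h s)) = h s" if "s : S" for s
  using ga(8) hG[OF that] p(1) by auto
 have op: "open ((%s. p (h s)) ` S)"
 proof (rule invariance_of_domain[OF _ S])
  show "continuous_on S (%s. p (h s))"
   by (rule continuous_on_compose2[OF p(2) continuous_on_subset[OF ch]]) (auto simp: S_def)
  show "inj_on (%s. p (h s)) S"
  proof (rule inj_onI)
   fix s t assume st: "s : S" "t : S" "p (h s) = p (h t)"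
   then have "h s = h t" using rg by metis
   then show "s = t" using kh st(1,2) unfolding S_def by (metis IntD1)
  qed
 qed
 obtain s where s: "s : V2" "chart G y = h s" using fc(2) by auto
 have sS: "s : S" using s x N(2) by (auto simp: S_def)
 have "y = p (h s)" using p(1) s(2) by metis
 then have "y : (%s. p (h s)) ` S" using sS by blast
 moreover have "(%s. p (h s)) ` S \<subseteq> chart_dom G" using rg hG by (auto simp: chart_dom_def)
 ultimately show "EX T. open T & y : T & T \<subseteq> chart_dom G" using op by blast
qed

text \<open>The plane chart is itself an admissible parametrisation of an open piece of the
  frontier, and its area density is one.\<close>

lemma mGam_distr:
 assumes G: "structural_acoustic G"
 shows "chart G : leb (chart_dom G) \<rightarrow>\<^sub>M mGam G" "distr (leb (chart_dom G)) (mGam G) (chart G) = mGam G"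
proof -
 note ga = structural_acousticD[OF G]
 let ?V = "chart_dom G" and ?e = "chart G"
 obtain p where p: "!!y. p (?e y) = y" "continuous_on UNIV p" "smooth_on ?e UNIV"
  "!!y. norm (cross3 (Fd ?e (at y) (axis 1 1)) (Fd ?e (at y) (axis 2 1))) = 1"
  using plane_chart_props[OF ga(7)] by blast
 have nz: "cross3 (Fd ?e (at y) (axis 1 1)) (Fd ?e (at y) (axis 2 1)) ~= 0" for y
  using p(4)[of y] by (metis norm_zero zero_neq_one)
 have V: "open ?V" by (rule open_chart_dom[OF G])
 then have Vb: "?V : sets borel" by auto
 have img: "?e ` ?V = Gam G" using ga(8) by (auto simp: chart_dom_def)
 have ce: "continuous_on ?V ?e" by (rule continuous_on_subset[OF smooth_on_continuous[OF p(3)]]) auto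
 have hom: "homeomorphism ?V (?e ` ?V) ?e p"
  by (intro homeomorphismI ce continuous_on_subset[OF p(2)]) (auto simp: p(1))
 have em: "?e : leb ?V \<rightarrow>\<^sub>M borel" by (rule continuous_on_measurable_leb[OF ce])
 have Gb: "Gam G : sets (surf G)" using Gam_borel[OF G] sets_surf[OF G] by auto
 have setsG: "sets (mGam G) = sets (restrict_space borel (Gam G))"
  unfolding mGam_def by (rule sets_restrict_space_cong[OF sets_surf[OF G]])
 have em': "?e : leb ?V \<rightarrow>\<^sub>M restrict_space borel (Gam G)"
  by (rule measurable_restrict_space2[OF _ em]) (use img in \<open>auto simp: space_leb\<close>)
 then show m: "?e : leb ?V \<rightarrow>\<^sub>M mGam G" using measurable_cong_sets[OF refl setsG, of "leb ?V"] by simp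
 show "distr (leb ?V) (mGam G) ?e = mGam G"
 proof (rule measure_eqI)
  fix A assume "A : sets (distr (leb ?V) (mGam G) ?e)"
  then have A: "A : sets (mGam G)" by simp
  then have A': "A : sets borel" "A \<subseteq> Gam G"
   unfolding setsG using Gam_borel[OF G] by (auto simp: sets_restrict_space_iff)
  define B where "B = ?e -` A \<inter> ?V"
  have B: "B : sets borel" "B \<subseteq> ?V"
   using measurable_sets[OF em A'(1)] sets_leb[OF Vb] by (auto simp: B_def space_leb)
  have "?e ` B = A \<inter> ?e ` ?V" by (auto simp: B_def)
  then have eB: "?e ` B = A" using A'(2) img by auto
  have "emeasure (surf G) (?e ` B) = (\<integral>\<^sup>+y\<in>B. ennreal (norm (cross3 (Fd ?e (at y) (axis 1 1)) (Fd ?e (at y) (axis 2 1)))) \<partial>lborel)"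
   using ga(4)[unfolded is_surface_measure_def, THEN conjunct2, THEN conjunct2, THEN spec[of _ ?V],
     THEN spec[of _ ?e], THEN spec[of _ p], THEN spec[of _ B]]
    V smooth_on_subset[OF p(3) subset_UNIV] hom ga(6) img nz B by simp
  then have "emeasure (surf G) A = emeasure lborel B" using B p(4) eB by simp
  moreover have "emeasure (mGam G) A = emeasure (surf G) A"
   unfolding mGam_def using A'(2) Gb by (subst emeasure_restrict_space) (auto simp: sets.Int)
  moreover have "emeasure (distr (leb ?V) (mGam G) ?e) A = emeasure lborel B"
   using A B Vb by (subst emeasure_distr[OF m]) (auto simp: B_def space_leb leb_def emeasure_restrict_space)
  ultimately show "emeasure (distr (leb ?V) (mGam G) ?e) A = emeasure (mGam G) A" by simp
 qed simp
qed

lemma bounded_chart_dom: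
 assumes G: "structural_acoustic G"
 shows "bounded (chart_dom G)"
proof -
 note ga = structural_acousticD[OF G]
 obtain p where p: "!!y. p (chart G y) = y" "continuous_on UNIV p" using plane_chart_props[OF ga(7)] by metis
 have "compact (p ` frontier (Om G))"
  by (intro compact_continuous_image continuous_on_subset[OF p(2)] compact_frontier_bounded ga) auto
 moreover have "chart_dom G \<subseteq> p ` frontier (Om G)"
 proof
  fix y assume "y : chart_dom G"
  then have "chart G y : frontier (Om G)" using ga(6) by (auto simp: chart_dom_def openin_open)
  then show "y : p ` frontier (Om G)" using p(1) by (metis imageI)
 qed
 ultimately show ?thesis using bounded_subset compact_imp_bounded by blast
qed

lemma finite_measure_mGam:
 assumes G: "structural_acoustic G"
 shows "finite_measure (mGam G)"
proof -
 have "finite_measure (leb (chart_dom G))"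
  using open_chart_dom[OF G] bounded_chart_dom[OF G] by (intro finite_measure_leb) auto
 then have "finite_measure (distr (leb (chart_dom G)) (mGam G) (chart G))"
  by (rule finite_measure.finite_measure_distr) (rule mGam_distr(1)[OF G])
 then show ?thesis using mGam_distr(2)[OF G] by simp
qed

lemma finite_measure_mOm: "structural_acoustic G ==> finite_measure (mOm G)"
 unfolding mOm_def using structural_acousticD by (intro finite_measure_leb) auto

section \<open>The supremum bound on \<open>H\<^sup>2\<^sub>0\<close> in the plane\<close>

lemma smooth_translate:
 assumes "smooth_on (ph :: 'a::euclidean_space => real) UNIV"
 shows "smooth_on (%y. ph (y + k)) UNIV" "Fd (%y. ph (y + k)) (at y) v = Fd ph (at (y + k)) v"
proof -
 show "smooth_on (%y. ph (y + k)) UNIV"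
  by (rule smooth_on_compose[OF open_UNIV open_UNIV assms smooth_on_add[OF open_UNIV
     smooth_on_linear[OF bounded_linear_ident open_UNIV] smooth_on_const[OF open_UNIV]]]) auto
 have "((%y. ph (y + k)) has_derivative (%v. Fd ph (at (y + k)) v)) (at y)"
  by (rule has_derivative_compose[where g = ph and f = "%y. y + k",
     OF _ smooth_on_has_derivative[OF assms open_UNIV UNIV_I]]) (auto intro!: derivative_eq_intros)
 from frechet_derivative_at[OF this]
 show "Fd (%y. ph (y + k)) (at y) v = Fd ph (at (y + k)) v" by metis
qed

text \<open>The mean value theorem twice: along \<open>v\<close> for the increment over
  \<open>w\<close>, then along \<open>w\<close> for the derivative in direction
  \<open>v\<close>.\<close>

lemma second_difference:
 assumes ph: "smooth_on (ph :: 'a::euclidean_space => real) UNIV"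
 shows "EX q. norm (q - x) <= norm v + norm w &
  ph (x + v + w) - ph (x + v) - (ph (x + w) - ph x)
   = Fd (%z. Fd ph (at z) v) (at q) w"
proof -
 let ?Ps = "%y. ph (y + w) - ph y"
 have s: "smooth_on ?Ps UNIV" by (intro smooth_on_diff smooth_translate ph open_UNIV)
 obtain t where t: "0 < t" "t < 1" "?Ps (x + v) - ?Ps x = Fd ?Ps (at (x + t *\<^sub>R v)) v"
  using line_mvt[OF s] by blast
 let ?p = "x + t *\<^sub>R v"
 have "Fd ?Ps (at ?p) v = Fd ph (at (?p + w)) v - Fd ph (at ?p) v"
  using frechet_derivative_diff_smooth[OF smooth_translate(1)[OF ph] ph] smooth_translate(2)[OF ph] by simp
 moreover obtain r where r: "0 < r" "r < 1" "Fd ph (at (?p + w)) v - Fd ph (at ?p) v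
   = Fd (%z. Fd ph (at z) v) (at (?p + r *\<^sub>R w)) w"
  using line_mvt[OF smooth_on_frechet[OF ph open_UNIV]] by blast
 moreover have "norm (?p + r *\<^sub>R w - x) <= norm v + norm w"
 proof -
  have "norm (t *\<^sub>R v + r *\<^sub>R w) <= norm (t *\<^sub>R v) + norm (r *\<^sub>R w)" by (rule norm_triangle_ineq)
  also have "... <= norm v + norm w" using t r by (intro add_mono) (auto intro!: mult_left_le_one_le)
  finally show ?thesis by (simp add: algebra_simps)
 qed
 ultimately show ?thesis using t by (intro exI[of _ "?p + r *\<^sub>R w"]) simp
qed

text \<open>The second difference quotient is symmetric in \<open>v\<close> and \<open>w\<close>,
  and by the two readings of the mean value theorem it converges to both mixed derivatives.\<close>

lemma mixed_second_derivative:
 assumes ph: "smooth_on (ph :: 'a::euclidean_space => real) UNIV"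
 defines "D \<equiv> %v w x. Fd (%z. Fd ph (at z) v) (at x) w"
 shows "D v w x = D w v x"
proof -
 have sc: "D (c *\<^sub>R v) (c *\<^sub>R w) z = c\<^sup>2 * D v w z" for c v w z
 proof -
  have l1: "linear (Fd ph (at y))" for y
   using linear_frechet_derivative[OF smooth_on_differentiable[OF ph open_UNIV UNIV_I]] .
  have s: "smooth_on (%z. Fd ph (at z) v) UNIV" by (rule smooth_on_frechet[OF ph open_UNIV])
  have l2: "linear (Fd (%z. Fd ph (at z) v) (at z))"
   using linear_frechet_derivative[OF smooth_on_differentiable[OF s open_UNIV UNIV_I]] .
  have "(%z. Fd ph (at z) (c *\<^sub>R v)) = (%z. c * Fd ph (at z) v)"
   using linear_scale[OF l1] by simp
  moreover have "Fd (%z. c * Fd ph (at z) v) (at z) h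
    = c * Fd (%z. Fd ph (at z) v) (at z) h" for h
   using frechet_derivative_mult_smooth[OF smooth_on_const[OF open_UNIV, of c] s, of z h] by simp
  ultimately show ?thesis using linear_scale[OF l2] by (simp add: D_def power2_eq_square)
 qed
 define h where "h n = inverse (real (Suc n))" for n
 have h: "h n > 0" for n by (simp add: h_def)
 have h0: "h \<longlonglongrightarrow> 0" unfolding h_def by (rule LIMSEQ_inverse_real_of_nat)
 define \<Delta> where "\<Delta> n = (ph (x + h n *\<^sub>R v + h n *\<^sub>R w) - ph (x + h n *\<^sub>R v) - (ph (x + h n *\<^sub>R w) - ph x)) / (h n)\<^sup>2" for n
 have lim: "d \<longlonglongrightarrow> D a b x" if d: "!!n. EX q. norm (q - x) <= h n * (norm a + norm b) & d n = D a b q" for d a b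
 proof -
  obtain q where q: "!!n. norm (q n - x) <= h n * (norm a + norm b)" "!!n. d n = D a b (q n)" using d by metis
  have g0: "(%n. h n * (norm a + norm b)) \<longlonglongrightarrow> 0" using tendsto_mult_left_zero[OF h0] .
  have "(%n. q n - x) \<longlonglongrightarrow> 0" by (rule Lim_null_comparison[OF always_eventually g0]) (use q(1) in simp)
  then have "q \<longlonglongrightarrow> x" by (simp add: LIM_zero_iff)
  moreover have "isCont (D a b) x"
   unfolding D_def using smooth_on_continuous[OF smooth_on_frechet[OF smooth_on_frechet[OF ph open_UNIV] open_UNIV]]
   by (simp add: continuous_on_eq_continuous_at)
  ultimately have "(%n. D a b (q n)) \<longlonglongrightarrow> D a b x" by (rule isCont_tendsto_compose[rotated])
  moreover have "d = (%n. D a b (q n))" using q(2) by auto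
  ultimately show ?thesis by simp
 qed
 have "\<Delta> \<longlonglongrightarrow> D v w x"
 proof (rule lim)
  fix n
  obtain q where "norm (q - x) <= norm (h n *\<^sub>R v) + norm (h n *\<^sub>R w)" "ph (x + h n *\<^sub>R v + h n *\<^sub>R w) - ph (x + h n *\<^sub>R v) - (ph (x + h n *\<^sub>R w) - ph x) = D (h n *\<^sub>R v) (h n *\<^sub>R w) q"
   unfolding D_def using second_difference[OF ph] by blast
  then show "EX q. norm (q - x) <= h n * (norm v + norm w) & \<Delta> n = D v w q"
   using h[of n] by (intro exI[of _ q]) (simp add: \<Delta>_def sc distrib_left)
 qed
 moreover have "\<Delta> \<longlonglongrightarrow> D w v x"
 proof (rule lim)
  fix n
  obtain q where "norm (q - x) <= norm (h n *\<^sub>R w) + norm (h n *\<^sub>R v)" "ph (x + h n *\<^sub>R w + h n *\<^sub>R v) - ph (x + h n *\<^sub>R w) - (ph (x + h n *\<^sub>R v) - ph x) = D (h n *\<^sub>R w) (h n *\<^sub>R v) q"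
   unfolding D_def using second_difference[OF ph] by blast
  then have q: "norm (q - x) <= h n * (norm w + norm v)"
    "ph (x + h n *\<^sub>R w + h n *\<^sub>R v) - ph (x + h n *\<^sub>R w) - (ph (x + h n *\<^sub>R v) - ph x) = (h n)\<^sup>2 * D w v q"
   using h[of n] by (simp_all add: sc distrib_left)
  have e: "x + h n *\<^sub>R w + h n *\<^sub>R v = x + h n *\<^sub>R v + h n *\<^sub>R w" by (simp add: add_ac)
  have "ph (x + h n *\<^sub>R v + h n *\<^sub>R w) - ph (x + h n *\<^sub>R v) - (ph (x + h n *\<^sub>R w) - ph x) = (h n)\<^sup>2 * D w v q"
   using q(2)[unfolded e] by linarith
  then show "EX q. norm (q - x) <= h n * (norm w + norm v) & \<Delta> n = D w v q"
   using h[of n] q(1) by (intro exI[of _ q]) (simp add: \<Delta>_def)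
 qed
 ultimately show ?thesis by (rule LIMSEQ_unique)
qed

definition pd :: "'a::euclidean_space => ('a => real) => 'a => real" where
 "pd b ph x = Fd ph (at x) b"

lemma pd_test_fun: "test_fun U ph ==> test_fun U (pd b ph)"
 unfolding pd_def[abs_def] by (rule test_fun_frechet)

lemma pd_commute: "smooth_on ph UNIV ==> pd a (pd b ph) = pd b (pd a ph)"
 unfolding pd_def[abs_def] by (rule ext) (rule mixed_second_derivative)

lemma pd_parts:
 "test_fun U f ==> test_fun U ze ==> (\<integral>x. f x * pd v ze x \<partial>lborel) = - (\<integral>x. pd v f x * ze x \<partial>lborel)"
 unfolding pd_def by (rule integral_by_parts_test_fun[OF test_fun_smooth])

abbreviation (input) e1 :: "real^2" where "e1 \<equiv> axis 1 1"

abbreviation (input) e2 :: "real^2" where "e2 \<equiv> axis 2 1"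

text \<open>Two integrations by parts give
  \<open>\<integral> \<phi>11 \<phi>22 = \<integral> \<phi>12^2\<close>, hence the squared norm of
  the Laplacian is that of \<open>\<phi>11\<close> plus that of \<open>\<phi>22\<close> plus twice
  that of \<open>\<phi>12\<close>.\<close>

lemma mixed_le_laplacian:
 assumes t: "test_fun UNIV (ph :: real^2 => real)"
 shows "L2_norm lborel (pd e2 (pd e1 ph)) <= L2_norm lborel (%x. \<Sum>b\<in>Basis. pd b (pd b ph) x)"
proof (rule power2_le_imp_le)
 note T = pd_test_fun[OF t] pd_test_fun[OF pd_test_fun[OF t]] pd_test_fun[OF pd_test_fun[OF pd_test_fun[OF t]]]
 note c = pd_commute[OF test_fun_smooth]
 let ?a = "pd e1 (pd e1 ph)" and ?b = "pd e2 (pd e2 ph)" and ?m = "pd e2 (pd e1 ph)"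
 note L = test_fun_L2[OF T(2)]
 have "(\<integral>x. ?b x * ?a x \<partial>lborel) = - (\<integral>x. pd e1 ?b x * pd e1 ph x \<partial>lborel)"
  by (rule pd_parts[OF T(2) T(1)])
 also have "pd e1 ?b = pd e2 ?m"
  using c[OF T(1), of e1 e2 e2] c[OF t, of e1 e2] by simp
 also have "- (\<integral>x. pd e2 ?m x * pd e1 ph x \<partial>lborel) = (\<integral>x. ?m x * pd e2 (pd e1 ph) x \<partial>lborel)"
  using pd_parts[OF T(2) T(1), of e2 e1 e2 e1] by simp
 finally have ab: "(\<integral>x. ?b x * ?a x \<partial>lborel) = (L2_norm lborel ?m)\<^sup>2"
  unfolding L2_norm_power2 by (simp add: power2_eq_square)
 have "(L2_norm lborel (%x. \<Sum>b\<in>Basis. pd b (pd b ph) x))\<^sup>2 = (\<integral>x. (?a x)\<^sup>2 + (?b x)\<^sup>2 + 2 * (?b x * ?a x) \<partial>lborel)"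
  unfolding L2_norm_power2 by (simp add: Basis_real2 axis_neq power2_sum mult_ac)
 also have "... = (L2_norm lborel ?a)\<^sup>2 + (L2_norm lborel ?b)\<^sup>2 + 2 * (L2_norm lborel ?m)\<^sup>2"
  unfolding ab[symmetric] unfolding L2_norm_power2
  using L2_integrable_square[OF L] L2_integrable_mult[OF L L] by simp
 finally show "(L2_norm lborel ?m)\<^sup>2 <= (L2_norm lborel (%x. \<Sum>b\<in>Basis. pd b (pd b ph) x))\<^sup>2"
  using zero_le_power2[of "L2_norm lborel ?a"] zero_le_power2[of "L2_norm lborel ?b"] zero_le_power2[of "L2_norm lborel ?m"] by linarith
qed (rule L2_norm_nonneg)

section \<open>Supremum of a test function in the plane\<close>

definition vec2 :: "real => real => real^2" where "vec2 s t = vector [s, t]"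

lemma vec2_nth [simp]: "vec2 s t $ 1 = s" "vec2 s t $ 2 = t"
 by (simp_all add: vec2_def)

lemma vec2_eq: "vec2 s t = s *\<^sub>R e1 + t *\<^sub>R e2"
 by (simp add: vec_eq_iff forall_2 axis_def)

lemma continuous_on_vec2: "continuous_on S (%p. vec2 (fst p) (snd p))"
 unfolding vec2_eq by (intro continuous_intros)

lemma measurable_vec2: "(%p. vec2 (fst p) (snd p)) : (lborel \<Otimes>\<^sub>M lborel) \<rightarrow>\<^sub>M borel"
 using borel_measurable_continuous_onI[OF continuous_on_vec2[of UNIV]] by (simp add: lborel_prod)

lemma lborel_vec2: "(lborel :: (real^2) measure) = distr (lborel \<Otimes>\<^sub>M lborel) borel (%p. vec2 (fst p) (snd p))"
proof (rule lborel_eqI)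
 fix l u :: "real^2" assume le: "!!b. b : Basis ==> l \<bullet> b <= u \<bullet> b"
 have le': "l $ i <= u $ i" for i using le[of "axis i 1"] by (simp add: inner_axis)
 have pre: "(%p. vec2 (fst p) (snd p)) -` box l u \<inter> space (lborel \<Otimes>\<^sub>M lborel)
   = box (l $ 1) (u $ 1) \<times> box (l $ 2) (u $ 2)"
  by (auto simp: mem_box_cart forall_2 space_pair_measure)
 have "emeasure (distr (lborel \<Otimes>\<^sub>M lborel) borel (%p. vec2 (fst p) (snd p))) (box l u)
   = emeasure (lborel \<Otimes>\<^sub>M lborel) (box (l $ 1) (u $ 1) \<times> box (l $ 2) (u $ 2))"
  by (subst emeasure_distr[OF measurable_vec2]) (simp_all only: pre borel_open open_box)
 also have "... = emeasure lborel (box (l $ 1) (u $ 1)) * emeasure lborel (box (l $ 2) (u $ 2))"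
  by (rule lborel.emeasure_pair_measure_Times) auto
 also have "... = ennreal (u $ 1 - l $ 1) * ennreal (u $ 2 - l $ 2)"
  using le'[of 1] le'[of 2] by (simp add: box_real)
 also have "... = ennreal (\<Prod>b\<in>Basis. (u - l) \<bullet> b)"
  using le' by (simp add: Basis_real2 inner_axis axis_neq ennreal_mult[symmetric])
 finally show "emeasure (distr (lborel \<Otimes>\<^sub>M lborel) borel (%p. vec2 (fst p) (snd p))) (box l u)
   = ennreal (\<Prod>b\<in>Basis. (u - l) \<bullet> b)" .
qed simp

lemma nn_integral_vec2:
 assumes K: "K : borel_measurable borel"
 shows "(\<integral>\<^sup>+s. \<integral>\<^sup>+t. K (vec2 s t) \<partial>lborel \<partial>lborel) = (\<integral>\<^sup>+z. K z \<partial>lborel)"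
proof -
 have "(\<integral>\<^sup>+z. K z \<partial>lborel) = (\<integral>\<^sup>+z. K z \<partial>distr (lborel \<Otimes>\<^sub>M lborel) borel (%p. vec2 (fst p) (snd p)))"
  using lborel_vec2 by simp
 also have "... = (\<integral>\<^sup>+p. K (vec2 (fst p) (snd p)) \<partial>(lborel \<Otimes>\<^sub>M lborel))"
  by (rule nn_integral_distr[OF measurable_vec2]) (use K in simp)
 also have "... = (\<integral>\<^sup>+s. \<integral>\<^sup>+t. K (vec2 s t) \<partial>lborel \<partial>lborel)"
  by (subst lborel.nn_integral_fst[symmetric]) (use measurable_compose[OF measurable_vec2 K] in simp_all)
 finally show ?thesis ..
qed

lemma line_sup_le:
 assumes t: "test_fun UNIV (ph :: real^2 => real)" and b: "norm b = 1"
 shows "ennreal \<bar>ph (p + s *\<^sub>R b)\<bar> <= (\<integral>\<^sup>+r. ennreal \<bar>pd b ph (p + r *\<^sub>R b)\<bar> \<partial>lborel)"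
proof -
 obtain K where K: "smooth_on ph UNIV" "compact K" "K \<subseteq> UNIV" "!!x. x \<notin> K ==> ph x = 0"
  using test_funE[OF t] by blast
 obtain R where R: "!!x. x : K ==> norm x <= R" using compact_imp_bounded[OF K(2)] unfolding bounded_iff by blast
 \<comment> \<open>To the left of \<open>s\<close> and so far out that the point lies beyond the
   support, which uses that \<open>b\<close> is a unit vector.\<close>
 define a where "a = - (\<bar>s\<bar> + \<bar>R\<bar> + norm p + 1)"
 have as: "a <= s" unfolding a_def using norm_ge_zero[of p] by linarith
 have z: "ph (p + a *\<^sub>R b) = 0"
 proof (rule K(4), rule notI)
  assume "p + a *\<^sub>R b : K"
  then have "norm (p + a *\<^sub>R b) <= R" by (rule R)
  moreover have "\<bar>a\<bar> - norm p <= norm (p + a *\<^sub>R b)"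
   using norm_triangle_ineq4[of "p + a *\<^sub>R b" p] b by simp
  ultimately show False by (simp add: a_def)
 qed
 have cont: "isCont (%r. pd b ph (p + r *\<^sub>R b)) r" for r
 proof -
  have "continuous_on UNIV (%r. pd b ph (p + r *\<^sub>R b))"
   by (rule continuous_on_compose2[OF smooth_on_continuous[OF test_fun_smooth[OF pd_test_fun[OF t]]]])
    (auto intro!: continuous_intros)
  then show ?thesis by (simp add: continuous_on_eq_continuous_at)
 qed
 have hb: "has_bochner_integral lborel (%r. pd b ph (p + r *\<^sub>R b) * indicator {a..s} r) (ph (p + s *\<^sub>R b) - ph (p + a *\<^sub>R b))"
  by (rule has_bochner_integral_FTC_Icc_real[OF as]) (auto simp: pd_def cont[unfolded pd_def] intro: line_has_derivative[OF K(1)])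
 then have int: "integrable lborel (%r. pd b ph (p + r *\<^sub>R b) * indicator {a..s} r)"
  and val: "(\<integral>r. pd b ph (p + r *\<^sub>R b) * indicator {a..s} r \<partial>lborel) = ph (p + s *\<^sub>R b)"
  using z by (auto simp: has_bochner_integral_iff)
 have "ennreal \<bar>ph (p + s *\<^sub>R b)\<bar> <= (\<integral>\<^sup>+r. ennreal (norm (pd b ph (p + r *\<^sub>R b) * indicator {a..s} r)) \<partial>lborel)"
  using integral_norm_bound_ennreal[OF int] val by simp
 also have "... <= (\<integral>\<^sup>+r. ennreal \<bar>pd b ph (p + r *\<^sub>R b)\<bar> \<partial>lborel)"
  by (intro nn_integral_mono ennreal_leI) (auto simp: indicator_def)
 finally show ?thesis .
qed

text \<open>Integrating along both axes bounds \<open>\<bar>ph\<bar>\<close> by the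
  \<open>L^1\<close> norm of the mixed derivative; Cauchy-Schwarz on \<open>V\<close> then produces
  the root of its measure.\<close>

lemma test_fun_sup_le:
 assumes V: "V : sets borel" "bounded V" and t: "test_fun V (ph :: real^2 => real)"
 shows "\<bar>ph x\<bar> <= sqrt (measure lborel V) * L2_norm lborel (%x. \<Sum>b\<in>Basis. pd b (pd b ph) x)"
proof -
 let ?m = "pd e2 (pd e1 ph)"
 have tU: "test_fun UNIV ph" by (rule test_fun_UNIV[OF t])
 have tm: "test_fun V ?m" by (intro pd_test_fun t)
 have [measurable]: "?m : borel_measurable borel" by (rule test_fun_measurable[OF tm])
 have "ennreal \<bar>ph x\<bar> = ennreal \<bar>ph (vec2 0 (x $ 2) + x $ 1 *\<^sub>R e1)\<bar>"
  by (rule arg_cong[where f = "%x. ennreal \<bar>ph x\<bar>"]) (simp add: vec_eq_iff forall_2 axis_def)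
 also have "... <= (\<integral>\<^sup>+s. ennreal \<bar>pd e1 ph (vec2 0 (x $ 2) + s *\<^sub>R e1)\<bar> \<partial>lborel)"
  by (rule line_sup_le[OF tU]) simp
 also have "... <= (\<integral>\<^sup>+s. \<integral>\<^sup>+r. ennreal \<bar>?m (vec2 s r)\<bar> \<partial>lborel \<partial>lborel)"
 proof (rule nn_integral_mono)
  fix s
  have "ennreal \<bar>pd e1 ph (vec2 0 (x $ 2) + s *\<^sub>R e1)\<bar> = ennreal \<bar>pd e1 ph (vec2 s 0 + x $ 2 *\<^sub>R e2)\<bar>"
   by (rule arg_cong[where f = "%x. ennreal \<bar>pd e1 ph x\<bar>"]) (simp add: vec_eq_iff forall_2 axis_def)
  also have "... <= (\<integral>\<^sup>+r. ennreal \<bar>?m (vec2 s 0 + r *\<^sub>R e2)\<bar> \<partial>lborel)"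
   by (rule line_sup_le[OF pd_test_fun[OF tU]]) simp
  also have "(%r. vec2 s 0 + r *\<^sub>R e2) = (%r. vec2 s r)"
   by (rule ext) (simp add: vec_eq_iff forall_2 axis_def)
  then have "(\<integral>\<^sup>+r. ennreal \<bar>?m (vec2 s 0 + r *\<^sub>R e2)\<bar> \<partial>lborel) = (\<integral>\<^sup>+r. ennreal \<bar>?m (vec2 s r)\<bar> \<partial>lborel)"
   by (metis (no_types))
  finally show "ennreal \<bar>pd e1 ph (vec2 0 (x $ 2) + s *\<^sub>R e1)\<bar> <= (\<integral>\<^sup>+r. ennreal \<bar>?m (vec2 s r)\<bar> \<partial>lborel)" .
 qed
 also have "... = (\<integral>\<^sup>+z. ennreal \<bar>?m z\<bar> \<partial>lborel)"
  using nn_integral_vec2[of "%z. ennreal \<bar>?m z\<bar>"] by simp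
 also have "... = ennreal (\<integral>z. \<bar>?m z\<bar> \<partial>lborel)"
  using test_fun_integrable[OF tm] by (intro nn_integral_eq_integral) auto
 finally have "\<bar>ph x\<bar> <= (\<integral>z. \<bar>?m z\<bar> \<partial>lborel)" by (simp add: ennreal_le_iff)
 also have "(\<integral>z. \<bar>?m z\<bar> \<partial>lborel) = L2_inner lborel (%z. \<bar>?m z\<bar>) (indicator V)"
 proof -
  have "\<bar>?m z\<bar> = \<bar>?m z\<bar> * indicator V z" for z using test_fun_zero[OF tm, of z] by (cases "z : V") auto
  then show ?thesis unfolding L2_inner_def by presburger
 qed
 also have "... <= L2_norm lborel (%z. \<bar>?m z\<bar>) * L2_norm lborel (indicator V)"
  using L2_cauchy_schwarz[OF L2_abs[OF test_fun_L2[OF tm]] L2_indicator[of V lborel]] V emeasure_bounded_finite[OF V(2)]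
  by (simp add: abs_le_iff)
 also have "L2_norm lborel (indicator V) = sqrt (measure lborel V)"
 proof -
  have "L2_inner lborel (indicator V) (indicator V) = (\<integral>z. indicator V z \<partial>lborel)"
   unfolding L2_inner_def by (rule Bochner_Integration.integral_cong) (auto simp: indicator_def)
  then show ?thesis using V by (simp add: L2_norm_def)
 qed
 also have "L2_norm lborel (%z. \<bar>?m z\<bar>) = L2_norm lborel ?m" by (rule L2_norm_abs)
 also have "L2_norm lborel ?m * sqrt (measure lborel V) <= L2_norm lborel (%x. \<Sum>b\<in>Basis. pd b (pd b ph) x) * sqrt (measure lborel V)"
  by (intro mult_right_mono mixed_le_laplacian[OF tU]) auto
 finally show ?thesis by (simp add: mult.commute)
qed

section \<open>Weak Laplacians and passage to \<open>H20\<close>\<close>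

lemma H2_H1: "u : H2 U ==> u : H1 U" and H2_weak_pd: "u : H2 U ==> b : Basis ==> weak_pd U b u : H1 U"
 by (auto simp: H2_def)

lemma weak_laplacian_L2: "u : H2 U ==> weak_laplacian U u : Lq_space 2 (leb U)"
 unfolding weak_laplacian_def[abs_def] by (intro L2_sum H1_weak_pd_L2 H2_weak_pd)

text \<open>The inner derivatives agree only almost everywhere; invariance of \<open>weak_pd\<close>
  under null sets lets the outer one be taken.\<close>

lemma weak_pd2_diff:
 assumes U: "open U" and u: "u : H2 U" "v : H2 U" and b: "b : Basis"
 shows "AE x in leb U. weak_pd U b (weak_pd U b (%x. u x - v x)) x = weak_pd U b (weak_pd U b u) x - weak_pd U b (weak_pd U b v) x"
proof -
 have Ub: "U : sets borel" using U by auto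
 note H = H2_H1[OF u(1)] H2_H1[OF u(2)] H2_weak_pd[OF u(1) b] H2_weak_pd[OF u(2) b]
 have "weak_pd U b (weak_pd U b (%x. u x - v x)) = weak_pd U b (%x. weak_pd U b u x - weak_pd U b v x)"
  by (rule weak_pd_cong_AE[OF Ub weak_pd_diff_AE[OF U H(1,2) b]])
   (auto intro!: L2_measurable L2_diff H1_weak_pd_L2 H1_diff Ub H b)
 then show ?thesis using weak_pd_diff_AE[OF U H(3,4) b] by simp
qed

lemma weak_laplacian_diff:
 assumes U: "open U" and u: "u : H2 U" "v : H2 U"
 shows "AE x in leb U. weak_laplacian U (%x. u x - v x) x = weak_laplacian U u x - weak_laplacian U v x"
proof -
 have "AE x in leb U. ALL b:Basis. weak_pd U b (weak_pd U b (%x. u x - v x)) x = weak_pd U b (weak_pd U b u) x - weak_pd U b (weak_pd U b v) x"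
  by (rule AE_finite_allI) (use weak_pd2_diff[OF U u] in auto)
 then show ?thesis by eventually_elim (simp add: weak_laplacian_def sum_subtractf)
qed

lemma H2_diff:
 assumes U: "open U" and u: "u : H2 U" "v : H2 U"
 shows "(%x. u x - v x) : H2 U"
 unfolding H2_def
proof (intro CollectI conjI ballI)
 have Ub: "U : sets borel" using U by auto
 show d: "(%x. u x - v x) : H1 U" by (intro H1_diff Ub H2_H1 u)
 fix b :: 'a assume b: "b : Basis"
 have "(%x. weak_pd U b u x - weak_pd U b v x) : H1 U" by (intro H1_diff Ub H2_weak_pd u b)
 moreover have ae: "AE x in leb U. weak_pd U b u x - weak_pd U b v x = weak_pd U b (%x. u x - v x) x"
  using weak_pd_diff_AE[OF U H2_H1[OF u(1)] H2_H1[OF u(2)] b] by (auto elim: eventually_mono)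
 moreover have m: "(%x. weak_pd U b u x - weak_pd U b v x) : borel_measurable (leb U)" "weak_pd U b (%x. u x - v x) : borel_measurable (leb U)"
  by (auto intro!: L2_measurable L2_diff H1_weak_pd_L2 d H2_H1 u b)
 ultimately show "weak_pd U b (%x. u x - v x) : H1 U"
  unfolding H1_def has_weak_pd_cong_AE[OF Ub ae m] using H1_weak_pd_L2[OF d b]
  by (simp add: has_weak_pd_cong_AE[OF Ub ae m])
qed

lemma smooth_H2:
 assumes f: "smooth_on f UNIV" and U: "bounded U" "open U"
 shows "f : H2 U" "AE x in leb U. weak_laplacian U f x = (\<Sum>b\<in>Basis. pd b (pd b f) x)"
proof -
 have Ub: "U : sets borel" using U by auto
 have fH: "f : H1 U" by (rule smooth_H1[OF f U(1) Ub])
 have s: "smooth_on (pd b f) UNIV" for b unfolding pd_def[abs_def] by (rule smooth_on_frechet[OF f open_UNIV])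
 have ae: "AE x in leb U. weak_pd U b f x = pd b f x" for b
  unfolding pd_def by (rule weak_pd_AE[OF U(2) has_weak_pd_smooth_bounded[OF f U(1) Ub]])
 have m: "weak_pd U b f : borel_measurable (leb U)" "pd b f : borel_measurable (leb U)" if "b : Basis" for b
  using L2_measurable[OF H1_weak_pd_L2[OF fH that]] smooth_measurable_leb[OF s] by auto
 show "f : H2 U"
  unfolding H2_def
 proof (intro CollectI conjI ballI fH)
  fix b :: 'a assume b: "b : Basis"
  have "has_weak_pd U c (weak_pd U b f) = has_weak_pd U c (pd b f)" for c
   by (rule has_weak_pd_cong_AE[OF Ub ae m[OF b]])
  then show "weak_pd U b f : H1 U"
   using smooth_H1[OF s U(1) Ub, of b] H1_weak_pd_L2[OF fH b] by (simp add: H1_def)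
 qed
 have "AE x in leb U. weak_pd U b (weak_pd U b f) x = pd b (pd b f) x" if "b : Basis" for b
  unfolding weak_pd_cong_AE[OF Ub ae m[OF that]] pd_def[of b "pd b f"]
  by (rule weak_pd_AE[OF U(2) has_weak_pd_smooth_bounded[OF s U(1) Ub]])
 then have "AE x in leb U. ALL b:Basis. weak_pd U b (weak_pd U b f) x = pd b (pd b f) x"
  by (intro AE_finite_allI) auto
 then show "AE x in leb U. weak_laplacian U f x = (\<Sum>b\<in>Basis. pd b (pd b f) x)"
  by eventually_elim (simp add: weak_laplacian_def)
qed

lemma H2_norm_bounds:
 shows "L2_norm (leb U) u <= H2_norm U u" "b : Basis ==> L2_norm (leb U) (weak_pd U b (weak_pd U b u)) <= H2_norm U u"
proof -
 have p: "(H2_norm U u)\<^sup>2 = (L2_norm (leb U) u)\<^sup>2 + (\<Sum>b\<in>Basis. (H1_norm U (weak_pd U b u))\<^sup>2)"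
  by (simp add: H2_norm_def sum_nonneg)
 have n: "0 <= H2_norm U u" by (simp add: H2_norm_def sum_nonneg)
 show "L2_norm (leb U) u <= H2_norm U u"
  by (rule power2_le_imp_le[OF _ n]) (simp add: p sum_nonneg)
 assume b: "b : Basis"
 have "L2_norm (leb U) (weak_pd U b (weak_pd U b u)) <= H1_norm U (weak_pd U b u)"
  by (rule order_trans[OF weak_pd_le_grad_norm[OF b] grad_le_H1_norm])
 also have "... <= H2_norm U u"
 proof (rule power2_le_imp_le[OF _ n])
  have "(H1_norm U (weak_pd U b u))\<^sup>2 <= (\<Sum>b\<in>Basis. (H1_norm U (weak_pd U b u))\<^sup>2)"
   using b by (intro member_le_sum) auto
  then show "(H1_norm U (weak_pd U b u))\<^sup>2 <= (H2_norm U u)\<^sup>2" unfolding p using zero_le_power2[of "L2_norm (leb U) u"] by linarith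
 qed
 finally show "L2_norm (leb U) (weak_pd U b (weak_pd U b u)) <= H2_norm U u" .
qed

lemma weak_laplacian_le_H2_norm:
 assumes "u : H2 (U :: 'a::euclidean_space set)"
 shows "L2_norm (leb U) (weak_laplacian U u) <= DIM('a) * H2_norm U u"
proof -
 have L: "weak_pd U b (weak_pd U b u) : Lq_space 2 (leb U)" if "b : Basis" for b
  by (intro H1_weak_pd_L2 H2_weak_pd assms that)
 have "L2_norm (leb U) (%x. \<Sum>b\<in>B. weak_pd U b (weak_pd U b u) x) <= (\<Sum>b\<in>B. L2_norm (leb U) (weak_pd U b (weak_pd U b u)))"
  if "finite B" "B \<subseteq> Basis" for B using that
 proof (induction B)
  case empty
  then show ?case by (simp add: L2_norm_def L2_inner_def)
 next
  case (insert b B)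
  have "L2_norm (leb U) (%x. weak_pd U b (weak_pd U b u) x + (\<Sum>b\<in>B. weak_pd U b (weak_pd U b u) x))
    <= L2_norm (leb U) (weak_pd U b (weak_pd U b u)) + L2_norm (leb U) (%x. \<Sum>b\<in>B. weak_pd U b (weak_pd U b u) x)"
   using insert.prems by (intro L2_norm_triangle L2_sum L) auto
  then show ?case using insert by simp
 qed
 from this[OF finite_Basis order_refl]
 have "L2_norm (leb U) (weak_laplacian U u) <= (\<Sum>b\<in>Basis. L2_norm (leb U) (weak_pd U b (weak_pd U b u)))"
  by (simp add: weak_laplacian_def[abs_def])
 also have "... <= (\<Sum>b\<in>(Basis :: 'a set). H2_norm U u)" by (intro sum_mono H2_norm_bounds)
 finally show ?thesis by simp
qed

text \<open>A supremum bound is not continuous in the norm of \<open>H2\<close>, so the excess of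
  \<open>\<bar>w\<bar>\<close> over the bound is shown to have zero \<open>L^2\<close> norm.\<close>

theorem H20_sup_le:
 fixes V :: "(real^2) set"
 assumes V: "open V" "bounded V" and w: "w : H20 V"
 shows "AE x in leb V. \<bar>w x\<bar> <= sqrt (measure lborel V) * L2_norm (leb V) (weak_laplacian V w)"
proof -
 have Vb: "V : sets borel" using V by auto
 obtain ph where wH: "w : H2 V" and ph: "!!n::nat. test_fun V (ph n)" "(%n. H2_norm V (%x. w x - ph n x)) \<longlonglongrightarrow> 0"
  using w unfolding H20_def by blast
 let ?c = "sqrt (measure lborel V)" and ?N = "L2_norm (leb V)"
 have phH: "ph n : H2 V" for n by (rule smooth_H2(1)[OF test_fun_smooth[OF ph(1)] V(2,1)])
 note L = weak_laplacian_L2[OF wH] weak_laplacian_L2[OF phH]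
 have dif: "?N (%x. weak_laplacian V w x - weak_laplacian V (ph n) x) <= 2 * H2_norm V (%x. w x - ph n x)" for n
 proof -
  have "?N (%x. weak_laplacian V w x - weak_laplacian V (ph n) x) = ?N (weak_laplacian V (%x. w x - ph n x))"
   by (rule L2_norm_cong_AE[symmetric, OF weak_laplacian_diff[OF V(1) wH phH]])
    (auto intro!: L2_measurable L2_diff L weak_laplacian_L2 H2_diff V wH phH)
  also have "... <= 2 * H2_norm V (%x. w x - ph n x)"
   using weak_laplacian_le_H2_norm[OF H2_diff[OF V(1) wH phH]] by simp
  finally show ?thesis .
 qed
 have sup: "\<bar>ph n x\<bar> <= ?c * ?N (weak_laplacian V (ph n))" for n x
 proof -
  have "?N (weak_laplacian V (ph n)) = ?N (%x. \<Sum>b\<in>Basis. pd b (pd b (ph n)) x)"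
   using smooth_H2(2)[OF test_fun_smooth[OF ph(1)] V(2,1)]
   by (rule L2_norm_cong_AE)
    (intro L2_measurable[OF L(2)] smooth_measurable_leb smooth_on_sum open_UNIV
     test_fun_smooth[OF pd_test_fun[OF pd_test_fun[OF ph(1)]]])+
  also have "... = L2_norm lborel (%x. \<Sum>b\<in>Basis. pd b (pd b (ph n)) x)"
  proof -
   have "indicator V x * (\<Sum>b\<in>Basis. pd b (pd b (ph n)) x) = (\<Sum>b\<in>Basis. pd b (pd b (ph n)) x)" for x
    using test_fun_zero[OF pd_test_fun[OF pd_test_fun[OF ph(1)]], of x] by (cases "x : V") auto
   then show ?thesis unfolding L2_norm_leb[OF Vb] by presburger
  qed
  finally show ?thesis using test_fun_sup_le[OF Vb V(2) ph(1), of n x] by simp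
 qed
 have "AE x in leb V. \<bar>w x\<bar> <= ?c * ?N (weak_laplacian V w) + e" if e: "e > 0" for e
 proof -
  let ?M = "?c * ?N (weak_laplacian V w) + e"
  have c0: "?c >= 0" by simp
  \<comment> \<open>For large \<open>n\<close> the approximation \<open>ph n\<close> stays below
    \<open>?M\<close>, so this excess is dominated by \<open>\<bar>w - ph n\<bar>\<close>.\<close>
  let ?f = "%x. max 0 (\<bar>w x\<bar> - ?M)"
  have wm: "w : borel_measurable (leb V)" by (rule L2_measurable[OF H1_L2[OF H2_H1[OF wH]]])
  have wf: "?f : borel_measurable (leb V)" using wm by measurable
  have d: "(%x. w x - ph n x) : Lq_space 2 (leb V)" for n by (intro L2_diff H1_L2 H2_H1 wH phH)
  have lim2: "(%n. ?c * (2 * H2_norm V (%x. w x - ph n x))) \<longlonglongrightarrow> ?c * (2 * 0)" by (intro tendsto_intros ph(2))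
  then have "\<forall>\<^sub>F n in sequentially. ?c * (2 * H2_norm V (%x. w x - ph n x)) < e" using e by (intro order_tendstoD(2)) auto
  then have ev: "\<forall>\<^sub>F n in sequentially. ?N ?f <= H2_norm V (%x. w x - ph n x) & ?f : Lq_space 2 (leb V)"
  proof eventually_elim
   case (elim n)
   have "?N (weak_laplacian V (ph n)) <= ?N (weak_laplacian V w) + 2 * H2_norm V (%x. w x - ph n x)"
    using L2_norm_triangle_sub[OF L(1) L(2)[of n]] dif[of n] by linarith
   then have "?c * ?N (weak_laplacian V (ph n)) <= ?c * (?N (weak_laplacian V w) + 2 * H2_norm V (%x. w x - ph n x))"
    by (rule mult_left_mono[OF _ c0])
   then have b: "\<bar>ph n x\<bar> <= ?M" for x using sup[of n x] elim by (simp add: distrib_left)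
   have "\<bar>?f x\<bar> <= \<bar>w x - ph n x\<bar>" for x using b[of x] by (auto simp: max_def)
   then have ae: "AE x in leb V. \<bar>?f x\<bar> <= \<bar>w x - ph n x\<bar>" by (intro AE_I2)
   have "?N ?f <= ?N (%x. w x - ph n x)" "?f : Lq_space 2 (leb V)"
    by (rule L2_norm_mono_AE[OF d wf ae])+
   then show ?case using order_trans[OF _ H2_norm_bounds(1)[of V "%x. w x - ph n x"]] by blast
  qed
  then have fL: "?f : Lq_space 2 (leb V)" using eventually_happens'[OF sequentially_bot] by blast
  have "?N ?f <= 0"
   by (rule tendsto_lowerbound[OF ph(2)]) (use ev in \<open>auto elim: eventually_mono\<close>)
  then have "?N ?f = 0" using L2_norm_nonneg[of "leb V" ?f] by simp
  then have "AE x in leb V. ?f x = 0" using L2_norm_eq_0_iff[OF fL] by simp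
  then show ?thesis by eventually_elim (simp add: max_def split: if_splits)
 qed
 then have "AE x in leb V. ALL n::nat. \<bar>w x\<bar> <= ?c * ?N (weak_laplacian V w) + inverse (real (Suc n))"
  unfolding AE_all_countable by simp
 then show ?thesis
 proof eventually_elim
  case (elim x)
  have "(%n. ?c * ?N (weak_laplacian V w) + inverse (real (Suc n))) \<longlonglongrightarrow> ?c * ?N (weak_laplacian V w) + 0"
   by (intro tendsto_intros LIMSEQ_inverse_real_of_nat)
  from tendsto_lowerbound[OF this always_eventually] elim show ?case by simp
 qed
qed

subsection \<open>Transfer to the flat part of the boundary\<close>

lemma inv_chart:
 assumes G: "structural_acoustic G"
 shows "inv (chart G) (chart G y) = y" "x : Gam G ==> chart G (inv (chart G) x) = x"
  "inv (chart G) : mGam G \<rightarrow>\<^sub>M leb (chart_dom G)" "distr (mGam G) (leb (chart_dom G)) (inv (chart G)) = leb (chart_dom G)"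
proof -
 note ga = structural_acousticD[OF G]
 obtain p where p: "!!y. p (chart G y) = y" "continuous_on UNIV p" using plane_chart_props[OF ga(7)] by metis
 have inj: "inj (chart G)" using p(1) by (metis injI)
 show i: "inv (chart G) (chart G y) = y" for y by (rule inv_f_f[OF inj])
 show c: "chart G (inv (chart G) x) = x" if "x : Gam G" for x using ga(8) that by (auto intro: f_inv_into_f)
 have ip: "inv (chart G) x = p x" if "x : Gam G" for x using c[OF that] p(1) by metis
 have sG: "space (mGam G) = Gam G"
  unfolding mGam_def using sets_eq_imp_space_eq[OF sets_surf[OF G]] by (simp add: space_restrict_space)
 have setsG: "sets (mGam G) = sets (restrict_space borel (Gam G))"
  unfolding mGam_def by (rule sets_restrict_space_cong[OF sets_surf[OF G]])
 have pm: "p : mGam G \<rightarrow>\<^sub>M borel"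
  unfolding measurable_cong_sets[OF setsG refl]
  by (rule measurable_restrict_space1) (rule borel_measurable_continuous_onI[OF p(2)])
 have "p : mGam G \<rightarrow>\<^sub>M restrict_space borel (chart_dom G)"
  by (rule measurable_restrict_space2[OF _ pm]) (use ip c sG in \<open>auto simp: chart_dom_def\<close>)
 moreover have "sets (leb (chart_dom G)) = sets (restrict_space borel (chart_dom G))"
  by (simp add: leb_def sets_restrict_space)
 ultimately have "p : mGam G \<rightarrow>\<^sub>M leb (chart_dom G)" using measurable_cong_sets[of "mGam G" "mGam G" "leb (chart_dom G)"] by simp
 then show m: "inv (chart G) : mGam G \<rightarrow>\<^sub>M leb (chart_dom G)"
  by (subst measurable_cong[of _ _ p]) (use ip sG in auto)
 have "distr (mGam G) (leb (chart_dom G)) (inv (chart G))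
   = distr (distr (leb (chart_dom G)) (mGam G) (chart G)) (leb (chart_dom G)) (inv (chart G))"
  by (simp only: mGam_distr(2)[OF G])
 also have "... = distr (leb (chart_dom G)) (leb (chart_dom G)) (inv (chart G) \<circ> chart G)"
  by (rule distr_distr[OF m mGam_distr(1)[OF G]])
 also have "... = leb (chart_dom G)"
  by (simp add: comp_def i distr_id2)
 finally show "distr (mGam G) (leb (chart_dom G)) (inv (chart G)) = leb (chart_dom G)" .
qed

lemma L2_pullback:
 assumes m: "T : M \<rightarrow>\<^sub>M N" and d: "distr M N T = N" and f: "f : Lq_space 2 N"
 shows "(%x. f (T x)) : Lq_space 2 M" "L2_norm M (%x. f (T x)) = L2_norm N f"
proof -
 have fm: "f : borel_measurable N" and fi: "integrable N (%x. (f x)\<^sup>2)" using f by (auto simp: Lq_space_2)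
 have fm2: "(%x. (f x)\<^sup>2) : borel_measurable N" using fm by measurable
 show "(%x. f (T x)) : Lq_space 2 M"
  unfolding Lq_space_2 using measurable_compose[OF m fm] integrable_distr_eq[OF m fm2] fi d by simp
 have "(L2_norm M (%x. f (T x)))\<^sup>2 = (L2_norm N f)\<^sup>2"
  unfolding L2_norm_power2 using integral_distr[OF m fm2] d by simp
 then show "L2_norm M (%x. f (T x)) = L2_norm N f" by (simp add: L2_norm_nonneg)
qed

lemma space_mGam: "structural_acoustic G ==> space (mGam G) = Gam G"
 unfolding mGam_def using sets_eq_imp_space_eq[OF sets_surf] by (simp add: space_restrict_space)

lemma H20_Gam_H2: "w : H20_Gam G ==> (w \<circ> chart G) : H2 (chart_dom G)"
 by (simp add: H20_Gam_def H20_def chart_dom_def)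

lemma L2_space_cong:
 assumes "!!x. x : space M ==> f x = g x"
 shows "f : Lq_space 2 M \<longleftrightarrow> g : Lq_space 2 M"
 unfolding Lq_space_2
 using measurable_cong[of M f g borel] Bochner_Integration.integrable_cong[OF refl, of M "%x. (f x)\<^sup>2" "%x. (g x)\<^sup>2"]
  assms by auto

lemma H20_Gam_L2:
 assumes G: "structural_acoustic G" and w: "w : H20_Gam G"
 shows "w : Lq_space 2 (mGam G)"
proof -
 have "(%x. (w \<circ> chart G) (inv (chart G) x)) : Lq_space 2 (mGam G)"
  by (rule L2_pullback(1)[OF inv_chart(3,4)[OF G] H1_L2[OF H2_H1[OF H20_Gam_H2[OF w]]]])
 then have *: "(%x. w (chart G (inv (chart G) x))) : Lq_space 2 (mGam G)" by simp
 have "w : Lq_space 2 (mGam G) \<longleftrightarrow> (%x. w (chart G (inv (chart G) x))) : Lq_space 2 (mGam G)"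
  by (rule L2_space_cong) (simp add: inv_chart(2)[OF G] space_mGam[OF G])
 then show ?thesis using * by (rule iffD2)
qed

lemma lap_Gam_L2:
 assumes G: "structural_acoustic G" and w: "w : H20_Gam G"
 shows "lap_Gam G w : Lq_space 2 (mGam G)"
  "L2_norm (mGam G) (lap_Gam G w) = L2_norm (leb (chart_dom G)) (weak_laplacian (chart_dom G) (w \<circ> chart G))"
 using L2_pullback[OF inv_chart(3,4)[OF G] weak_laplacian_L2[OF H20_Gam_H2[OF w]]]
 by (simp_all add: lap_Gam_def comp_def chart_dom_def)

lemma lap_Gam_diff:
 assumes G: "structural_acoustic G" and w: "w : H20_Gam G" "v : H20_Gam G"
 shows "AE x in mGam G. lap_Gam G (%x. w x - v x) x = lap_Gam G w x - lap_Gam G v x"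
  "lap_Gam G (%x. w x - v x) : Lq_space 2 (mGam G)"
proof -
 have e: "(%x. w x - v x) \<circ> chart G = (%y. (w \<circ> chart G) y - (v \<circ> chart G) y)" by auto
 have "AE y in distr (mGam G) (leb (chart_dom G)) (inv (chart G)).
   weak_laplacian (chart_dom G) ((%x. w x - v x) \<circ> chart G) y
   = weak_laplacian (chart_dom G) (w \<circ> chart G) y - weak_laplacian (chart_dom G) (v \<circ> chart G) y"
  unfolding inv_chart(4)[OF G] e by (intro weak_laplacian_diff open_chart_dom G H20_Gam_H2 w)
 from AE_distrD[OF inv_chart(3)[OF G] this]
 show "AE x in mGam G. lap_Gam G (%x. w x - v x) x = lap_Gam G w x - lap_Gam G v x"
  by (simp add: lap_Gam_def comp_def chart_dom_def)
 have "weak_laplacian (chart_dom G) ((%x. w x - v x) \<circ> chart G) : Lq_space 2 (leb (chart_dom G))"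
  unfolding e by (intro weak_laplacian_L2 H2_diff open_chart_dom G H20_Gam_H2 w)
 from L2_pullback(1)[OF inv_chart(3,4)[OF G] this]
 show "lap_Gam G (%x. w x - v x) : Lq_space 2 (mGam G)" by (simp add: lap_Gam_def comp_def chart_dom_def)
qed

lemma H20_Gam_sup_le:
 assumes G: "structural_acoustic G"
 obtains C where "0 <= C" "!!w. w : H20_Gam G ==> AE x in mGam G. \<bar>w x\<bar> <= C * L2_norm (mGam G) (lap_Gam G w)"
proof (rule that[of "sqrt (measure lborel (chart_dom G))"])
 fix w assume w: "w : H20_Gam G"
 have "w \<circ> chart G : H20 (chart_dom G)" using w by (simp add: H20_Gam_def chart_dom_def)
 from H20_sup_le[OF open_chart_dom[OF G] bounded_chart_dom[OF G] this]
 have "AE y in distr (mGam G) (leb (chart_dom G)) (inv (chart G)). \<bar>(w \<circ> chart G) y\<bar> <= sqrt (measure lborel (chart_dom G)) * L2_norm (mGam G) (lap_Gam G w)"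
  unfolding inv_chart(4)[OF G] lap_Gam_L2(2)[OF G w] .
 from AE_distrD[OF inv_chart(3)[OF G] this]
 have "AE x in mGam G. \<bar>w (chart G (inv (chart G) x))\<bar> <= sqrt (measure lborel (chart_dom G)) * L2_norm (mGam G) (lap_Gam G w)" by simp
 then show "AE x in mGam G. \<bar>w x\<bar> <= sqrt (measure lborel (chart_dom G)) * L2_norm (mGam G) (lap_Gam G w)"
  by (rule AE_mp) (rule AE_I2, use inv_chart(2)[OF G] space_mGam[OF G] in simp)
qed simp

text \<open>A restarted plate displacement meets the old one only almost everywhere; the Laplacians
  nevertheless coincide as functions.\<close>

lemma lap_Gam_cong_AE:
 assumes G: "structural_acoustic G" and w: "AE x in mGam G. w x = v x"
  "(w \<circ> chart G) : borel_measurable (leb (chart_dom G))" "(v \<circ> chart G) : borel_measurable (leb (chart_dom G))"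
 shows "lap_Gam G w = lap_Gam G v"
proof -
 have Vb: "chart_dom G : sets borel" using open_chart_dom[OF G] by auto
 have "AE x in distr (leb (chart_dom G)) (mGam G) (chart G). w x = v x" unfolding mGam_distr(2)[OF G] by (rule w(1))
 from AE_distrD[OF mGam_distr(1)[OF G] this]
 have "AE y in leb (chart_dom G). (w \<circ> chart G) y = (v \<circ> chart G) y" by simp
 from weak_pd_cong_AE[OF Vb this w(2,3)]
 have "weak_laplacian (chart_dom G) (w \<circ> chart G) = weak_laplacian (chart_dom G) (v \<circ> chart G)"
  by (simp add: weak_laplacian_def[abs_def])
 then show ?thesis by (simp add: lap_Gam_def chart_dom_def)
qed

section \<open>Integrals over time intervals\<close>

text \<open>Open intervals make values at end points and junctions irrelevant;
  \<open>time_integral\<close> differs only by the two end points.\<close>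

definition tint :: "real => real => (real => real) => bool" where
 "tint a b f \<longleftrightarrow> integrable lborel (%s. indicator {a<..<b} s * f s)"

definition J :: "real => real => (real => real) => real" where
 "J a b f = (\<integral>s. indicator {a<..<b} s * f s \<partial>lborel)"

lemma lborel_discrete_difference:
 fixes f g :: "real => real"
 assumes "countable X" "!!x. x \<notin> X ==> f x = g x"
 shows "integrable lborel f \<longleftrightarrow> integrable lborel g" "integral\<^sup>L lborel f = integral\<^sup>L lborel g"
proof -
 show "integrable lborel f \<longleftrightarrow> integrable lborel g"
  by (rule integrable_discrete_difference[where X = X]) (use assms in auto)
 show "integral\<^sup>L lborel f = integral\<^sup>L lborel g"
  by (rule integral_discrete_difference[where X = X]) (use assms in auto)
qed

lemma tint_leb: "integrable (leb {0<..<t}) f \<longleftrightarrow> tint 0 t f" "(\<integral>s. f s \<partial>leb {0<..<t}) = J 0 t f"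
 by (simp_all add: tint_def J_def integrable_leb integral_leb)

lemma time_integral_J: "integrable (leb {0..t}) f \<longleftrightarrow> tint 0 t f" "time_integral t f = J 0 t f"
proof -
 have e: "indicator {0..t} s * f s = indicator {0<..<t} s * f s" if "s \<notin> {0, t}" for s
  using that by (auto simp: indicator_def)
 show "integrable (leb {0..t}) f \<longleftrightarrow> tint 0 t f"
  unfolding tint_def integrable_leb[of "{0..t}", OF borel_closed[OF closed_atLeastAtMost]]
  by (rule lborel_discrete_difference(1)[where X = "{0, t}"]) (simp, erule e)
 show "time_integral t f = J 0 t f"
  unfolding J_def integral_leb[of "{0..t}", OF borel_closed[OF closed_atLeastAtMost]]
  by (rule lborel_discrete_difference(2)[where X = "{0, t}"]) (simp, erule e)
qed

lemma tint_cong: "(!!s. a < s ==> s < b ==> f s = g s) ==> tint a b f \<longleftrightarrow> tint a b g"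
 unfolding tint_def by (rule arg_cong[where f = "integrable lborel"]) (auto simp: indicator_def)

lemma J_cong: "(!!s. a < s ==> s < b ==> f s = g s) ==> J a b f = J a b g"
 unfolding J_def by (rule arg_cong[where f = "integral\<^sup>L lborel"]) (auto simp: indicator_def)

lemma tint_subset:
 assumes "tint a b f" "a <= a'" "b' <= b"
 shows "tint a' b' f"
proof -
 have "integrable lborel (%s. indicator {a'<..<b'} s *\<^sub>R (indicator {a<..<b} s * f s))"
  using assms(1) unfolding tint_def by (intro integrable_mult_indicator) auto
 moreover have "(%s. indicator {a'<..<b'} s *\<^sub>R (indicator {a<..<b} s * f s)) = (%s. indicator {a'<..<b'} s * f s)"
  by (rule ext) (use assms in \<open>auto simp: indicator_def\<close>)
 ultimately show ?thesis by (simp only: tint_def)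
qed

text \<open>Both pieces must be integrable: a divergent integral has the default value
  \<open>0\<close>, for which additivity can fail.\<close>

lemma J_split:
 assumes "a <= b" "b <= c" "tint a b f" "tint b c f"
 shows "tint a c f" "J a c f = J a b f + J b c f"
proof -
 have e: "indicator {a<..<b} s * f s + indicator {b<..<c} s * f s = indicator {a<..<c} s * f s" if "s \<notin> {b}" for s
  using that assms(1,2) by (auto simp: indicator_def)
 note i = assms(3,4)[unfolded tint_def]
 note dd = lborel_discrete_difference[of "{b}" "%s. indicator {a<..<b} s * f s + indicator {b<..<c} s * f s"
   "%s. indicator {a<..<c} s * f s", OF _ e, simplified]
 have "integrable lborel (%s. indicator {a<..<b} s * f s + indicator {b<..<c} s * f s)"
  by (rule Bochner_Integration.integrable_add[OF i])
 then show "tint a c f" unfolding tint_def by (rule dd(1)[THEN iffD1])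
 have "J a c f = (\<integral>s. indicator {a<..<b} s * f s + indicator {b<..<c} s * f s \<partial>lborel)"
  unfolding J_def by (rule dd(2)[symmetric])
 also have "... = J a b f + J b c f"
  unfolding J_def by (rule Bochner_Integration.integral_add[OF i])
 finally show "J a c f = J a b f + J b c f" .
qed

lemma tint_shift: "tint a b (%s. f (c + s)) \<longleftrightarrow> tint (c + a) (c + b) f"
proof -
 have "tint (c + a) (c + b) f \<longleftrightarrow> integrable lborel (%s. indicator {c + a<..<c + b} (c + 1 * s) * f (c + 1 * s))"
  unfolding tint_def by (subst lborel_integrable_real_affine_iff[symmetric, of 1 _ c]) auto
 also have "... \<longleftrightarrow> tint a b (%s. f (c + s))"
  unfolding tint_def by (rule arg_cong[where f = "integrable lborel"]) (auto simp: indicator_def)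
 finally show ?thesis ..
qed

lemma J_shift: "J a b (%s. f (c + s)) = J (c + a) (c + b) f"
proof -
 have "J (c + a) (c + b) f = (\<integral>s. indicator {c + a<..<c + b} (c + 1 * s) * f (c + 1 * s) \<partial>lborel)"
  unfolding J_def by (subst lborel_integral_real_affine[of 1 _ c]) auto
 also have "... = J a b (%s. f (c + s))"
  unfolding J_def by (rule arg_cong[where f = "integral\<^sup>L lborel"]) (auto simp: indicator_def)
 finally show ?thesis ..
qed

lemma tint_reflect: "tint a b (%s. f (c - s)) \<longleftrightarrow> tint (c - b) (c - a) f"
proof -
 have "tint (c - b) (c - a) f \<longleftrightarrow> integrable lborel (%s. indicator {c - b<..<c - a} (c + (-1) * s) * f (c + (-1) * s))"
  unfolding tint_def by (subst lborel_integrable_real_affine_iff[symmetric, of "-1" _ c]) auto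
 also have "... \<longleftrightarrow> tint a b (%s. f (c - s))"
  unfolding tint_def by (rule arg_cong[where f = "integrable lborel"]) (auto simp: indicator_def)
 finally show ?thesis ..
qed

lemma J_reflect: "J a b (%s. f (c - s)) = J (c - b) (c - a) f"
proof -
 have "J (c - b) (c - a) f = (\<integral>s. indicator {c - b<..<c - a} (c + (-1) * s) * f (c + (-1) * s) \<partial>lborel)"
  unfolding J_def by (subst lborel_integral_real_affine[of "-1" _ c]) auto
 also have "... = J a b (%s. f (c - s))"
  unfolding J_def by (rule arg_cong[where f = "integral\<^sup>L lborel"]) (auto simp: indicator_def)
 finally show ?thesis ..
qed

lemma J_minus: "J a b (%s. - f s) = - J a b f" "tint a b f ==> tint a b (%s. - f s)"
 unfolding J_def tint_def by simp_all

text \<open>Extended nonnegative values permit comparison before integrability is known.\<close>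

definition NJ :: "real => real => (real => ennreal) => ennreal" where
 "NJ a b f = (\<integral>\<^sup>+s. f s * indicator {a<..<b} s \<partial>lborel)"

lemma NJ_leb: "(\<integral>\<^sup>+s. f s \<partial>leb {a<..<b}) = NJ a b f"
 unfolding NJ_def by (rule nn_integral_leb) simp

lemma NJ_mono: "(!!s. a < s ==> s < b ==> f s <= g s) ==> NJ a b f <= NJ a b g"
 unfolding NJ_def by (intro nn_integral_mono) (auto simp: indicator_def)

lemma NJ_subset: "a <= a' ==> b' <= b ==> NJ a' b' f <= NJ a b f"
 unfolding NJ_def by (intro nn_integral_mono) (auto simp: indicator_def)

lemma J_eq_NJ:
 assumes "tint a b f" "!!s. a < s ==> s < b ==> 0 <= f s"
 shows "ennreal (J a b f) = NJ a b (%s. ennreal (f s))"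
proof -
 have "NJ a b (%s. ennreal (f s)) = (\<integral>\<^sup>+s. ennreal (indicator {a<..<b} s * f s) \<partial>lborel)"
  unfolding NJ_def by (rule nn_integral_cong) (auto simp: indicator_def)
 also have "... = ennreal (J a b f)"
  unfolding J_def by (rule nn_integral_eq_integral) (use assms in \<open>auto simp: tint_def indicator_def\<close>)
 finally show ?thesis ..
qed

lemma J_mono:
 assumes "tint a b f" "tint a b g" "!!s. a < s ==> s < b ==> f s <= g s"
 shows "J a b f <= J a b g"
 unfolding J_def by (rule integral_mono) (use assms in \<open>auto simp: tint_def indicator_def\<close>)

lemma continuous_tint:
 assumes "continuous_on {a..b} f"
 shows "tint a b f"
proof -
 have "integrable lborel (%s. indicator {a..b} s *\<^sub>R f s)" by (intro borel_integrable_compact assms) auto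
 then have "integrable lborel (%s. indicator {a<..<b} s *\<^sub>R (indicator {a..b} s *\<^sub>R f s))"
  by (rule integrable_mult_indicator[rotated]) simp
 moreover have "(%s. indicator {a<..<b} s *\<^sub>R (indicator {a..b} s *\<^sub>R f s)) = (%s. indicator {a<..<b} s * f s)"
  by (rule ext) (auto simp: indicator_def)
 ultimately show ?thesis by (simp only: tint_def)
qed

section \<open>Change of the time variable\<close>

text \<open>At \<open>T\<close> the first path wins and \<open>v 0\<close> is discarded, so
  agreement at the junction matters only up to null sets.\<close>

definition concat_time :: "real => (real => 'a) => (real => 'a) => real => 'a" where
 "concat_time T u v s = (if s <= T then u s else v (s - T))"

lemma C_time_iff:
 "u : C_time T X N \<longleftrightarrow> (ALL t:{0..T}. u t : X) &
  (ALL t:{0..T}. ALL e>0. EX d>0. ALL s:{0..T}. s ~= t --> \<bar>s - t\<bar> < d --> \<bar>N (%x. u s x - u t x)\<bar> < e)"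
 unfolding C_time_def Lim_within dist_real_def by (simp add: ball_conj_distrib imp_conjL)

lemma C_time_mem: "u : C_time T X N ==> 0 <= t ==> t <= T ==> u t : X"
 by (simp add: C_time_def)

lemma C_time_shift:
 assumes "u : C_time T X N" "0 <= a" "a + b <= T"
 shows "(%s. u (a + s)) : C_time b X N"
 unfolding C_time_iff
proof (intro conjI ballI allI impI)
 show "u (a + t) : X" if "t : {0..b}" for t using assms that by (auto intro: C_time_mem)
 fix t e :: real assume t: "t : {0..b}" and e: "e > 0"
 then have "a + t : {0..T}" using assms by auto
 then obtain d where "d > 0" "!!s. s : {0..T} ==> s ~= a + t ==> \<bar>s - (a + t)\<bar> < d ==> \<bar>N (%x. u s x - u (a + t) x)\<bar> < e"
  using assms(1) e unfolding C_time_iff by blast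
 then show "EX d>0. ALL s:{0..b}. s ~= t --> \<bar>s - t\<bar> < d --> \<bar>N (%x. u (a + s) x - u (a + t) x)\<bar> < e"
  using assms(2,3) by (intro exI[of _ d]) auto
qed

lemma C_time_reverse:
 assumes "u : C_time T X N"
 shows "(%s. u (T - s)) : C_time T X N"
 unfolding C_time_iff
proof (intro conjI ballI allI impI)
 show "u (T - t) : X" if "t : {0..T}" for t using assms that by (auto intro: C_time_mem)
 fix t e :: real assume t: "t : {0..T}" and e: "e > 0"
 then have "T - t : {0..T}" by auto
 then obtain d where "d > 0" "!!s. s : {0..T} ==> s ~= T - t ==> \<bar>s - (T - t)\<bar> < d ==> \<bar>N (%x. u s x - u (T - t) x)\<bar> < e"
  using assms(1) e unfolding C_time_iff by blast
 then show "EX d>0. ALL s:{0..T}. s ~= t --> \<bar>s - t\<bar> < d --> \<bar>N (%x. u (T - s) x - u (T - t) x)\<bar> < e"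
  by (intro exI[of _ d]) auto
qed

text \<open>The junction condition speaks of norms because \<open>v 0\<close> and \<open>u T\<close>
  may differ as functions.\<close>

lemma C_time_concat:
 assumes u: "u : C_time T X N" and v: "v : C_time ta X N" and T: "0 <= T" "0 < ta"
  and junction: "!!s. 0 < s ==> s <= ta ==> N (%x. v s x - u T x) = N (%x. v s x - v 0 x)"
 shows "concat_time T u v : C_time (T + ta) X N"
 unfolding C_time_iff
proof (intro conjI ballI allI impI)
 let ?w = "concat_time T u v"
 show "?w t : X" if "t : {0..T + ta}" for t
  using that u v T by (auto simp: concat_time_def intro: C_time_mem)
 fix t e :: real assume t: "t : {0..T + ta}" and e: "e > 0"
 have U: "EX d>0. ALL s:{0..T}. s ~= t --> \<bar>s - t\<bar> < d --> \<bar>N (%x. u s x - u t x)\<bar> < e" if "t <= T"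
  using u t e that unfolding C_time_iff by auto
 have V: "EX d>0. ALL s:{0..ta}. s ~= t - T --> \<bar>s - (t - T)\<bar> < d --> \<bar>N (%x. v s x - v (t - T) x)\<bar> < e" if "t >= T"
 proof -
  have "t - T : {0..ta}" using t that by auto
  then show ?thesis using v e unfolding C_time_iff by blast
 qed
 consider "t < T" | "t > T" | "t = T" by linarith
 then show "EX d>0. ALL s:{0..T + ta}. s ~= t --> \<bar>s - t\<bar> < d --> \<bar>N (%x. ?w s x - ?w t x)\<bar> < e"
 proof cases
  case 1
  then obtain d where "d > 0" "ALL s:{0..T}. s ~= t --> \<bar>s - t\<bar> < d --> \<bar>N (%x. u s x - u t x)\<bar> < e" using U by auto
  then show ?thesis using 1 by (intro exI[of _ "min d (T - t)"]) (auto simp: concat_time_def)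
 next
  case 2
  then obtain d where d: "d > 0" "!!s. s : {0..ta} ==> s ~= t - T ==> \<bar>s - (t - T)\<bar> < d ==> \<bar>N (%x. v s x - v (t - T) x)\<bar> < e" using V by auto
  have "\<bar>N (%x. ?w s x - ?w t x)\<bar> < e" if "s : {0..T + ta}" "s ~= t" "\<bar>s - t\<bar> < min d (t - T)" for s
   using d(2)[of "s - T"] that 2 by (auto simp: concat_time_def)
  then show ?thesis using 2 d(1) by (intro exI[of _ "min d (t - T)"]) auto
 next
  case 3
  then obtain d where d: "d > 0" "ALL s:{0..T}. s ~= t --> \<bar>s - t\<bar> < d --> \<bar>N (%x. u s x - u t x)\<bar> < e" using U by auto
  obtain d' where d': "d' > 0" "!!s. s : {0..ta} ==> s ~= 0 ==> \<bar>s\<bar> < d' ==> \<bar>N (%x. v s x - v 0 x)\<bar> < e" using V 3 by auto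
  have "\<bar>N (%x. ?w s x - ?w t x)\<bar> < e" if "s : {0..T + ta}" "s ~= t" "\<bar>s - t\<bar> < min d d'" for s
  proof (cases "s <= T")
   case True
   then show ?thesis using d(2) that 3 by (auto simp: concat_time_def)
  next
   case False
   then show ?thesis using d'(2)[of "s - T"] that 3 junction[of "s - T"] by (auto simp: concat_time_def)
  qed
  then show ?thesis using d(1) d'(1) by (intro exI[of _ "min d d'"]) auto
 qed
qed

subsection \<open>Joint measurability\<close>

abbreviation st_measurable :: "real => 'a measure => (real => 'a => real) => bool" where
 "st_measurable T M v \<equiv> case_prod v : borel_measurable (leb {0<..<T} \<Otimes>\<^sub>M M)"

lemma measurable_leb_interval:
 assumes "g : N \<rightarrow>\<^sub>M borel" "!!z. z : space N ==> a < g z & g z < (b::real)"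
 shows "g : N \<rightarrow>\<^sub>M leb {a<..<b}"
proof -
 have "sets (leb {a<..<b}) = sets (restrict_space borel {a<..<b})" by (simp add: leb_def sets_restrict_space)
 moreover have "g : N \<rightarrow>\<^sub>M restrict_space borel {a<..<b}"
  by (rule measurable_restrict_space2) (use assms in auto)
 ultimately show ?thesis using measurable_cong_sets[of N N "leb {a<..<b}"] by simp
qed

lemma measurable_id_leb: "(%s. s) : leb {a<..<b} \<rightarrow>\<^sub>M (borel :: real measure)"
 unfolding leb_def by (rule measurable_restrict_space1) simp

lemma st_measurable_compose:
 assumes v: "st_measurable T M v" and h: "h : leb {0<..<T'} \<rightarrow>\<^sub>M leb {0<..<T}"
 shows "st_measurable T' M (%s. v (h s))"
proof -
 have "(%p. (h (fst p), snd p)) : leb {0<..<T'} \<Otimes>\<^sub>M M \<rightarrow>\<^sub>M leb {0<..<T} \<Otimes>\<^sub>M M"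
  by (intro measurable_Pair measurable_compose[OF measurable_fst h] measurable_snd)
 from measurable_compose[OF this v] show ?thesis by (simp add: case_prod_beta)
qed

lemma st_measurable_shift:
 assumes v: "st_measurable T M v" and ab: "0 <= a" "a + b <= T"
 shows "st_measurable b M (%s. v (a + s))"
proof (rule st_measurable_compose[OF v])
 have "(%s. a + s) : leb {0<..<b} \<rightarrow>\<^sub>M borel"
  by (rule borel_measurable_add[OF borel_measurable_const measurable_id_leb])
 then show "(%s. a + s) : leb {0<..<b} \<rightarrow>\<^sub>M leb {0<..<T}"
  by (rule measurable_leb_interval) (use ab in \<open>auto simp: space_leb\<close>)
qed

lemma st_measurable_reverse:
 assumes v: "st_measurable T M v"
 shows "st_measurable T M (%s. v (T - s))"
proof (rule st_measurable_compose[OF v])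
 have "(%s. T - s) : leb {0<..<T} \<rightarrow>\<^sub>M borel"
  by (rule borel_measurable_diff[OF borel_measurable_const measurable_id_leb])
 then show "(%s. T - s) : leb {0<..<T} \<rightarrow>\<^sub>M leb {0<..<T}"
  by (rule measurable_leb_interval) (auto simp: space_leb)
qed

text \<open>Extension by zero puts all time intervals on one product space, where shifted paths can
  be added.\<close>

lemma st_measurable_ext:
 "st_measurable T M v \<longleftrightarrow> (%p. indicator {0<..<T} (fst p) * v (fst p) (snd p)) : borel_measurable (borel \<Otimes>\<^sub>M M)"
proof
 assume v: "st_measurable T M v"
 let ?R = "restrict_space (borel \<Otimes>\<^sub>M M) ({0<..<T} \<times> space M)"
 have "(%p. (fst p, snd p)) : ?R \<rightarrow>\<^sub>M leb {0<..<T} \<Otimes>\<^sub>M M"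
 proof (rule measurable_Pair)
  show "(%p. fst p) : ?R \<rightarrow>\<^sub>M leb {0<..<T}"
   by (rule measurable_leb_interval, rule measurable_restrict_space1, rule measurable_fst) (auto simp: space_restrict_space)
  show "(%p. snd p) : ?R \<rightarrow>\<^sub>M M" by (rule measurable_restrict_space1, rule measurable_snd)
 qed
 from measurable_compose[OF this v] have "(%p. v (fst p) (snd p)) : borel_measurable ?R" by (simp add: case_prod_beta')
 moreover have S: "{0<..<T} \<times> space M \<inter> space (borel \<Otimes>\<^sub>M M) : sets (borel \<Otimes>\<^sub>M M)"
  by (simp add: space_pair_measure)
 ultimately have *: "(%p. indicator ({0<..<T} \<times> space M) p *\<^sub>R v (fst p) (snd p)) : borel_measurable (borel \<Otimes>\<^sub>M M)"
  by (subst (asm) borel_measurable_restrict_space_iff[OF S]) auto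
 show "(%p. indicator {0<..<T} (fst p) * v (fst p) (snd p)) : borel_measurable (borel \<Otimes>\<^sub>M M)"
  by (rule measurable_cong[THEN iffD1, OF _ *]) (auto simp: space_pair_measure indicator_def)
next
 assume v: "(%p. indicator {0<..<T} (fst p) * v (fst p) (snd p)) : borel_measurable (borel \<Otimes>\<^sub>M M)"
 have "(%p. (fst p, snd p)) : leb {0<..<T} \<Otimes>\<^sub>M M \<rightarrow>\<^sub>M borel \<Otimes>\<^sub>M M"
  by (intro measurable_Pair measurable_compose[OF measurable_fst measurable_id_leb] measurable_snd)
 from measurable_compose[OF this v]
 have *: "(%p. indicator {0<..<T} (fst p) * v (fst p) (snd p)) : borel_measurable (leb {0<..<T} \<Otimes>\<^sub>M M)" by simp
 show "st_measurable T M v"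
  by (rule measurable_cong[THEN iffD1, OF _ *]) (auto simp: space_pair_measure space_leb)
qed

lemma st_measurable_concat:
 assumes u: "st_measurable T M u" and v: "st_measurable ta M v" and T: "0 <= T" "0 < ta" and uT: "T > 0 ==> u T : borel_measurable M"
 shows "st_measurable (T + ta) M (concat_time T u v)"
 unfolding st_measurable_ext
proof -
 note u' = u[unfolded st_measurable_ext]
 have "(%p. (fst p - T, snd p)) : borel \<Otimes>\<^sub>M M \<rightarrow>\<^sub>M borel \<Otimes>\<^sub>M M" by measurable
 from measurable_compose[OF this v[unfolded st_measurable_ext]]
 have v': "(%p. indicator {0<..<ta} (fst p - T) * v (fst p - T) (snd p)) : borel_measurable (borel \<Otimes>\<^sub>M M)" by simp
 \<comment> \<open>The open intervals on both sides miss the slice at \<open>T\<close>; it is added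
   separately and needs a measurable \<open>u T\<close>.\<close>
 have m: "(%p. if T > 0 then indicator {T} (fst p) * u T (snd p) else 0) : borel_measurable (borel \<Otimes>\<^sub>M M)"
 proof (cases "T > 0")
  case True
  have "(%p. u T (snd p)) : borel_measurable (borel \<Otimes>\<^sub>M M)" using uT[OF True] by measurable
  moreover have "(%p. indicator {T} (fst p) :: real) : borel_measurable (borel \<Otimes>\<^sub>M M)" by measurable
  ultimately have "(%p. indicator {T} (fst p) * u T (snd p)) : borel_measurable (borel \<Otimes>\<^sub>M M)"
   by (rule borel_measurable_times[rotated])
  then show ?thesis by (simp only: True if_True)
 qed simp
 show "(%p. indicator {0<..<T + ta} (fst p) * concat_time T u v (fst p) (snd p)) : borel_measurable (borel \<Otimes>\<^sub>M M)"
  by (rule measurable_cong[THEN iffD1, OF _ borel_measurable_add[OF borel_measurable_add[OF u' v'] m]])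
   (use T in \<open>auto simp: concat_time_def indicator_def\<close>)
qed

lemma st_measurable_section:
 assumes "st_measurable T M v" "0 < s" "s < T"
 shows "v s : borel_measurable M"
proof -
 have "(%x. (s, x)) : M \<rightarrow>\<^sub>M leb {0<..<T} \<Otimes>\<^sub>M M"
  using assms(2,3) by (intro measurable_Pair1') (simp add: space_leb)
 from measurable_compose[OF this assms(1)] show ?thesis by simp
qed

lemma (in sigma_finite_measure) st_nn_integral:
 assumes "st_measurable T M v" "F : borel_measurable borel"
 shows "(%s. \<integral>\<^sup>+x. F (v s x) \<partial>M) : borel_measurable (leb {0<..<T})"
  "(\<integral>\<^sup>+p. F (v (fst p) (snd p)) \<partial>(leb {0<..<T} \<Otimes>\<^sub>M M)) = NJ 0 T (%s. \<integral>\<^sup>+x. F (v s x) \<partial>M)"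
proof -
 have m: "(%p. F (v (fst p) (snd p))) : borel_measurable (leb {0<..<T} \<Otimes>\<^sub>M M)"
  using measurable_compose[OF assms] by (simp add: case_prod_beta)
 show "(%s. \<integral>\<^sup>+x. F (v s x) \<partial>M) : borel_measurable (leb {0<..<T})"
  using borel_measurable_nn_integral_fst[OF m] by simp
 show "(\<integral>\<^sup>+p. F (v (fst p) (snd p)) \<partial>(leb {0<..<T} \<Otimes>\<^sub>M M)) = NJ 0 T (%s. \<integral>\<^sup>+x. F (v s x) \<partial>M)"
  using nn_integral_fst[OF m] by (simp add: NJ_leb)
qed

text \<open>By Tonelli, integrability in space-time becomes finiteness of a one-dimensional
  integral, which shifts, reflects and splits easily.\<close>

lemma (in sigma_finite_measure) Lq_spacetime_iff:
 "v : Lq_spacetime T M q \<longleftrightarrow> st_measurable T M v & NJ 0 T (%s. \<integral>\<^sup>+x. ennreal (\<bar>v s x\<bar> powr q) \<partial>M) < \<infinity>"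
proof -
 have "integrable (leb {0<..<T} \<Otimes>\<^sub>M M) (%p. \<bar>case_prod v p\<bar> powr q) \<longleftrightarrow> NJ 0 T (%s. \<integral>\<^sup>+x. ennreal (\<bar>v s x\<bar> powr q) \<partial>M) < \<infinity>"
  if v: "st_measurable T M v"
 proof -
  have "(%p. \<bar>case_prod v p\<bar> powr q) : borel_measurable (leb {0<..<T} \<Otimes>\<^sub>M M)" using v by measurable
  then have "integrable (leb {0<..<T} \<Otimes>\<^sub>M M) (%p. \<bar>case_prod v p\<bar> powr q)
    \<longleftrightarrow> (\<integral>\<^sup>+p. ennreal (\<bar>v (fst p) (snd p)\<bar> powr q) \<partial>(leb {0<..<T} \<Otimes>\<^sub>M M)) < \<infinity>"
   by (simp add: integrable_iff_bounded case_prod_beta)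
  also have "(\<integral>\<^sup>+p. ennreal (\<bar>v (fst p) (snd p)\<bar> powr q) \<partial>(leb {0<..<T} \<Otimes>\<^sub>M M)) = NJ 0 T (%s. \<integral>\<^sup>+x. ennreal (\<bar>v s x\<bar> powr q) \<partial>M)"
   by (rule st_nn_integral(2)[OF v]) measurable
  finally show ?thesis .
 qed
 then show ?thesis by (auto simp: Lq_spacetime_def Lq_space_def)
qed

lemma borel_measurable_leb_ennreal:
 fixes f :: "real => ennreal"
 assumes "f : borel_measurable (leb {a<..<b})"
 shows "(%s. f s * indicator {a<..<b} s) : borel_measurable borel"
 using assms unfolding leb_def by (subst (asm) borel_measurable_restrict_space_iff_ennreal) auto

lemma NJ_shift: "NJ a b (%s. f (c + s)) = NJ (c + a) (c + b) f" if "f : borel_measurable (leb {c + a<..<c + b})"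
proof -
 have m: "(%s. f s * indicator {c + a<..<c + b} s) : borel_measurable borel"
  by (rule borel_measurable_leb_ennreal[OF that])
 have "NJ (c + a) (c + b) f = (\<integral>\<^sup>+s. f (c + s) * indicator {c + a<..<c + b} (c + s) \<partial>lborel)"
  unfolding NJ_def by (rule nn_integral_translate[OF m, symmetric])
 also have "... = NJ a b (%s. f (c + s))" unfolding NJ_def by (rule nn_integral_cong) (auto simp: indicator_def)
 finally show ?thesis ..
qed

lemma NJ_reflect: "NJ a b (%s. f (c - s)) = NJ (c - b) (c - a) f" if "f : borel_measurable (leb {c - b<..<c - a})"
proof -
 have m: "(%s. f s * indicator {c - b<..<c - a} s) : borel_measurable borel"
  by (rule borel_measurable_leb_ennreal[OF that])
 have "NJ (c - b) (c - a) f = (\<integral>\<^sup>+s. f (c - s) * indicator {c - b<..<c - a} (c - s) \<partial>lborel)"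
  unfolding NJ_def by (rule nn_integral_reflect[OF m, symmetric])
 also have "... = NJ a b (%s. f (c - s))" unfolding NJ_def by (rule nn_integral_cong) (auto simp: indicator_def)
 finally show ?thesis ..
qed

lemma (in sigma_finite_measure) Lq_spacetime_shift:
 assumes v: "v : Lq_spacetime T M q" and ab: "0 <= a" "a + b <= T"
 shows "(%s. v (a + s)) : Lq_spacetime b M q"
proof -
 have m: "st_measurable T M v" and f: "NJ 0 T (%s. \<integral>\<^sup>+x. ennreal (\<bar>v s x\<bar> powr q) \<partial>M) < \<infinity>"
  using v by (auto simp: Lq_spacetime_iff)
 let ?F = "%s. \<integral>\<^sup>+x. ennreal (\<bar>v s x\<bar> powr q) \<partial>M"
 have Fm: "?F : borel_measurable (leb {0<..<T})" by (rule st_nn_integral(1)[OF m]) measurable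
 have "(%s. s) : leb {a + 0<..<a + b} \<rightarrow>\<^sub>M leb {0<..<T}"
  by (rule measurable_leb_interval[OF measurable_id_leb]) (use ab in \<open>auto simp: space_leb\<close>)
 from measurable_compose[OF this Fm] have "NJ 0 b (%s. ?F (a + s)) = NJ (a + 0) (a + b) ?F" by (rule NJ_shift)
 also have "... <= NJ 0 T ?F" using ab by (intro NJ_subset) auto
 finally show ?thesis using st_measurable_shift[OF m ab] f by (auto simp: Lq_spacetime_iff intro: order_le_less_trans)
qed

lemma (in sigma_finite_measure) Lq_spacetime_reverse:
 assumes v: "v : Lq_spacetime T M q"
 shows "(%s. v (T - s)) : Lq_spacetime T M q"
proof -
 have m: "st_measurable T M v" and f: "NJ 0 T (%s. \<integral>\<^sup>+x. ennreal (\<bar>v s x\<bar> powr q) \<partial>M) < \<infinity>"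
  using v by (auto simp: Lq_spacetime_iff)
 let ?F = "%s. \<integral>\<^sup>+x. ennreal (\<bar>v s x\<bar> powr q) \<partial>M"
 have Fm: "?F : borel_measurable (leb {T - T<..<T - 0})" using st_nn_integral(1)[OF m, of "%y. ennreal (\<bar>y\<bar> powr q)"] by simp
 have "NJ 0 T (%s. ?F (T - s)) = NJ (T - T) (T - 0) ?F" by (rule NJ_reflect[OF Fm])
 then show ?thesis using st_measurable_reverse[OF m] f by (simp add: Lq_spacetime_iff)
qed

lemma NJ_split_le:
 assumes "a <= b" "b <= c" "f : borel_measurable (leb {a<..<b})" "f : borel_measurable (leb {b<..<c})"
 shows "NJ a c f <= NJ a b f + NJ b c f"
proof -
 have m: "(%s. f s * indicator {a<..<b} s) : borel_measurable borel" "(%s. f s * indicator {b<..<c} s) : borel_measurable borel"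
  by (rule borel_measurable_leb_ennreal[OF assms(3)], rule borel_measurable_leb_ennreal[OF assms(4)])
 have "NJ a c f = (\<integral>\<^sup>+s. f s * indicator {a<..<b} s + f s * indicator {b<..<c} s \<partial>lborel)"
  unfolding NJ_def
  by (rule nn_integral_cong_AE, rule AE_mp[OF AE_lborel_singleton[of b]], rule AE_I2)
   (use assms(1,2) in \<open>auto simp: indicator_def\<close>)
 also have "... = NJ a b f + NJ b c f" unfolding NJ_def using m by (intro nn_integral_add) auto
 finally show ?thesis by simp
qed

lemma (in sigma_finite_measure) Lq_spacetime_concat:
 assumes u: "u : Lq_spacetime T M q" and v: "v : Lq_spacetime ta M q" and T: "0 <= T" "0 < ta"
  and uT: "T > 0 ==> u T : borel_measurable M"
 shows "concat_time T u v : Lq_spacetime (T + ta) M q"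
proof -
 have um: "st_measurable T M u" and uf: "NJ 0 T (%s. \<integral>\<^sup>+x. ennreal (\<bar>u s x\<bar> powr q) \<partial>M) < \<infinity>"
  and vm: "st_measurable ta M v" and vf: "NJ 0 ta (%s. \<integral>\<^sup>+x. ennreal (\<bar>v s x\<bar> powr q) \<partial>M) < \<infinity>"
  using u v by (auto simp: Lq_spacetime_iff)
 let ?w = "concat_time T u v"
 have wm: "st_measurable (T + ta) M ?w" by (rule st_measurable_concat[OF um vm T uT])
 let ?F = "%s. \<integral>\<^sup>+x. ennreal (\<bar>?w s x\<bar> powr q) \<partial>M"
 have Fm: "?F : borel_measurable (leb {0<..<T + ta})" by (rule st_nn_integral(1)[OF wm]) measurable
 have sub: "?F : borel_measurable (leb {a<..<b})" if "0 <= a" "b <= T + ta" for a b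
 proof -
  have "(%s. s) : leb {a<..<b} \<rightarrow>\<^sub>M leb {0<..<T + ta}"
   by (rule measurable_leb_interval[OF measurable_id_leb]) (use that in \<open>auto simp: space_leb\<close>)
  from measurable_compose[OF this Fm] show ?thesis .
 qed
 let ?A = "NJ 0 T (%s. \<integral>\<^sup>+x. ennreal (\<bar>u s x\<bar> powr q) \<partial>M)" and ?B = "NJ 0 ta (%s. \<integral>\<^sup>+x. ennreal (\<bar>v s x\<bar> powr q) \<partial>M)"
 have 1: "NJ 0 (T + ta) ?F <= NJ 0 T ?F + NJ T (T + ta) ?F"
  by (rule NJ_split_le) (use T sub in auto)
 have 2: "NJ 0 T ?F <= ?A"
  by (rule NJ_mono) (simp add: concat_time_def)
 have "NJ T (T + ta) ?F = NJ 0 ta (%s. ?F (T + s))"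
  using NJ_shift[of ?F T 0 ta] sub[of T "T + ta"] T by simp
 also have "... <= ?B"
  by (rule NJ_mono) (simp add: concat_time_def)
 finally have "NJ 0 (T + ta) ?F <= ?A + ?B" using order_trans[OF 1 add_mono[OF 2]] by blast
 moreover have "?A + ?B < \<infinity>" using uf vf by simp
 ultimately have "NJ 0 (T + ta) ?F < \<infinity>" by (rule order_le_less_trans)
 then show ?thesis using wm by (simp add: Lq_spacetime_iff)
qed

section \<open>Time derivatives\<close>

lemma L1_L2_iff:
 "v : L1_L2 T M \<longleftrightarrow> st_measurable T M v & (AE s in lborel. s : {0<..<T} --> v s : Lq_space 2 M) & tint 0 T (%s. L2_norm M (v s))"
 by (simp add: L1_L2_def AE_leb tint_leb)

lemma time_deriv_iff:
 "time_deriv T M u v \<longleftrightarrow> v : L1_L2 T M &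
  (ALL t:{0..T}. AE x in M. tint 0 t (%s. v s x) & u t x = u 0 x + J 0 t (%s. v s x))"
 by (simp add: time_deriv_def time_integral_J)

lemma AE_lborel_shift: "AE s in lborel. P s ==> AE s in lborel. P (a + (s::real))"
proof -
 assume P: "AE s in lborel. P s"
 have m: "(+) a : lborel \<rightarrow>\<^sub>M borel" by simp
 have "AE s in distr lborel borel ((+) a). P s" using P by (simp only: lborel_distr_plus)
 from AE_distrD[OF m this] show ?thesis .
qed

lemma AE_lborel_reflect: "AE s in lborel. P s ==> AE s in lborel. P (a - (s::real))"
proof -
 assume P: "AE s in lborel. P s"
 have m: "(%s. a - s) : lborel \<rightarrow>\<^sub>M borel" by simp
 have "AE s in distr lborel borel (%s. a - s). P s" using P by (simp only: lborel_distr_reflect)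
 from AE_distrD[OF m this] show ?thesis .
qed

lemma L1_L2_shift:
 assumes v: "v : L1_L2 T M" and ab: "0 <= a" "a + b <= T"
 shows "(%s. v (a + s)) : L1_L2 b M"
 unfolding L1_L2_iff
proof (intro conjI)
 show "st_measurable b M (%s. v (a + s))" using v ab by (intro st_measurable_shift) (auto simp: L1_L2_iff)
 have "AE s in lborel. s : {0<..<T} --> v s : Lq_space 2 M" using v by (simp add: L1_L2_iff)
 from AE_lborel_shift[OF this, of a] show "AE s in lborel. s : {0<..<b} --> v (a + s) : Lq_space 2 M"
  by eventually_elim (use ab in auto)
 have "tint 0 T (%s. L2_norm M (v s))" using v by (simp add: L1_L2_iff)
 then have "tint (a + 0) (a + b) (%s. L2_norm M (v s))" by (rule tint_subset) (use ab in auto)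
 then show "tint 0 b (%s. L2_norm M (v (a + s)))" using tint_shift[of 0 b "%s. L2_norm M (v s)" a] by blast
qed

lemma L1_L2_reverse:
 assumes v: "v : L1_L2 T M"
 shows "(%s x. - v (T - s) x) : L1_L2 T M"
 unfolding L1_L2_iff
proof (intro conjI)
 have "st_measurable T M (%s. v (T - s))" using v by (intro st_measurable_reverse) (simp add: L1_L2_iff)
 then have "(%p. - (case p of (s, x) => v (T - s) x)) : borel_measurable (leb {0<..<T} \<Otimes>\<^sub>M M)" by (rule borel_measurable_uminus)
 then show "st_measurable T M (%s x. - v (T - s) x)" by (simp add: case_prod_beta')
 have "AE s in lborel. s : {0<..<T} --> v s : Lq_space 2 M" using v by (simp add: L1_L2_iff)
 from AE_lborel_reflect[OF this, of T] show "AE s in lborel. s : {0<..<T} --> (%x. - v (T - s) x) : Lq_space 2 M"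
  by eventually_elim (use L2_cmult[where c = "-1"] in auto)
 have "tint (T - T) (T - 0) (%s. L2_norm M (v s))" using v by (simp add: L1_L2_iff)
 then have "tint 0 T (%s. L2_norm M (v (T - s)))" using tint_reflect[of 0 T "%s. L2_norm M (v s)" T] by blast
 moreover have "L2_norm M (%x. - f x) = L2_norm M f" for f by (simp add: L2_norm_def L2_inner_def)
 ultimately show "tint 0 T (%s. L2_norm M (%x. - v (T - s) x))" by simp
qed

lemma L1_L2_concat:
 assumes u: "u : L1_L2 T M" and v: "v : L1_L2 ta M" and T: "0 <= T" "0 < ta" and uT: "T > 0 ==> u T : borel_measurable M"
 shows "concat_time T u v : L1_L2 (T + ta) M"
 unfolding L1_L2_iff
proof (intro conjI)
 let ?w = "concat_time T u v"
 show "st_measurable (T + ta) M ?w" using u v T uT by (intro st_measurable_concat) (auto simp: L1_L2_iff)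
 have 1: "AE s in lborel. s : {0<..<T} --> u s : Lq_space 2 M" using u by (simp add: L1_L2_iff)
 have "AE s in lborel. s : {0<..<ta} --> v s : Lq_space 2 M" using v by (simp add: L1_L2_iff)
 from 1 AE_lborel_shift[OF this, of "- T"] AE_lborel_singleton[of T]
 show "AE s in lborel. s : {0<..<T + ta} --> ?w s : Lq_space 2 M"
  by eventually_elim (auto simp: concat_time_def)
 have tu: "tint 0 T (%s. L2_norm M (u s))" and tv: "tint 0 ta (%s. L2_norm M (v s))" using u v by (auto simp: L1_L2_iff)
 have a: "tint 0 T (%s. L2_norm M (?w s))" using tu by (subst tint_cong[of _ _ _ "%s. L2_norm M (u s)"]) (auto simp: concat_time_def)
 have "tint 0 ta (%s. L2_norm M (?w (T + s)))" using tv by (subst tint_cong[of _ _ _ "%s. L2_norm M (v s)"]) (auto simp: concat_time_def)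
 then have b: "tint T (T + ta) (%s. L2_norm M (?w s))" using tint_shift[of 0 ta "%s. L2_norm M (?w s)" T] by simp
 show "tint 0 (T + ta) (%s. L2_norm M (?w s))" by (rule J_split(1)[OF T(1) _ a b]) (use T in simp)
qed

lemma time_deriv_shift:
 assumes v: "time_deriv T M u v" and ab: "0 <= a" "a + b <= T"
 shows "time_deriv b M (%s. u (a + s)) (%s. v (a + s))"
 unfolding time_deriv_iff
proof (intro conjI ballI)
 show "(%s. v (a + s)) : L1_L2 b M" using v ab by (intro L1_L2_shift) (auto simp: time_deriv_iff)
 fix t assume t: "t : {0..b}"
 have "AE x in M. tint 0 (a + t) (%s. v s x) & u (a + t) x = u 0 x + J 0 (a + t) (%s. v s x)"
  "AE x in M. tint 0 a (%s. v s x) & u a x = u 0 x + J 0 a (%s. v s x)"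
  using v t ab unfolding time_deriv_iff by auto
 then show "AE x in M. tint 0 t (%s. v (a + s) x) & u (a + t) x = u (a + 0) x + J 0 t (%s. v (a + s) x)"
 proof eventually_elim
  case (elim x)
  have i: "tint a (a + t) (%s. v s x)" using conjunct1[OF elim(1)] by (rule tint_subset) (use ab in auto)
  have "J 0 (a + t) (%s. v s x) = J 0 a (%s. v s x) + J a (a + t) (%s. v s x)"
   by (rule J_split(2)[OF _ _ conjunct1[OF elim(2)] i]) (use ab t in auto)
  then show ?case
   using elim i tint_shift[of 0 t "%s. v s x" a] J_shift[of 0 t "%s. v s x" a] by simp
 qed
qed

lemma time_deriv_reverse:
 assumes v: "time_deriv T M u v"
 shows "time_deriv T M (%s. u (T - s)) (%s x. - v (T - s) x)"
 unfolding time_deriv_iff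
proof (intro conjI ballI)
 show "(%s x. - v (T - s) x) : L1_L2 T M" using v by (intro L1_L2_reverse) (auto simp: time_deriv_iff)
 fix t assume t: "t : {0..T}"
 have "AE x in M. tint 0 (T - t) (%s. v s x) & u (T - t) x = u 0 x + J 0 (T - t) (%s. v s x)"
  "AE x in M. tint 0 T (%s. v s x) & u T x = u 0 x + J 0 T (%s. v s x)"
  using v t unfolding time_deriv_iff by auto
 then show "AE x in M. tint 0 t (%s. - v (T - s) x) & u (T - t) x = u (T - 0) x + J 0 t (%s. - v (T - s) x)"
 proof eventually_elim
  case (elim x)
  have i: "tint (T - t) T (%s. v s x)" using conjunct1[OF elim(2)] by (rule tint_subset) (use t in auto)
  have "J 0 T (%s. v s x) = J 0 (T - t) (%s. v s x) + J (T - t) T (%s. v s x)"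
   by (rule J_split(2)[OF _ _ conjunct1[OF elim(1)] i]) (use t in auto)
  then show ?case
   using elim i tint_reflect[of 0 t "%s. v s x" T] J_reflect[of 0 t "%s. v s x" T]
   by (simp add: J_minus)
 qed
qed

lemma time_deriv_concat:
 assumes v: "time_deriv T M u v" and v': "time_deriv ta M u' v'" and T: "0 <= T" "0 < ta"
  and vT: "T > 0 ==> v T : borel_measurable M" and junction: "AE x in M. u' 0 x = u T x"
 shows "time_deriv (T + ta) M (concat_time T u u') (concat_time T v v')"
 unfolding time_deriv_iff
proof (intro conjI ballI)
 let ?w = "concat_time T v v'"
 show "?w : L1_L2 (T + ta) M" using v v' T vT by (intro L1_L2_concat) (auto simp: time_deriv_iff)
 fix t assume t: "t : {0..T + ta}"
 have w: "tint 0 r (%s. ?w s x) = tint 0 r (%s. v s x)" "J 0 r (%s. ?w s x) = J 0 r (%s. v s x)" if "r <= T" for r x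
  using that by (auto intro!: tint_cong J_cong simp: concat_time_def)
 show "AE x in M. tint 0 t (%s. ?w s x) & concat_time T u u' t x = concat_time T u u' 0 x + J 0 t (%s. ?w s x)"
 proof (cases "t <= T")
  case True
  then have "AE x in M. tint 0 t (%s. v s x) & u t x = u 0 x + J 0 t (%s. v s x)" using v t unfolding time_deriv_iff by auto
  then show ?thesis unfolding w[OF True] using True T by (simp add: concat_time_def)
 next
  case False
  have "AE x in M. tint 0 T (%s. v s x) & u T x = u 0 x + J 0 T (%s. v s x)" using v T unfolding time_deriv_iff by auto
  moreover have "AE x in M. tint 0 (t - T) (%s. v' s x) & u' (t - T) x = u' 0 x + J 0 (t - T) (%s. v' s x)"
   using v' t False unfolding time_deriv_iff by auto
  ultimately show ?thesis using junction
  proof eventually_elim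
   case (elim x)
   have c: "tint 0 (t - T) (%s. ?w (T + s) x) = tint 0 (t - T) (%s. v' s x)" "J 0 (t - T) (%s. ?w (T + s) x) = J 0 (t - T) (%s. v' s x)"
    by (auto intro!: tint_cong J_cong simp: concat_time_def)
   have b: "tint T t (%s. ?w s x)" using elim(2) c(1) tint_shift[of 0 "t - T" "%s. ?w s x" T] by simp
   have a: "tint 0 T (%s. ?w s x)" using elim(1) w(1)[of T] by simp
   have "J 0 t (%s. ?w s x) = J 0 T (%s. ?w s x) + J T t (%s. ?w s x)" "tint 0 t (%s. ?w s x)"
    using J_split[OF T(1) _ a b] False by auto
   moreover have "J T t (%s. ?w s x) = J 0 (t - T) (%s. v' s x)"
    using c(2) J_shift[of 0 "t - T" "%s. ?w s x" T] by simp
   ultimately show ?case using elim False T w(2)[of T x] by (simp add: concat_time_def)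
  qed
 qed
qed

text \<open>Only open intervals are integrated over, so a derivative may be altered at the end
  point, for instance to make it measurable there.\<close>

lemma time_deriv_cong_interior:
 assumes v: "time_deriv T M u v" and e: "!!s. 0 < s ==> s < T ==> v s = v' s"
 shows "time_deriv T M u v'"
proof -
 have "v' : L1_L2 T M"
 proof -
  have "v : L1_L2 T M" using v by (simp add: time_deriv_iff)
  moreover have "st_measurable T M v \<longleftrightarrow> st_measurable T M v'"
   by (rule measurable_cong) (auto simp: space_pair_measure space_leb e)
  moreover have "tint 0 T (%s. L2_norm M (v s)) \<longleftrightarrow> tint 0 T (%s. L2_norm M (v' s))" by (rule tint_cong) (simp add: e)
  moreover have "(s : {0<..<T} --> v s : Lq_space 2 M) \<longleftrightarrow> (s : {0<..<T} --> v' s : Lq_space 2 M)" for s using e by auto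
  ultimately show ?thesis by (simp add: L1_L2_iff)
 qed
 moreover have "tint 0 t (%s. v s x) = tint 0 t (%s. v' s x)" "J 0 t (%s. v s x) = J 0 t (%s. v' s x)" if "t <= T" for t x
  using that e by (auto intro!: tint_cong J_cong)
 ultimately show ?thesis using v by (simp add: time_deriv_iff)
qed

text \<open>The null set in \<open>time_deriv\<close> depends on the time. The integral formula
  itself, read for all times and points, defines a jointly measurable function.\<close>

lemma time_deriv_version:
 assumes v: "time_deriv T M u v" and u0: "u 0 : borel_measurable M"
 obtains U where "st_measurable T M U" "!!t. 0 <= t ==> t <= T ==> AE x in M. U t x = u t x"
proof -
 \<comment> \<open>The inner indicator makes the integrand jointly measurable on the full line; it
   does not change the integral for \<open>t \<le> T\<close>.\<close>
 define U where "U t x = u 0 x + J 0 t (%s. indicator {0<..<T} s * v s x)" for t x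
 have "st_measurable T M v" using v by (simp add: time_deriv_iff L1_L2_iff)
 then have m: "(%p. indicator {0<..<T} (fst p) * v (fst p) (snd p)) : borel_measurable (borel \<Otimes>\<^sub>M M)" by (simp add: st_measurable_ext)
 have "(%p. (snd p, snd (fst p))) : (leb {0<..<T} \<Otimes>\<^sub>M M) \<Otimes>\<^sub>M lborel \<rightarrow>\<^sub>M borel \<Otimes>\<^sub>M M" by measurable
 from measurable_compose[OF this m]
 have a: "(%p. indicator {0<..<T} (snd p) * v (snd p) (snd (fst p))) : borel_measurable ((leb {0<..<T} \<Otimes>\<^sub>M M) \<Otimes>\<^sub>M lborel)" by simp
 have t[measurable]: "(%p. fst (fst p)) : borel_measurable ((leb {0<..<T} \<Otimes>\<^sub>M M) \<Otimes>\<^sub>M lborel)"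
  by (rule measurable_compose[OF measurable_compose[OF measurable_fst measurable_fst] measurable_id_leb])
 have "(%p. if 0 < snd p & snd p < fst (fst p) then 1 else 0 :: real) : borel_measurable ((leb {0<..<T} \<Otimes>\<^sub>M M) \<Otimes>\<^sub>M lborel)" by measurable
 from borel_measurable_times[OF this a]
 have "(%p. indicator {0<..<fst (fst p)} (snd p) * (indicator {0<..<T} (snd p) * v (snd p) (snd (fst p))))
   : borel_measurable ((leb {0<..<T} \<Otimes>\<^sub>M M) \<Otimes>\<^sub>M lborel)"
  by (rule measurable_cong[THEN iffD1, rotated]) (auto simp: indicator_def)
 then have b: "(%(q, s). indicator {0<..<fst q} s * (indicator {0<..<T} s * v s (snd q))) : borel_measurable ((leb {0<..<T} \<Otimes>\<^sub>M M) \<Otimes>\<^sub>M lborel)"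
  by (simp add: case_prod_beta')
 have "(%q. J 0 (fst q) (%s. indicator {0<..<T} s * v s (snd q))) : borel_measurable (leb {0<..<T} \<Otimes>\<^sub>M M)"
  unfolding J_def using lborel.borel_measurable_lebesgue_integral[OF b] by simp
 moreover have "(%q. u 0 (snd q)) : borel_measurable (leb {0<..<T} \<Otimes>\<^sub>M M)" using u0 by measurable
 ultimately have "st_measurable T M U" by (simp add: U_def case_prod_beta')
 moreover have "AE x in M. U t x = u t x" if t: "0 <= t" "t <= T" for t
 proof -
  have "AE x in M. tint 0 t (%s. v s x) & u t x = u 0 x + J 0 t (%s. v s x)" using v t by (auto simp: time_deriv_iff)
  then show ?thesis
  proof eventually_elim
   case (elim x)
   have "J 0 t (%s. indicator {0<..<T} s * v s x) = J 0 t (%s. v s x)" by (rule J_cong) (use t in simp)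
   then show ?case using elim by (simp add: U_def)
  qed
 qed
 ultimately show ?thesis using that by blast
qed

section \<open>Continuity in time of paths with an integrable derivative\<close>

lemma J_continuous:
 assumes "tint 0 T f"
 shows "continuous_on {0..T} (%t. J 0 t f)"
proof -
 have set: "set_integrable lborel {0<..<T} f" using assms by (simp add: tint_def set_integrable_def)
 have "f integrable_on {0..T}"
  using set_borel_integral_eq_integral(1)[OF set] by (simp add: integrable_on_open_interval_real)
 then have "continuous_on {0..T} (%t. integral {0..t} f)" by (rule indefinite_integral_continuous_1)
 moreover have "J 0 t f = integral {0..t} f" if "t : {0..T}" for t
 proof -
  have "tint 0 t f" by (rule tint_subset[OF assms]) (use that in auto)
  then have "set_integrable lborel {0<..<t} f" by (simp add: tint_def set_integrable_def)
  from set_borel_integral_eq_integral(2)[OF this] show ?thesis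
   by (simp add: J_def set_lebesgue_integral_def integral_open_interval_real)
 qed
 ultimately show ?thesis using continuous_on_cong[OF refl, of "{0..T}" "%t. J 0 t f" "%t. integral {0..t} f"] by blast
qed

abbreviation L2c :: "real => 'a measure => (real => 'a => real) set" where
 "L2c T M \<equiv> C_time T (Lq_space 2 M) (L2_norm M)"

lemma (in sigma_finite_measure) J_product:
 assumes "integrable (leb {0<..<t} \<Otimes>\<^sub>M M) (%p. H (fst p) (snd p))"
 shows "tint 0 t (%s. \<integral>x. H s x \<partial>M)" "J 0 t (%s. \<integral>x. H s x \<partial>M) = (\<integral>p. H (fst p) (snd p) \<partial>(leb {0<..<t} \<Otimes>\<^sub>M M))"
  "AE x in M. tint 0 t (%s. H s x)" "integrable M (%x. J 0 t (%s. H s x))"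
  "(\<integral>x. J 0 t (%s. H s x) \<partial>M) = J 0 t (%s. \<integral>x. H s x \<partial>M)"
proof -
 interpret L: sigma_finite_measure "leb {0<..<t}" by (rule sigma_finite_leb) simp
 interpret P: pair_sigma_finite "leb {0<..<t}" M by unfold_locales
 have i: "integrable (leb {0<..<t} \<Otimes>\<^sub>M M) (%(s, x). H s x)" using assms by (simp add: case_prod_beta')
 show 1: "tint 0 t (%s. \<integral>x. H s x \<partial>M)" using P.integrable_fst[OF i] by (simp add: tint_leb)
 show 2: "J 0 t (%s. \<integral>x. H s x \<partial>M) = (\<integral>p. H (fst p) (snd p) \<partial>(leb {0<..<t} \<Otimes>\<^sub>M M))"
  using P.integral_fst[OF i] by (simp add: tint_leb case_prod_beta')
 show "AE x in M. tint 0 t (%s. H s x)" using P.AE_integrable_snd[OF i] by (simp add: tint_leb)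
 show "integrable M (%x. J 0 t (%s. H s x))" using P.integrable_snd[OF i] by (simp add: tint_leb)
 show "(\<integral>x. J 0 t (%s. H s x) \<partial>M) = J 0 t (%s. \<integral>x. H s x \<partial>M)"
  using P.integral_snd[OF i] 2 by (simp add: tint_leb case_prod_beta')
qed

text \<open>Minkowski's integral inequality, by testing \<open>u(t) - u(s)\<close> against itself.\<close>

lemma time_deriv_L2_le:
 assumes M: "finite_measure M" and v: "time_deriv T M u v" and st: "0 <= s" "s <= t" "t <= T"
  and L2: "u s : Lq_space 2 M" "u t : Lq_space 2 M"
 shows "L2_norm M (%x. u t x - u s x) <= J s t (%r. L2_norm M (v r))"
proof -
 interpret finite_measure M by (rule M)
 let ?d = "%x. u t x - u s x" and ?n = "%r. L2_norm M (v r)"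
 have vm: "st_measurable t M v" and vL: "AE r in lborel. r : {0<..<T} --> v r : Lq_space 2 M" and vt: "tint s t ?n"
  using v st st_measurable_shift[where v = v and T = T and M = M and a = 0 and b = t] tint_subset[of 0 T ?n s t] by (auto simp: time_deriv_iff L1_L2_iff)
 have d: "?d : Lq_space 2 M" by (rule L2_diff[OF L2(2,1)])
 note dm[measurable] = L2_measurable[OF d]
 \<comment> \<open>The increment times the derivative, cut off before \<open>s\<close>, so that
   Fubini applies on an interval starting at \<open>0\<close>. Its double integral is the squared
   norm of the increment.\<close>
 define H where "H r x = ?d x * (if s < r then v r x else 0)" for r x
 define B where "B r = (if s < r then L2_norm M ?d * ?n r else 0)" for r
 have Be: "indicator {0<..<t} r * B r = L2_norm M ?d * (indicator {s<..<t} r * ?n r)" for r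
  using st by (auto simp: B_def indicator_def)
 have Bt: "tint 0 t B" and BJ: "J 0 t B = L2_norm M ?d * J s t ?n"
  using vt unfolding tint_def J_def Be by simp_all
 have id: "(%p. fst p) : borel_measurable (leb {0<..<t} \<Otimes>\<^sub>M M)" by (rule measurable_compose[OF measurable_fst measurable_id_leb])
 have vm': "(%p. v (fst p) (snd p)) : borel_measurable (leb {0<..<t} \<Otimes>\<^sub>M M)" using vm by (simp add: case_prod_beta')
 have Hm: "(%p. H (fst p) (snd p)) : borel_measurable (leb {0<..<t} \<Otimes>\<^sub>M M)" unfolding H_def using id vm' by measurable
 have cs: "(\<integral>\<^sup>+x. ennreal \<bar>H r x\<bar> \<partial>M) <= ennreal (B r)" "(\<integral>x. H r x \<partial>M) <= B r" if r: "v r : Lq_space 2 M" for r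
 proof -
  have i: "integrable M (%x. ?d x * v r x)" by (rule L2_integrable_mult[OF d r])
  have "(\<integral>x. \<bar>?d x * v r x\<bar> \<partial>M) <= L2_norm M ?d * ?n r"
   using L2_cauchy_schwarz[OF L2_abs[OF d] L2_abs[OF r]] by (simp add: L2_inner_def L2_norm_abs abs_mult)
  then show "(\<integral>\<^sup>+x. ennreal \<bar>H r x\<bar> \<partial>M) <= ennreal (B r)"
   using nn_integral_eq_integral[OF integrable_abs[OF i]] by (simp add: H_def B_def ennreal_leI)
  show "(\<integral>x. H r x \<partial>M) <= B r" using abs_le_D1[OF L2_cauchy_schwarz[OF d r]] by (simp add: H_def B_def L2_inner_def)
 qed
 have H: "integrable (leb {0<..<t} \<Otimes>\<^sub>M M) (%p. H (fst p) (snd p))"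
 proof (rule integrableI_bounded[OF Hm])
  have "(\<integral>\<^sup>+p. ennreal \<bar>H (fst p) (snd p)\<bar> \<partial>(leb {0<..<t} \<Otimes>\<^sub>M M)) = NJ 0 t (%r. \<integral>\<^sup>+x. ennreal \<bar>H r x\<bar> \<partial>M)"
   by (rule st_nn_integral(2)) (use Hm in \<open>auto simp: case_prod_beta'\<close>)
  also have "... <= NJ 0 t (%r. ennreal (B r))"
   unfolding NJ_def by (rule nn_integral_mono_AE, rule AE_mp[OF vL], rule AE_I2) (use cs(1) st in \<open>auto simp: indicator_def\<close>)
  also have "... = ennreal (J 0 t B)" by (rule J_eq_NJ[OF Bt, symmetric]) (simp add: B_def L2_norm_nonneg)
  finally show "(\<integral>\<^sup>+p. ennreal (norm (H (fst p) (snd p))) \<partial>(leb {0<..<t} \<Otimes>\<^sub>M M)) < \<infinity>"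
   by (simp add: order_le_less_trans)
 qed
 have Hx: "J 0 t (%r. H r x) = ?d x * J s t (%r. v r x)" for x
 proof -
  have "indicator {0<..<t} r * H r x = ?d x * (indicator {s<..<t} r * v r x)" for r using st by (auto simp: H_def indicator_def)
  then show ?thesis by (simp only: J_def integral_mult_right_zero)
 qed
 have ae: "AE x in M. ?d x = J s t (%r. v r x)"
 proof -
  have "AE x in M. tint 0 s (%r. v r x) & u s x = u 0 x + J 0 s (%r. v r x)" "AE x in M. tint 0 t (%r. v r x) & u t x = u 0 x + J 0 t (%r. v r x)"
   using v st by (auto simp: time_deriv_iff)
  then show ?thesis
  proof eventually_elim
   case (elim x)
   have "tint s t (%r. v r x)" by (rule tint_subset[OF conjunct1[OF elim(2)] st(1)]) simp
   from J_split(2)[OF st(1,2) conjunct1[OF elim(1)] this] elim show ?case by simp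
  qed
 qed
 have "(L2_norm M ?d)\<^sup>2 = (\<integral>x. ?d x * ?d x \<partial>M)" unfolding L2_norm_power2 by (simp add: power2_eq_square)
 also have "... = (\<integral>x. J 0 t (%r. H r x) \<partial>M)"
  by (rule integral_cong_AE) (use ae borel_measurable_integrable[OF J_product(4)[OF H]] in \<open>auto simp: Hx elim!: eventually_mono\<close>)
 also have "... = J 0 t (%r. \<integral>x. H r x \<partial>M)" by (rule J_product(5)[OF H])
 also have "... <= J 0 t B" unfolding J_def
  by (rule integral_mono_AE, use J_product(1)[OF H] Bt in \<open>auto simp: tint_def\<close>, rule AE_mp[OF vL], rule AE_I2)
   (use cs(2) st in \<open>auto simp: indicator_def\<close>)
 finally have "L2_norm M ?d * L2_norm M ?d <= L2_norm M ?d * J s t ?n" unfolding BJ by (simp add: power2_eq_square)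
 moreover have "0 <= J s t ?n" unfolding J_def by (simp add: L2_norm_nonneg)
 ultimately show ?thesis using L2_norm_nonneg[of M ?d] by (cases "L2_norm M ?d = 0") (auto simp: mult_le_cancel_left)
qed

text \<open>Increments are bounded by those of the continuous function
  \<open>t \<mapsto> J 0 t (%r. L2_norm M (v r))\<close>.\<close>

lemma time_deriv_L2c:
 assumes M: "finite_measure M" and v: "time_deriv T M u v" and L2: "!!t. 0 <= t ==> t <= T ==> u t : Lq_space 2 M"
 shows "u : L2c T M"
 unfolding C_time_iff
proof (intro conjI ballI allI impI)
 show "u t : Lq_space 2 M" if "t : {0..T}" for t using L2 that by simp
 fix t e :: real assume t: "t : {0..T}" and e: "e > 0"
 let ?N = "%r. L2_norm M (v r)"
 have vt: "tint 0 T ?N" using v by (simp add: time_deriv_iff L1_L2_iff)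
 obtain d where d: "d > 0" "!!s. s : {0..T} ==> dist s t < d ==> dist (J 0 s ?N) (J 0 t ?N) < e"
  using J_continuous[OF vt] t e unfolding continuous_on_iff by metis
 have dif: "J a b ?N = J 0 b ?N - J 0 a ?N" if "0 <= a" "a <= b" "b <= T" for a b
  using J_split(2)[OF that(1,2) tint_subset[OF vt] tint_subset[OF vt]] that by simp
 have "\<bar>L2_norm M (%x. u s x - u t x)\<bar> < e" if s: "s : {0..T}" "\<bar>s - t\<bar> < d" for s
 proof (cases "t <= s")
  case True
  then have "L2_norm M (%x. u s x - u t x) <= J 0 s ?N - J 0 t ?N"
   using time_deriv_L2_le[OF M v, of t s] t s dif[of t s] L2 by simp
  then show ?thesis using d(2)[of s] s by (simp add: dist_real_def L2_norm_nonneg)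
 next
  case False
  then have "L2_norm M (%x. u t x - u s x) <= J 0 t ?N - J 0 s ?N"
   using time_deriv_L2_le[OF M v, of s t] t s dif[of s t] L2 by simp
  then show ?thesis using d(2)[of s] s by (simp add: dist_real_def L2_norm_nonneg L2_norm_minus_commute[of M "u s"])
 qed
 then show "EX d>0. ALL s:{0..T}. s ~= t --> \<bar>s - t\<bar> < d --> \<bar>L2_norm M (%x. u s x - u t x)\<bar> < e" using d(1) by blast
qed

section \<open>Integrability in time\<close>

lemma L2c_inner_continuous:
 assumes f: "f : L2c T M" and g: "g : L2c T M"
 shows "continuous_on {0..T} (%s. L2_inner M (f s) (g s))"
 unfolding continuous_on_def
proof
 fix t assume t: "t : {0..T}"
 let ?F = "%s. L2_norm M (%x. f s x - f t x)" and ?G = "%s. L2_norm M (%x. g s x - g t x)"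
 have FG: "(?F \<longlongrightarrow> 0) (at t within {0..T})" "(?G \<longlongrightarrow> 0) (at t within {0..T})" using f g t by (auto simp: C_time_def)
 have mem: "f s : Lq_space 2 M" "g s : Lq_space 2 M" if "s : {0..T}" for s using f g that by (auto simp: C_time_def)
 have "((%s. ?F s * (L2_norm M (g t) + ?G s) + L2_norm M (f t) * ?G s) \<longlongrightarrow> 0 * (L2_norm M (g t) + 0) + L2_norm M (f t) * 0) (at t within {0..T})"
  by (intro tendsto_intros FG)
 then have lim: "((%s. ?F s * (L2_norm M (g t) + ?G s) + L2_norm M (f t) * ?G s) \<longlongrightarrow> 0) (at t within {0..T})" by simp
 have le: "norm (L2_inner M (f s) (g s) - L2_inner M (f t) (g t)) <= ?F s * (L2_norm M (g t) + ?G s) + L2_norm M (f t) * ?G s"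
  if s: "s : {0..T}" for s
 proof -
  note L = mem[OF s] mem[OF t]
  have "L2_inner M (f s) (g s) - L2_inner M (f t) (g t) = L2_inner M (%x. f s x - f t x) (g s) + L2_inner M (f t) (%x. g s x - g t x)"
   using L2_inner_diff_left[OF L(1,3,2)] L2_inner_diff_right[OF L(2,4,3)] by simp
  moreover have "\<bar>L2_inner M (%x. f s x - f t x) (g s)\<bar> <= ?F s * L2_norm M (g s)"
   using L2_cauchy_schwarz[OF L2_diff[OF L(1,3)] L(2)] by simp
  moreover have "?F s * L2_norm M (g s) <= ?F s * (L2_norm M (g t) + ?G s)"
   using L2_norm_triangle_sub[OF L(2,4)] by (intro mult_left_mono) (auto simp: L2_norm_nonneg)
  moreover have "\<bar>L2_inner M (f t) (%x. g s x - g t x)\<bar> <= L2_norm M (f t) * ?G s"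
   using L2_cauchy_schwarz[OF L(3) L2_diff[OF L(2,4)]] by simp
  ultimately show ?thesis by simp
 qed
 have "\<forall>\<^sub>F s in at t within {0..T}. norm (L2_inner M (f s) (g s) - L2_inner M (f t) (g t))
   <= ?F s * (L2_norm M (g t) + ?G s) + L2_norm M (f t) * ?G s"
  unfolding eventually_at_filter by (rule always_eventually) (use le in blast)
 from Lim_null_comparison[OF this lim]
 show "((%s. L2_inner M (f s) (g s)) \<longlongrightarrow> L2_inner M (f t) (g t)) (at t within {0..T})" by (rule LIM_zero_cancel)
qed

lemma L2c_bounded:
 assumes "f : L2c T M"
 obtains B where "B >= 0" "!!s. 0 <= s ==> s <= T ==> L2_norm M (f s) <= B"
proof -
 have "compact ((%s. L2_inner M (f s) (f s)) ` {0..T})"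
  by (rule compact_continuous_image[OF L2c_inner_continuous[OF assms assms] compact_Icc])
 then obtain B where B: "!!y. y : (%s. L2_inner M (f s) (f s)) ` {0..T} ==> norm y <= B"
  using compact_imp_bounded bounded_iff by metis
 have "L2_norm M (f s) <= sqrt \<bar>B\<bar>" if "0 <= s" "s <= T" for s
  unfolding L2_norm_def using B[of "L2_inner M (f s) (f s)"] that by (intro real_sqrt_le_mono) auto
 then show ?thesis by (intro that[of "sqrt \<bar>B\<bar>"]) auto
qed

text \<open>Compactness of the time interval: a Lebesgue number for the cover by intervals of
  oscillation below \<open>e / 2\<close>.\<close>

lemma L2c_uniform:
 assumes f: "f : L2c T M" and e: "e > 0"
 obtains d where "d > 0" "!!s t. s : {0..T} ==> t : {0..T} ==> \<bar>s - t\<bar> < d ==> L2_norm M (%x. f s x - f t x) < e"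
proof -
 have z: "L2_norm M (%x. h x - h x) = 0" for h by (simp add: L2_norm_def L2_inner_def)
 have "EX d>0. ALL s:{0..T}. \<bar>s - l\<bar> < d --> L2_norm M (%x. f s x - f l x) < e / 2" if l: "l : {0..T}" for l
 proof -
  have "e / 2 > 0" using e by simp
  then obtain d where d: "d > 0" "!!s. s : {0..T} ==> s ~= l ==> \<bar>s - l\<bar> < d ==> \<bar>L2_norm M (%x. f s x - f l x)\<bar> < e / 2"
   using f l unfolding C_time_iff by blast
  have "L2_norm M (%x. f s x - f l x) < e / 2" if "s : {0..T}" "\<bar>s - l\<bar> < d" for s
   using d(2)[of s] that z[of "f l"] e by (cases "s = l") auto
  then show ?thesis using d(1) by blast
 qed
 then obtain d where d: "!!l. l : {0..T} ==> d l > 0"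
   "!!l s. l : {0..T} ==> s : {0..T} ==> \<bar>s - l\<bar> < d l ==> L2_norm M (%x. f s x - f l x) < e / 2"
  by metis
 have cov: "{0..T} \<subseteq> \<Union>((%l. ball l (d l)) ` {0..T})" using d(1) by force
 have op: "open B" if "B : (%l. ball l (d l)) ` {0..T}" for B using that by auto
 obtain eps where eps: "0 < eps" "!!x. x : {0..T} ==> EX G:(%l. ball l (d l)) ` {0..T}. ball x eps \<subseteq> G"
  using Heine_Borel_lemma[OF compact_Icc cov op] by metis
 have "L2_norm M (%x. f s x - f t x) < e" if s: "s : {0..T}" and t: "t : {0..T}" and st: "\<bar>s - t\<bar> < eps" for s t
 proof -
  obtain l where l: "l : {0..T}" "ball s eps \<subseteq> ball l (d l)" using eps(2)[OF s] by blast
  have "s : ball l (d l)" "t : ball l (d l)" using l(2) eps(1) st by (auto simp: dist_real_def subset_eq)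
  then have "L2_norm M (%x. f s x - f l x) < e / 2" "L2_norm M (%x. f t x - f l x) < e / 2"
   using d(2)[OF l(1) s] d(2)[OF l(1) t] unfolding mem_ball dist_real_def by (simp_all only: abs_minus_commute)
  moreover have "L2_norm M (%x. f s x - f t x) <= L2_norm M (%x. f s x - f l x) + L2_norm M (%x. f l x - f t x)"
   by (rule L2_norm_triangle_diff) (use f s t l in \<open>auto simp: C_time_def\<close>)
  ultimately show ?thesis using L2_norm_minus_commute[of M "f l" "f t"] by simp
 qed
 then show ?thesis using that eps(1) by blast
qed

text \<open>The a.e. limit of step functions in time.\<close>

lemma L2c_version:
 assumes f: "f : L2c T M"
 obtains g where "st_measurable T M g" "!!t. 0 <= t ==> t <= T ==> AE x in M. g t x = f t x"
proof -
 have "EX d>0. ALL s:{0..T}. ALL t:{0..T}. \<bar>s - t\<bar> < d --> L2_norm M (%x. f s x - f t x) < (1/2)^k" for k :: nat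
 proof -
  obtain d where "d > 0" "!!s t. s : {0..T} ==> t : {0..T} ==> \<bar>s - t\<bar> < d ==> L2_norm M (%x. f s x - f t x) < (1/2)^k"
   using L2c_uniform[OF f, of "(1/2)^k"] by auto
  then show ?thesis by blast
 qed
 then obtain d where d: "!!k::nat. d k > 0"
   "!!k s t. s : {0..T} ==> t : {0..T} ==> \<bar>s - t\<bar> < d k ==> L2_norm M (%x. f s x - f t x) < (1/2)^k"
  by metis
 have L: "f t : Lq_space 2 M" if "0 <= t" "t <= T" for t using f that by (simp add: C_time_def)
 \<comment> \<open>Samples of \<open>f\<close> on a grid of mesh \<open>d k\<close>, with
   \<open>0\<close> off the interval; rounding time down to the grid takes countably many values,
   which yields joint measurability.\<close>
 define F where "F k i = (if 0 <= d k * of_int i & d k * of_int i <= T then f (d k * of_int i) else (%_. 0))" for k and i :: int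
 define h where "h k s = F k \<lfloor>s / d k\<rfloor>" for k s
 define g where "g s x = lim (%k. h k s x)" for s x
 have Fm: "F k i : borel_measurable M" for k i using L2_measurable[OF L] by (simp add: F_def)
 have hm: "(%p. h k (fst p) (snd p)) : borel_measurable (leb {0<..<T} \<Otimes>\<^sub>M M)" for k
  unfolding h_def
 proof (rule measurable_compose_countable)
  show "(%p. F k i (snd p)) : borel_measurable (leb {0<..<T} \<Otimes>\<^sub>M M)" for i
   by (rule measurable_compose[OF measurable_snd Fm])
  have "(%p. fst p) : borel_measurable (leb {0<..<T} \<Otimes>\<^sub>M M)"
   by (rule measurable_compose[OF measurable_fst measurable_id_leb])
  then show "(%p. \<lfloor>fst p / d k\<rfloor>) : leb {0<..<T} \<Otimes>\<^sub>M M \<rightarrow>\<^sub>M count_space UNIV" by measurable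
 qed
 have gm: "st_measurable T M g" unfolding g_def case_prod_beta' by (rule borel_measurable_lim_metric[OF hm])
 have "AE x in M. g t x = f t x" if t: "0 <= t" "t <= T" for t
 proof -
  have hk: "h k t : Lq_space 2 M" "L2_norm M (%x. h k t x - f t x) <= (1/2)^k" for k
  proof -
   let ?r = "d k * of_int \<lfloor>t / d k\<rfloor>"
   have 0: "0 <= \<lfloor>t / d k\<rfloor>" using t d(1)[of k] by simp
   have 1: "of_int \<lfloor>t / d k\<rfloor> <= t / d k" "t / d k < of_int \<lfloor>t / d k\<rfloor> + 1" by linarith+
   have "?r <= t" using mult_left_mono[OF 1(1), of "d k"] d(1)[of k] by simp
   moreover have "t < ?r + d k" using mult_strict_left_mono[OF 1(2) d(1)[of k]] d(1)[of k] by (simp add: distrib_left)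
   moreover have "0 <= ?r" using 0 d(1)[of k] by simp
   ultimately have r: "0 <= ?r" "?r <= t" "\<bar>?r - t\<bar> < d k" by auto
   then have "h k t = f ?r" using t by (simp add: h_def F_def)
   then show "h k t : Lq_space 2 M" "L2_norm M (%x. h k t x - f t x) <= (1/2)^k"
    using d(2)[of ?r t k] r t L by auto
  qed
  have [measurable]: "h k t : borel_measurable M" "f t : borel_measurable M" for k
   using L2_measurable[OF hk(1)] L2_measurable[OF L[OF t]] by auto
  \<comment> \<open>The squared errors have summable integrals, so they are summable, hence null
    sequences, at almost every point.\<close>
  have "(\<integral>\<^sup>+x. (\<Sum>k. ennreal ((h k t x - f t x)\<^sup>2)) \<partial>M) = (\<Sum>k. \<integral>\<^sup>+x. ennreal ((h k t x - f t x)\<^sup>2) \<partial>M)"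
   by (intro nn_integral_suminf) measurable
  also have "... <= (\<Sum>k. ennreal ((1/4)^k))"
  proof (rule suminf_le)
   fix k
   have "(L2_norm M (%x. h k t x - f t x))\<^sup>2 <= ((1/2)^k)\<^sup>2" using hk(2) by (intro power_mono) (auto simp: L2_norm_nonneg)
   also have "((1/2)^k)\<^sup>2 = ((1/4)^k :: real)" by (simp add: power2_eq_square power_mult_distrib[symmetric])
   finally show "(\<integral>\<^sup>+x. ennreal ((h k t x - f t x)\<^sup>2) \<partial>M) <= ennreal ((1/4)^k)"
    unfolding nn_integral_square_L2[OF L2_diff[OF hk(1) L[OF t]]] by (rule ennreal_leI)
  qed auto
  also have "... = ennreal (\<Sum>k. (1/4)^k)" by (rule suminf_ennreal2[OF _ summable_geometric]) simp_all
  also have "... < \<infinity>" by simp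
  finally have "(\<integral>\<^sup>+x. (\<Sum>k. ennreal ((h k t x - f t x)\<^sup>2)) \<partial>M) ~= \<infinity>" by simp
  then have "AE x in M. (\<Sum>k. ennreal ((h k t x - f t x)\<^sup>2)) ~= \<infinity>"
   by (intro nn_integral_noteq_infinite) measurable
  then show ?thesis
  proof eventually_elim
   case (elim x)
   then have "summable (%k. (h k t x - f t x)\<^sup>2)" by (intro summable_suminf_not_top) auto
   from summable_LIMSEQ_zero[OF this] have "(%k. (h k t x - f t x)\<^sup>2) \<longlonglongrightarrow> 0" .
   from tendsto_real_sqrt[OF this] have "(%k. \<bar>h k t x - f t x\<bar>) \<longlonglongrightarrow> 0" by simp
   from LIM_zero_cancel[OF tendsto_rabs_zero_cancel[OF this]] have "(%k. h k t x) \<longlonglongrightarrow> f t x" .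
   then show ?case unfolding g_def by (rule limI)
  qed
 qed
 then show ?thesis using that gm by blast
qed

text \<open>Since \<open>f\<close> need not be jointly measurable, measurability of the inner
  product in time is read off from a measurable version with the same slices up to null sets; a
  bound for \<open>f\<close> gives domination.\<close>

lemma L2c_tint:
 assumes M: "finite_measure M" and f: "f : L2c T M" and v: "v : L1_L2 T M"
 shows "tint 0 T (%s. L2_inner M (f s) (v s))"
proof -
 interpret finite_measure M by (rule M)
 obtain g where g: "st_measurable T M g" "!!t. 0 <= t ==> t <= T ==> AE x in M. g t x = f t x"
  using L2c_version[OF f] by blast
 obtain B where B: "B >= 0" "!!s. 0 <= s ==> s <= T ==> L2_norm M (f s) <= B" using L2c_bounded[OF f] by blast
 have vm: "st_measurable T M v" and vL: "AE s in lborel. s : {0<..<T} --> v s : Lq_space 2 M"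
  and vi: "tint 0 T (%s. L2_norm M (v s))" using v by (auto simp: L1_L2_iff)
 have fL: "f s : Lq_space 2 M" if "0 < s" "s < T" for s using f that by (simp add: C_time_def)
 have "(%p. case p of (s, x) => g s x * v s x) : borel_measurable (leb {0<..<T} \<Otimes>\<^sub>M M)"
  using borel_measurable_times[OF g(1) vm] by (simp add: case_prod_beta')
 from borel_measurable_lebesgue_integral[OF this]
 have "(%s. \<integral>x. g s x * v s x \<partial>M) : borel_measurable (leb {0<..<T})" by simp
 moreover have "(\<integral>x. g s x * v s x \<partial>M) = L2_inner M (f s) (v s)" if "s : space (leb {0<..<T})" for s
 proof -
  have s: "0 < s" "s < T" using that by (auto simp: space_leb)
  have "L2_inner M (g s) (v s) = L2_inner M (f s) (v s)"
   by (rule L2_inner_cong_AE)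
    (use g s vm L2_measurable[OF fL] in \<open>auto intro: st_measurable_section\<close>)
  then show ?thesis by (simp add: L2_inner_def)
 qed
 ultimately have m: "(%s. L2_inner M (f s) (v s)) : borel_measurable (leb {0<..<T})"
  using measurable_cong[of "leb {0<..<T}" "%s. \<integral>x. g s x * v s x \<partial>M" "%s. L2_inner M (f s) (v s)" borel] by blast
 have i: "integrable (leb {0<..<T}) (%s. B * L2_norm M (v s))" using vi by (simp add: tint_leb)
 have "AE s in leb {0<..<T}. norm (L2_inner M (f s) (v s)) <= norm (B * L2_norm M (v s))"
 proof -
  have "AE s in lborel. s : {0<..<T} --> norm (L2_inner M (f s) (v s)) <= norm (B * L2_norm M (v s))"
   using vL
  proof eventually_elim
   case (elim s)
   show ?case
   proof
    assume s: "s : {0<..<T}"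
    have "\<bar>L2_inner M (f s) (v s)\<bar> <= L2_norm M (f s) * L2_norm M (v s)"
     by (rule L2_cauchy_schwarz) (use fL elim s in auto)
    also have "... <= B * L2_norm M (v s)" using B(2)[of s] s by (intro mult_right_mono) (auto simp: L2_norm_nonneg)
    finally show "norm (L2_inner M (f s) (v s)) <= norm (B * L2_norm M (v s))" by simp
   qed
  qed
  then show ?thesis by (simp add: AE_leb)
 qed
 from Bochner_Integration.integrable_bound[OF i m this] show ?thesis by (simp add: tint_leb)
qed

section \<open>Estimates of the nonlinear terms\<close>

lemma powr_le_1_add: "0 <= (x::real) ==> q <= k ==> 0 < q ==> x powr q <= 1 + x powr k"
proof (cases "x <= 1")
 case True
 assume "0 <= x" "q <= k" "0 < q"
 then have "x powr q <= 1" using True powr_mono2[of q x 1] by simp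
 then show ?thesis by (simp add: add_increasing2)
next
 case False
 assume "q <= k"
 then have "x powr q <= x powr k" using False by (intro powr_mono) auto
 then show ?thesis by simp
qed

lemma powr_add_le:
 assumes "0 <= (a::real)" "0 <= b" "0 < q"
 shows "(a + b) powr q <= 2 powr q * (a powr q + b powr q)"
proof -
 have "(a + b) powr q <= (2 * max a b) powr q" using assms by (intro powr_mono2) auto
 also have "... = 2 powr q * max a b powr q" using assms by (simp add: powr_mult)
 also have "max a b powr q <= a powr q + b powr q" by (simp add: max_def)
 finally show ?thesis by simp
qed

text \<open>Estimate both factors by the larger of \<open>\<bar>x\<bar>\<close> and
  \<open>\<bar>y\<bar>\<close>; a power of the maximum is below the sum of the powers.\<close>

lemma damping_mult_le:
 assumes "m >= 1"
 shows "\<bar>damping m x * y\<bar> <= \<bar>x\<bar> powr (m + 1) + \<bar>y\<bar> powr (m + 1)"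
proof -
 let ?z = "max \<bar>x\<bar> \<bar>y\<bar>"
 have "\<bar>damping m x * y\<bar> = \<bar>x\<bar> powr (m - 1) * (\<bar>x\<bar> * \<bar>y\<bar>)" by (simp add: damping_def abs_mult)
 also have "... <= ?z powr (m - 1) * (?z * ?z)" using assms by (intro mult_mono powr_mono2) auto
 also have "... = ?z powr (m + 1)"
  by (cases "?z = 0") (auto simp: powr_add powr_diff)
 also have "... <= \<bar>x\<bar> powr (m + 1) + \<bar>y\<bar> powr (m + 1)" by (simp add: max_def)
 finally show ?thesis .
qed

text \<open>With \<open>\<sigma> = q - p - 1\<close>, the logarithm is at most
  \<open>x^\<sigma> / \<sigma>\<close> for large \<open>x\<close>, which fills the gap from
  \<open>p\<close> to \<open>q - 1\<close>. For \<open>x \<le> 1\<close> the product of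
  \<open>x\<close> and \<open>\<bar>ln x\<bar>\<close> is at most \<open>1\<close>.\<close>

lemma log_source_le:
 assumes p: "1 < p" and q: "p + 1 < q"
 shows "\<bar>log_source p s\<bar> <= (1 + 1 / (q - p - 1)) * (1 + \<bar>s\<bar> powr (q - 1))"
proof (cases "s = 0")
 case True
 then show ?thesis using q by (simp add: log_source_def add_nonneg_nonneg)
next
 case s: False
 let ?x = "\<bar>s\<bar>" and ?si = "q - p - 1"
 have e: "\<bar>log_source p s\<bar> = ?x powr (p - 1) * (?x * \<bar>ln ?x\<bar>)" using s by (simp add: log_source_def abs_mult)
 have n: "0 <= 1 / ?si" "0 <= ?x powr (q - 1)" using q by auto
 show ?thesis
 proof (cases "?x <= 1")
  case True
  have "- ln ?x <= 1 / ?x - 1" using ln_le_minus_one[of "1 / ?x"] s by (simp add: ln_div)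
  then have "?x * - ln ?x <= ?x * (1 / ?x - 1)" by (intro mult_left_mono) auto
  then have "?x * \<bar>ln ?x\<bar> <= 1" using True s by (simp add: right_diff_distrib ln_le_zero_iff)
  moreover have "?x powr (p - 1) <= 1" using True p powr_mono2[of "p - 1" ?x 1] by simp
  ultimately have "\<bar>log_source p s\<bar> <= 1 * 1" unfolding e by (intro mult_mono) auto
  also have "1 * 1 <= (1 + 1 / ?si) * (1 + ?x powr (q - 1))" using n by (intro mult_mono) auto
  finally show ?thesis .
 next
  case False
  have "?si * ln ?x <= ?x powr ?si" using ln_le_minus_one[of "?x powr ?si"] s by (simp add: ln_powr)
  then have l: "\<bar>ln ?x\<bar> <= ?x powr ?si / ?si" using False q by (simp add: field_simps)
  have "\<bar>log_source p s\<bar> <= ?x powr (p - 1) * (?x * (?x powr ?si / ?si))" unfolding e using l by (intro mult_left_mono) auto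
  also have "... = 1 / ?si * (?x powr (p - 1) * ?x powr 1 * ?x powr ?si)" using s by simp
  also have "... = 1 / ?si * ?x powr (q - 1)" unfolding powr_add[symmetric] by simp
  also have "... <= (1 + 1 / ?si) * (1 + ?x powr (q - 1))" using n by (intro mult_mono) simp_all
  finally show ?thesis .
 qed
qed

text \<open>Young's inequality, by distinguishing \<open>\<bar>y\<bar> \<le> K (1 + \<bar>s\<bar>)\<close> for a large \<open>K\<close> from the opposite case.\<close>

lemma log_source_young:
 assumes p: "1 < p" and q: "p + 1 < q" "q <= k" and e: "0 < eps"
 obtains C where "C >= 0" "!!s y. \<bar>log_source p s * y\<bar> <= eps * \<bar>y\<bar> powr k + C * (1 + \<bar>s\<bar> powr q)"
proof -
 define L where "L = 1 + 1 / (q - p - 1)"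
 \<comment> \<open>Chosen with \<open>K^(q - 1) = 2 * L / eps\<close>: once
   \<open>\<bar>y\<bar>\<close> exceeds \<open>K * (1 + \<bar>s\<bar>)\<close>, the source is at
   most \<open>eps * \<bar>y\<bar>^(q - 1)\<close>.\<close>
 define K where "K = (2 * L / eps) powr (1 / (q - 1))"
 define C where "C = 2 * L * K * 2 powr q"
 have L: "L > 0" using q by (simp add: L_def add_pos_pos)
 have K: "K > 0" using L e by (simp add: K_def)
 have Kp: "K powr (q - 1) = 2 * L / eps" unfolding K_def powr_powr using p q L e by simp
 have C: "C >= 0" using L K by (simp add: C_def)
 have main: "\<bar>log_source p s * y\<bar> <= eps * \<bar>y\<bar> powr q + C * (1 + \<bar>s\<bar> powr q)" for s y
 proof -
  let ?a = "1 + \<bar>s\<bar>"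
  have "1 + \<bar>s\<bar> powr (q - 1) <= 2 * ?a powr (q - 1)"
   using powr_mono2[of "q - 1" 1 ?a] powr_mono2[of "q - 1" "\<bar>s\<bar>" ?a] p q by simp
  then have "L * (1 + \<bar>s\<bar> powr (q - 1)) <= L * (2 * ?a powr (q - 1))" using L by (intro mult_left_mono) auto
  then have ls: "\<bar>log_source p s\<bar> <= 2 * L * ?a powr (q - 1)"
   using log_source_le[OF p q(1), of s] unfolding L_def[symmetric] by simp
  show ?thesis
  proof (cases "\<bar>y\<bar> <= K * ?a")
   case True
   have "\<bar>log_source p s * y\<bar> <= 2 * L * ?a powr (q - 1) * (K * ?a)"
    unfolding abs_mult using ls True L by (intro mult_mono) auto
   also have "... = 2 * L * K * ?a powr q" by (simp add: powr_diff add_pos_nonneg)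
   also have "... <= 2 * L * K * (2 powr q * (1 powr q + \<bar>s\<bar> powr q))"
    using powr_add_le[of 1 "\<bar>s\<bar>" q] L K p q by (intro mult_left_mono) auto
   finally have "\<bar>log_source p s * y\<bar> <= C * (1 + \<bar>s\<bar> powr q)" by (simp add: C_def mult.assoc)
   then show ?thesis using e by (simp add: add_increasing)
  next
   case False
   have "?a powr (q - 1) <= (\<bar>y\<bar> / K) powr (q - 1)" using False K p q by (intro powr_mono2) (auto simp: field_simps)
   also have "... = \<bar>y\<bar> powr (q - 1) * eps / (2 * L)" using K by (simp add: powr_divide Kp)
   finally have "2 * L * ?a powr (q - 1) <= eps * \<bar>y\<bar> powr (q - 1)" using L by (simp add: field_simps)
   then have "\<bar>log_source p s * y\<bar> <= eps * \<bar>y\<bar> powr (q - 1) * \<bar>y\<bar>"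
    unfolding abs_mult using ls by (intro mult_right_mono) auto
   also have "... = eps * \<bar>y\<bar> powr q" by (cases "y = 0") (auto simp: powr_diff)
   finally show ?thesis using C by (simp add: add_increasing2)
  qed
 qed
 \<comment> \<open>Raising the exponent of \<open>y\<close> from \<open>q\<close> to
   \<open>k\<close> costs the additive constant \<open>eps\<close>.\<close>
 have "\<bar>log_source p s * y\<bar> <= eps * \<bar>y\<bar> powr k + (C + eps) * (1 + \<bar>s\<bar> powr q)" for s y
 proof -
  have "eps * \<bar>y\<bar> powr q <= eps * (1 + \<bar>y\<bar> powr k)" using powr_le_1_add[of "\<bar>y\<bar>" q k] p q e by (intro mult_left_mono) auto
  moreover have "0 <= eps * \<bar>s\<bar> powr q" using e by simp
  ultimately show ?thesis using main[of s y] by (simp add: algebra_simps)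
 qed
 then show ?thesis using that[of "C + eps"] C e by simp
qed

section \<open>Hoelder's inequality in time and bounds in space-time\<close>

lemma J_affine:
 assumes "tint 0 t g" "0 <= t"
 shows "tint 0 t (%s. c + d * g s)" "J 0 t (%s. c + d * g s) = c * t + d * J 0 t g"
proof -
 have e: "indicator {0<..<t} s * (c + d * g s) = indicator {0<..<t} s *\<^sub>R c + d * (indicator {0<..<t} s * g s)" for s
  by (simp add: algebra_simps)
 have i: "integrable lborel (%s. indicator {0<..<t} s *\<^sub>R c)" "(\<integral>s. indicator {0<..<t} s *\<^sub>R c \<partial>lborel) = c * t"
  using assms(2) by auto
 show "tint 0 t (%s. c + d * g s)" "J 0 t (%s. c + d * g s) = c * t + d * J 0 t g"
  unfolding tint_def J_def e using i assms(1) by (simp_all add: tint_def)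
qed

text \<open>Hoelder's inequality with a nonoptimal constant. Pointwise
  \<open>\<bar>f\<bar> \<le> c + c^(1 - q) * \<bar>f\<bar>^q\<close> for every \<open>c > 0\<close>;
  integrating and taking \<open>c = ?X^(1 / q)\<close> balances the two terms.\<close>

lemma J_powr_le:
 assumes f: "tint 0 t f" "tint 0 t (%s. \<bar>f s\<bar> powr q)" and q: "1 < q" and t: "0 <= t"
 shows "\<bar>J 0 t f\<bar> powr q <= (1 + t) powr q * J 0 t (%s. \<bar>f s\<bar> powr q)"
proof -
 let ?X = "J 0 t (%s. \<bar>f s\<bar> powr q)"
 have X: "?X >= 0" by (simp add: J_def)
 have le: "\<bar>J 0 t f\<bar> <= c * t + c powr (1 - q) * ?X" if l: "c > 0" for c
 proof -
  have i: "integrable (leb {0<..<t}) f" using f(1) by (simp add: tint_leb)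
  have "\<bar>J 0 t f\<bar> <= J 0 t (%s. \<bar>f s\<bar>)" using integral_abs_bound[of "leb {0<..<t}" f] by (simp add: tint_leb)
  also have "... <= J 0 t (%s. c + c powr (1 - q) * \<bar>f s\<bar> powr q)"
  proof (rule J_mono[OF _ J_affine(1)[OF f(2) t]])
   show "tint 0 t (%s. \<bar>f s\<bar>)" using integrable_abs[OF i] by (simp add: tint_leb)
   fix s
   show "\<bar>f s\<bar> <= c + c powr (1 - q) * \<bar>f s\<bar> powr q"
   proof (cases "\<bar>f s\<bar> <= c")
    case True then show ?thesis by (simp add: add_increasing2)
   next
    case False
    have "\<bar>f s\<bar> = \<bar>f s\<bar> powr (1 - q) * \<bar>f s\<bar> powr q" using False l by (simp add: powr_add[symmetric])
    also have "... <= c powr (1 - q) * \<bar>f s\<bar> powr q" using False l q by (intro mult_right_mono powr_mono2') auto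
    finally show ?thesis using l by simp
   qed
  qed
  also have "... = c * t + c powr (1 - q) * ?X" by (rule J_affine(2)[OF f(2) t])
  finally show ?thesis .
 qed
 show ?thesis
 proof (cases "?X = 0")
  case True
  have "J 0 t f = 0"
  proof (rule ccontr)
   assume n: "J 0 t f ~= 0"
   \<comment> \<open>When \<open>?X = 0\<close> the bound is \<open>c * t\<close> for all positive
     \<open>c\<close>, and this \<open>c\<close> makes it too small.\<close>
   then have "\<bar>J 0 t f\<bar> <= \<bar>J 0 t f\<bar> / (t + 1) * t" using le[of "\<bar>J 0 t f\<bar> / (t + 1)"] True t by simp
   then show False using n t by (simp add: field_simps)
  qed
  then show ?thesis using True by simp
 next
  case False
  let ?l = "?X powr (1 / q)"
  have "?l powr (1 - q) * ?X = ?X powr ((1 / q) * (1 - q)) * ?X powr 1" using X by (simp add: powr_powr)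
  also have "... = ?l" unfolding powr_add[symmetric] using q by (simp add: field_simps)
  finally have "\<bar>J 0 t f\<bar> <= (1 + t) * ?l" using le[of ?l] False X by (simp add: algebra_simps)
  then have "\<bar>J 0 t f\<bar> powr q <= ((1 + t) * ?l) powr q" using q by (intro powr_mono2) auto
  also have "... = (1 + t) powr q * ?X" using t q X by (simp add: powr_mult powr_powr)
  finally show ?thesis .
 qed
qed

lemma (in finite_measure) st_integrable:
 assumes a: "a : Lq_spacetime T M k" and b: "b : Lq_spacetime T M l"
  and F: "(%z. F (fst z) (snd z)) : borel_measurable (borel \<Otimes>\<^sub>M borel)"
  and le: "!!x y. \<bar>F x y\<bar> <= C * (1 + \<bar>x\<bar> powr k + \<bar>y\<bar> powr l)"
 shows "integrable (leb {0<..<T} \<Otimes>\<^sub>M M) (%p. F (a (fst p) (snd p)) (b (fst p) (snd p)) :: real)"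
proof (rule Bochner_Integration.integrable_bound)
 interpret P: finite_measure "leb {0<..<T} \<Otimes>\<^sub>M M"
  by (intro finite_measure_pair_measure finite_measure_leb finite_measure_axioms) auto
 have ab: "(%p. a (fst p) (snd p)) : borel_measurable (leb {0<..<T} \<Otimes>\<^sub>M M)" "(%p. b (fst p) (snd p)) : borel_measurable (leb {0<..<T} \<Otimes>\<^sub>M M)"
  "integrable (leb {0<..<T} \<Otimes>\<^sub>M M) (%p. \<bar>a (fst p) (snd p)\<bar> powr k)" "integrable (leb {0<..<T} \<Otimes>\<^sub>M M) (%p. \<bar>b (fst p) (snd p)\<bar> powr l)"
  using a b by (simp_all add: Lq_spacetime_def Lq_space_def case_prod_beta')
 show "integrable (leb {0<..<T} \<Otimes>\<^sub>M M) (%p. C * (1 + \<bar>a (fst p) (snd p)\<bar> powr k + \<bar>b (fst p) (snd p)\<bar> powr l))"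
  using ab by simp
 show "(%p. F (a (fst p) (snd p)) (b (fst p) (snd p))) : borel_measurable (leb {0<..<T} \<Otimes>\<^sub>M M)"
  using measurable_compose[OF measurable_Pair[OF ab(1,2)] F] by simp
 show "AE p in leb {0<..<T} \<Otimes>\<^sub>M M. norm (F (a (fst p) (snd p)) (b (fst p) (snd p)))
   <= norm (C * (1 + \<bar>a (fst p) (snd p)\<bar> powr k + \<bar>b (fst p) (snd p)\<bar> powr l))"
  using le by (intro AE_I2) (metis abs_ge_self order_trans real_norm_def)
qed

lemma (in finite_measure) Lq_spacetime_mono:
 assumes v: "v : Lq_spacetime T M k" and q: "0 < q" "q <= k"
 shows "v : Lq_spacetime T M q"
proof -
 have "integrable (leb {0<..<T} \<Otimes>\<^sub>M M) (%p. \<bar>v (fst p) (snd p)\<bar> powr q)"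
  by (rule st_integrable[OF v v, where F = "%x y. \<bar>x\<bar> powr q" and C = 1]) (use powr_le_1_add q in \<open>auto intro: add_increasing2\<close>)
 then show ?thesis using v by (simp add: Lq_spacetime_def Lq_space_def case_prod_beta')
qed

lemma (in sigma_finite_measure) Lq_spacetime_restrict: "v : Lq_spacetime T M q ==> t <= T ==> v : Lq_spacetime t M q"
 using Lq_spacetime_shift[of v T q 0 t] by simp

lemma (in finite_measure) Lq_spacetimeI:
 assumes v: "st_measurable T M v" and R: "!!s. 0 < s ==> s < T ==> (\<integral>\<^sup>+x. ennreal (\<bar>v s x\<bar> powr q) \<partial>M) <= ennreal R"
 shows "v : Lq_spacetime T M q"
proof -
 have "NJ 0 T (%s. \<integral>\<^sup>+x. ennreal (\<bar>v s x\<bar> powr q) \<partial>M) <= NJ 0 T (%_. ennreal R)" by (rule NJ_mono) (rule R)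
 also have "... < \<infinity>" unfolding NJ_def using emeasure_bounded_finite[of "{0<..<T}"] by (subst nn_integral_cmult_indicator) (auto simp: ennreal_mult_less_top)
 finally show ?thesis using v by (simp add: Lq_spacetime_iff)
qed

text \<open>Pointwise in \<open>x\<close>, the integral formula and Hoelder in time bound
  \<open>\<bar>u t x\<bar>^q\<close> by an integrable function. It holds up to the final time, where
  the next restart takes its data.\<close>

lemma (in finite_measure) time_deriv_powr_le:
 assumes u: "time_deriv T M u v" and u0: "u 0 : Lq_space q M" and v: "v : Lq_spacetime T M q" and q: "1 < q" and t: "0 <= t" "t <= T"
 shows "integrable M (%x. 2 powr q * (\<bar>u 0 x\<bar> powr q + (1 + T) powr q * J 0 t (%s. \<bar>v s x\<bar> powr q)))"
  "AE x in M. \<bar>u t x\<bar> powr q <= 2 powr q * (\<bar>u 0 x\<bar> powr q + (1 + T) powr q * J 0 t (%s. \<bar>v s x\<bar> powr q))"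
proof -
 have vi: "integrable (leb {0<..<t} \<Otimes>\<^sub>M M) (%p. \<bar>v (fst p) (snd p)\<bar> powr q)"
  using Lq_spacetime_restrict[OF v t(2)] by (simp add: Lq_spacetime_def Lq_space_def case_prod_beta')
 show "integrable M (%x. 2 powr q * (\<bar>u 0 x\<bar> powr q + (1 + T) powr q * J 0 t (%s. \<bar>v s x\<bar> powr q)))"
  using u0 J_product(4)[OF vi] by (simp add: Lq_space_def)
 have "AE x in M. tint 0 t (%s. v s x) & u t x = u 0 x + J 0 t (%s. v s x)" using u t by (auto simp: time_deriv_iff)
 then show "AE x in M. \<bar>u t x\<bar> powr q <= 2 powr q * (\<bar>u 0 x\<bar> powr q + (1 + T) powr q * J 0 t (%s. \<bar>v s x\<bar> powr q))"
  using J_product(3)[OF vi]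
 proof eventually_elim
  case (elim x)
  have "\<bar>u t x\<bar> powr q <= (\<bar>u 0 x\<bar> + \<bar>J 0 t (%s. v s x)\<bar>) powr q" using elim q by (intro powr_mono2) auto
  also have "... <= 2 powr q * (\<bar>u 0 x\<bar> powr q + \<bar>J 0 t (%s. v s x)\<bar> powr q)" using q by (intro powr_add_le) auto
  also have "\<bar>J 0 t (%s. v s x)\<bar> powr q <= (1 + t) powr q * J 0 t (%s. \<bar>v s x\<bar> powr q)"
   by (rule J_powr_le) (use elim q t in auto)
  also have "... <= (1 + T) powr q * J 0 t (%s. \<bar>v s x\<bar> powr q)"
   using t q by (intro mult_right_mono powr_mono2) (auto simp: J_def)
  finally show ?case by simp
 qed
qed

text \<open>The bound for each slice grows with \<open>t\<close>, so its value at \<open>T\<close>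
  is uniform in time; applied to a jointly measurable version it gives integrability in
  space-time.\<close>

lemma (in finite_measure) time_deriv_Lq:
 assumes u: "time_deriv T M u v" and u0: "u 0 : Lq_space q M" and v: "v : Lq_spacetime T M q" and q: "1 < q"
 obtains U where "U : Lq_spacetime T M q" "!!t. 0 <= t ==> t <= T ==> AE x in M. U t x = u t x"
  "!!t. 0 < t ==> t < T ==> (\<integral>x. \<bar>U t x\<bar> powr q \<partial>M)
    <= 2 powr q * ((\<integral>x. \<bar>u 0 x\<bar> powr q \<partial>M) + (1 + T) powr q * J 0 t (%s. \<integral>x. \<bar>v s x\<bar> powr q \<partial>M))"
proof -
 have u0m: "u 0 : borel_measurable M" and u0i: "integrable M (%x. \<bar>u 0 x\<bar> powr q)" using u0 by (auto simp: Lq_space_def)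
 obtain U where U: "st_measurable T M U" "!!t. 0 <= t ==> t <= T ==> AE x in M. U t x = u t x"
  using time_deriv_version[OF u u0m] by blast
 let ?R = "%t x. 2 powr q * (\<bar>u 0 x\<bar> powr q + (1 + T) powr q * J 0 t (%s. \<bar>v s x\<bar> powr q))"
 have vi: "integrable (leb {0<..<t} \<Otimes>\<^sub>M M) (%p. \<bar>v (fst p) (snd p)\<bar> powr q)" if "t <= T" for t
  using Lq_spacetime_restrict[OF v that] by (simp add: Lq_spacetime_def Lq_space_def case_prod_beta')
 have Ri: "integrable M (?R t)" "(\<integral>x. ?R t x \<partial>M) = 2 powr q * ((\<integral>x. \<bar>u 0 x\<bar> powr q \<partial>M) + (1 + T) powr q * J 0 t (%s. \<integral>x. \<bar>v s x\<bar> powr q \<partial>M))" if "t <= T" for t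
  using u0i J_product(4,5)[OF vi[OF that]] by simp_all
 have ae: "AE x in M. \<bar>U t x\<bar> powr q <= ?R t x" if t: "0 < t" "t < T" for t
  using time_deriv_powr_le(2)[OF u u0 v q, of t] U(2)[of t] t by auto
 have Um: "U t : borel_measurable M" if "0 < t" "t < T" for t using st_measurable_section[OF U(1) that] .
 have Ui: "integrable M (%x. \<bar>U t x\<bar> powr q)" if t: "0 < t" "t < T" for t
 proof (rule Bochner_Integration.integrable_bound)
  show "integrable M (?R t)" using Ri(1) t by simp
  show "(%x. \<bar>U t x\<bar> powr q) : borel_measurable M" using Um[OF t] by measurable
  show "AE x in M. norm (\<bar>U t x\<bar> powr q) <= norm (?R t x)" using ae[OF t] by eventually_elim simp
 qed
 have le: "(\<integral>x. \<bar>U t x\<bar> powr q \<partial>M) <= (\<integral>x. ?R t x \<partial>M)" if t: "0 < t" "t < T" for t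
  using Ui[OF t] Ri(1)[of t] ae[OF t] t by (intro integral_mono_AE) auto
 have "U : Lq_spacetime T M q"
 proof (rule Lq_spacetimeI[OF U(1), where R = "\<integral>x. ?R T x \<partial>M"])
  fix t assume t: "0 < t" "t < T"
  have "(\<integral>\<^sup>+x. ennreal (\<bar>U t x\<bar> powr q) \<partial>M) = ennreal (\<integral>x. \<bar>U t x\<bar> powr q \<partial>M)" using Ui[OF t] by (intro nn_integral_eq_integral) auto
  also have "(\<integral>x. \<bar>U t x\<bar> powr q \<partial>M) <= (\<integral>x. ?R T x \<partial>M)"
  proof -
   have "J 0 t (%s. \<integral>x. \<bar>v s x\<bar> powr q \<partial>M) <= J 0 T (%s. \<integral>x. \<bar>v s x\<bar> powr q \<partial>M)"
    unfolding J_def using J_product(1)[OF vi[OF order_refl]] J_product(1)[OF vi[of t]] t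
    by (intro integral_mono) (auto simp: tint_def indicator_def)
   then show ?thesis using le[OF t] t unfolding Ri(2)[OF less_imp_le[OF t(2)]] Ri(2)[OF order_refl]
    by (auto intro!: order_trans[OF le[OF t, unfolded Ri(2)[OF less_imp_le[OF t(2)]]]] mult_left_mono add_left_mono)
  qed
  finally show "(\<integral>\<^sup>+x. ennreal (\<bar>U t x\<bar> powr q) \<partial>M) <= ennreal (\<integral>x. ?R T x \<partial>M)" by (simp add: ennreal_leI)
 qed
 then show ?thesis
 proof (rule that[OF _ U(2)])
  fix t assume t: "0 < t" "t < T"
  show "(\<integral>x. \<bar>U t x\<bar> powr q \<partial>M)
    <= 2 powr q * ((\<integral>x. \<bar>u 0 x\<bar> powr q \<partial>M) + (1 + T) powr q * J 0 t (%s. \<integral>x. \<bar>v s x\<bar> powr q \<partial>M))"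
   using le[OF t] unfolding Ri(2)[OF less_imp_le[OF t(2)]] .
 qed
qed

lemma source_measurable: "(%z. log_source p (fst z) * snd z) : borel_measurable (borel \<Otimes>\<^sub>M borel)"
 unfolding log_source_def by measurable

text \<open>Integrability is established in space-time for the measurable versions \<open>U\<close>
  and \<open>Ph\<close>; on each slice they produce the same spatial integral as \<open>u\<close>
  and \<open>ph\<close>.\<close>

lemma (in finite_measure) source_tint:
 assumes u: "time_deriv T M u v" "!!t. 0 <= t ==> t <= T ==> u t : borel_measurable M" "u 0 : Lq_space q M" "v : Lq_spacetime T M k"
  and pq: "1 < p" "p + 1 < q" "q <= k"
  and Ph: "Ph : Lq_spacetime T M k" "!!t. 0 < t ==> t < T ==> AE x in M. Ph t x = ph t x"
   "!!t. 0 < t ==> t < T ==> ph t : borel_measurable M"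
 shows "tint 0 T (%s. \<integral>x. log_source p (u s x) * ph s x \<partial>M)"
proof -
 have vq: "v : Lq_spacetime T M q" by (rule Lq_spacetime_mono[OF u(4)]) (use pq in auto)
 have q: "1 < q" using pq by simp
 obtain U where U: "U : Lq_spacetime T M q" "!!t. 0 <= t ==> t <= T ==> AE x in M. U t x = u t x"
  using time_deriv_Lq[OF u(1,3) vq q] by metis
 obtain C where C: "C >= 0" "!!s y. \<bar>log_source p s * y\<bar> <= 1 * \<bar>y\<bar> powr k + C * (1 + \<bar>s\<bar> powr q)"
  using log_source_young[OF pq zero_less_one] by blast
 have i: "integrable (leb {0<..<T} \<Otimes>\<^sub>M M) (%p'. log_source p (U (fst p') (snd p')) * Ph (fst p') (snd p'))"
 proof (rule st_integrable[OF U(1) Ph(1) source_measurable, where C = "1 + C"])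
  fix x y :: real
  have "0 <= C * \<bar>y\<bar> powr k" using C(1) by auto
  moreover have "(1 + C) * (1 + \<bar>x\<bar> powr q + \<bar>y\<bar> powr k) = (1 * \<bar>y\<bar> powr k + C * (1 + \<bar>x\<bar> powr q)) + (1 + \<bar>x\<bar> powr q + C * \<bar>y\<bar> powr k)"
   by (simp add: algebra_simps)
  ultimately show "\<bar>log_source p x * y\<bar> <= (1 + C) * (1 + \<bar>x\<bar> powr q + \<bar>y\<bar> powr k)"
   using C(2)[of x y] powr_ge_zero[of "\<bar>x\<bar>" q] by linarith
 qed
 have eq: "(\<integral>x. log_source p (u s x) * ph s x \<partial>M) = (\<integral>x. log_source p (U s x) * Ph s x \<partial>M)" if s: "0 < s" "s < T" for s
 proof (rule integral_cong_AE)
  have m: "u s : borel_measurable M" "U s : borel_measurable M" "Ph s : borel_measurable M" "ph s : borel_measurable M"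
   using u(2) s U(1) Ph by (auto simp: Lq_spacetime_iff intro: st_measurable_section)
  show "(%x. log_source p (u s x) * ph s x) : borel_measurable M" "(%x. log_source p (U s x) * Ph s x) : borel_measurable M"
   using measurable_compose[OF measurable_Pair[OF m(1,4)] source_measurable] measurable_compose[OF measurable_Pair[OF m(2,3)] source_measurable] by simp_all
  show "AE x in M. log_source p (u s x) * ph s x = log_source p (U s x) * Ph s x"
   using U(2)[of s] Ph(2)[OF s] s by (auto elim!: AE_mp)
 qed
 show ?thesis by (rule iffD2[OF tint_cong J_product(1)[OF i]]) (rule eq)
qed

lemma (in finite_measure) damping_tint:
 assumes a: "a : Lq_spacetime T M (m + 1)" and m: "1 <= m"
  and Ph: "Ph : Lq_spacetime T M (m + 1)" "!!t. 0 < t ==> t < T ==> AE x in M. Ph t x = ph t x"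
   "!!t. 0 < t ==> t < T ==> ph t : borel_measurable M"
 shows "tint 0 T (%s. \<integral>x. damping m (a s x) * ph s x \<partial>M)"
proof -
 have dm: "(%z. damping m (fst z) * snd z) : borel_measurable (borel \<Otimes>\<^sub>M borel)" unfolding damping_def by measurable
 have i: "integrable (leb {0<..<T} \<Otimes>\<^sub>M M) (%p'. damping m (a (fst p') (snd p')) * Ph (fst p') (snd p'))"
 proof (rule st_integrable[OF a Ph(1) dm, where C = 1])
  fix x y :: real
  show "\<bar>damping m x * y\<bar> <= 1 * (1 + \<bar>x\<bar> powr (m + 1) + \<bar>y\<bar> powr (m + 1))" using damping_mult_le[OF m, of x y] by simp
 qed
 have eq: "(\<integral>x. damping m (a s x) * ph s x \<partial>M) = (\<integral>x. damping m (a s x) * Ph s x \<partial>M)" if s: "0 < s" "s < T" for s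
 proof (rule integral_cong_AE)
  have am: "a s : borel_measurable M" "Ph s : borel_measurable M" using s a Ph(1) by (auto simp: Lq_spacetime_iff intro: st_measurable_section)
  show "(%x. damping m (a s x) * ph s x) : borel_measurable M" "(%x. damping m (a s x) * Ph s x) : borel_measurable M"
   using measurable_compose[OF measurable_Pair[OF am(1) Ph(3)[OF s]] dm] measurable_compose[OF measurable_Pair[OF am] dm] by simp_all
  show "AE x in M. damping m (a s x) * ph s x = damping m (a s x) * Ph s x" using Ph(2)[OF s] by auto
 qed
 show ?thesis by (rule iffD2[OF tint_cong J_product(1)[OF i]]) (rule eq)
qed

lemma (in finite_measure) Lq_spacetime_tint: "v : Lq_spacetime T M k ==> tint 0 T (%s. \<integral>x. \<bar>v s x\<bar> powr k \<partial>M)"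
 by (rule J_product(1)) (simp add: Lq_spacetime_def Lq_space_def case_prod_beta')

text \<open>Half of the damping absorbs the source up to the \<open>L\<^sup>q\<close> norm of \<open>u\<close>, and that norm is itself
 controlled by the damping since \<open>q \<le> k\<close>.\<close>

lemma (in finite_measure) source_bound:
 assumes pq: "1 < p" "p + 1 < q" "q <= k" and S: "0 <= S" and B: "0 <= B"
 obtains C where "C >= 0" "!!T u v t. time_deriv T M u v ==> (!!t. 0 <= t ==> t <= T ==> u t : borel_measurable M) ==>
  u 0 : Lq_space q M ==> (\<integral>x. \<bar>u 0 x\<bar> powr q \<partial>M) <= B ==> v : Lq_spacetime T M k ==> T <= S ==> 0 <= t ==> t <= T ==>
  J 0 t (%s. \<integral>x. log_source p (u s x) * v s x \<partial>M)
   <= 1/2 * J 0 t (%s. \<integral>x. \<bar>v s x\<bar> powr k \<partial>M) + C + C * J 0 t (%s. J 0 s (%s. \<integral>x. \<bar>v s x\<bar> powr k \<partial>M))"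
proof -
 obtain C0 where C0: "C0 >= 0" "!!s y. \<bar>log_source p s * y\<bar> <= 1/2 * \<bar>y\<bar> powr k + C0 * (1 + \<bar>s\<bar> powr q)"
  using log_source_young[OF pq, of "1/2"] by auto
 let ?\<mu> = "measure M (space M)"
 \<comment> \<open>\<open>D2\<close> multiplies the accumulated dissipation; \<open>D\<close>
   collects the initial norm and the cost of replacing \<open>q\<close> by \<open>k\<close>. They
   depend on \<open>S\<close> and \<open>B\<close> only, not on the path or on its interval.\<close>
 define D2 where "D2 = 2 powr q * (1 + S) powr q"
 define D where "D = 2 powr q * B + D2 * (?\<mu> * S)"
 define C where "C = C0 * (?\<mu> * S + D * S) + C0 * D2"
 have q: "1 < q" "0 < q" using pq by auto
 have D: "D2 >= 0" "D >= 0" "C0 * (?\<mu> * S + D * S) >= 0" using S B C0(1) by (auto simp: D2_def D_def)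
 have "J 0 t (%s. \<integral>x. log_source p (u s x) * v s x \<partial>M)
   <= 1/2 * J 0 t (%s. \<integral>x. \<bar>v s x\<bar> powr k \<partial>M) + C + C * J 0 t (%s. J 0 s (%s. \<integral>x. \<bar>v s x\<bar> powr k \<partial>M))"
  if u: "time_deriv T M u v" "!!t. 0 <= t ==> t <= T ==> u t : borel_measurable M" "u 0 : Lq_space q M" "(\<integral>x. \<bar>u 0 x\<bar> powr q \<partial>M) <= B"
   and v: "v : Lq_spacetime T M k" and T: "T <= S" and t: "0 <= t" "t <= T" for T u v t
 proof -
  let ?V = "%s. \<integral>x. \<bar>v s x\<bar> powr k \<partial>M" and ?Vq = "%s. \<integral>x. \<bar>v s x\<bar> powr q \<partial>M"
  have vq: "v : Lq_spacetime T M q" by (rule Lq_spacetime_mono[OF v]) (use pq in auto)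
  obtain U where U: "U : Lq_spacetime T M q" "!!t. 0 <= t ==> t <= T ==> AE x in M. U t x = u t x"
   "!!t. 0 < t ==> t < T ==> (\<integral>x. \<bar>U t x\<bar> powr q \<partial>M) <= 2 powr q * ((\<integral>x. \<bar>u 0 x\<bar> powr q \<partial>M) + (1 + T) powr q * J 0 t ?Vq)"
   using time_deriv_Lq[OF u(1,3) vq q(1)] by blast
  let ?P = "%t::real. leb {0<..<t} \<Otimes>\<^sub>M M"
  have fin: "finite_measure (?P s)" for s by (intro finite_measure_pair_measure finite_measure_leb finite_measure_axioms) auto
  have iv: "integrable (?P s) (%z. \<bar>v (fst z) (snd z)\<bar> powr k)" "integrable (?P s) (%z. \<bar>v (fst z) (snd z)\<bar> powr q)"
    "integrable (?P s) (%z. \<bar>U (fst z) (snd z)\<bar> powr q)" if "s <= T" for s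
   using Lq_spacetime_restrict[OF v that] Lq_spacetime_restrict[OF vq that] Lq_spacetime_restrict[OF U(1) that]
   by (auto simp: Lq_spacetime_def Lq_space_def case_prod_beta')
  have i1: "integrable (?P s) (%z. 1 :: real)" for s using finite_measure.integrable_const[OF fin] by blast
  have one: "(\<integral>z. 1 \<partial>?P s) = s * ?\<mu>" if "0 <= s" for s
   using J_product(2)[OF i1[of s], symmetric] J_affine(2)[of s "%_. 0" ?\<mu> 0] that by (simp add: tint_def)
  \<comment> \<open>Passing from exponent \<open>q\<close> to the larger \<open>k\<close> costs the
    measure of the space-time cylinder.\<close>
  have Vq: "J 0 s ?Vq <= ?\<mu> * S + J 0 s ?V" if s: "0 <= s" "s <= T" for s
  proof -
   have "J 0 s ?Vq = (\<integral>z. \<bar>v (fst z) (snd z)\<bar> powr q \<partial>?P s)" by (rule J_product(2)[OF iv(2)[OF s(2)]])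
   also have "... <= (\<integral>z. 1 + \<bar>v (fst z) (snd z)\<bar> powr k \<partial>?P s)"
    using iv[OF s(2)] i1 pq by (intro integral_mono powr_le_1_add) auto
   also have "... = s * ?\<mu> + J 0 s ?V"
    unfolding J_product(2)[OF iv(1)[OF s(2)]] using iv(1)[OF s(2)] i1 one[OF s(1)] by simp
   also have "s * ?\<mu> <= ?\<mu> * S" using s T by (simp add: mult.commute[of s] mult_left_mono)
   finally show ?thesis by simp
  qed
  have Us: "(\<integral>x. \<bar>U s x\<bar> powr q \<partial>M) <= D + D2 * J 0 s ?V" if s: "0 < s" "s < T" for s
  proof -
   have n: "0 <= J 0 s ?Vq" unfolding J_def by (intro integral_nonneg_AE) (simp add: indicator_def)
   have "(1 + T) powr q * J 0 s ?Vq <= (1 + S) powr q * (?\<mu> * S + J 0 s ?V)"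
    using Vq[of s] s T q n by (intro mult_mono powr_mono2) auto
   then have "(\<integral>x. \<bar>u 0 x\<bar> powr q \<partial>M) + (1 + T) powr q * J 0 s ?Vq <= B + (1 + S) powr q * (?\<mu> * S + J 0 s ?V)" using u(4) by simp
   from mult_left_mono[OF this, of "2 powr q"] U(3)[OF s] show ?thesis by (simp add: D_def D2_def algebra_simps)
  qed
  have tV: "tint 0 t (%s. J 0 s ?V)" by (rule continuous_tint, rule J_continuous, rule J_product(1)[OF iv(1)[OF t(2)]])
  have "J 0 t (%s. \<integral>x. \<bar>U s x\<bar> powr q \<partial>M) <= J 0 t (%s. D + D2 * J 0 s ?V)"
   by (rule J_mono[OF J_product(1)[OF iv(3)[OF t(2)]] J_affine(1)[OF tV t(1)]]) (use Us t in auto)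
  also have "... = D * t + D2 * J 0 t (%s. J 0 s ?V)" by (rule J_affine(2)[OF tV t(1)])
  also have "D * t <= D * S" using D(2) t T by (intro mult_left_mono) auto
  finally have JU: "J 0 t (%s. \<integral>x. \<bar>U s x\<bar> powr q \<partial>M) <= D * S + D2 * J 0 t (%s. J 0 s ?V)" by simp
  have iF: "integrable (?P t) (%z. log_source p (U (fst z) (snd z)) * v (fst z) (snd z))"
  proof (rule st_integrable[OF Lq_spacetime_restrict[OF U(1) t(2)] Lq_spacetime_restrict[OF v t(2)] source_measurable, where C = "1 + C0"])
   fix x y :: real
   have "0 <= C0 * \<bar>y\<bar> powr k" using C0(1) by auto
   moreover have "(1 + C0) * (1 + \<bar>x\<bar> powr q + \<bar>y\<bar> powr k) = (1/2 * \<bar>y\<bar> powr k + C0 * (1 + \<bar>x\<bar> powr q)) + (1 + \<bar>x\<bar> powr q + 1/2 * \<bar>y\<bar> powr k + C0 * \<bar>y\<bar> powr k)"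
    by (simp add: algebra_simps)
   ultimately show "\<bar>log_source p x * y\<bar> <= (1 + C0) * (1 + \<bar>x\<bar> powr q + \<bar>y\<bar> powr k)"
    using C0(2)[of x y] powr_ge_zero[of "\<bar>x\<bar>" q] powr_ge_zero[of "\<bar>y\<bar>" k] by linarith
  qed
  have "J 0 t (%s. \<integral>x. log_source p (u s x) * v s x \<partial>M) = J 0 t (%s. \<integral>x. log_source p (U s x) * v s x \<partial>M)"
  proof (rule J_cong, rule integral_cong_AE)
   fix s assume s: "0 < s" "s < t"
   have m: "u s : borel_measurable M" "U s : borel_measurable M" "v s : borel_measurable M"
    using u(2) s t U(1) v by (auto simp: Lq_spacetime_iff intro: st_measurable_section)
   show "(%x. log_source p (u s x) * v s x) : borel_measurable M" "(%x. log_source p (U s x) * v s x) : borel_measurable M"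
    using measurable_compose[OF measurable_Pair[OF m(1,3)] source_measurable] measurable_compose[OF measurable_Pair[OF m(2,3)] source_measurable] by simp_all
   show "AE x in M. log_source p (u s x) * v s x = log_source p (U s x) * v s x" using U(2)[of s] s t by auto
  qed
  also have "... = (\<integral>z. log_source p (U (fst z) (snd z)) * v (fst z) (snd z) \<partial>?P t)" by (rule J_product(2)[OF iF])
  also have "... <= (\<integral>z. 1/2 * \<bar>v (fst z) (snd z)\<bar> powr k + C0 * (1 + \<bar>U (fst z) (snd z)\<bar> powr q) \<partial>?P t)"
   using iv[OF t(2)] i1 C0(2) by (intro integral_mono iF) (auto intro: abs_le_D1)
  also have "... = 1/2 * J 0 t ?V + C0 * (t * ?\<mu> + J 0 t (%s. \<integral>x. \<bar>U s x\<bar> powr q \<partial>M))"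
   unfolding J_product(2)[OF iv(1)[OF t(2)]] J_product(2)[OF iv(3)[OF t(2)]] using iv[OF t(2)] i1[of t] one[OF t(1)] by simp
  also have "C0 * (t * ?\<mu> + J 0 t (%s. \<integral>x. \<bar>U s x\<bar> powr q \<partial>M)) <= C0 * (?\<mu> * S + (D * S + D2 * J 0 t (%s. J 0 s ?V)))"
   using JU C0(1) t T by (intro mult_left_mono add_mono) (auto simp: mult.commute[of t] mult_left_mono)
  also have "... <= C + C * J 0 t (%s. J 0 s ?V)"
  proof -
   have "0 <= J 0 t (%s. J 0 s ?V)" unfolding J_def by (intro integral_nonneg_AE AE_I2 mult_nonneg_nonneg) auto
   then have "0 <= C0 * (?\<mu> * S + D * S) * J 0 t (%s. J 0 s ?V)" "0 <= C0 * D2" using D C0(1) by auto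
   then show ?thesis by (simp add: C_def algebra_simps)
  qed
  finally show ?thesis by simp
 qed
 moreover have "C >= 0" using D C0(1) by (simp add: C_def)
 ultimately show ?thesis using that by blast
qed

section \<open>Paths in the energy space\<close>

abbreviation UC :: "acoustic_geometry => real => (real => real^3 => real) set" where
 "UC G T \<equiv> C_time T (H1_Gam0 G) (grad_norm (Om G))"

abbreviation WC :: "acoustic_geometry => real => (real => real^3 => real) set" where
 "WC G T \<equiv> C_time T (H20_Gam G) (%w. L2_norm (mGam G) (lap_Gam G w))"

lemma C_time_dominated:
 assumes u: "u : C_time T X N" and Y: "!!t. 0 <= t ==> t <= T ==> v t : Y"
  and le: "!!s t. 0 <= s ==> s <= T ==> 0 <= t ==> t <= T ==> \<bar>N' (%x. v s x - v t x)\<bar> <= N (%x. u s x - u t x)"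
 shows "v : C_time T Y N'"
 unfolding C_time_def
proof (intro CollectI ballI conjI)
 fix t assume t: "t : {0..T}"
 then show "v t : Y" using Y by simp
 have lim: "((%s. N (%x. u s x - u t x)) \<longlongrightarrow> 0) (at t within {0..T})" using u t by (simp add: C_time_def)
 have "\<forall>\<^sub>F s in at t within {0..T}. norm (N' (%x. v s x - v t x)) <= N (%x. u s x - u t x)"
  unfolding eventually_at_filter by (rule always_eventually) (use le t in auto)
 from Lim_null_comparison[OF this lim] show "((%s. N' (%x. v s x - v t x)) \<longlongrightarrow> 0) (at t within {0..T})" .
qed

lemma UC_H1: "u : UC G T ==> 0 <= t ==> t <= T ==> u t : H1 (Om G)"
 by (auto simp: C_time_def H1_Gam0_def)

lemma UC_measurable: "u : UC G T ==> 0 <= t ==> t <= T ==> u t : borel_measurable (mOm G)"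
 using L2_measurable[OF H1_L2[OF UC_H1]] by (simp add: mOm_def)

lemma weak_pd_L2c:
 assumes G: "structural_acoustic G" and u: "u : UC G T" and b: "b : Basis"
 shows "(%s. weak_pd (Om G) b (u s)) : L2c T (leb (Om G))"
proof (rule C_time_dominated[OF u])
 show "weak_pd (Om G) b (u t) : Lq_space 2 (leb (Om G))" if "0 <= t" "t <= T" for t using H1_weak_pd_L2[OF UC_H1[OF u that] b] .
 fix s t assume s: "0 <= s" "s <= T" and t: "0 <= t" "t <= T"
 show "\<bar>L2_norm (leb (Om G)) (%x. weak_pd (Om G) b (u s) x - weak_pd (Om G) b (u t) x)\<bar> <= grad_norm (Om G) (%x. u s x - u t x)"
  unfolding L2_norm_weak_pd_triangle[OF structural_acousticD(1)[OF G] UC_H1[OF u s] UC_H1[OF u t] b, symmetric]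
  using weak_pd_le_grad_norm[OF b] by (simp add: L2_norm_nonneg)
qed

lemma grad_inner_tint:
 assumes G: "structural_acoustic G" and u: "u : UC G T" and v: "v : UC G T"
 shows "tint 0 T (%s. grad_inner (Om G) (u s) (v s))"
 unfolding grad_inner_def
 by (rule continuous_tint, rule continuous_on_sum, rule L2c_inner_continuous) (rule weak_pd_L2c[OF G u] weak_pd_L2c[OF G v]; assumption)+

lemma lap_L2c:
 assumes G: "structural_acoustic G" and w: "w : WC G T"
 shows "(%s. lap_Gam G (w s)) : L2c T (mGam G)"
proof (rule C_time_dominated[OF w])
 have H: "w t : H20_Gam G" if "0 <= t" "t <= T" for t using C_time_mem[OF w that] .
 show "lap_Gam G (w t) : Lq_space 2 (mGam G)" if "0 <= t" "t <= T" for t using lap_Gam_L2(1)[OF G H[OF that]] .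
 fix s t assume s: "0 <= s" "s <= T" and t: "0 <= t" "t <= T"
 have "L2_norm (mGam G) (lap_Gam G (%x. w s x - w t x)) = L2_norm (mGam G) (%x. lap_Gam G (w s) x - lap_Gam G (w t) x)"
  by (rule L2_norm_cong_AE[OF lap_Gam_diff(1)[OF G H[OF s] H[OF t]]])
   (use L2_measurable[OF lap_Gam_diff(2)[OF G H[OF s] H[OF t]]] L2_measurable[OF L2_diff[OF lap_Gam_L2(1)[OF G H[OF s]] lap_Gam_L2(1)[OF G H[OF t]]]] in auto)
 then show "\<bar>L2_norm (mGam G) (%x. lap_Gam G (w s) x - lap_Gam G (w t) x)\<bar> <= L2_norm (mGam G) (lap_Gam G (%x. w s x - w t x))"
  by (simp add: L2_norm_nonneg)
qed

text \<open>Continuity in \<open>UC\<close> controls the gradient only, whereas the trace is bounded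
  by the full \<open>H1\<close> norm. The missing \<open>L^2\<close> part is supplied by the time
  derivative.\<close>

lemma trace_L2c:
 assumes G: "structural_acoustic G" and u: "u : UC G T" and ut: "time_deriv T (mOm G) u ut"
 shows "(%s. bdry_trace G (u s)) : L2c T (mGam G)"
proof -
 obtain K where K: "0 <= K" "!!u v. u : H1 (Om G) ==> v : H1 (Om G) ==>
   L2_norm (bdry_measure G) (%x. bdry_trace G u x - bdry_trace G v x) <= K * H1_norm (Om G) (%x. u x - v x)"
  "!!u. u : H1 (Om G) ==> bdry_trace G u : Lq_space 2 (bdry_measure G)"
  using bdry_trace_lipschitz[OF G] by blast
 have L: "u t : Lq_space 2 (mOm G)" if "0 <= t" "t <= T" for t using H1_L2[OF UC_H1[OF u that]] by (simp add: mOm_def)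
 have c: "u : L2c T (mOm G)" by (rule time_deriv_L2c[OF finite_measure_mOm[OF G] ut L])
 have sum: "u : C_time T (H1 (Om G)) (%v. K * (L2_norm (mOm G) v + grad_norm (Om G) v))"
  unfolding C_time_def
 proof (intro CollectI ballI conjI)
  fix t assume t: "t : {0..T}"
  then show "u t : H1 (Om G)" using UC_H1[OF u] by simp
  have "((%s. L2_norm (mOm G) (%x. u s x - u t x)) \<longlongrightarrow> 0) (at t within {0..T})"
   "((%s. grad_norm (Om G) (%x. u s x - u t x)) \<longlongrightarrow> 0) (at t within {0..T})"
   using c u t by (auto simp: C_time_def)
  from tendsto_mult_left[OF tendsto_add[OF this], of K]
  show "((%s. K * (L2_norm (mOm G) (%x. u s x - u t x) + grad_norm (Om G) (%x. u s x - u t x))) \<longlongrightarrow> 0) (at t within {0..T})" by simp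
 qed
 show ?thesis
 proof (rule C_time_dominated[OF sum])
  show "bdry_trace G (u t) : Lq_space 2 (mGam G)" if "0 <= t" "t <= T" for t by (rule L2_mGam(1)[OF G K(3)[OF UC_H1[OF u that]]])
  fix s t assume s: "0 <= s" "s <= T" and t: "0 <= t" "t <= T"
  note h = UC_H1[OF u s] UC_H1[OF u t]
  have "L2_norm (mGam G) (%x. bdry_trace G (u s) x - bdry_trace G (u t) x) <= K * H1_norm (Om G) (%x. u s x - u t x)"
   by (rule order_trans[OF L2_mGam(2)[OF G L2_diff[OF K(3)[OF h(1)] K(3)[OF h(2)]]] K(2)[OF h]])
  also have "... <= K * (L2_norm (mOm G) (%x. u s x - u t x) + grad_norm (Om G) (%x. u s x - u t x))"
   unfolding mOm_def by (rule mult_left_mono[OF H1_norm_le_grad K(1)])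
  finally show "\<bar>L2_norm (mGam G) (%x. bdry_trace G (u s) x - bdry_trace G (u t) x)\<bar> <= K * (L2_norm (mOm G) (%x. u s x - u t x) + grad_norm (Om G) (%x. u s x - u t x))"
   by (simp add: L2_norm_nonneg)
 qed
qed

lemma (in finite_measure) bounded_powr:
 assumes "f : borel_measurable M" "AE x in M. \<bar>f x\<bar> <= C" "0 < q"
 shows "f : Lq_space q M" "(\<integral>\<^sup>+x. ennreal (\<bar>f x\<bar> powr q) \<partial>M) <= ennreal (C powr q * measure M (space M))"
proof -
 have m: "(%x. \<bar>f x\<bar> powr q) : borel_measurable M" using assms(1) by measurable
 have ae: "AE x in M. \<bar>f x\<bar> powr q <= C powr q" using assms(2) by eventually_elim (use assms(3) in \<open>auto intro: powr_mono2\<close>)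
 have "(\<integral>\<^sup>+x. ennreal (\<bar>f x\<bar> powr q) \<partial>M) <= (\<integral>\<^sup>+x. ennreal (C powr q) \<partial>M)"
  by (rule nn_integral_mono_AE) (use ae in \<open>eventually_elim, simp add: ennreal_leI\<close>)
 also have "... = ennreal (C powr q * measure M (space M))" by (simp add: emeasure_eq_measure ennreal_mult)
 finally show "(\<integral>\<^sup>+x. ennreal (\<bar>f x\<bar> powr q) \<partial>M) <= ennreal (C powr q * measure M (space M))" .
 have "integrable M (%x. \<bar>f x\<bar> powr q)" by (rule integrable_const_bound[OF _ m, of "C powr q"]) (use ae in auto)
 then show "f : Lq_space q M" using assms(1) by (simp add: Lq_space_def)
qed

lemma H20_Gam_Lq:
 assumes G: "structural_acoustic G" and w: "w : H20_Gam G" and q: "0 < q"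
 shows "w : Lq_space q (mGam G)"
proof -
 interpret finite_measure "mGam G" by (rule finite_measure_mGam[OF G])
 obtain C where "!!w. w : H20_Gam G ==> AE x in mGam G. \<bar>w x\<bar> <= C * L2_norm (mGam G) (lap_Gam G w)" using H20_Gam_sup_le[OF G] by blast
 then show ?thesis using bounded_powr(1)[OF L2_measurable[OF H20_Gam_L2[OF G w]] _ q] w by blast
qed

text \<open>Plate test functions carry no integrability requirement of their own; the supremum bound
  puts a measurable version into every \<open>L^q\<close>, so the damping and source terms can be
  tested.\<close>

lemma WC_version:
 assumes G: "structural_acoustic G" and w: "w : WC G T" and wt: "time_deriv T (mGam G) w wt" and T: "0 <= T" and q: "0 < q"
 obtains W where "W : Lq_spacetime T (mGam G) q" "!!t. 0 < t ==> t < T ==> AE x in mGam G. W t x = w t x"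
proof -
 interpret finite_measure "mGam G" by (rule finite_measure_mGam[OF G])
 have H: "w t : H20_Gam G" if "0 <= t" "t <= T" for t using C_time_mem[OF w that] .
 have m: "w t : borel_measurable (mGam G)" if "0 <= t" "t <= T" for t using L2_measurable[OF H20_Gam_L2[OF G H[OF that]]] .
 obtain W where W: "st_measurable T (mGam G) W" "!!t. 0 <= t ==> t <= T ==> AE x in mGam G. W t x = w t x"
  using time_deriv_version[OF wt m[OF order_refl T]] by blast
 obtain C where C: "0 <= C" "!!w. w : H20_Gam G ==> AE x in mGam G. \<bar>w x\<bar> <= C * L2_norm (mGam G) (lap_Gam G w)" using H20_Gam_sup_le[OF G] by blast
 obtain B where B: "B >= 0" "!!s. 0 <= s ==> s <= T ==> L2_norm (mGam G) (lap_Gam G (w s)) <= B" using L2c_bounded[OF lap_L2c[OF G w]] by blast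
 have "W : Lq_spacetime T (mGam G) q"
 proof (rule Lq_spacetimeI[OF W(1)])
  fix s assume s: "0 < s" "s < T"
  have "C * L2_norm (mGam G) (lap_Gam G (w s)) <= C * B" using B(2)[of s] C(1) s by (intro mult_left_mono) auto
  then have ae: "AE x in mGam G. \<bar>W s x\<bar> <= C * B" using C(2)[OF H[of s]] W(2)[of s] s by fastforce
  show "(\<integral>\<^sup>+x. ennreal (\<bar>W s x\<bar> powr q) \<partial>mGam G) <= ennreal ((C * B) powr q * measure (mGam G) (space (mGam G)))"
   by (rule bounded_powr(2)[OF st_measurable_section[OF W(1) s] ae q])
 qed
 then show ?thesis using that W(2) by simp
qed

section \<open>Restriction and concatenation of solutions\<close>

definition regular_path where
 "regular_path G m r T u w ut wt \<longleftrightarrow>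
   u : UC G T & time_deriv T (mOm G) u ut & ut : L2c T (mOm G) & ut : Lq_spacetime T (mOm G) (m + 1) &
   w : WC G T & time_deriv T (mGam G) w wt & wt : L2c T (mGam G) & wt : Lq_spacetime T (mGam G) (r + 1)"

text \<open>The initial velocity \<open>a\<close> is a separate argument, so that the same form
  expresses the equation after a restart.\<close>

definition acoustic_eq where
 "acoustic_eq G m p a u ut wt ph pht t \<longleftrightarrow>
  L2_inner (mOm G) (ut t) (ph t) - L2_inner (mOm G) a (ph 0)
  - J 0 t (%s. L2_inner (mOm G) (ut s) (pht s))
  + J 0 t (%s. grad_inner (Om G) (u s) (ph s))
  - J 0 t (%s. L2_inner (mGam G) (wt s) (bdry_trace G (ph s)))
  + J 0 t (%s. \<integral>x. damping m (ut s x) * ph s x \<partial>mOm G)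
  = J 0 t (%s. \<integral>x. log_source p (u s x) * ph s x \<partial>mOm G)"

definition plate_eq where
 "plate_eq G r p b u w wt ps pst t \<longleftrightarrow>
  L2_inner (mGam G) (%x. wt t x + bdry_trace G (u t) x) (ps t) - L2_inner (mGam G) b (ps 0)
  - J 0 t (%s. L2_inner (mGam G) (wt s) (pst s))
  - J 0 t (%s. L2_inner (mGam G) (bdry_trace G (u s)) (pst s))
  + J 0 t (%s. L2_inner (mGam G) (lap_Gam G (w s)) (lap_Gam G (ps s)))
  + J 0 t (%s. \<integral>x. damping r (wt s x) * ps s x \<partial>mGam G)
  = J 0 t (%s. \<integral>x. log_source p (w s x) * ps s x \<partial>mGam G)"

definition balance where
 "balance G m r p u w ut wt t \<longleftrightarrow>
   energy G (u t) (w t) (ut t) (wt t)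
   + J 0 t (%s. \<integral>x. \<bar>ut s x\<bar> powr (m + 1) \<partial>mOm G)
   + J 0 t (%s. \<integral>x. \<bar>wt s x\<bar> powr (r + 1) \<partial>mGam G)
   = energy G (u 0) (w 0) (ut 0) (wt 0)
   + J 0 t (%s. \<integral>x. log_source p (u s x) * ut s x \<partial>mOm G)
   + J 0 t (%s. \<integral>x. log_source p (w s x) * wt s x \<partial>mGam G)"

lemma weak_solution_iff:
 "weak_solution G m r p u0 w0 u1 w1 T u w ut wt \<longleftrightarrow> regular_path G m r T u w ut wt &
   (u0, w0, u1, w1) : phase_space G &
   (AE x in mOm G. u 0 x = u0 x & ut 0 x = u1 x) & (AE x in mGam G. w 0 x = w0 x & wt 0 x = w1 x) &
   (ALL t:{0..T}. ALL ph pht. acoustic_test G m T ph pht --> acoustic_eq G m p u1 u ut wt ph pht t) &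
   (ALL t:{0..T}. ALL ps pst. plate_test G T ps pst --> plate_eq G r p (%x. w1 x + bdry_trace G u0 x) u w wt ps pst t)"
 unfolding weak_solution_def regular_path_def acoustic_eq_def plate_eq_def time_integral_J by blast

lemma energy_identity_iff: "energy_identity G m r p T u w ut wt \<longleftrightarrow> (ALL t:{0..T}. balance G m r p u w ut wt t)"
 by (simp add: energy_identity_def balance_def time_integral_J)

definition sol where
 "sol G m r p u0 w0 u1 w1 T u w ut wt \<longleftrightarrow>
   weak_solution G m r p u0 w0 u1 w1 T u w ut wt & energy_identity G m r p T u w ut wt"

lemma acoustic_eq_cong:
 assumes "!!s. 0 <= s ==> s <= t ==> u s = u' s & ut s = ut' s & wt s = wt' s & ph s = ph' s" "!!s. 0 < s ==> s < t ==> pht s = pht' s" "0 <= t"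
 shows "acoustic_eq G m p a u ut wt ph pht t \<longleftrightarrow> acoustic_eq G m p a u' ut' wt' ph' pht' t"
 unfolding acoustic_eq_def using assms by (simp cong: J_cong)

lemma plate_eq_cong:
 assumes "!!s. 0 <= s ==> s <= t ==> u s = u' s & w s = w' s & wt s = wt' s & ps s = ps' s" "!!s. 0 < s ==> s < t ==> pst s = pst' s" "0 <= t"
 shows "plate_eq G r p b u w wt ps pst t \<longleftrightarrow> plate_eq G r p b u' w' wt' ps' pst' t"
 unfolding plate_eq_def using assms by (simp cong: J_cong)

lemma balance_cong:
 assumes "!!s. 0 <= s ==> s <= t ==> u s = u' s & w s = w' s & ut s = ut' s & wt s = wt' s" "0 <= t"
 shows "balance G m r p u w ut wt t \<longleftrightarrow> balance G m r p u' w' ut' wt' t"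
 unfolding balance_def using assms by (simp cong: J_cong)

section \<open>Restriction of solutions to shorter intervals\<close>

lemma C_time_restrict: "u : C_time T' X N ==> T <= T' ==> u : C_time T X N"
 using C_time_shift[of u T' X N 0 T] by simp

lemma time_deriv_restrict: "time_deriv T' M u v ==> T <= T' ==> time_deriv T M u v"
 using time_deriv_shift[of T' M u v 0 T] by simp

lemma sigma_finite_mOm: "structural_acoustic G ==> sigma_finite_measure (mOm G)"
 using finite_measure_mOm finite_measure.axioms(1) by blast

lemma sigma_finite_mGam: "structural_acoustic G ==> sigma_finite_measure (mGam G)"
 using finite_measure_mGam finite_measure.axioms(1) by blast

lemma regular_path_restrict:
 assumes "structural_acoustic G" "regular_path G m r T' u w ut wt" "T <= T'"
 shows "regular_path G m r T u w ut wt"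
 using assms unfolding regular_path_def
 by (auto intro: C_time_restrict time_deriv_restrict sigma_finite_measure.Lq_spacetime_restrict[OF sigma_finite_mOm]
   sigma_finite_measure.Lq_spacetime_restrict[OF sigma_finite_mGam])

lemma reflect_extension:
 assumes u: "time_deriv T M u v" and T: "0 < T"
 obtains u' v' where "time_deriv (T + T) M u' v'" "!!s. s <= T ==> u' s = u s" "!!s. s < T ==> v' s = v s"
  "!!X N. u : C_time T X N ==> u' : C_time (T + T) X N"
  "!!q. sigma_finite_measure M ==> u T : borel_measurable M ==> u : Lq_spacetime T M q ==> u' : Lq_spacetime (T + T) M q"
proof -
 \<comment> \<open>Reflection keeps the value at \<open>T\<close> but reverses the sign of the
   derivative, whose value at \<open>T\<close> is reset to \<open>0\<close> so that this slice is
   measurable.\<close>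
 let ?u = "concat_time T u (%s. u (T - s))" and ?v = "concat_time T (v(T := (%_. 0))) (%s x. - v (T - s) x)"
 have "time_deriv T M u (v(T := (%_. 0)))" by (rule time_deriv_cong_interior[OF u]) simp
 from time_deriv_concat[OF this time_deriv_reverse[OF u] less_imp_le[OF T] T] have 1: "time_deriv (T + T) M ?u ?v" by simp
 have 2: "?u : C_time (T + T) X N" if "u : C_time T X N" for X N
  by (rule C_time_concat[OF that C_time_reverse[OF that]]) (use T in simp_all)
 have 3: "?u : Lq_spacetime (T + T) M q" if "sigma_finite_measure M" "u T : borel_measurable M" "u : Lq_spacetime T M q" for q
  by (rule sigma_finite_measure.Lq_spacetime_concat[OF that(1,3) sigma_finite_measure.Lq_spacetime_reverse[OF that(1,3)]]) (use T that(2) in simp_all)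
 show ?thesis by (rule that[OF 1 _ _ 2 3]) (auto simp: concat_time_def)
qed

text \<open>A weak solution on \<open>T'\<close> is tested only with functions defined up to
  \<open>T'\<close>. Those on \<open>[0, T]\<close> have to be extended, and a single reflection
  reaches \<open>T + T\<close>.\<close>

lemma sol_restrict_half:
 assumes G: "structural_acoustic G" and s: "sol G m r p u0 w0 u1 w1 T' u w ut wt" and T: "0 < T" "T <= T'" "T' <= T + T"
 shows "sol G m r p u0 w0 u1 w1 T u w ut wt"
proof -
 have A: "acoustic_eq G m p u1 u ut wt ph pht t" if t: "t : {0..T}" and te: "acoustic_test G m T ph pht" for t ph pht
 proof -
  have te': "ph : UC G T" "ph : Lq_spacetime T (mOm G) (m + 1)" "time_deriv T (mOm G) ph pht" using te by (auto simp: acoustic_test_def)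
  obtain ph' pht' where e: "time_deriv (T + T) (mOm G) ph' pht'" "!!s. s <= T ==> ph' s = ph s" "!!s. s < T ==> pht' s = pht s"
   "ph' : UC G (T + T)" "ph' : Lq_spacetime (T + T) (mOm G) (m + 1)"
   using reflect_extension[OF te'(3) T(1)] te'(1,2) sigma_finite_mOm[OF G] UC_measurable[OF te'(1) less_imp_le[OF T(1)] order_refl] by metis
  have "acoustic_test G m T' ph' pht'" unfolding acoustic_test_def
   using C_time_restrict[OF e(4) T(3)] sigma_finite_measure.Lq_spacetime_restrict[OF sigma_finite_mOm[OF G] e(5) T(3)] time_deriv_restrict[OF e(1) T(3)] by blast
  then have "acoustic_eq G m p u1 u ut wt ph' pht' t" using s t T by (auto simp: sol_def weak_solution_iff)
  moreover have "acoustic_eq G m p u1 u ut wt ph' pht' t \<longleftrightarrow> acoustic_eq G m p u1 u ut wt ph pht t"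
   by (rule acoustic_eq_cong) (use e t in auto)
  ultimately show ?thesis by simp
 qed
 have P: "plate_eq G r p (%x. w1 x + bdry_trace G u0 x) u w wt ps pst t" if t: "t : {0..T}" and te: "plate_test G T ps pst" for t ps pst
 proof -
  have te': "ps : WC G T" "time_deriv T (mGam G) ps pst" using te by (auto simp: plate_test_def)
  obtain ps' pst' where e: "time_deriv (T + T) (mGam G) ps' pst'" "!!s. s <= T ==> ps' s = ps s" "!!s. s < T ==> pst' s = pst s" "ps' : WC G (T + T)"
   using reflect_extension[OF te'(2) T(1)] te'(1) by metis
  have "plate_test G T' ps' pst'" unfolding plate_test_def using C_time_restrict[OF e(4) T(3)] time_deriv_restrict[OF e(1) T(3)] by blast
  then have "plate_eq G r p (%x. w1 x + bdry_trace G u0 x) u w wt ps' pst' t" using s t T by (auto simp: sol_def weak_solution_iff)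
  moreover have "plate_eq G r p (%x. w1 x + bdry_trace G u0 x) u w wt ps' pst' t \<longleftrightarrow> plate_eq G r p (%x. w1 x + bdry_trace G u0 x) u w wt ps pst t"
   by (rule plate_eq_cong) (use e t in auto)
  ultimately show ?thesis by simp
 qed
 have "regular_path G m r T u w ut wt" using s by (intro regular_path_restrict[OF G _ T(2)]) (auto simp: sol_def weak_solution_iff)
 then show ?thesis using s A P T by (auto simp: sol_def weak_solution_iff energy_identity_iff)
qed

text \<open>Since one reflection at most doubles an interval, the interval is halved repeatedly,
  never below \<open>T\<close>, until \<open>T\<close> is reached.\<close>

lemma sol_restrict:
 assumes G: "structural_acoustic G" and s: "sol G m r p u0 w0 u1 w1 T' u w ut wt" and T: "0 < T" "T <= T'"
 shows "sol G m r p u0 w0 u1 w1 T u w ut wt"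
proof -
 have *: "sol G m r p u0 w0 u1 w1 S u w ut wt ==> T <= S ==> S <= 2 ^ n * T ==> sol G m r p u0 w0 u1 w1 T u w ut wt" for n S
 proof (induction n arbitrary: S)
  case 0
  then show ?case by (simp add: order_antisym)
 next
  case (Suc n)
  have "sol G m r p u0 w0 u1 w1 (max T (S / 2)) u w ut wt" by (rule sol_restrict_half[OF G Suc.prems(1)]) (use Suc.prems T(1) in auto)
  then show ?case by (rule Suc.IH) (use Suc.prems T(1) in auto)
 qed
 obtain n where "T' / T < 2 ^ n" using real_arch_pow[of 2 "T' / T"] by auto
 then show ?thesis using *[OF s T(2), of n] T(1) by (simp add: field_simps)
qed

lemma C_time_cong: "(!!s. 0 <= s ==> s <= T ==> u s = v s) ==> u : C_time T X N \<longleftrightarrow> v : C_time T X N"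
 unfolding C_time_iff by (intro arg_cong2[where f = "(&)"] ball_cong refl all_cong ex_cong conj_cong imp_cong) simp_all

lemma time_deriv_cong:
 assumes "!!s. 0 <= s ==> s <= T ==> u s = u' s & v s = v' s" "time_deriv T M u v"
 shows "time_deriv T M u' v'"
proof -
 have "time_deriv T M u' v" using assms unfolding time_deriv_iff by simp
 then show ?thesis by (rule time_deriv_cong_interior) (use assms in simp)
qed

lemma Lq_spacetime_cong:
 assumes "!!s. 0 <= s ==> s <= T ==> u s = v s" "u : Lq_spacetime T M q"
 shows "v : Lq_spacetime T M q"
proof -
 have e: "case_prod u z = case_prod v z" if "z : space (leb {0<..<T} \<Otimes>\<^sub>M M)" for z
  using that assms(1) by (auto simp: space_pair_measure space_leb)
 have "case_prod u : borel_measurable (leb {0<..<T} \<Otimes>\<^sub>M M) \<longleftrightarrow> case_prod v : borel_measurable (leb {0<..<T} \<Otimes>\<^sub>M M)"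
  by (rule measurable_cong[OF e])
 moreover have "integrable (leb {0<..<T} \<Otimes>\<^sub>M M) (%z. \<bar>case_prod u z\<bar> powr q) \<longleftrightarrow> integrable (leb {0<..<T} \<Otimes>\<^sub>M M) (%z. \<bar>case_prod v z\<bar> powr q)"
  by (rule Bochner_Integration.integrable_cong[OF refl]) (simp only: e)
 ultimately show ?thesis using assms(2) by (simp add: Lq_spacetime_def Lq_space_def)
qed

lemma sol_cong:
 assumes e: "!!s. 0 <= s ==> s <= T ==> u s = u' s & w s = w' s & ut s = ut' s & wt s = wt' s" and T: "0 <= T"
  and s: "sol G m r p u0 w0 u1 w1 T u w ut wt"
 shows "sol G m r p u0 w0 u1 w1 T u' w' ut' wt'"
proof -
 have "regular_path G m r T u w ut wt" using s by (simp add: sol_def weak_solution_iff)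
 then have "regular_path G m r T u' w' ut' wt'"
  unfolding regular_path_def
  using C_time_cong[of T u u'] C_time_cong[of T w w'] C_time_cong[of T ut ut'] C_time_cong[of T wt wt'] e
   time_deriv_cong[of T u u' ut ut'] time_deriv_cong[of T w w' wt wt'] Lq_spacetime_cong[of T ut ut'] Lq_spacetime_cong[of T wt wt'] by simp
 moreover have "acoustic_eq G m p u1 u' ut' wt' ph pht t \<longleftrightarrow> acoustic_eq G m p u1 u ut wt ph pht t" if "t : {0..T}" for ph pht t
  by (rule acoustic_eq_cong) (use that e in auto)
 moreover have "plate_eq G r p b u' w' wt' ph pht t \<longleftrightarrow> plate_eq G r p b u w wt ph pht t" if "t : {0..T}" for ph pht t b
  by (rule plate_eq_cong) (use that e in auto)
 moreover have "balance G m r p u' w' ut' wt' t \<longleftrightarrow> balance G m r p u w ut wt t" if "t : {0..T}" for t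
  by (rule balance_cong) (use that e in auto)
 ultimately show ?thesis using s e[OF order_refl T] by (simp add: sol_def weak_solution_iff energy_identity_iff)
qed

section \<open>Integrability of the terms in the weak formulation and the energy identity\<close>

lemma acoustic_tints:
 assumes G: "structural_acoustic G" and pq: "1 <= m" "1 < p" "p + 1 < q" "q <= m + 1"
  and reg: "regular_path G m r T u w ut wt" and u0: "u 0 : Lq_space q (mOm G)" and te: "acoustic_test G m T ph pht"
 shows "tint 0 T (%s. L2_inner (mOm G) (ut s) (pht s))" "tint 0 T (%s. grad_inner (Om G) (u s) (ph s))"
  "tint 0 T (%s. L2_inner (mGam G) (wt s) (bdry_trace G (ph s)))" "tint 0 T (%s. \<integral>x. damping m (ut s x) * ph s x \<partial>mOm G)"
  "tint 0 T (%s. \<integral>x. log_source p (u s x) * ph s x \<partial>mOm G)"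
proof -
 note R = reg[unfolded regular_path_def] and F = finite_measure_mOm[OF G]
 have t: "ph : UC G T" "ph : Lq_spacetime T (mOm G) (m + 1)" "time_deriv T (mOm G) ph pht" "pht : L1_L2 T (mOm G)"
  using te by (auto simp: acoustic_test_def time_deriv_iff)
 show "tint 0 T (%s. L2_inner (mOm G) (ut s) (pht s))" by (rule L2c_tint[OF F _ t(4)]) (use R in simp)
 show "tint 0 T (%s. grad_inner (Om G) (u s) (ph s))" by (rule grad_inner_tint[OF G _ t(1)]) (use R in simp)
 show "tint 0 T (%s. L2_inner (mGam G) (wt s) (bdry_trace G (ph s)))"
  by (rule continuous_tint, rule L2c_inner_continuous[OF _ trace_L2c[OF G t(1,3)]]) (use R in simp)
 show "tint 0 T (%s. \<integral>x. damping m (ut s x) * ph s x \<partial>mOm G)"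
  by (rule finite_measure.damping_tint[OF F _ pq(1) t(2)]) (use R UC_measurable[OF t(1)] in auto)
 show "tint 0 T (%s. \<integral>x. log_source p (u s x) * ph s x \<partial>mOm G)"
  by (rule finite_measure.source_tint[where u = u and v = ut and T = T and k = "m + 1", OF F _ _ u0 _ pq(2-4) t(2)]) (use R UC_measurable[where u = u] UC_measurable[OF t(1)] in auto)
qed

lemma WC_measurable: "structural_acoustic G ==> w : WC G T ==> 0 <= t ==> t <= T ==> w t : borel_measurable (mGam G)"
 using L2_measurable[OF H20_Gam_L2[OF _ C_time_mem]] by blast

lemma plate_tints:
 assumes G: "structural_acoustic G" and pq: "1 <= r" "1 < p" "p + 1 < q" "q <= r + 1" and T: "0 <= T"
  and reg: "regular_path G m r T u w ut wt" and te: "plate_test G T ps pst"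
 shows "tint 0 T (%s. L2_inner (mGam G) (wt s) (pst s))" "tint 0 T (%s. L2_inner (mGam G) (bdry_trace G (u s)) (pst s))"
  "tint 0 T (%s. L2_inner (mGam G) (lap_Gam G (w s)) (lap_Gam G (ps s)))" "tint 0 T (%s. \<integral>x. damping r (wt s x) * ps s x \<partial>mGam G)"
  "tint 0 T (%s. \<integral>x. log_source p (w s x) * ps s x \<partial>mGam G)"
proof -
 note R = reg[unfolded regular_path_def] and F = finite_measure_mGam[OF G]
 have t: "ps : WC G T" "time_deriv T (mGam G) ps pst" "pst : L1_L2 T (mGam G)"
  using te by (auto simp: plate_test_def time_deriv_iff)
 have r: "0 < r + 1" "0 < q" using pq by auto
 obtain Ps where Ps: "Ps : Lq_spacetime T (mGam G) (r + 1)" "!!t. 0 < t ==> t < T ==> AE x in mGam G. Ps t x = ps t x"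
  using WC_version[OF G t(1,2) T r(1)] by blast
 have w0: "w 0 : Lq_space q (mGam G)" by (rule H20_Gam_Lq[OF G _ r(2)], rule C_time_mem[where u = w]) (use R T in auto)
 show "tint 0 T (%s. L2_inner (mGam G) (wt s) (pst s))" by (rule L2c_tint[OF F _ t(3)]) (use R in simp)
 show "tint 0 T (%s. L2_inner (mGam G) (bdry_trace G (u s)) (pst s))" by (rule L2c_tint[OF F trace_L2c[OF G, of u T ut] t(3)]) (use R in simp_all)
 show "tint 0 T (%s. L2_inner (mGam G) (lap_Gam G (w s)) (lap_Gam G (ps s)))"
  by (rule continuous_tint, rule L2c_inner_continuous[OF lap_L2c[OF G] lap_L2c[OF G t(1)]]) (use R in simp)
 show "tint 0 T (%s. \<integral>x. damping r (wt s x) * ps s x \<partial>mGam G)"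
  by (rule finite_measure.damping_tint[OF F _ pq(1) Ps]) (use R WC_measurable[OF G t(1)] in auto)
 show "tint 0 T (%s. \<integral>x. log_source p (w s x) * ps s x \<partial>mGam G)"
  by (rule finite_measure.source_tint[where u = w and v = wt and T = T and k = "r + 1", OF F _ _ w0 _ pq(2-4) Ps]) (use R WC_measurable[OF G, of w T] WC_measurable[OF G t(1)] in auto)
qed

lemma energy_tints:
 assumes G: "structural_acoustic G" and pq: "1 < p" "p + 1 < q" "q <= m + 1" "q <= r + 1" and T: "0 <= T"
  and reg: "regular_path G m r T u w ut wt" and u0: "u 0 : Lq_space q (mOm G)"
 shows "tint 0 T (%s. \<integral>x. \<bar>ut s x\<bar> powr (m + 1) \<partial>mOm G)" "tint 0 T (%s. \<integral>x. \<bar>wt s x\<bar> powr (r + 1) \<partial>mGam G)"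
  "tint 0 T (%s. \<integral>x. log_source p (u s x) * ut s x \<partial>mOm G)" "tint 0 T (%s. \<integral>x. log_source p (w s x) * wt s x \<partial>mGam G)"
proof -
 note R = reg[unfolded regular_path_def] and F = finite_measure_mGam[OF G] and F' = finite_measure_mOm[OF G]
 have q: "0 < q" using pq by simp
 have w0: "w 0 : Lq_space q (mGam G)" by (rule H20_Gam_Lq[OF G _ q], rule C_time_mem[where u = w]) (use R T in auto)
 show "tint 0 T (%s. \<integral>x. \<bar>ut s x\<bar> powr (m + 1) \<partial>mOm G)" "tint 0 T (%s. \<integral>x. \<bar>wt s x\<bar> powr (r + 1) \<partial>mGam G)"
  using R by (auto intro: finite_measure.Lq_spacetime_tint[OF F] finite_measure.Lq_spacetime_tint[OF F'])
 have m: "ut t : borel_measurable (mOm G)" "wt t : borel_measurable (mGam G)" if "0 < t" "t < T" for t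
  using R that by (auto intro!: L2_measurable C_time_mem[where T = T])
 show "tint 0 T (%s. \<integral>x. log_source p (u s x) * ut s x \<partial>mOm G)"
  by (rule finite_measure.source_tint[where u = u and v = ut and Ph = ut and T = T and k = "m + 1", OF F' _ _ u0 _ pq(1-3)]) (use R UC_measurable[where u = u] m in auto)
 show "tint 0 T (%s. \<integral>x. log_source p (w s x) * wt s x \<partial>mGam G)"
  by (rule finite_measure.source_tint[where u = w and v = wt and Ph = wt and T = T and k = "r + 1", OF F _ _ w0 _ pq(1,2,4)]) (use R WC_measurable[OF G, of w T] m in auto)
qed

section \<open>Concatenation of solutions\<close>

lemma J_glue:
 assumes T: "0 <= T" "0 <= s" and f: "tint 0 T f" and g: "tint 0 ta g" "s <= ta"
  and e: "!!r. 0 < r ==> r < T ==> h r = f r" "!!r. 0 < r ==> r < s ==> h (T + r) = g r"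
 shows "J 0 (T + s) h = J 0 T f + J 0 s g"
proof -
 have a: "tint 0 T h" "J 0 T h = J 0 T f" using f tint_cong[of 0 T h f] J_cong[of 0 T h f] e(1) by auto
 have g': "tint 0 s g" by (rule tint_subset[OF g(1)]) (use g(2) in auto)
 have b: "tint 0 s (%r. h (T + r))" "J 0 s (%r. h (T + r)) = J 0 s g" using g' tint_cong[of 0 s "%r. h (T + r)" g] J_cong[of 0 s "%r. h (T + r)" g] e(2) by auto
 have c: "tint T (T + s) h" "J T (T + s) h = J 0 s g" using b tint_shift[of 0 s h T] J_shift[of 0 s h T] by auto
 show ?thesis using J_split(2)[OF T(1) _ a(1) c(1)] T(2) a(2) c(2) by simp
qed

text \<open>At the junction the two solutions agree almost everywhere; the norms in the continuity
  conditions depend only on classes.\<close>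

lemma regular_path_glue:
 assumes G: "structural_acoustic G" and u: "regular_path G m r T u w ut wt" and v: "regular_path G m r ta v z vt zt" and T: "0 < T" "0 < ta"
  and ae: "AE x in mOm G. v 0 x = u T x & vt 0 x = ut T x" "AE x in mGam G. z 0 x = w T x & zt 0 x = wt T x"
 shows "regular_path G m r (T + ta) (concat_time T u v) (concat_time T w z) (concat_time T ut vt) (concat_time T wt zt)"
proof -
 note R = u[unfolded regular_path_def] and R' = v[unfolded regular_path_def]
 have T0: "0 <= T" "T <= T" "0 <= ta" using T by auto
 have memu: "u T : borel_measurable (mOm G)" "ut T : Lq_space 2 (mOm G)" "wt T : Lq_space 2 (mGam G)"
  using R T0 UC_measurable[where u = u] C_time_mem[of _ T _ _ T] by auto
 have memv: "v s : borel_measurable (mOm G)" "vt s : Lq_space 2 (mOm G)" "zt s : Lq_space 2 (mGam G)" if "0 <= s" "s <= ta" for s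
  using R' that UC_measurable[where u = v] C_time_mem[of _ ta _ _ s] by auto
 have chart: "(f \<circ> chart G) : borel_measurable (leb (chart_dom G))" if "f : H20_Gam G" for f
  using L2_measurable[OF H1_L2] H20_Gam_H2[OF that] by (auto simp: H2_def)
 have cd: "((%x. f x - g x) \<circ> chart G) : borel_measurable (leb (chart_dom G))" if "f : H20_Gam G" "g : H20_Gam G" for f g
  using borel_measurable_diff[OF chart[OF that(1)] chart[OF that(2)]] by (simp add: o_def)
 have H: "w T : H20_Gam G" "s : {0..ta} ==> z s : H20_Gam G" for s using R R' T0 C_time_mem[of _ _ "H20_Gam G"] by auto
 have 1: "concat_time T u v : UC G (T + ta)"
 proof (rule C_time_concat)
  fix s assume s: "0 < s" "s <= ta"
  have "AE x in leb (Om G). v s x - u T x = v s x - v 0 x" using ae(1) unfolding mOm_def by eventually_elim auto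
  then show "grad_norm (Om G) (%x. v s x - u T x) = grad_norm (Om G) (%x. v s x - v 0 x)"
   by (rule H1_norm_cong_AE(2)[OF structural_acousticD(5)[OF G]]) (use memu memv[of s] memv[of 0] s in \<open>auto simp: mOm_def\<close>)
 qed (use R R' T in auto)
 have 2: "concat_time T w z : WC G (T + ta)"
 proof (rule C_time_concat)
  fix s assume s: "0 < s" "s <= ta"
  have "AE x in mGam G. z s x - w T x = z s x - z 0 x" using ae(2) by eventually_elim auto
  then have "lap_Gam G (%x. z s x - w T x) = lap_Gam G (%x. z s x - z 0 x)"
   by (rule lap_Gam_cong_AE[OF G]) (rule cd; use H s in auto)+
  then show "L2_norm (mGam G) (lap_Gam G (%x. z s x - w T x)) = L2_norm (mGam G) (lap_Gam G (%x. z s x - z 0 x))" by simp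
 qed (use R R' T in auto)
 have L2: "concat_time T f g : L2c (T + ta) M" if f: "f : L2c T M" and g: "g : L2c ta M" and fg: "AE x in M. g 0 x = f T x" for f g and M :: "(real^3) measure"
 proof (rule C_time_concat[OF f g T0(1) T(2)])
  fix s assume s: "0 < s" "s <= ta"
  have m: "f T : Lq_space 2 M" "g s : Lq_space 2 M" "g 0 : Lq_space 2 M" using C_time_mem[OF f T0(1,2)] C_time_mem[OF g] s T0 by auto
  have "AE x in M. g s x - f T x = g s x - g 0 x" using fg by eventually_elim auto
  then show "L2_norm M (%x. g s x - f T x) = L2_norm M (%x. g s x - g 0 x)"
   by (rule L2_norm_cong_AE) (use L2_measurable[OF L2_diff[OF m(2,1)]] L2_measurable[OF L2_diff[OF m(2,3)]] in auto)
 qed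
 have 3: "concat_time T ut vt : L2c (T + ta) (mOm G)" "concat_time T wt zt : L2c (T + ta) (mGam G)" by (rule L2; use R R' ae in auto)+
 have 4: "time_deriv (T + ta) (mOm G) (concat_time T u v) (concat_time T ut vt)" "time_deriv (T + ta) (mGam G) (concat_time T w z) (concat_time T wt zt)"
  by (rule time_deriv_concat; use R R' ae T0 T L2_measurable[OF memu(2)] L2_measurable[OF memu(3)] in auto)+
 have 5: "concat_time T ut vt : Lq_spacetime (T + ta) (mOm G) (m + 1)"
  by (rule sigma_finite_measure.Lq_spacetime_concat[OF sigma_finite_mOm[OF G]]) (use R R' T0 T L2_measurable[OF memu(2)] in auto)
 have 6: "concat_time T wt zt : Lq_spacetime (T + ta) (mGam G) (r + 1)"
  by (rule sigma_finite_measure.Lq_spacetime_concat[OF sigma_finite_mGam[OF G]]) (use R R' T0 T L2_measurable[OF memu(3)] in auto)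
 show ?thesis unfolding regular_path_def using 1 2 3 4 5 6 by blast
qed

text \<open>For a time beyond \<open>T\<close>, add the first equation at \<open>T\<close> and the
  shifted second one. The pairings at \<open>T\<close> cancel exactly because the second solution
  has the functions \<open>ut T\<close>, \<open>wt T\<close> and \<open>u T\<close> themselves as
  data. The balance instead starts from \<open>v 0\<close>, \<open>z 0\<close>, \<open>vt 0\<close>,
  \<open>zt 0\<close>, which is why equality of the energies is assumed.\<close>

lemma sol_glue:
 assumes G: "structural_acoustic G" and pq: "1 <= m" "1 <= r" "1 < p" "p + 1 < q" "q <= m + 1" "q <= r + 1"
  and u: "sol G m r p u0 w0 u1 w1 T u w ut wt" and v: "sol G m r p (u T) (w T) (ut T) (wt T) ta v z vt zt"
  and T: "0 < T" "0 < ta" and uq: "u 0 : Lq_space q (mOm G)" and vq: "v 0 : Lq_space q (mOm G)"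
  and E: "energy G (v 0) (z 0) (vt 0) (zt 0) = energy G (u T) (w T) (ut T) (wt T)"
 shows "sol G m r p u0 w0 u1 w1 (T + ta) (concat_time T u v) (concat_time T w z) (concat_time T ut vt) (concat_time T wt zt)"
proof -
 let ?u = "concat_time T u v" and ?w = "concat_time T w z" and ?ut = "concat_time T ut vt" and ?wt = "concat_time T wt zt"
 have S: "regular_path G m r T u w ut wt" "!!t. t : {0..T} ==> balance G m r p u w ut wt t"
  "!!t ph pht. t : {0..T} ==> acoustic_test G m T ph pht ==> acoustic_eq G m p u1 u ut wt ph pht t"
  "!!t ps pst. t : {0..T} ==> plate_test G T ps pst ==> plate_eq G r p (%x. w1 x + bdry_trace G u0 x) u w wt ps pst t"
  using u by (auto simp: sol_def weak_solution_iff energy_identity_iff)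
 have S': "regular_path G m r ta v z vt zt" "!!t. t : {0..ta} ==> balance G m r p v z vt zt t"
  "!!t ph pht. t : {0..ta} ==> acoustic_test G m ta ph pht ==> acoustic_eq G m p (ut T) v vt zt ph pht t"
  "!!t ps pst. t : {0..ta} ==> plate_test G ta ps pst ==> plate_eq G r p (%x. wt T x + bdry_trace G (u T) x) v z zt ps pst t"
  using v by (auto simp: sol_def weak_solution_iff energy_identity_iff)
 have reg: "regular_path G m r (T + ta) ?u ?w ?ut ?wt"
  by (rule regular_path_glue[OF G S(1) S'(1) T]) (use v in \<open>auto simp: sol_def weak_solution_iff\<close>)
 have T0: "0 <= T" "0 <= ta" using T by auto
 have lo: "?u s = u s" "?w s = w s" "?ut s = ut s" "?wt s = wt s" if "s <= T" for s using that by (simp_all add: concat_time_def)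
 have hi: "?u (T + s) = v s" "?w (T + s) = z s" "?ut (T + s) = vt s" "?wt (T + s) = zt s" if "0 < s" for s using that by (simp_all add: concat_time_def)
 have A: "acoustic_eq G m p u1 ?u ?ut ?wt ph pht t" if t: "t : {0..T + ta}" and te: "acoustic_test G m (T + ta) ph pht" for t ph pht
 proof -
  have te1: "acoustic_test G m T ph pht"
   using te T0 sigma_finite_measure.Lq_spacetime_restrict[OF sigma_finite_mOm[OF G]] unfolding acoustic_test_def
   by (auto intro: C_time_restrict time_deriv_restrict)
  have te2: "acoustic_test G m ta (%s. ph (T + s)) (%s. pht (T + s))"
   using te T0 sigma_finite_measure.Lq_spacetime_shift[OF sigma_finite_mOm[OF G]] unfolding acoustic_test_def
   by (auto intro!: C_time_shift[where T = "T + ta"] time_deriv_shift[where T = "T + ta"])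
  show ?thesis
  proof (cases "t <= T")
   case True
   have "acoustic_eq G m p u1 ?u ?ut ?wt ph pht t \<longleftrightarrow> acoustic_eq G m p u1 u ut wt ph pht t"
    by (rule acoustic_eq_cong) (use True t lo in auto)
   then show ?thesis using S(3)[OF _ te1] True t by simp
  next
   case False
   define s where "s = t - T"
   have s: "0 < s" "s <= ta" "0 <= s" "t = T + s" using False t by (auto simp: s_def)
   note i = acoustic_tints[OF G pq(1,3-5) S(1) uq te1] and j = acoustic_tints[OF G pq(1,3-5) S'(1) vq te2]
   note g = J_glue[OF T0(1) s(3) i(1) j(1) s(2)] J_glue[OF T0(1) s(3) i(2) j(2) s(2)] J_glue[OF T0(1) s(3) i(3) j(3) s(2)]
    J_glue[OF T0(1) s(3) i(4) j(4) s(2)] J_glue[OF T0(1) s(3) i(5) j(5) s(2)]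
   have e: "J 0 t (%s. L2_inner (mOm G) (?ut s) (pht s)) = J 0 T (%s. L2_inner (mOm G) (ut s) (pht s)) + J 0 s (%s. L2_inner (mOm G) (vt s) (pht (T + s)))"
    "J 0 t (%s. grad_inner (Om G) (?u s) (ph s)) = J 0 T (%s. grad_inner (Om G) (u s) (ph s)) + J 0 s (%s. grad_inner (Om G) (v s) (ph (T + s)))"
    "J 0 t (%s. L2_inner (mGam G) (?wt s) (bdry_trace G (ph s))) = J 0 T (%s. L2_inner (mGam G) (wt s) (bdry_trace G (ph s))) + J 0 s (%s. L2_inner (mGam G) (zt s) (bdry_trace G (ph (T + s))))"
    "J 0 t (%s. \<integral>x. damping m (?ut s x) * ph s x \<partial>mOm G) = J 0 T (%s. \<integral>x. damping m (ut s x) * ph s x \<partial>mOm G) + J 0 s (%s. \<integral>x. damping m (vt s x) * ph (T + s) x \<partial>mOm G)"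
    "J 0 t (%s. \<integral>x. log_source p (?u s x) * ph s x \<partial>mOm G) = J 0 T (%s. \<integral>x. log_source p (u s x) * ph s x \<partial>mOm G) + J 0 s (%s. \<integral>x. log_source p (v s x) * ph (T + s) x \<partial>mOm G)"
    unfolding s(4) by (rule g; simp add: lo hi)+
   have "acoustic_eq G m p u1 u ut wt ph pht T" "acoustic_eq G m p (ut T) v vt zt (%s. ph (T + s)) (%s. pht (T + s)) s"
    using S(3)[OF _ te1] S'(3)[OF _ te2] s T0 by auto
   then show ?thesis unfolding acoustic_eq_def e by (simp add: s(4) hi[OF s(1)])
  qed
 qed
 have P: "plate_eq G r p (%x. w1 x + bdry_trace G u0 x) ?u ?w ?wt ps pst t" if t: "t : {0..T + ta}" and te: "plate_test G (T + ta) ps pst" for t ps pst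
 proof -
  have te1: "plate_test G T ps pst" using te T0 unfolding plate_test_def by (auto intro: C_time_restrict time_deriv_restrict)
  have te2: "plate_test G ta (%s. ps (T + s)) (%s. pst (T + s))"
   using te T0 unfolding plate_test_def by (auto intro!: C_time_shift[where T = "T + ta"] time_deriv_shift[where T = "T + ta"])
  show ?thesis
  proof (cases "t <= T")
   case True
   have "plate_eq G r p (%x. w1 x + bdry_trace G u0 x) ?u ?w ?wt ps pst t \<longleftrightarrow> plate_eq G r p (%x. w1 x + bdry_trace G u0 x) u w wt ps pst t"
    by (rule plate_eq_cong) (use True t lo in auto)
   then show ?thesis using S(4)[OF _ te1] True t by simp
  next
   case False
   define s where "s = t - T"
   have s: "0 < s" "s <= ta" "0 <= s" "t = T + s" using False t by (auto simp: s_def)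
   note i = plate_tints[OF G pq(2-4,6) T0(1) S(1) te1] and j = plate_tints[OF G pq(2-4,6) T0(2) S'(1) te2]
   note g = J_glue[OF T0(1) s(3) i(1) j(1) s(2)] J_glue[OF T0(1) s(3) i(2) j(2) s(2)] J_glue[OF T0(1) s(3) i(3) j(3) s(2)]
    J_glue[OF T0(1) s(3) i(4) j(4) s(2)] J_glue[OF T0(1) s(3) i(5) j(5) s(2)]
   have e: "J 0 t (%s. L2_inner (mGam G) (?wt s) (pst s)) = J 0 T (%s. L2_inner (mGam G) (wt s) (pst s)) + J 0 s (%s. L2_inner (mGam G) (zt s) (pst (T + s)))"
    "J 0 t (%s. L2_inner (mGam G) (bdry_trace G (?u s)) (pst s)) = J 0 T (%s. L2_inner (mGam G) (bdry_trace G (u s)) (pst s)) + J 0 s (%s. L2_inner (mGam G) (bdry_trace G (v s)) (pst (T + s)))"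
    "J 0 t (%s. L2_inner (mGam G) (lap_Gam G (?w s)) (lap_Gam G (ps s))) = J 0 T (%s. L2_inner (mGam G) (lap_Gam G (w s)) (lap_Gam G (ps s))) + J 0 s (%s. L2_inner (mGam G) (lap_Gam G (z s)) (lap_Gam G (ps (T + s))))"
    "J 0 t (%s. \<integral>x. damping r (?wt s x) * ps s x \<partial>mGam G) = J 0 T (%s. \<integral>x. damping r (wt s x) * ps s x \<partial>mGam G) + J 0 s (%s. \<integral>x. damping r (zt s x) * ps (T + s) x \<partial>mGam G)"
    "J 0 t (%s. \<integral>x. log_source p (?w s x) * ps s x \<partial>mGam G) = J 0 T (%s. \<integral>x. log_source p (w s x) * ps s x \<partial>mGam G) + J 0 s (%s. \<integral>x. log_source p (z s x) * ps (T + s) x \<partial>mGam G)"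
    unfolding s(4) by (rule g; simp add: lo hi)+
   have "plate_eq G r p (%x. w1 x + bdry_trace G u0 x) u w wt ps pst T"
    "plate_eq G r p (%x. wt T x + bdry_trace G (u T) x) v z zt (%s. ps (T + s)) (%s. pst (T + s)) s"
    using S(4)[OF _ te1] S'(4)[OF _ te2] s T0 by auto
   then show ?thesis unfolding plate_eq_def e by (simp add: s(4) hi[OF s(1)])
  qed
 qed
 have B: "balance G m r p ?u ?w ?ut ?wt t" if t: "t : {0..T + ta}" for t
 proof (cases "t <= T")
  case True
  have "balance G m r p ?u ?w ?ut ?wt t \<longleftrightarrow> balance G m r p u w ut wt t" by (rule balance_cong) (use True t lo in auto)
  then show ?thesis using S(2) True t by simp
 next
  case False
  define s where "s = t - T"
  have s: "0 < s" "s <= ta" "0 <= s" "t = T + s" using False t by (auto simp: s_def)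
  note i = energy_tints[OF G pq(3-6) T0(1) S(1) uq] and j = energy_tints[OF G pq(3-6) T0(2) S'(1) vq]
  note g = J_glue[OF T0(1) s(3) i(1) j(1) s(2)] J_glue[OF T0(1) s(3) i(2) j(2) s(2)] J_glue[OF T0(1) s(3) i(3) j(3) s(2)] J_glue[OF T0(1) s(3) i(4) j(4) s(2)]
  have e: "J 0 t (%s. \<integral>x. \<bar>?ut s x\<bar> powr (m + 1) \<partial>mOm G) = J 0 T (%s. \<integral>x. \<bar>ut s x\<bar> powr (m + 1) \<partial>mOm G) + J 0 s (%s. \<integral>x. \<bar>vt s x\<bar> powr (m + 1) \<partial>mOm G)"
   "J 0 t (%s. \<integral>x. \<bar>?wt s x\<bar> powr (r + 1) \<partial>mGam G) = J 0 T (%s. \<integral>x. \<bar>wt s x\<bar> powr (r + 1) \<partial>mGam G) + J 0 s (%s. \<integral>x. \<bar>zt s x\<bar> powr (r + 1) \<partial>mGam G)"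
   "J 0 t (%s. \<integral>x. log_source p (?u s x) * ?ut s x \<partial>mOm G) = J 0 T (%s. \<integral>x. log_source p (u s x) * ut s x \<partial>mOm G) + J 0 s (%s. \<integral>x. log_source p (v s x) * vt s x \<partial>mOm G)"
   "J 0 t (%s. \<integral>x. log_source p (?w s x) * ?wt s x \<partial>mGam G) = J 0 T (%s. \<integral>x. log_source p (w s x) * wt s x \<partial>mGam G) + J 0 s (%s. \<integral>x. log_source p (z s x) * zt s x \<partial>mGam G)"
   unfolding s(4) by (rule g; simp add: lo hi)+
  have "balance G m r p u w ut wt T" "balance G m r p v z vt zt s" using S(2) S'(2) s T0 by auto
  then show ?thesis unfolding balance_def e E by (simp add: s(4) hi[OF s(1)] lo[OF T0(1)])
 qed
 show ?thesis unfolding sol_def weak_solution_iff energy_identity_iff using u reg A P B lo[OF T0(1)] by (auto simp: sol_def weak_solution_iff)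
qed

section \<open>The energy bound\<close>

text \<open>Maximise \<open>exp (- 2 b s) * y s\<close>. At the maximiser the integral term returns
  at most half of the maximum, which is absorbed; the price is the factor \<open>2\<close> and the
  doubled rate.\<close>

lemma gronwall:
 fixes y :: "real => real"
 assumes y: "continuous_on {0..T} y" and b: "b > 0"
  and le: "!!t. 0 <= t ==> t <= T ==> y t <= a + b * J 0 t y" and a: "0 <= a" and t: "0 <= t" "t <= T"
 shows "y t <= 2 * a * exp (2 * b * t)"
proof -
 have "continuous_on {0..T} (%s. exp (- (2 * b * s)) * y s)" by (intro continuous_intros y)
 then obtain t1 where t1: "t1 : {0..T}" "!!s. s : {0..T} ==> exp (- (2 * b * s)) * y s <= exp (- (2 * b * t1)) * y t1"
  using continuous_attains_sup[of "{0..T}" "%s. exp (- (2 * b * s)) * y s"] t by auto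
 define M where "M = exp (- (2 * b * t1)) * y t1"
 have yM: "y s <= M * exp (2 * b * s)" if "0 <= s" "s <= T" for s
  using t1(2)[of s] that unfolding M_def[symmetric] by (simp add: exp_minus field_simps)
 have "M <= 2 * a"
 proof (cases "M < 0")
  case True then show ?thesis using a by simp
 next
  case False
  let ?e = "%s. exp (2 * b * s)"
  have "J 0 t1 ?e = time_integral t1 ?e" by (simp add: time_integral_J)
  also have "... = (\<integral>s. ?e s * indicator {0..t1} s \<partial>lborel)" by (simp add: integral_leb mult.commute)
  also have "... = ?e t1 / (2 * b) - ?e 0 / (2 * b)"
   by (rule has_bochner_integral_integral_eq, rule has_bochner_integral_FTC_Icc_real)
    (use t1(1) b in \<open>auto intro!: derivative_eq_intros continuous_intros\<close>)
  finally have Je: "J 0 t1 ?e = (?e t1 - 1) / (2 * b)" by (simp add: diff_divide_distrib)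
  have te: "tint 0 t1 ?e" by (rule continuous_tint) (intro continuous_intros)
  have t10: "0 <= t1" using t1(1) by simp
  have "J 0 t1 y <= J 0 t1 (%s. 0 + M * ?e s)"
   by (rule J_mono[OF continuous_tint J_affine(1)[OF te t10]]) (use yM t1(1) continuous_on_subset[OF y] in auto)
  also have "... = M * ((?e t1 - 1) / (2 * b))" using J_affine(2)[OF te t10, of 0 M] Je by simp
  finally have "b * J 0 t1 y <= b * (M * ((?e t1 - 1) / (2 * b)))" using b by (intro mult_left_mono) auto
  also have "... = M * (?e t1 - 1) / 2" using b by simp
  finally have "2 * (b * J 0 t1 y) <= M * (?e t1 - 1)" by simp
  moreover have "M * (?e t1 - 1) = M * ?e t1 - M" by (simp add: right_diff_distrib)
  moreover have "y t1 <= a + b * J 0 t1 y" using le[of t1] t1(1) by simp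
  moreover have "y t1 = M * ?e t1" by (simp add: M_def exp_minus field_simps)
  ultimately have "M * ?e t1 <= 2 * a - M" by linarith
  moreover have "M * 1 <= M * ?e t1" using False b t10 by (intro mult_left_mono) auto
  ultimately show ?thesis using False by simp
 qed
 then have "M * exp (2 * b * t) <= 2 * a * exp (2 * b * t)" by (intro mult_right_mono) auto
 from order_trans[OF yM[OF t] this] show ?thesis .
qed

lemma J_add: "tint a b f ==> tint a b g ==> J a b (%s. f s + g s) = J a b f + J a b g"
 by (simp add: J_def tint_def distrib_left)

text \<open>\<open>K\<close> is uniform over all solutions from these data on any interval inside
  \<open>[0, S]\<close>, including those obtained by concatenation; continuation relies on this
  uniformity.\<close>

lemma energy_bound:
 assumes G: "structural_acoustic G" and pq: "1 <= m" "1 <= r" "1 < p" "p + 1 < q" "q <= m + 1" "q <= r + 1" and S: "0 <= S"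
  and B: "0 <= B"
 obtains K where "!!T u w ut wt t. sol G m r p u0 w0 u1 w1 T u w ut wt ==> u 0 : Lq_space q (mOm G) ==>
   (\<integral>x. \<bar>u 0 x\<bar> powr q \<partial>mOm G) <= B ==> (\<integral>x. \<bar>w 0 x\<bar> powr q \<partial>mGam G) <= B ==> energy G (u 0) (w 0) (ut 0) (wt 0) <= B ==>
   T <= S ==> 0 <= t ==> t <= T ==> energy G (u t) (w t) (ut t) (wt t) <= K"
proof -
 note F = finite_measure_mOm[OF G] and F' = finite_measure_mGam[OF G]
 show ?thesis
 proof (rule finite_measure.source_bound[OF F pq(3-5) S B], goal_cases)
 case C1: (1 C1)
 show ?case
 proof (rule finite_measure.source_bound[OF F' pq(3,4,6) S B], goal_cases)
 case C2: (1 C2)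
 \<comment> \<open>\<open>A\<close> is the energy bound plus the additive constants of the two
   source estimates. Absorbing half of the dissipation doubles \<open>A\<close> and
   \<open>C1 + C2\<close>; the \<open>+ 1\<close> in \<open>b\<close> keeps the rate positive, and
   \<open>Y\<close> is the resulting Gronwall bound at \<open>S\<close>.\<close>
 define A where "A = B + C1 + C2"
 define b where "b = 2 * (C1 + C2) + 1"
 define Y where "Y = 2 * (2 * A) * exp (2 * b * S)"
 have pos: "0 <= A" "b > 0" "Y >= 0" using B C1(1) C2(1) by (auto simp: A_def b_def Y_def)
 show ?case
 proof (rule that[of "A + (C1 + C2) * (Y * S)"])
  fix T u w ut wt t
  assume s: "sol G m r p u0 w0 u1 w1 T u w ut wt" and u0: "u 0 : Lq_space q (mOm G)" "(\<integral>x. \<bar>u 0 x\<bar> powr q \<partial>mOm G) <= B"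
   and w0: "(\<integral>x. \<bar>w 0 x\<bar> powr q \<partial>mGam G) <= B" and E: "energy G (u 0) (w 0) (ut 0) (wt 0) <= B" and T: "T <= S" and t: "0 <= t" "t <= T"
  have T0: "0 <= T" using t by simp
  have reg: "regular_path G m r T u w ut wt" and bal: "!!t. t : {0..T} ==> balance G m r p u w ut wt t"
   using s by (auto simp: sol_def weak_solution_iff energy_identity_iff)
  note R = reg[unfolded regular_path_def]
  have w0q: "w 0 : Lq_space q (mGam G)" by (rule H20_Gam_Lq[OF G], rule C_time_mem[where u = w]) (use R T0 pq in auto)
  let ?V = "%s. \<integral>x. \<bar>ut s x\<bar> powr (m + 1) \<partial>mOm G" and ?W = "%s. \<integral>x. \<bar>wt s x\<bar> powr (r + 1) \<partial>mGam G"
  let ?y = "%t. J 0 t ?V + J 0 t ?W"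
  note VW = energy_tints(1,2)[OF G pq(3-6) T0 reg u0(1)]
  have cV: "continuous_on {0..T} (%t. J 0 t ?V)" "continuous_on {0..T} (%t. J 0 t ?W)" using VW by (auto intro: J_continuous)
  have nn: "0 <= J 0 t (%s. J 0 s ?V)" "0 <= J 0 t (%s. J 0 s ?W)" for t
   unfolding J_def by (intro integral_nonneg_AE AE_I2 mult_nonneg_nonneg; simp)+
  have main: "energy G (u t) (w t) (ut t) (wt t) + 1/2 * J 0 t ?V + 1/2 * J 0 t ?W <= A + (C1 + C2) * J 0 t ?y" if t: "0 <= t" "t <= T" for t
  proof -
   have "J 0 t (%s. \<integral>x. log_source p (u s x) * ut s x \<partial>mOm G) <= 1/2 * J 0 t ?V + C1 + C1 * J 0 t (%s. J 0 s ?V)"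
    by (rule C1(2)[of T u ut t, OF _ _ u0 _ T t]) (use R UC_measurable[where u = u] in auto)
   moreover have "J 0 t (%s. \<integral>x. log_source p (w s x) * wt s x \<partial>mGam G) <= 1/2 * J 0 t ?W + C2 + C2 * J 0 t (%s. J 0 s ?W)"
    by (rule C2(2)[of T w wt t, OF _ _ w0q w0 _ T t]) (use R WC_measurable[OF G] in auto)
   moreover have y: "J 0 t ?y = J 0 t (%s. J 0 s ?V) + J 0 t (%s. J 0 s ?W)"
    by (rule J_add; rule continuous_tint, rule continuous_on_subset[OF cV(1)] continuous_on_subset[OF cV(2)]) (use t in auto)
   moreover have "0 <= C1 * J 0 t (%s. J 0 s ?W)" "0 <= C2 * J 0 t (%s. J 0 s ?V)" using nn C1(1) C2(1) by auto
   moreover have "(C1 + C2) * J 0 t ?y = C1 * J 0 t (%s. J 0 s ?V) + C1 * J 0 t (%s. J 0 s ?W) + C2 * J 0 t (%s. J 0 s ?V) + C2 * J 0 t (%s. J 0 s ?W)"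
    unfolding y by (simp add: algebra_simps)
   moreover have "balance G m r p u w ut wt t" using bal[of t] t by simp
   ultimately show ?thesis using E unfolding balance_def A_def by linarith
  qed
  have en: "0 <= energy G a b c d" for a b c d by (simp add: energy_def)
  have cy: "continuous_on {0..T} ?y" by (intro continuous_on_add cV)
  have y: "?y t <= Y" if t: "0 <= t" "t <= T" for t
  proof -
   have "?y s <= 2 * A + b * J 0 s ?y" if s: "0 <= s" "s <= T" for s
   proof -
    have "0 <= J 0 s ?y" unfolding J_def by (intro integral_nonneg_AE AE_I2 mult_nonneg_nonneg add_nonneg_nonneg) simp_all
    moreover have "b * J 0 s ?y = 2 * ((C1 + C2) * J 0 s ?y) + J 0 s ?y" unfolding b_def by (simp add: distrib_right)
    ultimately show ?thesis using main[OF s] en[of "u s" "w s" "ut s" "wt s"] by linarith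
   qed
   from gronwall[OF cy pos(2) this _ t] have "?y t <= 2 * (2 * A) * exp (2 * b * t)" using pos(1) by simp
   also have "... <= Y" unfolding Y_def using pos t T by (intro mult_left_mono) auto
   finally show ?thesis .
  qed
  \<comment> \<open>The constant is written as \<open>c + d * g s\<close> so that the affine formula
    evaluates its integral.\<close>
  have "J 0 t ?y <= J 0 t (%s. Y + 0 * 0)"
   by (rule J_mono[OF continuous_tint[OF continuous_on_subset[OF cy]] J_affine(1)[OF _ t(1)]]) (use y t in \<open>auto simp: tint_def\<close>)
  also have "... = Y * t" using J_affine(2)[of t "%_. 0" Y 0] t by (simp add: tint_def)
  also have "... <= Y * S" using pos t T by (intro mult_left_mono) auto
  finally have "(C1 + C2) * J 0 t ?y <= (C1 + C2) * (Y * S)" using C1(1) C2(1) by (intro mult_left_mono) auto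
  moreover have "0 <= ?y t" unfolding J_def by (intro add_nonneg_nonneg integral_nonneg_AE AE_I2 mult_nonneg_nonneg) simp_all
  ultimately show "energy G (u t) (w t) (ut t) (wt t) <= A + (C1 + C2) * (Y * S)" using main[OF t] by linarith
 qed
 qed
 qed
qed

section \<open>Continuation\<close>

lemma Lq_space_cong_AE:
 assumes "f : Lq_space q M" "AE x in M. f x = g x" "g : borel_measurable M"
 shows "g : Lq_space q M"
proof -
 have m: "f : borel_measurable M" and i: "integrable M (%x. \<bar>f x\<bar> powr q)" using assms by (auto simp: Lq_space_def)
 have "integrable M (%x. \<bar>g x\<bar> powr q)"
  by (rule integrable_cong_AE_imp[OF i]) (use assms(2,3) in auto)
 then show ?thesis using assms by (simp add: Lq_space_def)
qed

lemma (in finite_measure) Lq_space_mono: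
 assumes f: "f : Lq_space k M" and q: "0 < q" "q <= k"
 shows "f : Lq_space q M"
proof -
 have m: "f : borel_measurable M" and i: "integrable M (%x. 1 + \<bar>f x\<bar> powr k)" using f by (auto simp: Lq_space_def)
 have "integrable M (%x. \<bar>f x\<bar> powr q)"
  by (rule Bochner_Integration.integrable_bound[OF i]) (use m powr_le_1_add q in \<open>auto intro!: AE_I2\<close>)
 then show ?thesis using m by (simp add: Lq_space_def)
qed

text \<open>Matches the energy at the start of a restarted solution with the energy at the end of
  the previous one.\<close>

lemma energy_cong_AE:
 assumes G: "structural_acoustic G" and u: "AE x in mOm G. v x = u x" "v : borel_measurable (mOm G)" "u : borel_measurable (mOm G)"
  and ut: "AE x in mOm G. vt x = ut x" "vt : borel_measurable (mOm G)" "ut : borel_measurable (mOm G)"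
  and w: "AE x in mGam G. z x = w x" "z : H20_Gam G" "w : H20_Gam G"
  and wt: "AE x in mGam G. zt x = wt x" "zt : borel_measurable (mGam G)" "wt : borel_measurable (mGam G)"
 shows "energy G v z vt zt = energy G u w ut wt"
proof -
 have chart: "(f \<circ> chart G) : borel_measurable (leb (chart_dom G))" if "f : H20_Gam G" for f
  using L2_measurable[OF H1_L2] H20_Gam_H2[OF that] by (auto simp: H2_def)
 show ?thesis
  unfolding energy_def L2_norm_cong_AE[OF ut] L2_norm_cong_AE[OF wt] lap_Gam_cong_AE[OF G w(1) chart[OF w(2)] chart[OF w(3)]]
   H1_norm_cong_AE(2)[OF structural_acousticD(5)[OF G] u[unfolded mOm_def]] by simp
qed

text \<open>The bound \<open>K\<close> is fixed for the whole target interval before the step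
  \<open>ta\<close> is taken from it, so \<open>ta\<close> stays the same at every restart.\<close>

lemma sol_extend:
 assumes G: "structural_acoustic G" and pq: "1 <= m" "1 <= r" "1 < p" "p + 1 < q" "q <= m + 1" "q <= r + 1"
  and loc: "local_theory G m r p"
  and u: "sol G m r p u0 w0 u1 w1 T u w ut wt" and uq: "u 0 : Lq_space q (mOm G)" and T: "0 < T" "T <= S"
 obtains u' w' ut' wt' where "sol G m r p u0 w0 u1 w1 S u' w' ut' wt'" "!!s. s <= T ==> u' s = u s & w' s = w s & ut' s = ut s & wt' s = wt s"
proof -
 define B where "B = \<bar>energy G (u 0) (w 0) (ut 0) (wt 0)\<bar> + (\<integral>x. \<bar>u 0 x\<bar> powr q \<partial>mOm G) + (\<integral>x. \<bar>w 0 x\<bar> powr q \<partial>mGam G)"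
 have n: "0 <= (\<integral>x. \<bar>u 0 x\<bar> powr q \<partial>mOm G)" "0 <= (\<integral>x. \<bar>w 0 x\<bar> powr q \<partial>mGam G)" by auto
 have B: "0 <= B" "(\<integral>x. \<bar>u 0 x\<bar> powr q \<partial>mOm G) <= B" "(\<integral>x. \<bar>w 0 x\<bar> powr q \<partial>mGam G) <= B" "energy G (u 0) (w 0) (ut 0) (wt 0) <= B"
  using n unfolding B_def by linarith+
 have S: "0 <= S" using T by simp
 obtain K where K: "!!T u w ut wt t. sol G m r p u0 w0 u1 w1 T u w ut wt ==> u 0 : Lq_space q (mOm G) ==>
   (\<integral>x. \<bar>u 0 x\<bar> powr q \<partial>mOm G) <= B ==> (\<integral>x. \<bar>w 0 x\<bar> powr q \<partial>mGam G) <= B ==> energy G (u 0) (w 0) (ut 0) (wt 0) <= B ==>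
   T <= S ==> 0 <= t ==> t <= T ==> energy G (u t) (w t) (ut t) (wt t) <= K"
  using energy_bound[OF G pq S B(1), of u0 w0 u1 w1] by blast
 obtain ta where ta: "ta > 0" "!!u0 w0 u1 w1. (u0, w0, u1, w1) : phase_space G ==> energy G u0 w0 u1 w1 <= K ==>
   EX u w ut wt. sol G m r p u0 w0 u1 w1 ta u w ut wt"
  using loc[unfolded local_theory_def, rule_format, of K] unfolding sol_def by blast
 have step: "EX u' w' ut' wt'. sol G m r p u0 w0 u1 w1 (min S (T + real k * ta)) u' w' ut' wt' &
   (ALL s<=T. u' s = u s & w' s = w s & ut' s = ut s & wt' s = wt s)" for k
 proof (induction k)
  case 0
  show ?case by (rule exI[of _ u], rule exI[of _ w], rule exI[of _ ut], rule exI[of _ wt]) (use u T in \<open>auto simp: min_def\<close>)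
 next
  case (Suc k)
  define R where "R = min S (T + real k * ta)"
  have R: "0 < R" "R <= S" "T <= R" "0 <= R" using T ta(1) by (auto simp: R_def intro: add_pos_nonneg)
  obtain u' w' ut' wt' where s: "sol G m r p u0 w0 u1 w1 R u' w' ut' wt'"
   and agree: "!!s. s <= T ==> u' s = u s & w' s = w s & ut' s = ut s & wt' s = wt s"
   using Suc.IH unfolding R_def[symmetric] by blast
  have z: "u' 0 = u 0" "w' 0 = w 0" "ut' 0 = ut 0" "wt' 0 = wt 0" using agree[of 0] T by auto
  have "regular_path G m r R u' w' ut' wt'" using s by (simp add: sol_def weak_solution_iff)
  note R' = this[unfolded regular_path_def]
  have mem: "u' R : H1_Gam0 G" "w' R : H20_Gam G" "ut' R : Lq_space 2 (mOm G)" "wt' R : Lq_space 2 (mGam G)"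
   using R' R C_time_mem[of _ R _ _ R] by auto
  have "energy G (u' R) (w' R) (ut' R) (wt' R) <= K" by (rule K[OF s]) (use z uq B R in auto)
  then obtain v z' vt zt where v: "sol G m r p (u' R) (w' R) (ut' R) (wt' R) ta v z' vt zt"
   using ta(2)[of "u' R" "w' R" "ut' R" "wt' R"] mem by (auto simp: phase_space_def)
  have "regular_path G m r ta v z' vt zt" and ae: "AE x in mOm G. v 0 x = u' R x & vt 0 x = ut' R x" "AE x in mGam G. z' 0 x = w' R x & zt 0 x = wt' R x"
   using v by (auto simp: sol_def weak_solution_iff)
  note V = this(1)[unfolded regular_path_def]
  have t0: "0 <= ta" using ta(1) by simp
  have mem': "v 0 : borel_measurable (mOm G)" "z' 0 : H20_Gam G" "vt 0 : Lq_space 2 (mOm G)" "zt 0 : Lq_space 2 (mGam G)"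
   using V t0 UC_measurable[where u = v] C_time_mem[of _ ta _ _ 0] by auto
  have um: "u' R : borel_measurable (mOm G)" using UC_measurable[where u = u'] R' R by blast
  interpret finite_measure "mOm G" by (rule finite_measure_mOm[OF G])
  have q: "1 < q" "0 < q" using pq by auto
  have utq: "ut' : Lq_spacetime R (mOm G) q" by (rule Lq_spacetime_mono[of _ _ "m + 1"]) (use R' pq q in auto)
  have u0q: "u' 0 : Lq_space q (mOm G)" using z uq by simp
  have "time_deriv R (mOm G) u' ut'" using R' by simp
  note pl = time_deriv_powr_le[OF this u0q utq q(1) R(4) order_refl]
  \<comment> \<open>The final displacement is again in \<open>L^q\<close>; gluing needs this for the
    integrability of the source after the restart.\<close>
  have "integrable (mOm G) (%x. \<bar>u' R x\<bar> powr q)"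
   by (rule Bochner_Integration.integrable_bound[OF pl(1)]) (use um in measurable, use pl(2) in \<open>auto elim!: eventually_mono\<close>)
  then have "u' R : Lq_space q (mOm G)" using um by (simp add: Lq_space_def)
  moreover have ae': "AE x in mOm G. u' R x = v 0 x" using ae(1) by eventually_elim simp
  ultimately have vq: "v 0 : Lq_space q (mOm G)" using mem'(1) by (rule Lq_space_cong_AE)
  have E: "energy G (v 0) (z' 0) (vt 0) (zt 0) = energy G (u' R) (w' R) (ut' R) (wt' R)"
   by (rule energy_cong_AE[OF G]) (use ae mem mem' um in \<open>auto intro: L2_measurable\<close>)
  note g = sol_glue[OF G pq s v R(1) ta(1) u0q vq E]
  let ?R = "min S (T + real (Suc k) * ta)"
  have "0 < ?R" using T ta(1) by (auto intro: add_pos_nonneg)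
  moreover have "?R <= R + ta" using ta(1) by (auto simp: R_def algebra_simps)
  ultimately have "sol G m r p u0 w0 u1 w1 ?R (concat_time R u' v) (concat_time R w' z') (concat_time R ut' vt) (concat_time R wt' zt)"
   by (rule sol_restrict[OF G g])
  then show ?case using agree R(3) by (intro exI conjI) (assumption, auto simp: concat_time_def)
 qed
 obtain k :: nat where "(S - T) / ta < real k" using reals_Archimedean2 by blast
 then have "min S (T + real k * ta) = S" using ta(1) by (simp add: field_simps)
 then show ?thesis using step[of k] that by auto
qed

theorem theorem2p3:
  fixes G :: acoustic_geometry
    and m r p T0 :: real
    and u0 w0 u1 w1 :: "real^3 \<Rightarrow> real"
    and u w ut wt :: "real \<Rightarrow> real^3 \<Rightarrow> real"
  assumes geometry: "structural_acoustic G"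
    and exponents: "m \<ge> 1" "r \<ge> 1" "1 < p" "p < 6" "p * ((m + 1) / m) < 6"
    and local_existence: "local_theory G m r p"
    and data: "(u0, w0, u1, w1) \<in> phase_space G"
    and u0_Lq: "\<exists>\<delta>>0. u0 \<in> Lq_space (p + 1 + \<delta>) (mOm G)"
    and p_less: "p < min m r"
    and T0: "T0 > 0"
    and solution: "weak_solution G m r p u0 w0 u1 w1 T0 u w ut wt"
    and identity: "energy_identity G m r p T0 u w ut wt"
  shows "\<exists>u' w' ut' wt'.
           (\<forall>t\<in>{0..T0}. u' t = u t \<and> w' t = w t \<and> ut' t = ut t \<and> wt' t = wt t) \<and>
           (\<forall>T>0. weak_solution G m r p u0 w0 u1 w1 T u' w' ut' wt' \<and>
                  energy_identity G m r p T u' w' ut' wt')"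
proof -
 obtain de where de: "de > 0" "u0 : Lq_space (p + 1 + de) (mOm G)" using u0_Lq by blast
 \<comment> \<open>The largest exponent allowed by the integrability of \<open>u0\<close> and by
   both damping exponents; it exceeds \<open>p + 1\<close> because
   \<open>p < min m r\<close>.\<close>
 define q where "q = p + 1 + min de (min m r - p)"
 have pq: "1 <= m" "1 <= r" "1 < p" "p + 1 < q" "q <= m + 1" "q <= r + 1" using exponents p_less de(1) by (auto simp: q_def)
 interpret finite_measure "mOm G" by (rule finite_measure_mOm[OF geometry])
 have s0: "sol G m r p u0 w0 u1 w1 T0 u w ut wt" using solution identity by (simp add: sol_def)
 have "u : UC G T0" "AE x in mOm G. u0 x = u 0 x" using solution by (auto simp: weak_solution_def elim!: eventually_mono)
 moreover have "u0 : Lq_space q (mOm G)" by (rule Lq_space_mono[OF de(2)]) (use pq in \<open>auto simp: q_def\<close>)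
 ultimately have uq: "u 0 : Lq_space q (mOm G)" using UC_measurable[where u = u and t = 0] T0 by (auto intro: Lq_space_cong_AE)
 let ?sol = "%T z. sol G m r p u0 w0 u1 w1 T (%t. fst (z t)) (%t. fst (snd (z t))) (%t. fst (snd (snd (z t)))) (%t. snd (snd (snd (z t))))"
 define z0 where "z0 t = (u t, w t, ut t, wt t)" for t
 \<comment> \<open>The four paths are packed into one tuple, so that dependent choice yields a
   single sequence of extensions, each prolonging its predecessor.\<close>
 have "EX f. ALL n. (?sol (T0 + real n) (f n) & (ALL s<=T0. f n s = z0 s)) & (ALL s<=T0 + real n. f (Suc n) s = f n s)"
 proof (rule dependent_nat_choice)
  show "EX z. ?sol (T0 + real 0) z & (ALL s<=T0. z s = z0 s)" using s0 by (auto simp: z0_def intro!: exI[of _ z0])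
  fix z n assume z: "?sol (T0 + real n) z & (ALL s<=T0. z s = z0 s)"
  then have uq': "fst (z 0) : Lq_space q (mOm G)" using uq T0 by (simp add: z0_def)
  have T: "0 < T0 + real n" "T0 + real n <= T0 + real (Suc n)" using T0 by auto
  show "EX y. (?sol (T0 + real (Suc n)) y & (ALL s<=T0. y s = z0 s)) & (ALL s<=T0 + real n. y s = z s)"
  proof (rule sol_extend[where u = "%t. fst (z t)" and w = "%t. fst (snd (z t))" and ut = "%t. fst (snd (snd (z t)))"
     and wt = "%t. snd (snd (snd (z t)))", OF geometry pq local_existence conjunct1[OF z] uq' T])
   fix u' w' ut' wt'
   assume e: "sol G m r p u0 w0 u1 w1 (T0 + real (Suc n)) u' w' ut' wt'"
    "!!s. s <= T0 + real n ==> u' s = fst (z s) & w' s = fst (snd (z s)) & ut' s = fst (snd (snd (z s))) & wt' s = snd (snd (snd (z s)))"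
   let ?z = "%s. (u' s, w' s, ut' s, wt' s)"
   have 1: "?z s = z s" if "s <= T0 + real n" for s using e(2)[OF that] by (simp add: prod_eq_iff)
   have 2: "?z s = z0 s" if "s <= T0" for s using 1[of s] z that by simp
   have 3: "?sol (T0 + real (Suc n)) ?z" using e(1) by (simp only: fst_conv snd_conv)
   show ?thesis by (rule exI[of _ ?z]) (use 1 2 3 in blast)
  qed
 qed
 then obtain f where f: "!!n. ?sol (T0 + real n) (f n)" "!!n s. s <= T0 ==> f n s = z0 s" "!!n s. s <= T0 + real n ==> f (Suc n) s = f n s"
  by blast
 have mono: "f (n + k) s = f n s" if "s <= T0 + real n" for n k s using f(3)[of s "n + _"] that by (induction k) auto
 \<comment> \<open>The extension with index \<open>nat \<lceil>t\<rceil>\<close> lives on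
   \<open>[0, T0 + nat \<lceil>t\<rceil>]\<close> and so covers \<open>t\<close>; later extensions
   agree with it there.\<close>
 define z where "z t = f (nat \<lceil>t\<rceil>) t" for t
 have zf: "z s = f n s" if "s <= real n" for s n
 proof -
  have "nat \<lceil>s\<rceil> <= n" "s <= T0 + real (nat \<lceil>s\<rceil>)" using that T0 by (linarith, linarith)
  then show ?thesis using mono[of s "nat \<lceil>s\<rceil>" "n - nat \<lceil>s\<rceil>"] by (simp add: z_def)
 qed
 have A: "?sol T z" if T: "T > 0" for T
 proof -
  obtain n :: nat where n: "T <= real n" using real_arch_simple by blast
  have a: "?sol T (f n)" by (rule sol_restrict[OF geometry f(1)]) (use T T0 n in auto)
  have "z s = f n s" if "s <= T" for s using that n by (intro zf) simp
  then show ?thesis using T by (intro sol_cong[OF _ _ a]) simp_all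
 qed
 have B: "z t = z0 t" if "t : {0..T0}" for t using f(2) that by (simp add: z_def)
 let ?u = "%t. fst (z t)" and ?w = "%t. fst (snd (z t))" and ?ut = "%t. fst (snd (snd (z t)))" and ?wt = "%t. snd (snd (snd (z t)))"
 show ?thesis
 proof (rule exI[of _ ?u], rule exI[of _ ?w], rule exI[of _ ?ut], rule exI[of _ ?wt], rule conjI)
  show "ALL t:{0..T0}. ?u t = u t & ?w t = w t & ?ut t = ut t & ?wt t = wt t" using B by (simp add: z0_def)
  show "ALL T>0. weak_solution G m r p u0 w0 u1 w1 T ?u ?w ?ut ?wt & energy_identity G m r p T ?u ?w ?ut ?wt"
   using A unfolding sol_def by blast
 qed
qed

end
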